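(* Let $\sigma\ge\frac12$, $R>0$, $T>0$, $u_0\in D(\mathcal E)$, and assume (H.0) and (H.2). For $\varepsilon>0$ let $u_\varepsilon\in C([0,T];D(\mathcal E))$ be the mild solution $$u_\varepsilon(t)=S_{\beta_\varepsilon}(t,0)u_0+\mathrm i\int_0^tS_{\beta_\varepsilon}(t,s)F_R(u_\varepsilon(s))\,ds,$$ with $\beta_\varepsilon(t)=\int_0^t\frac1\varepsilon m(\frac s{\varepsilon^2})ds$, and let $u$ be the mild solution of the same equation with $\beta_\varepsilon$ replaced by the Brownian motion $\beta$ (i.e. the mild solution of $du=\mathrm i\Delta_\Gamma u\,d\beta-\frac12\Delta_\Gamma^2u\,dt+\mathrm iF_R(u)dt$, $u(0)=u_0$). Then $u_\varepsilon$ converges in law to $u$ in $C([0,T];D(\mathcal E))$ as $\varepsilon\to0$.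
   Context: Quantum graph setting: $\Gamma$ is a finite connected metric graph (edges identified with $[0,l_e]$ or $[0,\infty)$), $L^2(\Gamma)=\bigoplus_eL^2(I_e)$; $\Delta_\Gamma$ is the self-adjoint Laplacian $(\Delta_\Gamma f)_e=f_e''$ on $D(\Delta_\Gamma)=\{f\in H^2(\Gamma):A_v\underline f(v)+B_v\underline f'(v)=0\ \forall v\}$, where for each vertex $v$ of degree $n_v$, $A_v,B_v\in\mathbb C^{n_v\times n_v}$, $(A_v,B_v)$ has rank $n_v$ and $A_vB_v^\dagger$ is self-adjoint; equivalently there are mutually orthogonal projectors $P_{D,v},P_{N,v},P_{R,v}=I-P_{D,v}-P_{N,v}$ and self-adjoint invertible $\Lambda_v$ on $P_{R,v}\mathbb C^{n_v}$ with conditions $P_{D,v}\underline f(v)=0$, $P_{N,v}\underline f'(v)=0$, $P_{R,v}\underline f'(v)=\Lambda_vP_{R,v}\underline f(v)$. $\mathcal E(f,f)=\sum_e\int|f_e'|^2+\sum_v\langle\Lambda_vP_{R,v}\underline f(v),P_{R,v}\underline f(v)\rangle$ on $D(\mathcal E)=\{f\in H^1(\Gamma):P_{D,v}\underline f(v)=0\ \forall v\}$ is the form of $-\Delta_\Gamma$, with Hilbert norm $\|f\|_{D(\mathcal E)}=(M\|f\|_{L^2}^2+\mathcal E(f,f))^{1/2}$ equivalent to the $H^1$-norm for suitable $M>0$. For $n\in C([0,T];\mathbb R)$, $S_n(t,s)=e^{\mathrm i[n(t)-n(s)]\Delta_\Gamma}$. $\theta\in C_0^\infty(\mathbb R)$,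 $\theta=1$ on $[0,1]$, $\theta=0$ on $[2,\infty)$; $F_R(x)=|x|^{2\sigma}x\,\theta(|x|^2/R)$. (H.2): $F_R(u)\in D(\mathcal E)$ for all $u\in D(\mathcal E)$. (H.0): $m=(m(t))_{t\ge0}$ is a real stochastic process with locally integrable paths such that $\beta_\varepsilon=\big(\int_0^t\frac1\varepsilon m(\frac s{\varepsilon^2})ds\big)_{t\ge0}$ converges in law, as $\varepsilon\to0$, in $C([0,T];\mathbb R)$ to a standard Brownian motion $\beta$. *)

theory Defs
  imports "HOL-Probability.Probability"
begin

text \<open>Edges form a finite type 'e.  len e is the length of edge e (a positive extended
real; \<infinity> encodes a half-line [0,\<infinity>)).  An edge end is a pair (e,b): (e,False) is the
point x = 0, (e,True) the point x = len e (only present if len e is finite).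
vtx maps each edge end to the vertex it is attached to.\<close>

definition edge_int :: "('e \<Rightarrow> ereal) \<Rightarrow> 'e \<Rightarrow> real set" where
  "edge_int len e = {x. 0 \<le> x \<and> ereal x \<le> len e}"

definition valid_end :: "('e \<Rightarrow> ereal) \<Rightarrow> 'e \<times> bool \<Rightarrow> bool" where
  "valid_end len p \<longleftrightarrow> (snd p \<longrightarrow> len (fst p) \<noteq> \<infinity>)"

definition ends :: "('e \<Rightarrow> ereal) \<Rightarrow> ('e \<times> bool \<Rightarrow> 'v) \<Rightarrow> 'v \<Rightarrow> ('e \<times> bool) set" where
  "ends len vtx v = {p. valid_end len p \<and> vtx p = v}"

definition vertices :: "('e \<Rightarrow> ereal) \<Rightarrow> ('e \<times> bool \<Rightarrow> 'v) \<Rightarrow> 'v set" where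
  "vertices len vtx = vtx ` {p. valid_end len p}"

definition endpt :: "('e \<Rightarrow> ereal) \<Rightarrow> 'e \<times> bool \<Rightarrow> real" where
  "endpt len p = (if snd p then real_of_ereal (len (fst p)) else 0)"

definition edge_adj :: "('e \<Rightarrow> ereal) \<Rightarrow> ('e \<times> bool \<Rightarrow> 'v) \<Rightarrow> 'e \<Rightarrow> 'e \<Rightarrow> bool" where
  "edge_adj len vtx e e' \<longleftrightarrow>
     (\<exists>p q. valid_end len p \<and> valid_end len q \<and> fst p = e \<and> fst q = e' \<and> vtx p = vtx q)"

definition connected_graph :: "('e \<Rightarrow> ereal) \<Rightarrow> ('e \<times> bool \<Rightarrow> 'v) \<Rightarrow> bool" where
  "connected_graph len vtx \<longleftrightarrow> (\<forall>e e'. (edge_adj len vtx)\<^sup>*\<^sup>* e e')"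

section \<open>Sobolev spaces on an interval (functions are represented by representatives)\<close>

definition L2 :: "real set \<Rightarrow> (real \<Rightarrow> complex) \<Rightarrow> bool" where
  "L2 S f \<longleftrightarrow> f \<in> borel_measurable (lebesgue_on S) \<and>
              integrable (lebesgue_on S) (\<lambda>x. (cmod (f x))\<^sup>2)"

text \<open>g is a weak derivative of f on the interval S, f being its absolutely continuous
  representative.\<close>
definition wderiv :: "real set \<Rightarrow> (real \<Rightarrow> complex) \<Rightarrow> (real \<Rightarrow> complex) \<Rightarrow> bool" where
  "wderiv S f g \<longleftrightarrow> (\<forall>x\<in>S. \<forall>y\<in>S. x \<le> y \<longrightarrow> (g has_integral (f y - f x)) {x..y})"

definition H1 :: "real set \<Rightarrow> (real \<Rightarrow> complex) \<Rightarrow> bool" where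
  "H1 S f \<longleftrightarrow> L2 S f \<and> (\<exists>g. L2 S g \<and> wderiv S f g)"

definition H2 :: "real set \<Rightarrow> (real \<Rightarrow> complex) \<Rightarrow> bool" where
  "H2 S f \<longleftrightarrow> L2 S f \<and> (\<exists>g. L2 S g \<and> wderiv S f g \<and> (\<exists>h. L2 S h \<and> wderiv S g h))"

text \<open>first derivative (a.e. determined) of an H1 function\<close>
definition d1 :: "real set \<Rightarrow> (real \<Rightarrow> complex) \<Rightarrow> real \<Rightarrow> complex" where
  "d1 S f = (SOME g. L2 S g \<and> wderiv S f g)"

text \<open>first derivative of an H2 function, continuous representative (unique on S)\<close>
definition dd :: "real set \<Rightarrow> (real \<Rightarrow> complex) \<Rightarrow> real \<Rightarrow> complex" where
  "dd S f = (SOME g. L2 S g \<and> wderiv S f g \<and> (\<exists>h. L2 S h \<and> wderiv S g h))"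

definition d2 :: "real set \<Rightarrow> (real \<Rightarrow> complex) \<Rightarrow> real \<Rightarrow> complex" where
  "d2 S f = (SOME h. L2 S h \<and> wderiv S (dd S f) h)"

definition L2G :: "('e \<Rightarrow> ereal) \<Rightarrow> ('e \<Rightarrow> real \<Rightarrow> complex) \<Rightarrow> bool" where
  "L2G len F \<longleftrightarrow> (\<forall>e. L2 (edge_int len e) (F e))"

definition H1G :: "('e \<Rightarrow> ereal) \<Rightarrow> ('e \<Rightarrow> real \<Rightarrow> complex) \<Rightarrow> bool" where
  "H1G len F \<longleftrightarrow> (\<forall>e. H1 (edge_int len e) (F e))"

definition H2G :: "('e \<Rightarrow> ereal) \<Rightarrow> ('e \<Rightarrow> real \<Rightarrow> complex) \<Rightarrow> bool" where
  "H2G len F \<longleftrightarrow> (\<forall>e. H2 (edge_int len e) (F e))"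

definition innerG :: "('e::finite \<Rightarrow> ereal) \<Rightarrow> ('e \<Rightarrow> real \<Rightarrow> complex) \<Rightarrow> ('e \<Rightarrow> real \<Rightarrow> complex) \<Rightarrow> complex" where
  "innerG len F G = (\<Sum>e\<in>UNIV. LINT x|lebesgue_on (edge_int len e). F e x * cnj (G e x))"

definition normG :: "('e::finite \<Rightarrow> ereal) \<Rightarrow> ('e \<Rightarrow> real \<Rightarrow> complex) \<Rightarrow> real" where
  "normG len F = sqrt (\<Sum>e\<in>UNIV. LINT x|lebesgue_on (edge_int len e). (cmod (F e x))\<^sup>2)"

definition H1norm :: "('e::finite \<Rightarrow> ereal) \<Rightarrow> ('e \<Rightarrow> real \<Rightarrow> complex) \<Rightarrow> real" where
  "H1norm len F = sqrt (\<Sum>e\<in>UNIV.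
      (LINT x|lebesgue_on (edge_int len e). (cmod (F e x))\<^sup>2) +
      (LINT x|lebesgue_on (edge_int len e). (cmod (d1 (edge_int len e) (F e) x))\<^sup>2))"

definition gdiff :: "('e \<Rightarrow> real \<Rightarrow> complex) \<Rightarrow> ('e \<Rightarrow> real \<Rightarrow> complex) \<Rightarrow> ('e \<Rightarrow> real \<Rightarrow> complex)" where
  "gdiff F G = (\<lambda>e x. F e x - G e x)"

text \<open>boundary values and inward (into the edge) derivatives at edge ends\<close>
definition bval :: "('e \<Rightarrow> ereal) \<Rightarrow> ('e \<Rightarrow> real \<Rightarrow> complex) \<Rightarrow> 'e \<times> bool \<Rightarrow> complex" where
  "bval len F p = F (fst p) (endpt len p)"

definition dval :: "('e \<Rightarrow> ereal) \<Rightarrow> ('e \<Rightarrow> real \<Rightarrow> complex) \<Rightarrow> 'e \<times> bool \<Rightarrow> complex" where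
  "dval len F p = (if snd p then - dd (edge_int len (fst p)) (F (fst p)) (endpt len p)
                   else dd (edge_int len (fst p)) (F (fst p)) 0)"

text \<open>Matrices at vertex v are indexed by the edge ends at v: A :: end => end => complex.\<close>
definition mapp :: "('e \<times> bool) set \<Rightarrow> ('e \<times> bool \<Rightarrow> 'e \<times> bool \<Rightarrow> complex)
    \<Rightarrow> ('e \<times> bool \<Rightarrow> complex) \<Rightarrow> 'e \<times> bool \<Rightarrow> complex" where
  "mapp E A x = (\<lambda>i. \<Sum>j\<in>E. A i j * x j)"

definition mmul :: "('e \<times> bool) set \<Rightarrow> ('e \<times> bool \<Rightarrow> 'e \<times> bool \<Rightarrow> complex)
    \<Rightarrow> ('e \<times> bool \<Rightarrow> 'e \<times> bool \<Rightarrow> complex) \<Rightarrow> 'e \<times> bool \<Rightarrow> 'e \<times> bool \<Rightarrow> complex" where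
  "mmul E A B = (\<lambda>i k. \<Sum>j\<in>E. A i j * B j k)"

definition herm_on :: "('e \<times> bool) set \<Rightarrow> ('e \<times> bool \<Rightarrow> 'e \<times> bool \<Rightarrow> complex) \<Rightarrow> bool" where
  "herm_on E A \<longleftrightarrow> (\<forall>i\<in>E. \<forall>j\<in>E. A i j = cnj (A j i))"

definition orth_proj_on :: "('e \<times> bool) set \<Rightarrow> ('e \<times> bool \<Rightarrow> 'e \<times> bool \<Rightarrow> complex) \<Rightarrow> bool" where
  "orth_proj_on E P \<longleftrightarrow> herm_on E P \<and> (\<forall>i\<in>E. \<forall>j\<in>E. mmul E P P i j = P i j)"

definition PRm :: "('e \<times> bool \<Rightarrow> 'e \<times> bool \<Rightarrow> complex) \<Rightarrow> ('e \<times> bool \<Rightarrow> 'e \<times> bool \<Rightarrow> complex)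
    \<Rightarrow> 'e \<times> bool \<Rightarrow> 'e \<times> bool \<Rightarrow> complex" where
  "PRm PD PN = (\<lambda>i j. (if i = j then 1 else 0) - PD i j - PN i j)"

definition qgraph :: "('e \<Rightarrow> ereal) \<Rightarrow> ('e \<times> bool \<Rightarrow> 'v)
    \<Rightarrow> ('v \<Rightarrow> 'e \<times> bool \<Rightarrow> 'e \<times> bool \<Rightarrow> complex) \<Rightarrow> ('v \<Rightarrow> 'e \<times> bool \<Rightarrow> 'e \<times> bool \<Rightarrow> complex)
    \<Rightarrow> ('v \<Rightarrow> 'e \<times> bool \<Rightarrow> 'e \<times> bool \<Rightarrow> complex) \<Rightarrow> bool" where
  "qgraph len vtx PD PN Lam \<longleftrightarrow>
     (\<forall>e. 0 < len e) \<and> connected_graph len vtx \<and>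
     (\<forall>v. let E = ends len vtx v; PR = PRm (PD v) (PN v) in
        orth_proj_on E (PD v) \<and> orth_proj_on E (PN v) \<and>
        (\<forall>i\<in>E. \<forall>j\<in>E. mmul E (PD v) (PN v) i j = 0) \<and>
        herm_on E (Lam v) \<and>
        (\<forall>i\<in>E. \<forall>j\<in>E. mmul E PR (mmul E (Lam v) PR) i j = Lam v i j) \<and>
        (\<forall>x. (\<forall>i\<in>E. mapp E PR x i = x i) \<and> (\<forall>i\<in>E. mapp E (Lam v) x i = 0)
              \<longrightarrow> (\<forall>i\<in>E. x i = 0)))"

definition DLap :: "('e \<Rightarrow> ereal) \<Rightarrow> ('e \<times> bool \<Rightarrow> 'v)
    \<Rightarrow> ('v \<Rightarrow> 'e \<times> bool \<Rightarrow> 'e \<times> bool \<Rightarrow> complex) \<Rightarrow> ('v \<Rightarrow> 'e \<times> bool \<Rightarrow> 'e \<times> bool \<Rightarrow> complex)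
    \<Rightarrow> ('v \<Rightarrow> 'e \<times> bool \<Rightarrow> 'e \<times> bool \<Rightarrow> complex) \<Rightarrow> ('e \<Rightarrow> real \<Rightarrow> complex) set" where
  "DLap len vtx PD PN Lam = {F. H2G len F \<and>
     (\<forall>v. \<forall>i\<in>ends len vtx v. let E = ends len vtx v; PR = PRm (PD v) (PN v) in
        mapp E (PD v) (bval len F) i = 0 \<and>
        mapp E (PN v) (dval len F) i = 0 \<and>
        mapp E PR (dval len F) i = mapp E (Lam v) (mapp E PR (bval len F)) i)}"

definition Lap :: "('e \<Rightarrow> ereal) \<Rightarrow> ('e \<Rightarrow> real \<Rightarrow> complex) \<Rightarrow> ('e \<Rightarrow> real \<Rightarrow> complex)" where
  "Lap len F = (\<lambda>e. d2 (edge_int len e) (F e))"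

definition DE :: "('e \<Rightarrow> ereal) \<Rightarrow> ('e \<times> bool \<Rightarrow> 'v)
    \<Rightarrow> ('v \<Rightarrow> 'e \<times> bool \<Rightarrow> 'e \<times> bool \<Rightarrow> complex) \<Rightarrow> ('e \<Rightarrow> real \<Rightarrow> complex) set" where
  "DE len vtx PD = {F. H1G len F \<and>
     (\<forall>v. \<forall>i\<in>ends len vtx v. mapp (ends len vtx v) (PD v) (bval len F) i = 0)}"

definition Eform :: "('e::finite \<Rightarrow> ereal) \<Rightarrow> ('e \<times> bool \<Rightarrow> 'v)
    \<Rightarrow> ('v \<Rightarrow> 'e \<times> bool \<Rightarrow> 'e \<times> bool \<Rightarrow> complex) \<Rightarrow> ('v \<Rightarrow> 'e \<times> bool \<Rightarrow> 'e \<times> bool \<Rightarrow> complex)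
    \<Rightarrow> ('v \<Rightarrow> 'e \<times> bool \<Rightarrow> 'e \<times> bool \<Rightarrow> complex) \<Rightarrow> ('e \<Rightarrow> real \<Rightarrow> complex) \<Rightarrow> real" where
  "Eform len vtx PD PN Lam F =
     (\<Sum>e\<in>UNIV. LINT x|lebesgue_on (edge_int len e). (cmod (d1 (edge_int len e) (F e) x))\<^sup>2) +
     Re (\<Sum>v\<in>vertices len vtx. let E = ends len vtx v; PR = PRm (PD v) (PN v);
            y = mapp E PR (bval len F) in
          \<Sum>i\<in>E. mapp E (Lam v) y i * cnj (y i))"

definition normE :: "real \<Rightarrow> ('e::finite \<Rightarrow> ereal) \<Rightarrow> ('e \<times> bool \<Rightarrow> 'v)
    \<Rightarrow> ('v \<Rightarrow> 'e \<times> bool \<Rightarrow> 'e \<times> bool \<Rightarrow> complex) \<Rightarrow> ('v \<Rightarrow> 'e \<times> bool \<Rightarrow> 'e \<times> bool \<Rightarrow> complex)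
    \<Rightarrow> ('v \<Rightarrow> 'e \<times> bool \<Rightarrow> 'e \<times> bool \<Rightarrow> complex) \<Rightarrow> ('e \<Rightarrow> real \<Rightarrow> complex) \<Rightarrow> real" where
  "normE M len vtx PD PN Lam F = sqrt (M * (normG len F)\<^sup>2 + Eform len vtx PD PN Lam F)"

text \<open>S is a strongly continuous group of bounded linear operators on L2(Gamma)
  (acting on representatives, compatibly with a.e. equality) whose generator is
  i times the Laplacian on D(Laplacian).  Such a group is unique (up to a.e. equality)
  and equals exp(i tau Laplacian).\<close>
definition schr_group :: "('e::finite \<Rightarrow> ereal) \<Rightarrow> ('e \<times> bool \<Rightarrow> 'v)
    \<Rightarrow> ('v \<Rightarrow> 'e \<times> bool \<Rightarrow> 'e \<times> bool \<Rightarrow> complex) \<Rightarrow> ('v \<Rightarrow> 'e \<times> bool \<Rightarrow> 'e \<times> bool \<Rightarrow> complex)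
    \<Rightarrow> ('v \<Rightarrow> 'e \<times> bool \<Rightarrow> 'e \<times> bool \<Rightarrow> complex)
    \<Rightarrow> (real \<Rightarrow> ('e \<Rightarrow> real \<Rightarrow> complex) \<Rightarrow> ('e \<Rightarrow> real \<Rightarrow> complex)) \<Rightarrow> bool" where
  "schr_group len vtx PD PN Lam S \<longleftrightarrow>
     (\<forall>\<tau> F. L2G len F \<longrightarrow> L2G len (S \<tau> F)) \<and>
     (\<forall>\<tau> F G. L2G len F \<and> L2G len G \<and> normG len (gdiff F G) = 0 \<longrightarrow>
        normG len (gdiff (S \<tau> F) (S \<tau> G)) = 0) \<and>
     (\<forall>\<tau> F G c. L2G len F \<and> L2G len G \<longrightarrow>
        normG len (gdiff (S \<tau> (\<lambda>e x. F e x + c * G e x))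
                         (\<lambda>e x. S \<tau> F e x + c * S \<tau> G e x)) = 0) \<and>
     (\<forall>\<tau>. \<exists>K. \<forall>F. L2G len F \<longrightarrow> normG len (S \<tau> F) \<le> K * normG len F) \<and>
     (\<forall>F. L2G len F \<longrightarrow> normG len (gdiff (S 0 F) F) = 0) \<and>
     (\<forall>s t F. L2G len F \<longrightarrow> normG len (gdiff (S (s + t) F) (S s (S t F))) = 0) \<and>
     (\<forall>F. L2G len F \<longrightarrow> ((\<lambda>\<tau>. normG len (gdiff (S \<tau> F) F)) \<longlongrightarrow> 0) (at 0)) \<and>
     (\<forall>F\<in>DLap len vtx PD PN Lam.
        ((\<lambda>\<tau>. normG len (\<lambda>e x. (S \<tau> F e x - F e x) / complex_of_real \<tau> - \<i> * Lap len F e x))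
           \<longlongrightarrow> 0) (at 0))"

definition smooth_compact :: "(real \<Rightarrow> real) \<Rightarrow> bool" where
  "smooth_compact \<theta> \<longleftrightarrow> (\<forall>k x. ((deriv ^^ k) \<theta>) differentiable (at x)) \<and>
                          compact (closure {x. \<theta> x \<noteq> 0})"

definition FR :: "real \<Rightarrow> real \<Rightarrow> (real \<Rightarrow> real) \<Rightarrow> complex \<Rightarrow> complex" where
  "FR \<sigma> R \<theta> z = complex_of_real ((cmod z) powr (2 * \<sigma>) * \<theta> ((cmod z)\<^sup>2 / R)) * z"

definition FRG :: "real \<Rightarrow> real \<Rightarrow> (real \<Rightarrow> real) \<Rightarrow> ('e \<Rightarrow> real \<Rightarrow> complex) \<Rightarrow> ('e \<Rightarrow> real \<Rightarrow> complex)" where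
  "FRG \<sigma> R \<theta> F = (\<lambda>e x. FR \<sigma> R \<theta> (F e x))"

definition CDE :: "real \<Rightarrow> real \<Rightarrow> ('e::finite \<Rightarrow> ereal) \<Rightarrow> ('e \<times> bool \<Rightarrow> 'v)
    \<Rightarrow> ('v \<Rightarrow> 'e \<times> bool \<Rightarrow> 'e \<times> bool \<Rightarrow> complex) \<Rightarrow> ('v \<Rightarrow> 'e \<times> bool \<Rightarrow> 'e \<times> bool \<Rightarrow> complex)
    \<Rightarrow> ('v \<Rightarrow> 'e \<times> bool \<Rightarrow> 'e \<times> bool \<Rightarrow> complex) \<Rightarrow> (real \<Rightarrow> 'e \<Rightarrow> real \<Rightarrow> complex) \<Rightarrow> bool" where
  "CDE T M len vtx PD PN Lam u \<longleftrightarrow>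
     (\<forall>t\<in>{0..T}. u t \<in> DE len vtx PD) \<and>
     (\<forall>t\<in>{0..T}. \<forall>\<epsilon>>0. \<exists>\<delta>>0. \<forall>s\<in>{0..T}. \<bar>s - t\<bar> < \<delta> \<longrightarrow>
        normE M len vtx PD PN Lam (gdiff (u s) (u t)) < \<epsilon>)"

definition distCDE :: "real \<Rightarrow> real \<Rightarrow> ('e::finite \<Rightarrow> ereal) \<Rightarrow> ('e \<times> bool \<Rightarrow> 'v)
    \<Rightarrow> ('v \<Rightarrow> 'e \<times> bool \<Rightarrow> 'e \<times> bool \<Rightarrow> complex) \<Rightarrow> ('v \<Rightarrow> 'e \<times> bool \<Rightarrow> 'e \<times> bool \<Rightarrow> complex)
    \<Rightarrow> ('v \<Rightarrow> 'e \<times> bool \<Rightarrow> 'e \<times> bool \<Rightarrow> complex)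
    \<Rightarrow> (real \<Rightarrow> 'e \<Rightarrow> real \<Rightarrow> complex) \<Rightarrow> (real \<Rightarrow> 'e \<Rightarrow> real \<Rightarrow> complex) \<Rightarrow> real" where
  "distCDE T M len vtx PD PN Lam u w = (SUP t\<in>{0..T}. normE M len vtx PD PN Lam (gdiff (u t) (w t)))"

definition CR :: "real \<Rightarrow> (real \<Rightarrow> real) \<Rightarrow> bool" where
  "CR T x \<longleftrightarrow> continuous_on {0..T} x"

definition distCR :: "real \<Rightarrow> (real \<Rightarrow> real) \<Rightarrow> (real \<Rightarrow> real) \<Rightarrow> real" where
  "distCR T x y = (SUP t\<in>{0..T}. \<bar>x t - y t\<bar>)"

text \<open>Mild solution on [0,T] of  u(t) = S_n(t,0)u0 + i int_0^t S_n(t,s) F_R(u(s)) ds,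
  where S_n(t,s) = exp(i (n t - n s) Laplacian) = S (n t - n s); the L2-valued
  identity is stated weakly (tested against every L2 function).\<close>
definition mild_sol :: "real \<Rightarrow> real \<Rightarrow> ('e::finite \<Rightarrow> ereal) \<Rightarrow> ('e \<times> bool \<Rightarrow> 'v)
    \<Rightarrow> ('v \<Rightarrow> 'e \<times> bool \<Rightarrow> 'e \<times> bool \<Rightarrow> complex) \<Rightarrow> ('v \<Rightarrow> 'e \<times> bool \<Rightarrow> 'e \<times> bool \<Rightarrow> complex)
    \<Rightarrow> ('v \<Rightarrow> 'e \<times> bool \<Rightarrow> 'e \<times> bool \<Rightarrow> complex)
    \<Rightarrow> (real \<Rightarrow> ('e \<Rightarrow> real \<Rightarrow> complex) \<Rightarrow> ('e \<Rightarrow> real \<Rightarrow> complex))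
    \<Rightarrow> real \<Rightarrow> real \<Rightarrow> (real \<Rightarrow> real) \<Rightarrow> (real \<Rightarrow> real) \<Rightarrow> ('e \<Rightarrow> real \<Rightarrow> complex)
    \<Rightarrow> (real \<Rightarrow> 'e \<Rightarrow> real \<Rightarrow> complex) \<Rightarrow> bool" where
  "mild_sol T M len vtx PD PN Lam S \<sigma> R \<theta> n u0 u \<longleftrightarrow>
     CDE T M len vtx PD PN Lam u \<and>
     (\<forall>t\<in>{0..T}. \<forall>G. L2G len G \<longrightarrow>
        innerG len (u t) G =
          innerG len (S (n t - n 0) u0) G +
          \<i> * integral {0..t} (\<lambda>s. innerG len (S (n t - n s) (FRG \<sigma> R \<theta> (u s))) G))"

definition bdd_cont :: "('p \<Rightarrow> bool) \<Rightarrow> ('p \<Rightarrow> 'p \<Rightarrow> real) \<Rightarrow> ('p \<Rightarrow> real) \<Rightarrow> bool" where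
  "bdd_cont P d \<Phi> \<longleftrightarrow> (\<exists>B. \<forall>x. P x \<longrightarrow> \<bar>\<Phi> x\<bar> \<le> B) \<and>
     (\<forall>x. P x \<longrightarrow> (\<forall>\<epsilon>>0. \<exists>\<delta>>0. \<forall>y. P y \<and> d x y < \<delta> \<longrightarrow> \<bar>\<Phi> x - \<Phi> y\<bar> < \<epsilon>))"

definition conv_law :: "'w measure \<Rightarrow> (real \<Rightarrow> 'w \<Rightarrow> 'p) \<Rightarrow> 'z measure \<Rightarrow> ('z \<Rightarrow> 'p)
    \<Rightarrow> ('p \<Rightarrow> bool) \<Rightarrow> ('p \<Rightarrow> 'p \<Rightarrow> real) \<Rightarrow> bool" where
  "conv_law M X N Y P d \<longleftrightarrow>
     (\<forall>\<epsilon>>0. \<forall>\<omega>\<in>space M. P (X \<epsilon> \<omega>)) \<and> (\<forall>\<omega>\<in>space N. P (Y \<omega>)) \<and>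
     (\<forall>\<Phi>. bdd_cont P d \<Phi> \<longrightarrow>
        (\<forall>\<epsilon>>0. (\<lambda>\<omega>. \<Phi> (X \<epsilon> \<omega>)) \<in> borel_measurable M) \<and>
        (\<lambda>\<omega>. \<Phi> (Y \<omega>)) \<in> borel_measurable N \<and>
        ((\<lambda>\<epsilon>. LINT \<omega>|M. \<Phi> (X \<epsilon> \<omega>)) \<longlongrightarrow> (LINT \<omega>|N. \<Phi> (Y \<omega>))) (at_right 0))"

definition std_BM :: "'z measure \<Rightarrow> (real \<Rightarrow> 'z \<Rightarrow> real) \<Rightarrow> bool" where
  "std_BM N \<beta> \<longleftrightarrow> prob_space N \<and>
     (\<forall>t\<ge>0. \<beta> t \<in> borel_measurable N) \<and>
     (\<forall>\<omega>\<in>space N. \<beta> 0 \<omega> = 0 \<and> continuous_on {0..} (\<lambda>t. \<beta> t \<omega>)) \<and>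
     (\<forall>s t. 0 \<le> s \<and> s < t \<longrightarrow>
        distributed N lborel (\<lambda>\<omega>. \<beta> t \<omega> - \<beta> s \<omega>)
          (\<lambda>x. ennreal (normal_density 0 (sqrt (t - s)) x))) \<and>
     (\<forall>ts. sorted_wrt (<) ts \<and> (\<forall>t\<in>set ts. 0 \<le> t) \<longrightarrow>
        prob_space.indep_vars N (\<lambda>_. borel)
          (\<lambda>i \<omega>. \<beta> (ts ! Suc i) \<omega> - \<beta> (ts ! i) \<omega>) {..<length ts - 1})"

definition beta_eps :: "(real \<Rightarrow> 'w \<Rightarrow> real) \<Rightarrow> real \<Rightarrow> 'w \<Rightarrow> real \<Rightarrow> real" where
  "beta_eps m \<epsilon> \<omega> t = (LINT s:{0..t}|lborel. m (s / \<epsilon>\<^sup>2) \<omega> / \<epsilon>)"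

definition H0 :: "real \<Rightarrow> 'w measure \<Rightarrow> (real \<Rightarrow> 'w \<Rightarrow> real) \<Rightarrow> 'z measure \<Rightarrow> (real \<Rightarrow> 'z \<Rightarrow> real) \<Rightarrow> bool" where
  "H0 T M m N \<beta> \<longleftrightarrow> prob_space M \<and>
     (\<forall>t\<ge>0. m t \<in> borel_measurable M) \<and>
     (\<forall>\<omega>\<in>space M. \<forall>b\<ge>0. set_integrable lborel {0..b} (\<lambda>s. m s \<omega>)) \<and>
     std_BM N \<beta> \<and>
     conv_law M (beta_eps m) N (\<lambda>\<omega> t. \<beta> t \<omega>) (CR T) (distCR T)"

definition H2hyp :: "real \<Rightarrow> real \<Rightarrow> (real \<Rightarrow> real) \<Rightarrow> ('e \<Rightarrow> ereal) \<Rightarrow> ('e \<times> bool \<Rightarrow> 'v)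
    \<Rightarrow> ('v \<Rightarrow> 'e \<times> bool \<Rightarrow> 'e \<times> bool \<Rightarrow> complex) \<Rightarrow> bool" where
  "H2hyp \<sigma> R \<theta> len vtx PD \<longleftrightarrow> (\<forall>F\<in>DE len vtx PD. FRG \<sigma> R \<theta> F \<in> DE len vtx PD)"

end

theory Submission
  imports Defs "HOL-Library.Function_Algebras"
begin

text \<open>
  The mild solution depends continuously on the driving path, so convergence in law of the paths
  carries over. Write \<open>A = Mc - \<Delta>\<close>. For \<open>f\<close> in the form domain and \<open>g\<close> in the domain of
  \<open>\<Delta>\<close> one has \<open>\<langle>S(\<tau>) f, A g\<rangle> = a(f, S(-\<tau>) g)\<close>, where \<open>a\<close> is the energy form; as the group is isometric
  for \<open>a\<close>, testing the difference of two mild solutions against \<open>A g\<close> bounds its energy norm and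
  Gronwall's lemma applies. This way no element \<open>S(\<tau>) f\<close> ever has to be shown to lie in the form
  domain, and neither completeness of \<open>L\<^sup>2\<close> nor existence of solutions for arbitrary paths is used.

  The hypothesis on \<open>S\<close> only says that its generator extends \<open>\<i> \<Delta>\<close>. Equality follows because
  \<open>\<mu> - \<Delta>\<close> is onto for suitable \<open>\<mu>\<close>: on each edge the equation is solved by integration, and the
  vertex conditions give a square linear system for the coefficients of the exponentials, which is
  injective by Green's formula. The resolvents also show that the domain of \<open>\<Delta>\<close> is dense in the
  form domain.
\<close>

section \<open>Continuous mapping along a relation\<close>

text \<open>The mild identity is only available tested against L2 functions, while convergence is
  wanted in the energy norm. \<open>D\<close> is dense in the form domain for that norm, so a bound
  of <w, A g> by C times the energy norm of \<open>g\<close>, for all \<open>g\<close> in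
  \<open>D\<close>, bounds the energy norm of w by C. The modulus of continuity of S(\<tau>) f
  depends on f; compactness of the curve \<open>F (u r)\<close> makes it uniform along the reference
  solution. The Lipschitz bound of the nonlinearity grows with the energy norm of one argument only,
  so Gronwall's constant depends on the reference solution alone and the same \<delta> serves all
  competing solutions. That bound rests on a globally Lipschitz differential of \<open>FR\<close>,
  where 2 \<sigma> \<ge> 1 and the cut-off enter. Density of \<open>D\<close> comes from resolvents:
  f - l (l + A)^-1 f is bounded in energy norm and tends to 0 in L2 as l grows, and such sequences
  are weakly null for the form, which on an edge reduces to integrals of derivatives over
  intervals.\<close>

lemma upper_approximation:
  fixes d :: "'p \<Rightarrow> 'p \<Rightarrow> real" and dist' :: "'q \<Rightarrow> 'q \<Rightarrow> real"
  assumes d0: "\<And>x. P x \<Longrightarrow> d x x = 0" and dnn: "\<And>x y. P x \<Longrightarrow> P y \<Longrightarrow> 0 \<le> d x y"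
    and dsym: "\<And>x y. P x \<Longrightarrow> P y \<Longrightarrow> d x y = d y x"
    and dtri: "\<And>x y z. P x \<Longrightarrow> P y \<Longrightarrow> P z \<Longrightarrow> d x z \<le> d x y + d y z"
    and relQ: "\<And>n u. Rel n u \<Longrightarrow> Q u"
    and cont: "\<And>n u e. P n \<Longrightarrow> Rel n u \<Longrightarrow> e > 0 \<Longrightarrow>
        \<exists>\<delta>>0. \<forall>n' u'. P n' \<and> Rel n' u' \<and> d n n' < \<delta> \<longrightarrow> dist' u u' < e"
    and ne: "P n0" "Rel n0 u0"
    and \<Phi>: "bdd_cont Q dist' \<Phi>"
  obtains h :: "nat \<Rightarrow> 'p \<Rightarrow> real" and B :: real where "\<And>k. bdd_cont P d (h k)"
    "\<And>k x. P x \<Longrightarrow> \<bar>h k x\<bar> \<le> B"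
    "\<And>k x v. P x \<Longrightarrow> Rel x v \<Longrightarrow> \<Phi> v \<le> h k x"
    "\<And>x v. P x \<Longrightarrow> Rel x v \<Longrightarrow> (\<lambda>k. h k x) \<longlonglongrightarrow> \<Phi> v"
proof -
  obtain B where B: "\<And>v. Q v \<Longrightarrow> \<bar>\<Phi> v\<bar> \<le> B" using \<Phi> by (auto simp: bdd_cont_def)
  define Z where "Z = {(y, v). P y \<and> Rel y v}"
  have Zne: "Z \<noteq> {}" using ne by (auto simp: Z_def)
  have B0: "0 \<le> B" using B[of u0] relQ[OF ne(2)] by fastforce
  \<comment> \<open>The cut-off at \<open>-B\<close> keeps \<open>g\<close> bounded although
    \<open>d\<close> need not be bounded. It does not disturb the approximation, because \<Phi>
    \<ge> -B on \<open>Q\<close>.\<close>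
  define g where "g = (\<lambda>k x z. max (-B) (\<Phi> (snd z) - real k * d x (fst z)))"
  define h where "h = (\<lambda>k x. SUP z\<in>Z. g k x z)"
  have gB: "\<bar>g k x z\<bar> \<le> B" if "P x" "z \<in> Z" for k x z
  proof -
    have "\<bar>\<Phi> (snd z)\<bar> \<le> B" using that relQ by (intro B) (auto simp: Z_def)
    moreover have "0 \<le> real k * d x (fst z)" using that dnn by (auto simp: Z_def)
    ultimately show ?thesis using B0 unfolding g_def by auto
  qed
  have bdd: "bdd_above (g k x ` Z)" if "P x" for k x
    using gB[OF that, of _ k] by (intro bdd_aboveI2[of _ _ B]) (auto simp: abs_le_iff)
  have hB: "\<bar>h k x\<bar> \<le> B" if "P x" for k x
  proof -
    have "h k x \<le> B" unfolding h_def using gB[OF that] by (intro cSUP_least Zne) (auto simp: abs_le_iff)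
    moreover have "- B \<le> h k x"
    proof -
      obtain z where z: "z \<in> Z" using Zne by auto
      have "-B \<le> g k x z" by (simp add: g_def)
      also have "g k x z \<le> h k x" unfolding h_def by (rule cSUP_upper[OF z bdd[OF that]])
      finally show ?thesis .
    qed
    ultimately show ?thesis by linarith
  qed
  have lip: "h k x \<le> h k y + real k * d x y" if "P x" "P y" for k x y
    unfolding h_def
  proof (rule cSUP_least[OF Zne])
    fix z assume z: "z \<in> Z"
    have "d y (fst z) \<le> d y x + d x (fst z)" using z that by (intro dtri) (auto simp: Z_def)
    hence "real k * d y (fst z) \<le> real k * d x y + real k * d x (fst z)"
      using dsym[OF that] by (metis distrib_left mult_left_mono of_nat_0_le_iff)
    moreover have "0 \<le> real k * d x y" using dnn that by simp
    ultimately have "g k x z \<le> g k y z + real k * d x y" by (auto simp: g_def)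
    also have "g k y z \<le> (SUP z\<in>Z. g k y z)" by (rule cSUP_upper[OF z bdd[OF that(2)]])
    finally show "g k x z \<le> (SUP z\<in>Z. g k y z) + real k * d x y" by simp
  qed
  have ge: "\<Phi> v \<le> h k x" if "P x" "Rel x v" for k x v
  proof -
    have z: "(x, v) \<in> Z" using that by (auto simp: Z_def)
    have "\<Phi> v \<le> g k x (x, v)" using d0[OF that(1)] by (simp add: g_def)
    also have "\<dots> \<le> h k x" unfolding h_def by (rule cSUP_upper[OF z bdd[OF that(1)]])
    finally show ?thesis .
  qed
  have lim: "(\<lambda>k. h k x) \<longlonglongrightarrow> \<Phi> v" if xv: "P x" "Rel x v" for x v
  proof (rule LIMSEQ_I)
    fix e :: real assume "e > 0"
    hence e2: "e/2 > 0" by simp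
    obtain \<eta> where \<eta>: "\<eta> > 0" "\<And>w. Q w \<Longrightarrow> dist' v w < \<eta> \<Longrightarrow> \<bar>\<Phi> v - \<Phi> w\<bar> < e/2"
      using \<Phi> relQ[OF xv(2)] e2 unfolding bdd_cont_def by meson
    obtain \<delta> where \<delta>: "\<delta> > 0" "\<And>n' u'. P n' \<Longrightarrow> Rel n' u' \<Longrightarrow> d x n' < \<delta> \<Longrightarrow> dist' v u' < \<eta>"
      using cont[OF xv \<eta>(1)] by blast
    \<comment> \<open>For k \<ge> K the penalty at distance at least \<delta> is 2 B or more, so a
      far pair contributes at most B - 2 B = -B, which lies below \<Phi> v.\<close>
    obtain K :: nat where K: "real K > 2 * B / \<delta>" using reals_Archimedean2 by blast
    have "norm (h k x - \<Phi> v) < e" if "k \<ge> K" for k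
    proof -
      have "h k x \<le> \<Phi> v + e/2" unfolding h_def
      proof (rule cSUP_least[OF Zne])
        fix z assume z: "z \<in> Z"
        obtain y w where zz: "z = (y, w)" "P y" "Rel y w" using z by (auto simp: Z_def)
        have Bv: "-B \<le> \<Phi> v" "\<Phi> w \<le> B" using B[OF relQ[OF xv(2)]] B[OF relQ[OF zz(3)]] by auto
        have kd: "0 \<le> real k * d x y" using dnn xv zz by simp
        show "g k x z \<le> \<Phi> v + e/2"
        proof (cases "d x y < \<delta>")
          case True
          then have "\<bar>\<Phi> v - \<Phi> w\<bar> < e/2" using \<delta> zz \<eta> relQ by blast
          then show ?thesis using kd Bv e2 unfolding g_def zz fst_conv snd_conv by linarith
        next
          case False
          have "2 * B \<le> real K * \<delta>" using K \<delta>(1) by (simp add: field_simps)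
          also have "\<dots> \<le> real k * d x y" using False that \<delta>(1) by (intro mult_mono) auto
          finally show ?thesis using Bv e2 unfolding g_def zz fst_conv snd_conv by linarith
        qed
      qed
      then show ?thesis using ge[OF xv, of k] \<open>e > 0\<close> by simp
    qed
    then show "\<exists>K. \<forall>k\<ge>K. norm (h k x - \<Phi> v) < e" by blast
  qed
  have "bdd_cont P d (h k)" for k
    unfolding bdd_cont_def
  proof (intro conjI allI impI)
    show "\<exists>B. \<forall>x. P x \<longrightarrow> \<bar>h k x\<bar> \<le> B" using hB by blast
  next
    fix x and e :: real assume "P x" "e > 0"
    \<comment> \<open>\<open>h k\<close> is Lipschitz with constant k; dividing by k + 1 also covers
      k = 0.\<close>
    show "\<exists>\<delta>>0. \<forall>y. P y \<and> d x y < \<delta> \<longrightarrow> \<bar>h k x - h k y\<bar> < e"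
    proof (intro exI[of _ "e / (real k + 1)"] conjI allI impI)
      show "e / (real k + 1) > 0" using \<open>e > 0\<close> by simp
      fix y assume y: "P y \<and> d x y < e / (real k + 1)"
      have "real k * d x y \<le> (real k + 1) * d x y" using dnn \<open>P x\<close> y by (simp add: mult_right_mono)
      also have "\<dots> < e" using y by (simp add: field_simps)
      finally have "real k * d x y < e" .
      then show "\<bar>h k x - h k y\<bar> < e"
        using lip[of x y k] lip[of y x k] dsym[of x y] \<open>P x\<close> y by auto
    qed
  qed
  from that[OF this hB ge lim] show ?thesis by blast
qed

text \<open>The relation need not be defined on all of \<open>P\<close>: sup-convolutions \<open>h k\<close> of a test function
  are Lipschitz on all of \<open>P\<close> and decrease to it on the domain of the relation, so that no extension
  theorem (and no solvability for every path) is needed.\<close>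
lemma conv_law_relation:
  fixes d :: "'p \<Rightarrow> 'p \<Rightarrow> real" and dist' :: "'q \<Rightarrow> 'q \<Rightarrow> real"
  assumes M: "prob_space M" and N: "prob_space N"
    and d0: "\<And>x. P x \<Longrightarrow> d x x = 0" and dnn: "\<And>x y. P x \<Longrightarrow> P y \<Longrightarrow> 0 \<le> d x y"
    and dsym: "\<And>x y. P x \<Longrightarrow> P y \<Longrightarrow> d x y = d y x"
    and dtri: "\<And>x y z. P x \<Longrightarrow> P y \<Longrightarrow> P z \<Longrightarrow> d x z \<le> d x y + d y z"
    and relQ: "\<And>n u. Rel n u \<Longrightarrow> Q u"
    and cont: "\<And>n u e. P n \<Longrightarrow> Rel n u \<Longrightarrow> e > 0 \<Longrightarrow>
        \<exists>\<delta>>0. \<forall>n' u'. P n' \<and> Rel n' u' \<and> d n n' < \<delta> \<longrightarrow> dist' u u' < e"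
    and XY: "conv_law M X N Y P d"
    and RX: "\<And>\<epsilon> \<omega>. \<epsilon> > 0 \<Longrightarrow> \<omega> \<in> space M \<Longrightarrow> Rel (X \<epsilon> \<omega>) (X' \<epsilon> \<omega>)"
    and RY: "\<And>\<omega>. \<omega> \<in> space N \<Longrightarrow> Rel (Y \<omega>) (Y' \<omega>)"
  shows "conv_law M X' N Y' Q dist'"
proof -
  interpret M: prob_space M by fact
  interpret N: prob_space N by fact
  have PX: "P (X \<epsilon> \<omega>)" if "\<epsilon> > 0" "\<omega> \<in> space M" for \<epsilon> \<omega>
    using XY that by (auto simp: conv_law_def)
  have PY: "P (Y \<omega>)" if "\<omega> \<in> space N" for \<omega>
    using XY that by (auto simp: conv_law_def)
  obtain \<omega>0 where w0: "\<omega>0 \<in> space N" using N.not_empty by blast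
  \<comment> \<open>One-sided bounds suffice: \<open>h k\<close> lies above \<Phi> and converges in
    law for each fixed k, which bounds the upper limit. Applying the same to -\<Phi> yields the
    lower limit.\<close>
  have key: "(\<forall>\<epsilon>>0. (\<lambda>\<omega>. \<Phi> (X' \<epsilon> \<omega>)) \<in> borel_measurable M) \<and>
      (\<lambda>\<omega>. \<Phi> (Y' \<omega>)) \<in> borel_measurable N \<and>
      (\<forall>e>0. \<forall>\<^sub>F \<epsilon> in at_right 0. (LINT \<omega>|M. \<Phi> (X' \<epsilon> \<omega>)) < (LINT \<omega>|N. \<Phi> (Y' \<omega>)) + e)"
    if \<Phi>: "bdd_cont Q dist' \<Phi>" for \<Phi>
  proof -
    obtain h B where hb: "\<And>k. bdd_cont P d (h k)"
      and hB: "\<And>k x. P x \<Longrightarrow> \<bar>h k x\<bar> \<le> B"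
      and hge: "\<And>k x v. P x \<Longrightarrow> Rel x v \<Longrightarrow> \<Phi> v \<le> h k x"
      and hlim: "\<And>x v. P x \<Longrightarrow> Rel x v \<Longrightarrow> (\<lambda>k. h k x) \<longlonglongrightarrow> \<Phi> v"
      by (rule upper_approximation[of P d Rel Q dist' "Y \<omega>0" "Y' \<omega>0" \<Phi>])
        (assumption | rule d0 dnn dsym dtri cont PY[OF w0] RY[OF w0] \<Phi> | erule relQ | blast)+
    have mX: "(\<lambda>\<omega>. h k (X \<epsilon> \<omega>)) \<in> borel_measurable M" if "\<epsilon> > 0" for k \<epsilon>
      using XY hb that unfolding conv_law_def by blast
    have mY: "(\<lambda>\<omega>. h k (Y \<omega>)) \<in> borel_measurable N" for k
      using XY hb unfolding conv_law_def by blast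
    have lh: "((\<lambda>\<epsilon>. LINT \<omega>|M. h k (X \<epsilon> \<omega>)) \<longlongrightarrow> (LINT \<omega>|N. h k (Y \<omega>))) (at_right 0)" for k
      using XY hb unfolding conv_law_def by blast
    have mX': "(\<lambda>\<omega>. \<Phi> (X' \<epsilon> \<omega>)) \<in> borel_measurable M" if "\<epsilon> > 0" for \<epsilon>
      by (rule borel_measurable_LIMSEQ_real[where u="\<lambda>k \<omega>. h k (X \<epsilon> \<omega>)", OF _ mX[OF that]]) (use hlim PX RX that in blast)
    have mY': "(\<lambda>\<omega>. \<Phi> (Y' \<omega>)) \<in> borel_measurable N"
      by (rule borel_measurable_LIMSEQ_real[where u="\<lambda>k \<omega>. h k (Y \<omega>)", OF _ mY]) (use hlim PY RY in blast)
    have "(\<lambda>k. LINT \<omega>|N. h k (Y \<omega>)) \<longlonglongrightarrow> (LINT \<omega>|N. \<Phi> (Y' \<omega>))"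
      by (rule integral_dominated_convergence[where w="\<lambda>_. B"])
        (use mY mY' hlim hB PY RY in \<open>auto intro!: AE_I2\<close>)
    have "\<forall>\<^sub>F \<epsilon> in at_right 0. (LINT \<omega>|M. \<Phi> (X' \<epsilon> \<omega>)) < (LINT \<omega>|N. \<Phi> (Y' \<omega>)) + e" if "e > 0" for e
    proof -
      have "\<forall>\<^sub>F k in sequentially. (LINT \<omega>|N. h k (Y \<omega>)) < (LINT \<omega>|N. \<Phi> (Y' \<omega>)) + e"
        using \<open>(\<lambda>k. LINT \<omega>|N. h k (Y \<omega>)) \<longlonglongrightarrow> _\<close> that by (intro order_tendstoD) auto
      then obtain k where k: "(LINT \<omega>|N. h k (Y \<omega>)) < (LINT \<omega>|N. \<Phi> (Y' \<omega>)) + e"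
        by (auto simp: eventually_sequentially)
      have ev: "\<forall>\<^sub>F \<epsilon> in at_right 0. (LINT \<omega>|M. h k (X \<epsilon> \<omega>)) < (LINT \<omega>|N. \<Phi> (Y' \<omega>)) + e"
        using lh k by (intro order_tendstoD)
      have pos: "\<forall>\<^sub>F \<epsilon> in at_right (0::real). 0 < \<epsilon>" by (simp add: eventually_at_right_less)
      show ?thesis using ev pos
      proof eventually_elim
        case (elim \<epsilon>)
        \<comment> \<open>The bound \<open>B\<close> is known for the approximants
          \<open>h k\<close> and reaches \<Phi> in the limit.\<close>
        have lb: "-B \<le> \<Phi> (X' \<epsilon> \<omega>)" if "\<omega> \<in> space M" for \<omega>
        proof (rule LIMSEQ_le_const[OF hlim[OF PX[OF elim(2) that] RX[OF elim(2) that]]])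
          show "\<exists>N. \<forall>n\<ge>N. - B \<le> h n (X \<epsilon> \<omega>)" using hB[OF PX[OF elim(2) that]] abs_le_D2 by (metis minus_le_iff)
        qed
        have ub: "\<Phi> (X' \<epsilon> \<omega>) \<le> h k (X \<epsilon> \<omega>)" if "\<omega> \<in> space M" for \<omega>
          using hge PX RX elim that by blast
        have hB': "\<bar>h k (X \<epsilon> \<omega>)\<bar> \<le> B" if "\<omega> \<in> space M" for \<omega> using hB PX elim that by blast
        have "(LINT \<omega>|M. \<Phi> (X' \<epsilon> \<omega>)) \<le> (LINT \<omega>|M. h k (X \<epsilon> \<omega>))"
        proof (rule integral_mono)
          show "integrable M (\<lambda>\<omega>. h k (X \<epsilon> \<omega>))"
            by (rule M.integrable_const_bound[where B=B]) (use hB' mX elim in auto)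
          show "integrable M (\<lambda>\<omega>. \<Phi> (X' \<epsilon> \<omega>))"
          proof (rule M.integrable_const_bound[where B=B])
            show "AE \<omega> in M. norm (\<Phi> (X' \<epsilon> \<omega>)) \<le> B" using ub hB' lb
              by (intro AE_I2) (force simp: abs_le_iff)
          qed (use mX' elim in auto)
        qed (use ub in auto)
        then show ?case using elim by linarith
      qed
    qed
    then show ?thesis using mX' mY' by blast
  qed
  have neg: "bdd_cont Q dist' (\<lambda>v. - \<Phi> v)" if "bdd_cont Q dist' \<Phi>" for \<Phi>
    using that unfolding bdd_cont_def by (simp add: abs_minus_commute add.commute[of "- _"])
  show ?thesis
    unfolding conv_law_def
  proof (intro conjI allI impI ballI)
    show "Q (X' \<epsilon> \<omega>)" if "\<epsilon> > 0" "\<omega> \<in> space M" for \<epsilon> \<omega> using relQ RX that by blast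
    show "Q (Y' \<omega>)" if "\<omega> \<in> space N" for \<omega> using relQ RY that by blast
  next
    fix \<Phi> assume \<Phi>: "bdd_cont Q dist' \<Phi>"
    show "(\<lambda>\<omega>. \<Phi> (X' \<epsilon> \<omega>)) \<in> borel_measurable M" if "\<epsilon> > 0" for \<epsilon> using key[OF \<Phi>] that by blast
    show "(\<lambda>\<omega>. \<Phi> (Y' \<omega>)) \<in> borel_measurable N" using key[OF \<Phi>] by blast
    show "((\<lambda>\<epsilon>. LINT \<omega>|M. \<Phi> (X' \<epsilon> \<omega>)) \<longlongrightarrow> (LINT \<omega>|N. \<Phi> (Y' \<omega>))) (at_right 0)"
    proof (rule order_tendstoI)
      fix a assume "(LINT \<omega>|N. \<Phi> (Y' \<omega>)) < a"
      then have "0 < a - (LINT \<omega>|N. \<Phi> (Y' \<omega>))" by simp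
      with key[OF \<Phi>] have "\<forall>\<^sub>F \<epsilon> in at_right 0. (LINT \<omega>|M. \<Phi> (X' \<epsilon> \<omega>)) <
          (LINT \<omega>|N. \<Phi> (Y' \<omega>)) + (a - (LINT \<omega>|N. \<Phi> (Y' \<omega>)))" by blast
      then show "\<forall>\<^sub>F \<epsilon> in at_right 0. (LINT \<omega>|M. \<Phi> (X' \<epsilon> \<omega>)) < a" by simp
    next
      fix a assume "a < (LINT \<omega>|N. \<Phi> (Y' \<omega>))"
      then have "0 < (LINT \<omega>|N. \<Phi> (Y' \<omega>)) - a" by simp
      with key[OF neg[OF \<Phi>]] have "\<forall>\<^sub>F \<epsilon> in at_right 0. (LINT \<omega>|M. - \<Phi> (X' \<epsilon> \<omega>)) <
          (LINT \<omega>|N. - \<Phi> (Y' \<omega>)) + ((LINT \<omega>|N. \<Phi> (Y' \<omega>)) - a)" by blast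
      then show "\<forall>\<^sub>F \<epsilon> in at_right 0. a < (LINT \<omega>|M. \<Phi> (X' \<epsilon> \<omega>))" by simp
    qed
  qed
qed

section \<open>The uniform distance on real paths\<close>

lemma distCR_metric:
  assumes "T > 0"
  shows "CR T x \<Longrightarrow> distCR T x x = 0" "CR T x \<Longrightarrow> CR T y \<Longrightarrow> 0 \<le> distCR T x y"
    "distCR T x y = distCR T y x"
    "CR T x \<Longrightarrow> CR T y \<Longrightarrow> CR T z \<Longrightarrow> distCR T x z \<le> distCR T x y + distCR T y z"
    "CR T x \<Longrightarrow> CR T y \<Longrightarrow> t \<in> {0..T} \<Longrightarrow> \<bar>x t - y t\<bar> \<le> distCR T x y"
proof -
  have ne: "{0..T} \<noteq> {}" using assms by auto
  have bdd: "bdd_above ((\<lambda>t. \<bar>x t - y t\<bar>) ` {0..T})" if "CR T x" "CR T y" for x y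
  proof -
    have "compact ((\<lambda>t. \<bar>x t - y t\<bar>) ` {0..T})"
      using that unfolding CR_def by (intro compact_continuous_image continuous_intros) auto
    then show ?thesis by (intro bounded_imp_bdd_above compact_imp_bounded)
  qed
  show le: "\<bar>x t - y t\<bar> \<le> distCR T x y" if "CR T x" "CR T y" "t \<in> {0..T}" for x y t
    unfolding distCR_def by (rule cSUP_upper[OF that(3) bdd[OF that(1,2)]])
  show "distCR T x x = 0" if "CR T x" using ne by (simp add: distCR_def)
  show "0 \<le> distCR T x y" if "CR T x" "CR T y"
    using le[OF that, of 0] assms by force
  show "distCR T x y = distCR T y x" by (simp add: distCR_def abs_minus_commute)
  show "distCR T x z \<le> distCR T x y + distCR T y z" if "CR T x" "CR T y" "CR T z"
    unfolding distCR_def[of T x z]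
  proof (rule cSUP_least[OF ne])
    fix t assume t: "t \<in> {0..T}"
    show "\<bar>x t - z t\<bar> \<le> distCR T x y + distCR T y z"
      using le[OF that(1,2) t] le[OF that(2,3) t] by linarith
  qed
qed

section \<open>Semi-inner product spaces\<close>

text \<open>Only semidefinite, on a subset of a function type: elements are representatives, so a
  null norm means equality almost everywhere. The same locale serves L2 on an edge, L2 on the graph
  and the form domain.\<close>

locale semi_inner =
  fixes scl :: "complex \<Rightarrow> 'h::ab_group_add \<Rightarrow> 'h" and V :: "'h set" and ip :: "'h \<Rightarrow> 'h \<Rightarrow> complex"
  assumes scl_vs: "vector_space scl"
    and V_zero: "0 \<in> V"
    and V_add: "\<And>x y. x \<in> V \<Longrightarrow> y \<in> V \<Longrightarrow> x + y \<in> V"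
    and V_scl: "\<And>c x. x \<in> V \<Longrightarrow> scl c x \<in> V"
    and ip_add: "\<And>x y z. x \<in> V \<Longrightarrow> y \<in> V \<Longrightarrow> z \<in> V \<Longrightarrow> ip (x + y) z = ip x z + ip y z"
    and ip_scl: "\<And>c x z. x \<in> V \<Longrightarrow> z \<in> V \<Longrightarrow> ip (scl c x) z = c * ip x z"
    and ip_cnj: "\<And>x y. x \<in> V \<Longrightarrow> y \<in> V \<Longrightarrow> ip y x = cnj (ip x y)"
    and ip_nonneg: "\<And>x. x \<in> V \<Longrightarrow> 0 \<le> Re (ip x x)"
begin

sublocale vs: vector_space scl by (rule scl_vs)

definition nrm :: "'h \<Rightarrow> real" where "nrm x = sqrt (Re (ip x x))"

lemma V_minus: "x \<in> V \<Longrightarrow> - x \<in> V"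
  using V_scl[of x "-1"] by (simp add: vs.scale_minus_left)

lemma V_diff: "x \<in> V \<Longrightarrow> y \<in> V \<Longrightarrow> x - y \<in> V"
  using V_add[of x "-y"] V_minus[of y] by simp

lemmas V_closed = V_zero V_add V_scl V_minus V_diff

lemma ip_minus: "x \<in> V \<Longrightarrow> z \<in> V \<Longrightarrow> ip (- x) z = - ip x z"
  using ip_scl[of x z "-1"] by (simp add: vs.scale_minus_left)

lemma ip_diff: "x \<in> V \<Longrightarrow> y \<in> V \<Longrightarrow> z \<in> V \<Longrightarrow> ip (x - y) z = ip x z - ip y z"
  using ip_add[of x "-y" z] ip_minus[of y z] V_minus[of y] by simp

lemma ip_add_right: "x \<in> V \<Longrightarrow> y \<in> V \<Longrightarrow> z \<in> V \<Longrightarrow> ip z (x + y) = ip z x + ip z y"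
  using ip_cnj[of "x+y" z] ip_cnj[of x z] ip_cnj[of y z] ip_add[of x y z] V_add[of x y] by simp

lemma ip_scl_right: "x \<in> V \<Longrightarrow> z \<in> V \<Longrightarrow> ip z (scl c x) = cnj c * ip z x"
  using ip_cnj[of "scl c x" z] ip_cnj[of x z] ip_scl[of x z c] V_scl[of x c] by simp

lemma ip_minus_right: "x \<in> V \<Longrightarrow> z \<in> V \<Longrightarrow> ip z (- x) = - ip z x"
  using ip_cnj[of "- x" z] ip_cnj[of x z] ip_minus[of x z] V_minus[of x] by simp

lemma ip_diff_right: "x \<in> V \<Longrightarrow> y \<in> V \<Longrightarrow> z \<in> V \<Longrightarrow> ip z (x - y) = ip z x - ip z y"
  using ip_cnj[of "x-y" z] ip_cnj[of x z] ip_cnj[of y z] ip_diff[of x y z] V_diff[of x y] by simp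

lemmas ip_simps = ip_add ip_scl ip_minus ip_diff ip_add_right ip_scl_right ip_minus_right ip_diff_right

lemma nrm_nonneg [simp]: "x \<in> V \<Longrightarrow> 0 \<le> nrm x"
  using ip_nonneg by (simp add: nrm_def)

lemma nrm_le_0: "x \<in> V \<Longrightarrow> nrm x \<le> 0 \<Longrightarrow> nrm x = 0"
  using nrm_nonneg by (meson order_antisym)

lemma ip_self: "x \<in> V \<Longrightarrow> ip x x = complex_of_real ((nrm x)\<^sup>2)"
  using ip_nonneg[of x] ip_cnj[of x x] by (simp add: nrm_def complex_eq_iff)

lemma Re_ip_commute: "x \<in> V \<Longrightarrow> y \<in> V \<Longrightarrow> Re (ip y x) = Re (ip x y)"
  using ip_cnj[of x y] by simp

lemma Cauchy_Schwarz:
  assumes x: "x \<in> V" and y: "y \<in> V"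
  shows "cmod (ip x y) \<le> nrm x * nrm y"
proof -
  define c where "c = ip x y"
  have q: "0 \<le> (nrm x)\<^sup>2 - 2 * Re (cnj t * c) + (cmod t)\<^sup>2 * (nrm y)\<^sup>2" for t
  proof -
    have "ip (x - scl t y) (x - scl t y) = ip x x - cnj t * c - t * cnj c + t * cnj t * ip y y"
      using x y ip_cnj[of x y] by (simp add: ip_simps V_closed c_def algebra_simps)
    from arg_cong[OF this, of Re] have "Re (ip (x - scl t y) (x - scl t y)) =
        (nrm x)\<^sup>2 - 2 * Re (cnj t * c) + (cmod t)\<^sup>2 * (nrm y)\<^sup>2"
      unfolding complex_norm_square[symmetric] ip_self[OF x] ip_self[OF y]
      by (simp del: of_real_power of_real_mult add: of_real_mult[symmetric] algebra_simps)
    with ip_nonneg[of "x - scl t y"] x y show ?thesis by (simp add: V_closed)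
  qed
  show ?thesis
  proof (cases "nrm y = 0")
    case True
    have "c = 0"
    proof (rule ccontr)
      assume "c \<noteq> 0"
      \<comment> \<open>Chosen so that the linear term of \<open>q\<close> equals
        \<open>(nrm x)\<^sup>2 + 1\<close>, which makes the expression negative; the quadratic term
        is absent because \<open>nrm y = 0\<close>.\<close>
      define r where "r = ((nrm x)\<^sup>2 + 1) / (2 * (cmod c)\<^sup>2)"
      have "Re (cnj (complex_of_real r * c) * c) = r * (cmod c)\<^sup>2"
        unfolding cmod_power2 by (simp add: algebra_simps power2_eq_square)
      with q[of "complex_of_real r * c"] True have "0 \<le> (nrm x)\<^sup>2 - 2 * (r * (cmod c)\<^sup>2)" by simp
      then show False using \<open>c \<noteq> 0\<close> by (simp add: r_def)
    qed
    then show ?thesis using True by (simp add: c_def)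
  next
    case False
    then have b: "(nrm y)\<^sup>2 > 0" by simp
    \<comment> \<open>The minimiser of the quadratic expression in \<open>q\<close>.\<close>
    define t where "t = c / complex_of_real ((nrm y)\<^sup>2)"
    have "cmod t = cmod c / (nrm y)\<^sup>2" by (simp add: t_def norm_divide norm_power del: of_real_power)
    then have "(cmod t)\<^sup>2 * (nrm y)\<^sup>2 = (cmod c)\<^sup>2 / (nrm y)\<^sup>2"
      using False by (simp add: power_divide power2_eq_square)
    moreover have "Re (cnj t * c) = (cmod c)\<^sup>2 / (nrm y)\<^sup>2"
    proof -
      have "cnj t * c = complex_of_real ((cmod c)\<^sup>2 / (nrm y)\<^sup>2)"
        unfolding t_def using complex_norm_square[of c] by (simp add: mult.commute)
      then show ?thesis by simp
    qed
    ultimately have "0 \<le> (nrm x)\<^sup>2 - (cmod c)\<^sup>2 / (nrm y)\<^sup>2" using q[of t] by simp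
    then have "(cmod c)\<^sup>2 \<le> (nrm x * nrm y)\<^sup>2" using b by (simp add: field_simps power_mult_distrib)
    then show ?thesis unfolding c_def using x y by (simp add: abs_le_square_iff[symmetric])
  qed
qed

lemma nrm_triangle: assumes "x \<in> V" "y \<in> V" shows "nrm (x + y) \<le> nrm x + nrm y"
proof (rule power2_le_imp_le)
  have "(nrm (x + y))\<^sup>2 = Re (ip (x + y) (x + y))" using assms by (simp add: ip_self V_closed)
  also have "\<dots> = (nrm x)\<^sup>2 + 2 * Re (ip x y) + (nrm y)\<^sup>2"
    using assms Re_ip_commute[of x y] ip_self[of x] ip_self[of y] by (simp add: ip_simps V_closed)
  also have "\<dots> \<le> (nrm x)\<^sup>2 + 2 * (nrm x * nrm y) + (nrm y)\<^sup>2"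
    using Cauchy_Schwarz[OF assms] complex_Re_le_cmod[of "ip x y"] by simp
  finally show "(nrm (x + y))\<^sup>2 \<le> (nrm x + nrm y)\<^sup>2" by (simp add: power2_sum)
qed (use assms in \<open>simp add: V_closed\<close>)

lemma nrm_scl: "x \<in> V \<Longrightarrow> nrm (scl c x) = cmod c * nrm x"
proof -
  assume x: "x \<in> V"
  have "(nrm (scl c x))\<^sup>2 = (cmod c * nrm x)\<^sup>2"
  proof -
    have "complex_of_real ((nrm (scl c x))\<^sup>2) = c * cnj c * complex_of_real ((nrm x)\<^sup>2)"
      using x by (simp add: ip_self[symmetric] V_closed ip_simps del: of_real_power)
    also have "\<dots> = complex_of_real ((cmod c * nrm x)\<^sup>2)"
      by (simp add: complex_norm_square[symmetric] power_mult_distrib)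
    finally show ?thesis using of_real_eq_iff by blast
  qed
  then show ?thesis using x by (simp add: V_closed)
qed

lemma nrm_zero [simp]: "nrm 0 = 0"
  using nrm_scl[OF V_zero, of 0] by (simp add: vs.scale_zero_left)

lemma nrm_minus: "x \<in> V \<Longrightarrow> nrm (- x) = nrm x"
  using nrm_scl[of x "-1"] by (simp add: vs.scale_minus_left)

lemma nrm_commute: "x \<in> V \<Longrightarrow> y \<in> V \<Longrightarrow> nrm (x - y) = nrm (y - x)"
  using nrm_minus[of "x - y"] V_diff by simp

lemma nrm_diff_triangle:
  "x \<in> V \<Longrightarrow> y \<in> V \<Longrightarrow> z \<in> V \<Longrightarrow> nrm (x - z) \<le> nrm (x - y) + nrm (y - z)"
  using nrm_triangle[of "x - y" "y - z"] V_diff by simp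

lemma nrm_diff_le: "x \<in> V \<Longrightarrow> y \<in> V \<Longrightarrow> nrm (x - y) \<le> nrm x + nrm y"
  using nrm_triangle[of x "-y"] nrm_minus[of y] V_minus by simp

lemma nrm_diff_ge: "x \<in> V \<Longrightarrow> y \<in> V \<Longrightarrow> \<bar>nrm x - nrm y\<bar> \<le> nrm (x - y)"
  using nrm_triangle[of "x - y" y] nrm_triangle[of "y - x" x] nrm_commute[of x y] V_diff by fastforce

text \<open>Equality modulo null vectors. It takes the place of a quotient space: the group and the
  derivatives chosen by \<open>SOME\<close> are determined only up to this relation.\<close>

definition eqv :: "'h \<Rightarrow> 'h \<Rightarrow> bool" (infix "\<doteq>" 50) where
  "x \<doteq> y \<longleftrightarrow> x \<in> V \<and> y \<in> V \<and> nrm (x - y) = 0"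

lemma eqvI: "x \<in> V \<Longrightarrow> y \<in> V \<Longrightarrow> nrm (x - y) = 0 \<Longrightarrow> x \<doteq> y" by (simp add: eqv_def)
lemma eqv_refl: "x \<in> V \<Longrightarrow> x \<doteq> x" by (simp add: eqv_def)
lemma eqv_sym: "x \<doteq> y \<Longrightarrow> y \<doteq> x" using nrm_commute by (auto simp: eqv_def)
lemma eqv_trans [trans]: "x \<doteq> y \<Longrightarrow> y \<doteq> z \<Longrightarrow> x \<doteq> z"
  using nrm_diff_triangle[of x y z] nrm_le_0[of "x - z"] V_diff[of x z] by (auto simp: eqv_def)
lemma eqv_add: assumes "x \<doteq> y" "x' \<doteq> y'" shows "x + x' \<doteq> y + y'"
proof -
  have "nrm ((x + x') - (y + y')) \<le> nrm (x - y) + nrm (x' - y')"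
    using nrm_triangle[of "x - y" "x' - y'"] assms by (simp add: eqv_def V_closed algebra_simps)
  then show ?thesis using assms nrm_le_0[of "(x + x') - (y + y')"] by (simp add: eqv_def V_closed)
qed
lemma eqv_scl: assumes "x \<doteq> y" shows "scl c x \<doteq> scl c y"
  using assms nrm_scl[of "x - y" c] by (simp add: eqv_def V_closed vs.scale_right_diff_distrib)
lemma eqv_diff: assumes "x \<doteq> y" "x' \<doteq> y'" shows "x - x' \<doteq> y - y'"
  using eqv_add[OF assms(1) eqv_scl[OF assms(2), of "-1"]] by (simp add: vs.scale_minus_left)
lemma eqv_V: "x \<doteq> y \<Longrightarrow> x \<in> V" "x \<doteq> y \<Longrightarrow> y \<in> V" by (auto simp: eqv_def)

lemma eqv_ip: assumes "x \<doteq> y" "z \<in> V" shows "ip x z = ip y z" "ip z x = ip z y"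
proof -
  have "cmod (ip (x - y) z) \<le> 0" using Cauchy_Schwarz[of "x - y" z] assms by (simp add: eqv_def V_closed)
  then show 1: "ip x z = ip y z" using assms by (simp add: ip_diff eqv_def)
  show "ip z x = ip z y" using 1 ip_cnj[of x z] ip_cnj[of y z] assms by (simp add: eqv_def)
qed

lemma eqv_nrm: "x \<doteq> y \<Longrightarrow> nrm x = nrm y"
  using eqv_ip[of x y x] eqv_ip[of x y y] by (auto simp: nrm_def eqv_def)

end

section \<open>Unitary groups and their form domains\<close>

lemma tendsto_0_squeeze:
  fixes f h :: "'a \<Rightarrow> real"
  assumes "(h \<longlongrightarrow> b) F" "b = 0" "\<And>x. 0 \<le> f x" "\<And>x. f x \<le> h x"
  shows "(f \<longlongrightarrow> 0) F"
  by (rule tendsto_sandwich[where f="\<lambda>_. 0" and h=h]) (use assms in auto)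

text \<open>\<open>V\<close> stands for L2, \<open>W\<close> for the form domain, \<open>D\<close>
  for the domain of the Laplacian \<open>Lp\<close>. In \<open>resolvent\<close>, non-real \<mu>
  serves the invariance of \<open>D\<close> under the group, real \<mu> the approximation of
  \<open>W\<close> by \<open>D\<close>. The condition \<open>weak\<close> stands in for weak
  compactness of bounded sets in the form domain.\<close>

locale form_group = H: semi_inner scl V ip + E: semi_inner scl W a
  for scl :: "complex \<Rightarrow> 'h::ab_group_add \<Rightarrow> 'h" and V ip W a +
  fixes D :: "'h set" and Lp :: "'h \<Rightarrow> 'h" and Mc :: real and S :: "real \<Rightarrow> 'h \<Rightarrow> 'h"
  assumes W_sub: "W \<subseteq> V" and D_sub: "D \<subseteq> W"
    and Lp_V: "\<And>g. g \<in> D \<Longrightarrow> Lp g \<in> V"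
    and coercive: "\<exists>c>0. \<forall>f\<in>W. c * H.nrm f \<le> E.nrm f"
    and green: "\<And>f g. f \<in> W \<Longrightarrow> g \<in> D \<Longrightarrow> a f g = ip f (scl (of_real Mc) g - Lp g)"
    and resolvent: "\<And>h \<mu>. h \<in> V \<Longrightarrow> Im \<mu> \<noteq> 0 \<or> Re \<mu> \<ge> Mc \<Longrightarrow> \<exists>g\<in>D. H.nrm (scl \<mu> g - Lp g - h) = 0"
    and weak: "\<And>v f B. (\<And>j::nat. v j \<in> W) \<Longrightarrow> (\<And>j. E.nrm (v j) \<le> B) \<Longrightarrow>
      (\<lambda>j. H.nrm (v j)) \<longlonglongrightarrow> 0 \<Longrightarrow> f \<in> W \<Longrightarrow> (\<lambda>j. a (v j) f) \<longlonglongrightarrow> 0"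
    and S_V: "\<And>t f. f \<in> V \<Longrightarrow> S t f \<in> V"
    and S_lin: "\<And>t f g c. f \<in> V \<Longrightarrow> g \<in> V \<Longrightarrow> H.nrm (S t (f + scl c g) - (S t f + scl c (S t g))) = 0"
    and S_bdd: "\<And>t. \<exists>K. \<forall>f\<in>V. H.nrm (S t f) \<le> K * H.nrm f"
    and S_0: "\<And>f. f \<in> V \<Longrightarrow> H.nrm (S 0 f - f) = 0"
    and S_add: "\<And>s t f. f \<in> V \<Longrightarrow> H.nrm (S (s + t) f - S s (S t f)) = 0"
    and S_cont: "\<And>f. f \<in> V \<Longrightarrow> ((\<lambda>\<tau>. H.nrm (S \<tau> f - f)) \<longlongrightarrow> 0) (at 0)"
    and S_gen: "\<And>g. g \<in> D \<Longrightarrow>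
      ((\<lambda>\<tau>. H.nrm (scl (1 / of_real \<tau>) (S \<tau> g - g) - scl \<i> (Lp g))) \<longlongrightarrow> 0) (at 0)"
begin

notation H.eqv (infix "\<doteq>" 50)

lemma WV [simp]: "f \<in> W \<Longrightarrow> f \<in> V" using W_sub by auto
lemma DW [simp]: "f \<in> D \<Longrightarrow> f \<in> W" using D_sub by auto
lemmas VC = H.V_closed E.V_closed S_V Lp_V

definition Aop :: "'h \<Rightarrow> 'h" where "Aop g = scl (of_real Mc) g - Lp g"

lemma Aop_V: "g \<in> D \<Longrightarrow> Aop g \<in> V" by (simp add: Aop_def VC)
lemma green': "f \<in> W \<Longrightarrow> g \<in> D \<Longrightarrow> a f g = ip f (Aop g)" by (simp add: green Aop_def)

lemma S_add_eqv: "f \<in> V \<Longrightarrow> S (s + t) f \<doteq> S s (S t f)" by (simp add: H.eqvI VC S_add)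
lemma S_0_eqv: "f \<in> V \<Longrightarrow> S 0 f \<doteq> f" by (simp add: H.eqvI VC S_0)
lemma S_lin_eqv: "f \<in> V \<Longrightarrow> g \<in> V \<Longrightarrow> S t (f + scl c g) \<doteq> S t f + scl c (S t g)"
  by (intro H.eqvI S_lin) (auto simp: VC)

lemma S_diff_eqv: assumes "f \<in> V" "g \<in> V" shows "S t (f - g) \<doteq> S t f - S t g"
  using S_lin_eqv[OF assms, of t "-1"] by (simp add: H.vs.scale_minus_left)

lemma S_eqv: assumes "f \<doteq> g" shows "S t f \<doteq> S t g"
proof -
  have fg: "f \<in> V" "g \<in> V" using assms by (auto dest: H.eqv_V)
  obtain K where K: "\<And>f. f \<in> V \<Longrightarrow> H.nrm (S t f) \<le> K * H.nrm f" using S_bdd by blast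
  have "H.nrm (S t (f - g)) \<le> 0" using K[of "f - g"] assms fg by (simp add: H.eqv_def VC)
  then have "H.nrm (S t f - S t g) \<le> 0" using H.eqv_nrm[OF S_diff_eqv[OF fg, of t]] by simp
  then show ?thesis using fg by (intro H.eqvI H.nrm_le_0 VC)
qed

lemma S_zero_eqv: "S t 0 \<doteq> 0"
proof -
  obtain K where K: "\<And>f. f \<in> V \<Longrightarrow> H.nrm (S t f) \<le> K * H.nrm f" using S_bdd by blast
  have "H.nrm (S t 0) \<le> 0" using K[of 0] by (simp add: VC)
  then show ?thesis by (intro H.eqvI VC H.nrm_le_0) simp
qed

lemma S_scl_eqv: assumes "f \<in> V" shows "S t (scl c f) \<doteq> scl c (S t f)"
proof -
  have "S t (0 + scl c f) \<doteq> S t 0 + scl c (S t f)" by (rule S_lin_eqv) (auto simp: assms VC)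
  also have "\<dots> \<doteq> 0 + scl c (S t f)" by (intro H.eqv_add S_zero_eqv H.eqv_refl) (simp add: assms VC)
  finally show ?thesis by simp
qed

lemma S_inv_eqv: "f \<in> V \<Longrightarrow> S t (S (- t) f) \<doteq> f"
  using H.eqv_trans[OF H.eqv_sym[OF S_add_eqv[of f t "- t"]]] S_0_eqv[of f] by simp

lemma S_Aop_eqv: assumes "g \<in> D" "S t g \<doteq> G" "S t (Lp g) \<doteq> Lp G" shows "S t (Aop g) \<doteq> Aop G"
proof -
  have "S t (Aop g) \<doteq> S t (scl (of_real Mc) g) - S t (Lp g)"
    unfolding Aop_def by (rule S_diff_eqv) (auto simp: assms VC)
  also have "\<dots> \<doteq> scl (of_real Mc) G - Lp G"
    by (intro H.eqv_diff assms H.eqv_trans[OF S_scl_eqv H.eqv_scl[OF assms(2)]]) (simp add: assms)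
  finally show ?thesis by (simp add: Aop_def)
qed

section \<open>The generator and the invariance of the domain\<close>

definition gen :: "'h \<Rightarrow> 'h \<Rightarrow> bool" where
  "gen f p \<longleftrightarrow> f \<in> V \<and> p \<in> V \<and>
     ((\<lambda>\<tau>. H.nrm (scl (1 / of_real \<tau>) (S \<tau> f - f) - p)) \<longlongrightarrow> 0) (at 0)"

lemma gen_D: "g \<in> D \<Longrightarrow> gen g (scl \<i> (Lp g))"
  unfolding gen_def by (intro conjI S_gen) (simp_all add: VC)

lemma gen_cong: assumes "gen f p" "p \<doteq> q" shows "gen f q"
proof -
  have "H.nrm (scl (1 / of_real \<tau>) (S \<tau> f - f) - p) = H.nrm (scl (1 / of_real \<tau>) (S \<tau> f - f) - q)" for \<tau>
    using assms by (intro H.eqv_nrm H.eqv_diff H.eqv_refl) (auto simp: gen_def VC)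
  then show ?thesis using assms by (auto simp: gen_def dest: H.eqv_V)
qed

lemma gen_S: assumes "gen f p" shows "gen (S t f) (S t p)"
proof -
  have fp: "f \<in> V" "p \<in> V" using assms by (auto simp: gen_def)
  obtain K where K: "\<And>f. f \<in> V \<Longrightarrow> H.nrm (S t f) \<le> K * H.nrm f" using S_bdd by blast
  let ?q = "\<lambda>\<tau>. scl (1 / of_real \<tau>) (S \<tau> f - f) - p"
  have *: "H.nrm (scl (1 / of_real \<tau>) (S \<tau> (S t f) - S t f) - S t p) \<le> K * H.nrm (?q \<tau>)" for \<tau>
  proof -
    have c: "S \<tau> (S t f) \<doteq> S t (S \<tau> f)"
      using H.eqv_trans[OF H.eqv_sym[OF S_add_eqv[OF fp(1), of \<tau> t]]] S_add_eqv[OF fp(1), of t \<tau>]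
      by (simp add: add.commute)
    have "S t (?q \<tau>) \<doteq> S t (scl (1 / of_real \<tau>) (S \<tau> f - f)) - S t p"
      by (rule S_diff_eqv) (auto simp: fp VC)
    also have "\<dots> \<doteq> scl (1 / of_real \<tau>) (S t (S \<tau> f - f)) - S t p"
      by (intro H.eqv_diff S_scl_eqv H.eqv_refl) (auto simp: fp VC)
    also have "\<dots> \<doteq> scl (1 / of_real \<tau>) (S t (S \<tau> f) - S t f) - S t p"
      by (intro H.eqv_diff H.eqv_scl S_diff_eqv H.eqv_refl) (auto simp: fp VC)
    also have "\<dots> \<doteq> scl (1 / of_real \<tau>) (S \<tau> (S t f) - S t f) - S t p"
      by (intro H.eqv_diff H.eqv_scl H.eqv_sym[OF c] H.eqv_refl) (auto simp: fp VC)
    finally show ?thesis using H.eqv_nrm K[of "?q \<tau>"] by (auto simp: fp VC)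
  qed
  have "((\<lambda>\<tau>. K * H.nrm (?q \<tau>)) \<longlongrightarrow> K * 0) (at 0)"
    using assms by (intro tendsto_mult tendsto_const) (auto simp: gen_def)
  then have "((\<lambda>\<tau>. H.nrm (scl (1 / of_real \<tau>) (S \<tau> (S t f) - S t f) - S t p)) \<longlongrightarrow> 0) (at 0)"
    by (rule tendsto_0_squeeze) (auto simp: * fp VC intro!: always_eventually)
  then show ?thesis by (simp add: gen_def fp VC)
qed

lemma gen_diff: assumes "gen f p" "gen g q" shows "gen (f - g) (p - q)"
proof -
  have V: "f \<in> V" "p \<in> V" "g \<in> V" "q \<in> V" using assms by (auto simp: gen_def)
  let ?q = "\<lambda>f p \<tau>. scl (1 / of_real \<tau>) (S \<tau> f - f) - p"
  have *: "H.nrm (?q (f - g) (p - q) \<tau>) \<le> H.nrm (?q f p \<tau>) + H.nrm (?q g q \<tau>)" for \<tau>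
  proof -
    have "?q (f - g) (p - q) \<tau> \<doteq> scl (1 / of_real \<tau>) ((S \<tau> f - S \<tau> g) - (f - g)) - (p - q)"
      by (intro H.eqv_diff H.eqv_scl S_diff_eqv H.eqv_refl) (auto simp: V VC)
    also have "scl (1 / of_real \<tau>) ((S \<tau> f - S \<tau> g) - (f - g)) - (p - q) = ?q f p \<tau> - ?q g q \<tau>"
      by (simp add: H.vs.scale_right_diff_distrib algebra_simps)
    finally have "H.nrm (?q (f - g) (p - q) \<tau>) = H.nrm (?q f p \<tau> - ?q g q \<tau>)" by (rule H.eqv_nrm)
    then show ?thesis using H.nrm_diff_le[of "?q f p \<tau>" "?q g q \<tau>"] by (simp add: V VC)
  qed
  have "((\<lambda>\<tau>. H.nrm (?q f p \<tau>) + H.nrm (?q g q \<tau>)) \<longlongrightarrow> 0 + 0) (at 0)"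
    using assms by (intro tendsto_add) (auto simp: gen_def)
  then have "((\<lambda>\<tau>. H.nrm (?q (f - g) (p - q) \<tau>)) \<longlongrightarrow> 0) (at 0)"
    by (rule tendsto_0_squeeze) (auto simp: * V VC intro!: always_eventually)
  then show ?thesis by (simp add: gen_def V VC)
qed

text \<open>The product rule for the pairing. The real part turns it into a statement on real
  functions, where a vanishing derivative gives constancy; imaginary parts are recovered later by
  inserting a factor \<i>.\<close>

lemma DERIV_Re_ip_S:
  assumes "gen f p" "gen g q"
  shows "DERIV (\<lambda>t. Re (ip (S t f) (S t g))) t :> Re (ip (S t p) (S t g)) + Re (ip (S t f) (S t q))"
proof -
  define F P G Q where FPGQ: "F = S t f" "P = S t p" "G = S t g" "Q = S t q"
  have gF: "gen F P" and gG: "gen G Q" using assms gen_S FPGQ by auto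
  then have V: "F \<in> V" "P \<in> V" "G \<in> V" "Q \<in> V" and fg: "f \<in> V" "g \<in> V"
    using assms by (auto simp: gen_def)
  define dq where "dq = (\<lambda>X \<tau>. scl (1 / of_real \<tau>) (S \<tau> X - X))"
  have dqV: "dq X \<tau> \<in> V" if "X \<in> V" for X \<tau> using that by (simp add: dq_def VC)
  have lim: "((\<lambda>\<tau>. ip (dq X \<tau>) Z) \<longlongrightarrow> ip Y Z) (at 0)" if "gen X Y" "Z \<in> V" for X Y Z
  proof -
    have XY: "X \<in> V" "Y \<in> V" using that by (auto simp: gen_def)
    have "((\<lambda>\<tau>. H.nrm (dq X \<tau> - Y) * H.nrm Z) \<longlongrightarrow> 0 * H.nrm Z) (at 0)"
      using that by (intro tendsto_mult tendsto_const) (auto simp: gen_def dq_def)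
    then have t0: "((\<lambda>\<tau>. H.nrm (dq X \<tau> - Y) * H.nrm Z) \<longlongrightarrow> 0) (at 0)" by simp
    have "cmod (ip (dq X \<tau>) Z - ip Y Z) \<le> H.nrm (dq X \<tau> - Y) * H.nrm Z" for \<tau>
      using H.Cauchy_Schwarz[of "dq X \<tau> - Y" Z] that(2) XY dqV[OF XY(1), of \<tau>] by (simp add: H.ip_diff VC)
    then have "((\<lambda>\<tau>. ip (dq X \<tau>) Z - ip Y Z) \<longlongrightarrow> 0) (at 0)"
      by (intro Lim_null_comparison[OF _ t0] always_eventually) auto
    then show ?thesis by (simp add: LIM_zero_iff)
  qed
  have nd: "((\<lambda>\<tau>. H.nrm (S \<tau> X - X)) \<longlongrightarrow> 0) (at 0)" if "X \<in> V" for X using S_cont that by simp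
  \<comment> \<open>The second-order term of the product rule: the difference quotient of
    \<open>F\<close> stays bounded while the increment of \<open>G\<close> tends to 0.\<close>
  have bd: "((\<lambda>\<tau>. ip (dq F \<tau>) (S \<tau> G - G)) \<longlongrightarrow> 0) (at 0)"
  proof (rule Lim_null_comparison)
    show "\<forall>\<^sub>F \<tau> in at 0. norm (ip (dq F \<tau>) (S \<tau> G - G)) \<le> (H.nrm (dq F \<tau> - P) + H.nrm P) * H.nrm (S \<tau> G - G)"
    proof (intro always_eventually allI)
      fix \<tau>
      have "H.nrm (dq F \<tau>) \<le> H.nrm (dq F \<tau> - P) + H.nrm P"
        using H.nrm_triangle[of "dq F \<tau> - P" P] V dqV by (simp add: VC)
      then show "norm (ip (dq F \<tau>) (S \<tau> G - G)) \<le> (H.nrm (dq F \<tau> - P) + H.nrm P) * H.nrm (S \<tau> G - G)"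
        using H.Cauchy_Schwarz[of "dq F \<tau>" "S \<tau> G - G"] V dqV
        by (meson H.V_diff H.nrm_nonneg S_V mult_right_mono order_trans)
    qed
    have "((\<lambda>\<tau>. (H.nrm (dq F \<tau> - P) + H.nrm P) * H.nrm (S \<tau> G - G)) \<longlongrightarrow> (0 + H.nrm P) * 0) (at 0)"
      using gF V by (intro tendsto_intros nd) (auto simp: gen_def dq_def)
    then show "((\<lambda>\<tau>. (H.nrm (dq F \<tau> - P) + H.nrm P) * H.nrm (S \<tau> G - G)) \<longlongrightarrow> 0) (at 0)" by simp
  qed
  have quot: "(Re (ip (S (t + \<tau>) f) (S (t + \<tau>) g)) - Re (ip (S t f) (S t g))) / \<tau>
      = Re (ip (dq F \<tau>) G) + Re (ip (dq G \<tau>) F) + Re (ip (dq F \<tau>) (S \<tau> G - G))" if "\<tau> \<noteq> 0" for \<tau>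
  proof -
    have "S (t + \<tau>) f \<doteq> S \<tau> F" "S (t + \<tau>) g \<doteq> S \<tau> G"
      using S_add_eqv[of f \<tau> t] S_add_eqv[of g \<tau> t] fg by (auto simp: FPGQ add.commute)
    then have "ip (S (t + \<tau>) f) (S (t + \<tau>) g) = ip (S \<tau> F) (S \<tau> G)"
      using H.eqv_ip(1)[of "S (t + \<tau>) f" "S \<tau> F" "S (t + \<tau>) g"] H.eqv_ip(2)[of "S (t + \<tau>) g" "S \<tau> G" "S \<tau> F"]
      by (simp add: fg V VC)
    moreover have "ip (S \<tau> F) (S \<tau> G) - ip F G = ip (S \<tau> F - F) G + ip F (S \<tau> G - G) + ip (S \<tau> F - F) (S \<tau> G - G)"
      using V by (simp add: H.ip_simps VC)
    moreover have "ip (S \<tau> F - F) X = of_real \<tau> * ip (dq F \<tau>) X" if "X \<in> V" for X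
      using \<open>\<tau> \<noteq> 0\<close> that V by (simp add: dq_def H.ip_scl VC)
    moreover have "Re (ip F (S \<tau> G - G)) = \<tau> * Re (ip (dq G \<tau>) F)"
      using \<open>\<tau> \<noteq> 0\<close> V H.Re_ip_commute[of F "S \<tau> G - G"] by (simp add: dq_def H.ip_scl VC)
    ultimately show ?thesis using that V
      by (simp add: FPGQ(1,3)[symmetric] VC diff_divide_distrib[symmetric] add_divide_distrib
          minus_complex.sel(1)[symmetric] del: minus_complex.sel)
  qed
  have "((\<lambda>\<tau>. Re (ip (dq F \<tau>) G) + Re (ip (dq G \<tau>) F) + Re (ip (dq F \<tau>) (S \<tau> G - G)))
      \<longlongrightarrow> Re (ip P G) + Re (ip Q F) + Re 0) (at 0)"
    by (intro tendsto_add tendsto_Re lim bd gF gG V)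
  then have "((\<lambda>\<tau>. (Re (ip (S (t + \<tau>) f) (S (t + \<tau>) g)) - Re (ip (S t f) (S t g))) / \<tau>)
      \<longlongrightarrow> Re (ip P G) + Re (ip Q F) + Re 0) (at 0)"
    by (rule Lim_transform_eventually) (auto simp: quot eventually_at_filter intro!: always_eventually)
  then show ?thesis unfolding DERIV_def using H.Re_ip_commute[of F Q] V by (simp add: FPGQ)
qed

text \<open>An eigenvector of the generator grows exponentially, which contradicts boundedness of \<open>S 1\<close>.\<close>
lemma gen_eigenvector_null:
  assumes K: "\<And>f. f \<in> V \<Longrightarrow> H.nrm (S 1 f) \<le> K * H.nrm f" "K \<ge> 1"
    and z: "gen z (scl (of_real (ln (2 * K))) z)"
  shows "H.nrm z = 0"
proof -
  define l where "l = ln (2 * K)"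
  \<comment> \<open>Over unit time an eigenvector with eigenvalue ln (2 K) grows by the factor 2 K,
    twice what the bound on \<open>S 1\<close> permits.\<close>
  have zV: "z \<in> V" using z by (simp add: gen_def)
  define N where "N = (\<lambda>t. Re (ip (S t z) (S t z)))"
  have dN: "DERIV N t :> 2 * l * N t" for t
  proof -
    have e: "S t (scl (of_real l) z) \<doteq> scl (of_real l) (S t z)" using S_scl_eqv zV by blast
    have "ip (S t (scl (of_real l) z)) (S t z) = of_real l * ip (S t z) (S t z)"
      "ip (S t z) (S t (scl (of_real l) z)) = of_real l * ip (S t z) (S t z)"
      using H.eqv_ip[OF e, of "S t z"] zV by (auto simp: VC H.ip_simps)
    then show ?thesis using DERIV_Re_ip_S[OF z z, of t] by (simp add: N_def l_def[symmetric] mult.assoc)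
  qed
  have "DERIV (\<lambda>t. exp (- 2 * l * t) * N t) t :> 0" for t
    by (auto intro!: derivative_eq_intros dN simp: algebra_simps)
  then have "exp (- 2 * l * 1) * N 1 = exp (- 2 * l * 0) * N 0"
    by (intro DERIV_isconst_all[where f="\<lambda>t. exp (- 2 * l * t) * N t"]) auto
  then have "N 1 = exp (2 * l) * N 0" by (simp add: exp_minus field_simps)
  also have "exp (2 * l) = (2 * K)\<^sup>2" using K(2) exp_double[of l] by (simp add: l_def)
  also have "N 0 = (H.nrm z)\<^sup>2"
    using H.eqv_nrm[OF S_0_eqv[OF zV]] H.ip_self[of "S 0 z"] zV by (simp add: N_def VC)
  finally have "(H.nrm (S 1 z))\<^sup>2 = (2 * K * H.nrm z)\<^sup>2"
    using H.ip_self[of "S 1 z"] zV by (simp add: N_def VC power_mult_distrib)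
  then have "H.nrm (S 1 z) = 2 * K * H.nrm z" using zV K(2) by (simp add: VC)
  with K(1)[OF zV] K(2) have "H.nrm z \<le> 0" by simp
  then show ?thesis by (intro H.nrm_le_0 zV)
qed

text \<open>\<open>S t g\<close> lies in the domain of the generator, but it is not yet known to be
  represented in \<open>D\<close>. Surjectivity produces G in \<open>D\<close> with l G - \<i> Lp G
  = l S t g - S t (\<i> Lp g). Then G - S t g is an eigenvector of the generator for l, hence null
  by the choice of l.\<close>

lemma S_D: assumes g: "g \<in> D" shows "\<exists>G\<in>D. S t g \<doteq> G \<and> S t (Lp g) \<doteq> Lp G"
proof -
  obtain K0 where K0: "\<And>f. f \<in> V \<Longrightarrow> H.nrm (S 1 f) \<le> K0 * H.nrm f" using S_bdd by blast
  define K where "K = max K0 1"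
  have K: "H.nrm (S 1 f) \<le> K * H.nrm f" if "f \<in> V" for f
    using K0[OF that] mult_right_mono[of K0 K "H.nrm f"] that by (simp add: K_def)
  have K1: "K \<ge> 1" by (simp add: K_def)
  define l where "l = ln (2 * K)"
  have l: "l > 0" using K1 by (simp add: l_def ln_gt_zero)
  define y where "y = S t (scl \<i> (Lp g))"
  have V: "g \<in> V" "y \<in> V" "S t g \<in> V" using g by (auto simp: y_def VC)
  define f where "f = scl (of_real l) (S t g) - y"
  \<comment> \<open>Multiplication by -\<i> turns l - \<i> Lp into -\<i> l - Lp, a resolvent
    equation with non-real parameter.\<close>
  have "scl (-\<i>) f \<in> V" using V by (simp add: f_def VC)
  moreover have "Im (- \<i> * of_real l) \<noteq> 0" using l by simp
  ultimately obtain G where G: "G \<in> D" "H.nrm (scl (- \<i> * of_real l) G - Lp G - scl (-\<i>) f) = 0"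
    using resolvent by blast
  have GV: "G \<in> V" "Lp G \<in> V" using G by (auto simp: VC)
  have "scl (- \<i> * of_real l) G - Lp G \<doteq> scl (-\<i>) f" using G V by (intro H.eqvI) (auto simp: f_def VC)
  from H.eqv_scl[OF this, of \<i>] have e1: "scl (of_real l) G - scl \<i> (Lp G) \<doteq> f"
    by (simp add: H.vs.scale_right_diff_distrib f_def)
  from H.eqv_diff[OF H.eqv_diff[OF H.eqv_refl[of "scl (of_real l) G"] this] H.eqv_refl[of y]]
  have e2: "scl \<i> (Lp G) - y \<doteq> scl (of_real l) (G - S t g)"
    using GV V by (simp add: f_def VC H.vs.scale_right_diff_distrib)
  have "gen (G - S t g) (scl \<i> (Lp G) - y)"
    unfolding y_def by (intro gen_diff gen_D G gen_S g)
  from gen_cong[OF this e2] have "H.nrm (G - S t g) = 0"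
    using gen_eigenvector_null[OF K K1] unfolding l_def by blast
  then have 1: "S t g \<doteq> G" using GV V H.nrm_commute by (intro H.eqvI) auto
  have "scl (of_real l) (G - S t g) \<doteq> 0"
    using \<open>H.nrm (G - S t g) = 0\<close> GV V by (intro H.eqvI) (auto simp: VC H.nrm_scl)
  from H.eqv_trans[OF e2 this] have "scl \<i> (Lp G) - y \<doteq> 0" .
  from H.eqv_add[OF this H.eqv_refl[of y]] V have "scl \<i> (Lp G) \<doteq> y" by simp
  also have "y \<doteq> scl \<i> (S t (Lp g))" unfolding y_def using g by (intro S_scl_eqv) (simp add: VC)
  finally have "scl (-\<i>) (scl \<i> (Lp G)) \<doteq> scl (-\<i>) (scl \<i> (S t (Lp g)))" by (rule H.eqv_scl)
  then have "Lp G \<doteq> S t (Lp g)" by simp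
  then show ?thesis using 1 G H.eqv_sym by blast
qed

section \<open>Symmetry of the Laplacian and isometry on its domain\<close>

lemma Aop_sym: assumes "f \<in> D" "g \<in> D" shows "ip (Aop f) g = ip f (Aop g)"
  using green'[of f g] green'[of g f] E.ip_cnj[of g f] H.ip_cnj[of g "Aop f"] assms Aop_V by simp

lemma Lp_sym: assumes "f \<in> D" "g \<in> D" shows "ip (Lp f) g = ip f (Lp g)"
  using Aop_sym[OF assms] assms by (simp add: Aop_def H.ip_simps VC)

text \<open>With F and G in \<open>D\<close> representing \<open>S t f\<close> and
  \<open>S t g\<close>, the derivative of the pairing is \<i> (<Lp F, G> - <F, Lp G>), up to the
  constant \<open>c\<close>, and vanishes by symmetry. The choices c = 1 and c = \<i> give real and
  imaginary part.\<close>

lemma isometry_D: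
  assumes f: "f \<in> D" and g: "g \<in> D" shows "ip (S t f) (S t g) = ip f g"
proof -
  have Re: "Re (ip (S t f) (S t (scl c g))) = Re (ip f (scl c g))" if "c = 1 \<or> c = \<i>" for c
  proof -
    have gen_c: "gen (scl c g) (scl c (scl \<i> (Lp g)))" 
    proof -
      have "((\<lambda>\<tau>. H.nrm (scl (1 / of_real \<tau>) (S \<tau> (scl c g) - scl c g) - scl c (scl \<i> (Lp g)))) \<longlongrightarrow> 0) (at 0)"
      proof -
        have "H.nrm (scl (1 / of_real \<tau>) (S \<tau> (scl c g) - scl c g) - scl c (scl \<i> (Lp g)))
          = H.nrm (scl (1 / of_real \<tau>) (S \<tau> g - g) - scl \<i> (Lp g))" for \<tau>
        proof -
          have "scl (1 / of_real \<tau>) (S \<tau> (scl c g) - scl c g) - scl c (scl \<i> (Lp g))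
            \<doteq> scl (1 / of_real \<tau>) (scl c (S \<tau> g) - scl c g) - scl c (scl \<i> (Lp g))"
            using g by (intro H.eqv_diff H.eqv_scl S_scl_eqv H.eqv_refl) (auto simp: VC)
          also have "scl (1 / of_real \<tau>) (scl c (S \<tau> g) - scl c g) - scl c (scl \<i> (Lp g))
            = scl c (scl (1 / of_real \<tau>) (S \<tau> g - g) - scl \<i> (Lp g))"
            by (simp add: H.vs.scale_right_diff_distrib mult.commute)
          finally have "scl (1 / of_real \<tau>) (S \<tau> (scl c g) - scl c g) - scl c (scl \<i> (Lp g))
            \<doteq> scl c (scl (1 / of_real \<tau>) (S \<tau> g - g) - scl \<i> (Lp g))" .
          from H.eqv_nrm[OF this] show ?thesis using that g by (auto simp: H.nrm_scl VC)
        qed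
        then show ?thesis using S_gen[OF g] by simp
      qed
      then show ?thesis using g by (simp add: gen_def VC)
    qed
    have "DERIV (\<lambda>t. Re (ip (S t f) (S t (scl c g)))) t :> 0" for t
    proof -
      obtain F where F: "F \<in> D" "S t f \<doteq> F" "S t (Lp f) \<doteq> Lp F" using S_D[OF f] by blast
      obtain G where G: "G \<in> D" "S t g \<doteq> G" "S t (Lp g) \<doteq> Lp G" using S_D[OF g] by blast
      have s1: "S t (scl c g) \<doteq> scl c G" using S_scl_eqv[of g] H.eqv_scl[OF G(2)] g H.eqv_trans by (meson DW WV)
      have s2: "S t (scl c (scl \<i> (Lp g))) \<doteq> scl c (scl \<i> (Lp G))"
      proof -
        have "S t (scl c (scl \<i> (Lp g))) \<doteq> scl c (S t (scl \<i> (Lp g)))" using g by (intro S_scl_eqv) (auto simp: VC)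
        also have "\<dots> \<doteq> scl c (scl \<i> (S t (Lp g)))" using g by (intro S_scl_eqv H.eqv_scl) (auto simp: VC)
        also have "\<dots> \<doteq> scl c (scl \<i> (Lp G))" by (intro H.eqv_scl G)
        finally show ?thesis .
      qed
      have s3: "S t (scl \<i> (Lp f)) \<doteq> scl \<i> (Lp F)"
        using S_scl_eqv[of "Lp f" t \<i>] H.eqv_scl[OF F(3), of \<i>] f H.eqv_trans by (meson Lp_V)
      have V: "F \<in> V" "G \<in> V" "Lp F \<in> V" "Lp G \<in> V" using F G by (auto simp: VC)
      have "ip (S t (scl \<i> (Lp f))) (S t (scl c g)) = ip (scl \<i> (Lp F)) (scl c G)"
        using H.eqv_ip(1)[OF s3, of "S t (scl c g)"] H.eqv_ip(2)[OF s1, of "scl \<i> (Lp F)"] g V by (simp add: VC)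
      moreover have "ip (S t f) (S t (scl c (scl \<i> (Lp g)))) = ip F (scl c (scl \<i> (Lp G)))"
        using H.eqv_ip(1)[OF F(2), of "S t (scl c (scl \<i> (Lp g)))"] H.eqv_ip(2)[OF s2, of F] g V by (simp add: VC)
      moreover have "ip (scl \<i> (Lp F)) (scl c G) + ip F (scl c (scl \<i> (Lp G))) = 0"
        using V Lp_sym[OF F(1) G(1)] by (simp add: H.ip_simps VC)
      ultimately have "Re (ip (S t (scl \<i> (Lp f))) (S t (scl c g))) + Re (ip (S t f) (S t (scl c (scl \<i> (Lp g))))) = 0"
        by (metis plus_complex.sel(1) zero_complex.sel(1))
      then show ?thesis using DERIV_Re_ip_S[OF gen_D[OF f] gen_c, of t] by simp
    qed
    then have "Re (ip (S t f) (S t (scl c g))) = Re (ip (S 0 f) (S 0 (scl c g)))"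
      by (intro DERIV_isconst_all[where f="\<lambda>t. Re (ip (S t f) (S t (scl c g)))"]) auto
    also have "ip (S 0 f) (S 0 (scl c g)) = ip f (scl c g)"
      using H.eqv_ip(1)[OF S_0_eqv[of f], of "S 0 (scl c g)"] H.eqv_ip(2)[OF S_0_eqv[of "scl c g"], of f] f g
      by (simp add: VC)
    finally show ?thesis .
  qed
  have "ip (S t f) (S t (scl \<i> g)) = ip (S t f) (scl \<i> (S t g))"
    using f g by (intro H.eqv_ip(2) S_scl_eqv) (auto simp: VC)
  then have "Im (ip (S t f) (S t g)) = Im (ip f g)"
    using Re[of \<i>] f g by (simp add: H.ip_simps VC)
  moreover have "Re (ip (S t f) (S t g)) = Re (ip f g)" using Re[of 1] by simp
  ultimately show ?thesis by (simp add: complex_eq_iff)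
qed

text \<open>\<open>g = \<lambda> (\<lambda> + A)\<^sup>-\<^sup>1 f\<close> with \<open>A = Mc - Lp\<close>.\<close>
lemma resolvent_approx:
  assumes f: "f \<in> W" and l: "l > 0"
  obtains g where "g \<in> D" "Aop g \<doteq> scl (of_real l) (f - g)" "E.nrm g \<le> E.nrm f"
    "l * (H.nrm (f - g))\<^sup>2 \<le> (E.nrm f)\<^sup>2" "(E.nrm (f - g))\<^sup>2 \<le> Re (a (f - g) f)"
proof -
  obtain g where g: "g \<in> D" "H.nrm (scl (of_real (Mc + l)) g - Lp g - scl (of_real l) f) = 0"
    using resolvent[of "scl (of_real l) f" "of_real (Mc + l)"] f l by (auto simp: VC)
  have V: "f \<in> V" "g \<in> V" "Lp g \<in> V" "g \<in> W" using f g by (auto simp: VC)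
  have "scl (of_real (Mc + l)) g - Lp g \<doteq> scl (of_real l) f" using g V by (intro H.eqvI) (auto simp: VC)
  from H.eqv_diff[OF this H.eqv_refl[of "scl (of_real l) g"]]
  have A: "Aop g \<doteq> scl (of_real l) (f - g)"
    using V by (simp add: Aop_def VC H.vs.scale_right_diff_distrib H.vs.scale_left_distrib algebra_simps)
  \<comment> \<open>Testing the resolvent equation Aop g = l (f - g) with f - g gives the identity
    \<open>k\<close>, from which all the norm bounds follow.\<close>
  have "a (f - g) g = ip (f - g) (scl (of_real l) (f - g))"
    using green'[of "f - g" g] H.eqv_ip(2)[OF A, of "f - g"] V f g by (simp add: VC)
  also have "\<dots> = of_real (l * (H.nrm (f - g))\<^sup>2)"
    using V H.ip_self[of "f - g"] by (simp add: H.ip_scl_right VC)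
  finally have k: "Re (a (f - g) g) = l * (H.nrm (f - g))\<^sup>2" by simp
  have k0: "Re (a f g) = (E.nrm g)\<^sup>2 + l * (H.nrm (f - g))\<^sup>2"
    using k f V E.ip_self[of g] by (simp add: E.ip_simps)
  have cs: "Re (a f g) \<le> E.nrm f * E.nrm g"
    using E.Cauchy_Schwarz[of f g] f V complex_Re_le_cmod[of "a f g"] by simp
  have l2: "0 \<le> l * (H.nrm (f - g))\<^sup>2" using l by simp
  have le: "E.nrm g \<le> E.nrm f"
  proof (cases "E.nrm g = 0")
    case False
    then have "0 < E.nrm g" using E.nrm_nonneg[OF V(4)] by (simp add: less_le del: E.nrm_nonneg)
    moreover have "E.nrm g * E.nrm g \<le> E.nrm f * E.nrm g" using k0 cs l2 by (simp add: power2_eq_square)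
    ultimately show ?thesis by simp
  qed (use f in simp)
  have "E.nrm f * E.nrm g \<le> (E.nrm f)\<^sup>2" using le f by (simp add: power2_eq_square mult_left_mono)
  then have 4: "l * (H.nrm (f - g))\<^sup>2 \<le> (E.nrm f)\<^sup>2" using k0 cs zero_le_power2[of "E.nrm g"] by linarith
  have "(E.nrm (f - g))\<^sup>2 = Re (a (f - g) (f - g))" using E.ip_self[of "f - g"] f V by (simp add: VC)
  also have "\<dots> = Re (a (f - g) f) - Re (a (f - g) g)" using f V by (simp add: E.ip_diff_right VC)
  also have "\<dots> \<le> Re (a (f - g) f)" using k l2 by simp
  finally show ?thesis using that[OF g(1) A le 4] by blast
qed

lemma resolvent_approx_H:
  assumes f: "f \<in> W" and e: "e > 0"
  obtains g l where "g \<in> D" "Aop g \<doteq> scl (of_real l) (f - g)" "H.nrm (f - g) < e"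
proof -
  \<comment> \<open>The distance is at most \<open>E.nrm f / sqrt l\<close>; with this l it is e
    times \<open>E.nrm f / (E.nrm f + 1)\<close>. The summand 1 makes the bound strict and keeps l
    positive.\<close>
  define l where "l = ((E.nrm f + 1) / e)\<^sup>2"
  have Ef: "0 \<le> E.nrm f" using f by simp
  have l: "l > 0" unfolding l_def using e Ef by (intro zero_less_power divide_pos_pos) linarith+
  from resolvent_approx[OF f l] obtain g where g: "g \<in> D" "Aop g \<doteq> scl (of_real l) (f - g)"
    "l * (H.nrm (f - g))\<^sup>2 \<le> (E.nrm f)\<^sup>2" by metis
  have gV: "f - g \<in> V" using f g by (simp add: VC)
  have "((E.nrm f + 1) * H.nrm (f - g))\<^sup>2 = e\<^sup>2 * (l * (H.nrm (f - g))\<^sup>2)"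
    using e by (simp add: l_def power_divide power_mult_distrib)
  also have "\<dots> \<le> e\<^sup>2 * (E.nrm f)\<^sup>2" using g(3) by (intro mult_left_mono) auto
  finally have "((E.nrm f + 1) * H.nrm (f - g))\<^sup>2 \<le> (E.nrm f * e)\<^sup>2"
    by (simp add: power_mult_distrib mult.commute)
  then have "(E.nrm f + 1) * H.nrm (f - g) \<le> E.nrm f * e"
    by (rule power2_le_imp_le) (use Ef e in simp)
  also have "\<dots> < (E.nrm f + 1) * e" using e by (simp add: algebra_simps)
  finally have "H.nrm (f - g) < e" using Ef by (simp add: mult_less_cancel_left)
  then show ?thesis using that g by blast
qed

text \<open>The errors f - g of the resolvent approximants are bounded in energy norm and null in
  L2, so \<open>weak\<close> applies to them. The inequality bounding their squared energy norm by
  \<open>Re (a (f - g) f)\<close> upgrades weak to strong convergence. That \<open>Aop g\<close> is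
  represented by an element p of \<open>W\<close>, namely a multiple of f - g, is exported because
  the adjoint and isometry facts are available on \<open>W\<close>.\<close>

lemma form_dense:
  assumes f: "f \<in> W" and e: "e > 0"
  obtains g p where "g \<in> D" "p \<in> W" "Aop g \<doteq> p" "E.nrm (f - g) < e"
proof -
  have "\<exists>g. g \<in> D \<and> Aop g \<doteq> scl (of_real (real j + 1)) (f - g) \<and> E.nrm g \<le> E.nrm f \<and>
    (real j + 1) * (H.nrm (f - g))\<^sup>2 \<le> (E.nrm f)\<^sup>2 \<and> (E.nrm (f - g))\<^sup>2 \<le> Re (a (f - g) f)" for j :: nat
    by (rule resolvent_approx[OF f, of "real j + 1"]) auto
  then obtain g where g: "\<And>j. g j \<in> D" "\<And>j. Aop (g j) \<doteq> scl (of_real (real j + 1)) (f - g j)"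
    "\<And>j. E.nrm (g j) \<le> E.nrm f" "\<And>j. (real j + 1) * (H.nrm (f - g j))\<^sup>2 \<le> (E.nrm f)\<^sup>2"
    "\<And>j. (E.nrm (f - g j))\<^sup>2 \<le> Re (a (f - g j) f)" by metis
  have W: "f - g j \<in> W" for j using f g by (simp add: VC)
  have "(\<lambda>j. (E.nrm f)\<^sup>2 * inverse (real (Suc j))) \<longlonglongrightarrow> (E.nrm f)\<^sup>2 * 0"
    by (intro tendsto_intros LIMSEQ_inverse_real_of_nat)
  then have "(\<lambda>j. (H.nrm (f - g j))\<^sup>2) \<longlonglongrightarrow> 0"
    by (rule tendsto_0_squeeze) (use g(4) in \<open>auto simp: field_simps intro!: always_eventually\<close>)
  from tendsto_real_sqrt[OF this] have H0: "(\<lambda>j. H.nrm (f - g j)) \<longlonglongrightarrow> 0" using W by simp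
  have "E.nrm (f - g j) \<le> 2 * E.nrm f" for j
    using E.nrm_diff_le[of f "g j"] f g(1)[of j] g(3)[of j] by simp
  from weak[OF W this H0 f] have "(\<lambda>j. Re (a (f - g j) f)) \<longlonglongrightarrow> 0"
    using tendsto_Re by fastforce
  then have "(\<lambda>j. (E.nrm (f - g j))\<^sup>2) \<longlonglongrightarrow> 0"
    by (rule tendsto_0_squeeze) (use g(5) in \<open>auto intro!: always_eventually\<close>)
  from tendsto_real_sqrt[OF this] have "(\<lambda>j. E.nrm (f - g j)) \<longlonglongrightarrow> 0" using W by simp
  from order_tendstoD(2)[OF this e] obtain j where "E.nrm (f - g j) < e"
    by (auto simp: eventually_sequentially)
  then show ?thesis using that[OF g(1) _ g(2)] W by (simp add: VC)
qed

section \<open>Unitarity on the form domain\<close>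

lemma unitary_closure:
  assumes f: "f \<in> V" and h: "h \<in> V"
    and ap: "\<And>e. e > 0 \<Longrightarrow> \<exists>g\<in>V. H.nrm (f - g) < e \<and> ip (S t g) (S t h) = ip g h"
  shows "ip (S t f) (S t h) = ip f h"
proof -
  obtain K where K: "\<And>f. f \<in> V \<Longrightarrow> H.nrm (S t f) \<le> K * H.nrm f" using S_bdd by blast
  define C where "C = \<bar>K\<bar> * H.nrm (S t h) + H.nrm h"
  have C0: "C \<ge> 0" using h by (simp add: C_def VC)
  have "cmod (ip (S t f) (S t h) - ip f h) \<le> 0 + e" if "e > 0" for e
  proof -
    obtain g where g: "g \<in> V" "H.nrm (f - g) < e / (C + 1)" "ip (S t g) (S t h) = ip g h"
      using ap[of "e / (C + 1)"] \<open>e > 0\<close> C0 by auto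
    have fg: "f - g \<in> V" using f g by (simp add: VC)
    have "ip (S t f) (S t h) - ip f h = ip (S t f - S t g) (S t h) - ip (f - g) h"
      using f g h by (simp add: H.ip_simps VC)
    also have "ip (S t f - S t g) (S t h) = ip (S t (f - g)) (S t h)"
      using H.eqv_ip(1)[OF S_diff_eqv[OF f g(1), of t], of "S t h"] h by (simp add: VC)
    finally have "cmod (ip (S t f) (S t h) - ip f h) \<le> cmod (ip (S t (f - g)) (S t h)) + cmod (ip (f - g) h)"
      using norm_triangle_ineq4 by metis
    also have "\<dots> \<le> H.nrm (S t (f - g)) * H.nrm (S t h) + H.nrm (f - g) * H.nrm h"
      using fg h by (intro add_mono H.Cauchy_Schwarz) (auto simp: VC)
    also have "\<dots> \<le> (\<bar>K\<bar> * H.nrm (f - g)) * H.nrm (S t h) + H.nrm (f - g) * H.nrm h"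
      using K[OF fg] fg h by (intro add_mono mult_right_mono)
        (auto simp: VC intro: order_trans[OF _ mult_right_mono[of K "\<bar>K\<bar>"]])
    also have "\<dots> = C * H.nrm (f - g)" by (simp add: C_def algebra_simps)
    also have "\<dots> \<le> C * (e / (C + 1))" using g C0 by (intro mult_left_mono) auto
    also have "\<dots> \<le> e" using C0 \<open>e > 0\<close> by (simp add: field_simps)
    finally show ?thesis by simp
  qed
  then have "cmod (ip (S t f) (S t h) - ip f h) \<le> 0" using field_le_epsilon by blast
  then show ?thesis by simp
qed

text \<open>The second argument is not approximated: it is written as \<open>Aop g\<close> with g in
  \<open>D\<close>, and \<open>Aop\<close> is moved to the first argument by symmetry. There it must
  act on a k whose image \<open>Aop k\<close> is already covered by \<open>isometry_D\<close>; a
  resolvent approximant of an element of \<open>D\<close> has this property, since its image is a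
  combination of elements of \<open>D\<close>. Two closure steps, from approximants to
  \<open>D\<close> and from \<open>D\<close> to \<open>W\<close>, finish the proof.\<close>

lemma unitary:
  assumes f: "f \<in> W" and h: "h \<in> V" shows "ip (S t f) (S t h) = ip f h"
proof -
  have "\<exists>g\<in>D. H.nrm (scl (of_real Mc) g - Lp g - h) = 0" by (rule resolvent[OF h]) simp
  then obtain g where g: "g \<in> D" "H.nrm (Aop g - h) = 0" by (auto simp: Aop_def)
  have gh: "Aop g \<doteq> h" using g h by (intro H.eqvI) (auto simp: Aop_V)
  obtain G where G: "G \<in> D" "S t g \<doteq> G" "S t (Lp g) \<doteq> Lp G" using S_D[OF g(1)] by blast
  have SAg: "S t h \<doteq> Aop G"
    using H.eqv_trans[OF H.eqv_sym[OF S_eqv[OF gh]] S_Aop_eqv[OF g(1) G(2,3)]] .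
  have 1: "ip (S t k) (S t h) = ip k h"
    if k: "k \<in> D" and p: "Aop k \<doteq> p" "ip (S t p) (S t g) = ip p g" for k p
  proof -
    obtain K where K: "K \<in> D" "S t k \<doteq> K" "S t (Lp k) \<doteq> Lp K" using S_D[OF k] by blast
    have V: "k \<in> V" "K \<in> V" "g \<in> V" "G \<in> V" "p \<in> V" using k K g G p by (auto dest: H.eqv_V)
    have SAk: "S t p \<doteq> Aop K"
      using H.eqv_trans[OF H.eqv_sym[OF S_eqv[OF p(1)]] S_Aop_eqv[OF k K(2,3)]] .
    have "ip (S t k) (S t h) = ip K (Aop G)"
      using H.eqv_ip(1)[OF K(2), of "S t h"] H.eqv_ip(2)[OF SAg, of K] h V by (simp add: VC)
    also have "\<dots> = ip (Aop K) G" using Aop_sym[OF K(1) G(1)] by simp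
    also have "\<dots> = ip (S t p) (S t g)"
      using H.eqv_ip(1)[OF SAk, of G] H.eqv_ip(2)[OF G(2), of "S t p"] V by (simp add: VC)
    also have "\<dots> = ip p g" by (rule p)
    also have "\<dots> = ip (Aop k) g" using H.eqv_ip(1)[OF p(1), of g] V by simp
    also have "\<dots> = ip k (Aop g)" using Aop_sym[OF k g(1)] .
    also have "\<dots> = ip k h" using H.eqv_ip(2)[OF gh, of k] V by simp
    finally show ?thesis .
  qed
  have 2: "ip (S t k) (S t h) = ip k h" if k: "k \<in> D" for k
  proof (rule unitary_closure[OF _ h])
    fix e :: real assume "e > 0"
    then obtain q l where q: "q \<in> D" "Aop q \<doteq> scl (of_real l) (k - q)" "H.nrm (k - q) < e"
      using resolvent_approx_H[of k e] k by auto
    have "S t (scl (of_real l) (k - q)) \<doteq> scl (of_real l) (S t k - S t q)"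
      by (rule H.eqv_trans[OF S_scl_eqv H.eqv_scl[OF S_diff_eqv]]) (use k q in \<open>auto simp: VC\<close>)
    then have "ip (S t (scl (of_real l) (k - q))) (S t g) = ip (scl (of_real l) (S t k - S t q)) (S t g)"
      using g by (intro H.eqv_ip(1)) (auto simp: VC)
    also have "\<dots> = ip (scl (of_real l) (k - q)) g"
      using isometry_D[OF k g(1)] isometry_D[OF q(1) g(1)] k q g by (simp add: H.ip_simps VC)
    finally show "\<exists>g\<in>V. H.nrm (k - g) < e \<and> ip (S t g) (S t h) = ip g h"
      using 1[OF q(1,2)] q by (intro bexI[of _ q]) auto
  qed (use k in simp)
  show ?thesis
  proof (rule unitary_closure[OF _ h])
    fix e :: real assume "e > 0"
    then obtain q where "q \<in> D" "H.nrm (f - q) < e" using resolvent_approx_H[OF f] by metis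
    then show "\<exists>g\<in>V. H.nrm (f - g) < e \<and> ip (S t g) (S t h) = ip g h"
      using 2 by (intro bexI[of _ q]) auto
  qed (use f in simp)
qed

section \<open>Duality between the group and the energy form\<close>

lemma S_adjoint: assumes f: "f \<in> W" and h: "h \<in> V" shows "ip (S t f) h = ip f (S (- t) h)"
  using unitary[OF f, of "S (-t) h" t] H.eqv_ip(2)[OF S_inv_eqv[OF h, of t], of "S t f"] f h by (simp add: VC)

lemma S_isometry: assumes f: "f \<in> W" shows "H.nrm (S t f) = H.nrm f"
  using unitary[OF f, of f t] f by (simp add: H.nrm_def)

lemma S_isometry_diff: assumes f: "f \<in> W" shows "H.nrm (S s f - S t f) = H.nrm (S (s - t) f - f)"
proof -
  have V: "f \<in> V" using f by simp
  have "ip (S s f) (S t f) = ip (S (s - t) f) f"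
  proof -
    have "S s f \<doteq> S t (S (s - t) f)" using S_add_eqv[OF V, of t "s - t"] by simp
    then have "ip (S t f) (S s f) = ip (S t f) (S t (S (s - t) f))" using V by (intro H.eqv_ip(2)) (auto simp: VC)
    also have "\<dots> = ip f (S (s - t) f)" using unitary[OF f] V by (simp add: VC)
    finally show ?thesis using H.ip_cnj[of "S t f" "S s f"] H.ip_cnj[of f "S (s - t) f"] V by (simp add: VC)
  qed
  then have "Re (ip (S s f - S t f) (S s f - S t f)) = Re (ip (S (s - t) f - f) (S (s - t) f - f))"
    using V unitary[OF f, of f] H.Re_ip_commute[of "S s f" "S t f"] H.Re_ip_commute[of "S (s - t) f" f]
    by (simp add: H.ip_simps VC)
  then show ?thesis by (simp add: H.nrm_def)
qed

lemma S_Aop_dual: assumes f: "f \<in> W" and g: "g \<in> D"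
  obtains G where "G \<in> D" "S (- t) g \<doteq> G" "ip (S t f) (Aop g) = a f G" "E.nrm G = E.nrm g"
proof -
  obtain G where G: "G \<in> D" "S (-t) g \<doteq> G" "S (-t) (Lp g) \<doteq> Lp G" using S_D[OF g] by blast
  have SA: "S (-t) (Aop g) \<doteq> Aop G" using S_Aop_eqv[OF g G(2,3)] .
  have "ip (S t f) (Aop g) = ip f (Aop G)"
    using S_adjoint[OF f Aop_V[OF g], of t] H.eqv_ip(2)[OF SA, of f] f by simp
  then have 1: "ip (S t f) (Aop g) = a f G" using green'[OF f G(1)] by simp
  \<comment> \<open>Green's identity turns the energy of G into an L2 pairing of g with
    \<open>Aop g\<close>, which unitarity preserves.\<close>
  have "a G G = ip G (Aop G)" using green' G by simp
  also have "\<dots> = ip (S (-t) g) (S (-t) (Aop g))"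
    using H.eqv_ip(1)[OF G(2), of "Aop G"] H.eqv_ip(2)[OF SA, of "S (-t) g"] G g by (simp add: VC Aop_V)
  also have "\<dots> = ip g (Aop g)" using unitary[of g "Aop g"] g by (simp add: Aop_V)
  also have "\<dots> = a g g" using green' g by simp
  finally show ?thesis using that[OF G(1,2) 1] by (simp add: E.nrm_def)
qed

lemma dual_bound: assumes f: "f \<in> W" and g: "g \<in> D"
  shows "cmod (ip (S t f) (Aop g)) \<le> E.nrm f * E.nrm g"
proof -
  obtain G where G: "G \<in> D" "ip (S t f) (Aop g) = a f G" "E.nrm G = E.nrm g"
    using S_Aop_dual[OF f g, of t] by metis
  then show ?thesis using E.Cauchy_Schwarz[of f G] f by simp
qed

text \<open>Strong continuity of the group for the energy norm, in dual form. For k in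
  \<open>D\<close> with image p = Aop k in \<open>W\<close>, the operator moves onto k and
  continuity of S(s) p in L2 suffices. The remainder f - k is small in energy norm and stays so
  under the group by \<open>dual_bound\<close>.\<close>

lemma dual_continuity: assumes f: "f \<in> W" and e: "e > 0"
  shows "\<exists>\<delta>>0. \<forall>s t. \<bar>s - t\<bar> < \<delta> \<longrightarrow> (\<forall>g\<in>D. cmod (ip (S s f) (Aop g) - ip (S t f) (Aop g)) \<le> e * E.nrm g)"
proof -
  obtain c where c: "c > 0" "\<And>f. f \<in> W \<Longrightarrow> c * H.nrm f \<le> E.nrm f" using coercive by blast
  obtain k p where k: "k \<in> D" "p \<in> W" "Aop k \<doteq> p" "E.nrm (f - k) < e / 4"
    using form_dense[OF f, of "e/4"] e by auto
  have kW: "f - k \<in> W" using f k by (simp add: VC)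
  \<comment> \<open>The coercivity constant c converts the L2 norm of g into its energy norm. The
    budget is e/4 for the remainder at each of the two times and e/2 for p.\<close>
  have "e * c / 2 > 0" using e c by simp
  then have "\<forall>\<^sub>F \<tau> in at 0. H.nrm (S \<tau> p - p) < e * c / 2"
    using order_tendstoD(2)[OF S_cont[OF WV[OF k(2)]]] by blast
  then obtain \<delta> where \<delta>: "\<delta> > 0" "\<And>\<tau>. \<tau> \<noteq> 0 \<Longrightarrow> \<bar>\<tau>\<bar> < \<delta> \<Longrightarrow> H.nrm (S \<tau> p - p) < e * c / 2"
    unfolding eventually_at by (auto simp: dist_real_def)
  have \<delta>': "H.nrm (S \<tau> p - p) \<le> e * c / 2" if "\<bar>\<tau>\<bar> < \<delta>" for \<tau>
    using \<delta>(2)[of \<tau>] that S_0[of p] k(2) e c by (cases "\<tau> = 0") auto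
  have sp: "ip (S s k) (Aop g) = ip (S s p) g" if g: "g \<in> D" for s g
  proof -
    obtain G where G: "G \<in> D" "S (- s) g \<doteq> G" "ip (S s k) (Aop g) = a k G"
      using S_Aop_dual[of k g s] k g by (metis DW)
    have V: "k \<in> V" "p \<in> V" "G \<in> V" "g \<in> V" using k G g by auto
    have "a k G = ip (Aop k) G" using green'[of k G] Aop_sym[of k G] k G by simp
    also have "\<dots> = ip p (S (- s) g)"
      using H.eqv_ip(1)[OF k(3), of G] H.eqv_ip(2)[OF G(2), of p] V by simp
    also have "\<dots> = ip (S s p) g" using S_adjoint[OF k(2), of g s] V by simp
    finally show ?thesis using G by simp
  qed
  have "cmod (ip (S s f) (Aop g) - ip (S t f) (Aop g)) \<le> e * E.nrm g" if st: "\<bar>s - t\<bar> < \<delta>" and g: "g \<in> D" for s t g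
  proof -
    have gV: "g \<in> V" "g \<in> W" "k \<in> V" "p \<in> V" "f \<in> V" using g k f by auto
    have split: "ip (S r f) (Aop g) = ip (S r (f - k)) (Aop g) + ip (S r p) g" for r
    proof -
      have "ip (S r (f - k)) (Aop g) = ip (S r f - S r k) (Aop g)"
        using gV Aop_V[OF g] by (intro H.eqv_ip(1) S_diff_eqv)
      then show ?thesis using sp[OF g, of r] gV Aop_V[OF g] by (simp add: H.ip_simps VC)
    qed
    have "cmod (ip (S s p - S t p) g) \<le> H.nrm (S s p - S t p) * H.nrm g"
      using gV by (intro H.Cauchy_Schwarz) (auto simp: VC)
    also have "\<dots> = H.nrm (S (s - t) p - p) * H.nrm g" using S_isometry_diff[OF k(2)] by simp
    also have "\<dots> \<le> e * c / 2 * H.nrm g" using \<delta>'[OF st] gV by (intro mult_right_mono) auto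
    also have "\<dots> = e / 2 * (c * H.nrm g)" by simp
    also have "\<dots> \<le> e / 2 * E.nrm g" using c(2)[of g] gV e by (intro mult_left_mono) auto
    finally have 1: "cmod (ip (S s p - S t p) g) \<le> e / 2 * E.nrm g" .
    have 2: "cmod (ip (S r (f - k)) (Aop g)) \<le> e / 4 * E.nrm g" for r
      using dual_bound[OF kW g, of r] k(4) gV mult_right_mono[of "E.nrm (f - k)" "e/4" "E.nrm g"]
      by (meson E.nrm_nonneg less_imp_le order_trans)
    have "ip (S s f) (Aop g) - ip (S t f) (Aop g) =
        ip (S s (f - k)) (Aop g) - ip (S t (f - k)) (Aop g) + ip (S s p - S t p) g"
      using split[of s] split[of t] gV by (simp add: H.ip_simps VC)
    then have "cmod (ip (S s f) (Aop g) - ip (S t f) (Aop g)) \<le>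
        cmod (ip (S s (f - k)) (Aop g)) + cmod (ip (S t (f - k)) (Aop g)) + cmod (ip (S s p - S t p) g)"
      by (metis (no_types, opaque_lifting) add_mono_thms_linordered_semiring(3) norm_triangle_ineq norm_triangle_ineq4 order_trans)
    also have "\<dots> \<le> e / 4 * E.nrm g + e / 4 * E.nrm g + e / 2 * E.nrm g" by (intro add_mono 1 2)
    finally show ?thesis by (simp add: algebra_simps)
  qed
  then show ?thesis using \<delta>(1) by blast
qed

text \<open>For w itself in \<open>D\<close> one would take g = w, and Green's identity would give
  the bound at once. In general w is approximated by elements of \<open>D\<close> in energy
  norm.\<close>

lemma nrm_le_dual:
  assumes w: "w \<in> W" and A: "A \<ge> 0" and d: "\<And>g. g \<in> D \<Longrightarrow> cmod (ip w (Aop g)) \<le> A * E.nrm g"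
  shows "E.nrm w \<le> A"
proof -
  have "(E.nrm w)\<^sup>2 \<le> A * E.nrm w + e" if "e > 0" for e
  proof -
    \<comment> \<open>Chosen so that the total error, with coefficient at most A + E.nrm w + 1,
      equals e.\<close>
    define e' where "e' = e / (A + E.nrm w + 1)"
    have pos: "A + E.nrm w + 1 > 0" using A w E.nrm_nonneg[OF w] by linarith
    then have e': "e' > 0" using that by (simp add: e'_def)
    obtain g where g: "g \<in> D" "E.nrm (w - g) < e'" using form_dense[OF w e'] by metis
    have gW: "g \<in> W" "w - g \<in> W" using g w by (auto simp: VC)
    have "(E.nrm w)\<^sup>2 = cmod (a w w)" using E.ip_self[OF w] by (simp add: norm_power)
    also have "a w w = a w g + a w (w - g)" using w gW by (simp add: E.ip_simps)
    also have "cmod \<dots> \<le> A * E.nrm g + E.nrm w * E.nrm (w - g)"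
      using d[OF g(1)] green'[OF w g(1)] E.Cauchy_Schwarz[OF w gW(2)]
      by (metis add_mono norm_triangle_le)
    also have "\<dots> \<le> A * (E.nrm w + e') + E.nrm w * e'"
      using g(2) E.nrm_diff_ge[of w g] w gW A by (intro add_mono mult_left_mono) auto
    also have "\<dots> \<le> A * E.nrm w + (A + E.nrm w + 1) * e'" using e' by (simp add: algebra_simps)
    also have "(A + E.nrm w + 1) * e' = e" using pos by (simp add: e'_def)
    finally show ?thesis .
  qed
  then have le: "(E.nrm w)\<^sup>2 \<le> A * E.nrm w" by (rule field_le_epsilon)
  show ?thesis
  proof (cases "E.nrm w = 0")
    case False
    then have "0 < E.nrm w" using E.nrm_nonneg[OF w] by (simp add: less_le del: E.nrm_nonneg)
    then show ?thesis using le by (simp add: power2_eq_square)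
  qed (use A in simp)
qed

end

section \<open>Continuous dependence of mild solutions on the path\<close>

lemma gronwall:
  fixes \<phi> :: "real \<Rightarrow> real"
  assumes c: "continuous_on {0..T} \<phi>" and L: "L \<ge> 0"
    and le: "\<And>t. t \<in> {0..T} \<Longrightarrow> \<phi> t \<le> A + L * integral {0..t} \<phi>" and t: "t \<in> {0..T}"
  shows "\<phi> t \<le> A * exp (L * t)"
proof -
  define J where "J = (\<lambda>x. integral {0..x} \<phi>)"
  have dJ: "(J has_real_derivative \<phi> x) (at x within {0..T})" if "x \<in> {0..T}" for x
    unfolding J_def using integral_has_real_derivative[OF c that] .
  have cJ: "continuous_on {0..T} J"
    using dJ by (intro DERIV_continuous_on) auto
  \<comment> \<open>The assumed inequality says precisely that this integrating-factor expression
    has nonpositive derivative.\<close>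
  define \<psi> where "\<psi> = (\<lambda>x. exp (- L * x) * (A + L * J x))"
  have "\<psi> t \<le> \<psi> 0"
  proof (rule DERIV_nonpos_imp_decreasing_open[where f=\<psi> and a=0 and b=t])
    show "0 \<le> t" using t by simp
    show "continuous_on {0..t} \<psi>" unfolding \<psi>_def using t
      by (intro continuous_intros continuous_on_subset[OF cJ]) auto
    fix x assume x: "0 < x" "x < t"
    have xT: "x \<in> {0..T}" using x t by simp
    have "DERIV J x :> \<phi> x" using dJ[OF xT] at_within_Icc_at[of 0 x T] x t by simp
    then have "DERIV \<psi> x :> exp (- L * x) * L * (\<phi> x - (A + L * J x))"
      unfolding \<psi>_def by (auto intro!: derivative_eq_intros simp: algebra_simps)
    moreover have "exp (- L * x) * L * (\<phi> x - (A + L * J x)) \<le> 0"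
      using le[OF xT] L by (intro mult_nonneg_nonpos) (auto simp: J_def)
    ultimately show "\<exists>y. DERIV \<psi> x :> y \<and> y \<le> 0" by blast
  qed
  then have "A + L * J t \<le> A * exp (L * t)"
    by (simp add: \<psi>_def J_def exp_minus field_simps)
  then show ?thesis using le[OF t] by (simp add: J_def)
qed

text \<open>In \<open>F_lip\<close> the growth factor involves v alone. Taking v on the reference
  solution makes Gronwall's constant independent of the solution compared with it.\<close>

locale nls = form_group scl V ip W a D Lp Mc S
  for scl :: "complex \<Rightarrow> 'h::ab_group_add \<Rightarrow> 'h" and V ip W a D Lp Mc S +
  fixes F :: "'h \<Rightarrow> 'h" and T :: real and u0 :: 'h
  assumes F_W: "\<And>v. v \<in> W \<Longrightarrow> F v \<in> W"
    and F_lip: "\<exists>L\<ge>0. \<forall>v\<in>W. \<forall>w\<in>W. E.nrm (F w - F v) \<le> L * (1 + E.nrm v) * E.nrm (w - v)"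
    and T: "T > 0" and u0: "u0 \<in> W"
begin

definition curve :: "(real \<Rightarrow> 'h) \<Rightarrow> bool" where
  "curve u \<longleftrightarrow> (\<forall>t\<in>{0..T}. u t \<in> W) \<and>
     (\<forall>t\<in>{0..T}. \<forall>\<epsilon>>0. \<exists>\<delta>>0. \<forall>s\<in>{0..T}. \<bar>s - t\<bar> < \<delta> \<longrightarrow> E.nrm (u s - u t) < \<epsilon>)"

definition mild :: "(real \<Rightarrow> real) \<Rightarrow> (real \<Rightarrow> 'h) \<Rightarrow> bool" where
  "mild n u \<longleftrightarrow> curve u \<and> (\<forall>t\<in>{0..T}. \<forall>G\<in>V.
     ip (u t) G = ip (S (n t - n 0) u0) G + \<i> * integral {0..t} (\<lambda>s. ip (S (n t - n s) (F (u s))) G))"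

lemma curveW: "curve u \<Longrightarrow> t \<in> {0..T} \<Longrightarrow> u t \<in> W" by (simp add: curve_def)

lemma curve_tendsto: assumes "curve u" "t \<in> {0..T}"
  shows "((\<lambda>s. E.nrm (u s - u t)) \<longlongrightarrow> 0) (at t within {0..T})"
  unfolding tendsto_iff eventually_at
proof (intro allI impI)
  fix e :: real assume "e > 0"
  then obtain \<delta> where \<delta>: "\<delta> > 0" "\<And>s. s \<in> {0..T} \<Longrightarrow> \<bar>s - t\<bar> < \<delta> \<Longrightarrow> E.nrm (u s - u t) < e"
    using assms unfolding curve_def by meson
  have "dist (E.nrm (u s - u t)) 0 < e" if "s \<in> {0..T}" "dist s t < \<delta>" for s
    using \<delta>(2)[OF that(1)] that assms E.nrm_nonneg[of "u s - u t"]
    by (simp add: dist_real_def VC curveW)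
  then show "\<exists>d>0. \<forall>x\<in>{0..T}. x \<noteq> t \<and> dist x t < d \<longrightarrow> dist (E.nrm (u x - u t)) 0 < e"
    using \<delta>(1) by blast
qed

lemma curve_diff_continuous: assumes u: "curve u" and v: "curve v"
  shows "continuous_on {0..T} (\<lambda>t. E.nrm (u t - v t))"
  unfolding continuous_on_def
proof (intro ballI)
  fix t assume t: "t \<in> {0..T}"
  have "((\<lambda>s. E.nrm (u s - u t) + E.nrm (v s - v t)) \<longlongrightarrow> 0 + 0) (at t within {0..T})"
    by (intro tendsto_add curve_tendsto u v t)
  then have 0: "((\<lambda>s. E.nrm (u s - u t) + E.nrm (v s - v t)) \<longlongrightarrow> 0) (at t within {0..T})" by simp
  have "norm (E.nrm (u s - v s) - E.nrm (u t - v t)) \<le> E.nrm (u s - u t) + E.nrm (v s - v t)" if s: "s \<in> {0..T}" for s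
  proof -
    have W: "u s \<in> W" "u t \<in> W" "v s \<in> W" "v t \<in> W" using u v s t by (auto intro: curveW)
    have "\<bar>E.nrm (u s - v s) - E.nrm (u t - v t)\<bar> \<le> E.nrm ((u s - v s) - (u t - v t))"
      using W by (intro E.nrm_diff_ge) (auto simp: VC)
    also have "(u s - v s) - (u t - v t) = (u s - u t) - (v s - v t)" by simp
    also have "E.nrm \<dots> \<le> E.nrm (u s - u t) + E.nrm (v s - v t)"
      using W by (intro E.nrm_diff_le) (auto simp: VC)
    finally show ?thesis by simp
  qed
  then have "\<forall>\<^sub>F s in at t within {0..T}. norm (E.nrm (u s - v s) - E.nrm (u t - v t)) \<le> E.nrm (u s - u t) + E.nrm (v s - v t)"
    unfolding eventually_at by (intro exI[of _ 1]) auto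
  from Lim_null_comparison[OF this 0]
  show "((\<lambda>s. E.nrm (u s - v s)) \<longlongrightarrow> E.nrm (u t - v t)) (at t within {0..T})" by (simp add: LIM_zero_iff)
qed

lemma curve_zero: "curve (\<lambda>_. 0)"
  unfolding curve_def by (auto simp: VC intro: exI[of _ "1::real"])

lemma curve_bounded: assumes u: "curve u" obtains B where "B \<ge> 0" "\<And>t. t \<in> {0..T} \<Longrightarrow> E.nrm (u t) \<le> B"
proof -
  have "continuous_on {0..T} (\<lambda>t. E.nrm (u t))" using curve_diff_continuous[OF u curve_zero] by simp
  from compact_imp_bounded[OF compact_continuous_image[OF this compact_Icc]]
  obtain B where "B > 0" "\<And>t. t \<in> {0..T} \<Longrightarrow> \<bar>E.nrm (u t)\<bar> \<le> B"
    unfolding bounded_pos by auto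
  then show ?thesis using that[of B] by fastforce
qed

lemma curve_F: assumes u: "curve u" shows "curve (\<lambda>t. F (u t))"
proof -
  obtain L where L: "L \<ge> 0" "\<And>v w. v \<in> W \<Longrightarrow> w \<in> W \<Longrightarrow> E.nrm (F w - F v) \<le> L * (1 + E.nrm v) * E.nrm (w - v)"
    using F_lip by blast
  show ?thesis unfolding curve_def
  proof (intro conjI ballI allI impI)
    show "F (u t) \<in> W" if "t \<in> {0..T}" for t using that u by (intro F_W curveW)
    fix t and e :: real assume t: "t \<in> {0..T}" and e: "e > 0"
    define K where "K = L * (1 + E.nrm (u t)) + 1"
    have ut: "u t \<in> W" using u t by (rule curveW)
    have K: "K > 0" unfolding K_def using L(1) E.nrm_nonneg[OF ut] by (intro add_nonneg_pos mult_nonneg_nonneg) auto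
    then have "e / K > 0" using e by simp
    then obtain \<delta> where \<delta>: "\<delta> > 0" "\<And>s. s \<in> {0..T} \<Longrightarrow> \<bar>s - t\<bar> < \<delta> \<Longrightarrow> E.nrm (u s - u t) < e / K"
      using u t unfolding curve_def by meson
    have "E.nrm (F (u s) - F (u t)) < e" if s: "s \<in> {0..T}" "\<bar>s - t\<bar> < \<delta>" for s
    proof -
      have us: "u s \<in> W" using u s(1) by (rule curveW)
      have "E.nrm (F (u s) - F (u t)) \<le> (K - 1) * E.nrm (u s - u t)"
        using L(2)[OF ut us] by (simp add: K_def)
      also have "\<dots> \<le> K * E.nrm (u s - u t)" using ut us by (intro mult_right_mono) (auto simp: VC)
      also have "\<dots> < K * (e / K)" using \<delta>(2)[OF s] K by (intro mult_strict_left_mono) auto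
      also have "\<dots> = e" using K by simp
      finally show ?thesis .
    qed
    then show "\<exists>\<delta>>0. \<forall>s\<in>{0..T}. \<bar>s - t\<bar> < \<delta> \<longrightarrow> E.nrm (F (u s) - F (u t)) < e" using \<delta>(1) by blast
  qed
qed

text \<open>Gives integrability of the integrands in \<open>mild\<close>, so that two mild
  identities can be subtracted under one integral.\<close>

lemma integrand_continuous:
  assumes v: "curve v" and n: "continuous_on {0..T} n" and G: "G \<in> V"
  shows "continuous_on {0..T} (\<lambda>s. ip (S (b - n s) (v s)) G)"
  unfolding continuous_on_def
proof (intro ballI)
  fix t assume t: "t \<in> {0..T}"
  obtain c where c: "c > 0" "\<And>f. f \<in> W \<Longrightarrow> c * H.nrm f \<le> E.nrm f" using coercive by blast
  have vt: "v t \<in> W" using v t by (rule curveW)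
  define q where "q = (\<lambda>\<tau>. H.nrm (S \<tau> (v t) - v t))"
  have q0: "q 0 = 0" unfolding q_def using S_0 vt by simp
  have "isCont q 0" unfolding isCont_def q0 unfolding q_def using S_cont[of "v t"] vt by simp
  moreover have "((\<lambda>s. (b - n s) - (b - n t)) \<longlongrightarrow> (b - n t) - (b - n t)) (at t within {0..T})"
    using n t by (intro tendsto_intros) (auto simp: continuous_on_def)
  ultimately have q: "((\<lambda>s. q ((b - n s) - (b - n t))) \<longlongrightarrow> 0) (at t within {0..T})"
    using isCont_tendsto_compose[of 0 q] q0 by fastforce
  have "((\<lambda>s. (E.nrm (v s - v t) / c + q ((b - n s) - (b - n t))) * H.nrm G) \<longlongrightarrow> (0 / c + 0) * H.nrm G) (at t within {0..T})"
    using c by (intro tendsto_intros curve_tendsto v t q) auto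
  then have 0: "((\<lambda>s. (E.nrm (v s - v t) / c + q ((b - n s) - (b - n t))) * H.nrm G) \<longlongrightarrow> 0) (at t within {0..T})" by simp
  have "cmod (ip (S (b - n s) (v s)) G - ip (S (b - n t) (v t)) G) \<le>
      (E.nrm (v s - v t) / c + q ((b - n s) - (b - n t))) * H.nrm G" if s: "s \<in> {0..T}" for s
  proof -
    have vs: "v s \<in> W" using v s by (rule curveW)
    let ?x = "S (b - n s) (v s)" and ?y = "S (b - n s) (v t)" and ?z = "S (b - n t) (v t)"
    have V: "?x \<in> V" "?y \<in> V" "?z \<in> V" using vs vt by (auto simp: VC)
    have "ip ?x G - ip ?z G = ip (?x - ?z) G" using V G by (simp add: H.ip_diff)
    then have "cmod (ip ?x G - ip ?z G) \<le> H.nrm (?x - ?z) * H.nrm G"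
      using H.Cauchy_Schwarz[of "?x - ?z" G] V G by (simp add: VC)
    also have "H.nrm (?x - ?z) \<le> H.nrm (?x - ?y) + H.nrm (?y - ?z)" using V by (rule H.nrm_diff_triangle)
    also have "H.nrm (?x - ?y) = H.nrm (S (b - n s) (v s - v t))"
      using vs vt by (intro H.eqv_nrm[OF H.eqv_sym[OF S_diff_eqv]]) auto
    also have "\<dots> = H.nrm (v s - v t)" using vs vt by (intro S_isometry) (auto simp: VC)
    also have "\<dots> \<le> E.nrm (v s - v t) / c"
      using c(2)[of "v s - v t"] c(1) vs vt by (simp add: VC field_simps)
    also have "H.nrm (?y - ?z) = q ((b - n s) - (b - n t))" unfolding q_def by (rule S_isometry_diff[OF vt])
    finally show ?thesis using G by (simp add: mult_right_mono)
  qed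
  then have "\<forall>\<^sub>F s in at t within {0..T}. norm (ip (S (b - n s) (v s)) G - ip (S (b - n t) (v t)) G) \<le>
      (E.nrm (v s - v t) / c + q ((b - n s) - (b - n t))) * H.nrm G"
    unfolding eventually_at by (intro exI[of _ 1]) auto
  from Lim_null_comparison[OF this 0]
  show "((\<lambda>s. ip (S (b - n s) (v s)) G) \<longlongrightarrow> ip (S (b - n t) (v t)) G) (at t within {0..T})"
    by (simp add: LIM_zero_iff)
qed

text \<open>The modulus in \<open>dual_continuity\<close> depends on the vector. Finitely many small
  energy balls cover the compact curve, and the minimum of their moduli works everywhere: two thirds
  of e go to the distance from the centre, one third to the centre itself.\<close>

lemma dual_continuity_curve:
  assumes v: "curve v" and e: "e > 0"
  shows "\<exists>\<delta>>0. \<forall>r\<in>{0..T}. \<forall>s t. \<bar>s - t\<bar> < \<delta> \<longrightarrow>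
    (\<forall>g\<in>D. cmod (ip (S s (v r)) (Aop g) - ip (S t (v r)) (Aop g)) \<le> e * E.nrm g)"
proof -
  have e3: "e / 3 > 0" using e by simp
  have "\<exists>\<delta>>0. \<forall>s t. \<bar>s - t\<bar> < \<delta> \<longrightarrow> (\<forall>g\<in>D. cmod (ip (S s (v r)) (Aop g) - ip (S t (v r)) (Aop g)) \<le> e / 3 * E.nrm g)"
    if "r \<in> {0..T}" for r by (rule dual_continuity[OF curveW[OF v that] e3])
  then obtain \<delta> where \<delta>: "\<And>r. r \<in> {0..T} \<Longrightarrow> \<delta> r > 0"
    "\<And>r s t g. r \<in> {0..T} \<Longrightarrow> \<bar>s - t\<bar> < \<delta> r \<Longrightarrow> g \<in> D \<Longrightarrow>
      cmod (ip (S s (v r)) (Aop g) - ip (S t (v r)) (Aop g)) \<le> e / 3 * E.nrm g"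
    by metis
  have "\<exists>\<eta>>0. \<forall>s\<in>{0..T}. \<bar>s - r\<bar> < \<eta> \<longrightarrow> E.nrm (v s - v r) < e / 3" if "r \<in> {0..T}" for r
    using v that e3 unfolding curve_def by blast
  then obtain \<eta> where \<eta>: "\<And>r. r \<in> {0..T} \<Longrightarrow> \<eta> r > 0"
    "\<And>r s. r \<in> {0..T} \<Longrightarrow> s \<in> {0..T} \<Longrightarrow> \<bar>s - r\<bar> < \<eta> r \<Longrightarrow> E.nrm (v s - v r) < e / 3"
    by metis
  have "\<And>r. r \<in> {0..T} \<Longrightarrow> open (ball r (\<eta> r))" by simp
  moreover have "{0..T} \<subseteq> (\<Union>r\<in>{0..T}. ball r (\<eta> r))" using \<eta>(1) by force
  ultimately obtain C where C: "C \<subseteq> {0..T}" "finite C" "{0..T} \<subseteq> (\<Union>r\<in>C. ball r (\<eta> r))"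
    by (rule compactE_image[OF compact_Icc])
  have Cne: "C \<noteq> {}" using C(3) T by fastforce
  define d where "d = Min (\<delta> ` C)"
  have d: "d > 0" unfolding d_def using C \<delta>(1) Cne by (subst Min_gr_iff) auto
  have "cmod (ip (S s (v r)) (Aop g) - ip (S t (v r)) (Aop g)) \<le> e * E.nrm g"
    if r: "r \<in> {0..T}" and st: "\<bar>s - t\<bar> < d" and g: "g \<in> D" for r s t g
  proof -
    obtain r' where r': "r' \<in> C" "\<bar>r - r'\<bar> < \<eta> r'" using C(3) r by (fastforce simp: dist_real_def)
    have r'T: "r' \<in> {0..T}" using r' C by auto
    have W: "v r \<in> W" "v r' \<in> W" "v r - v r' \<in> W" using v r r'T by (auto intro!: E.V_diff intro: curveW)
    have "d \<le> \<delta> r'" unfolding d_def using C r' by simp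
    then have 1: "cmod (ip (S s (v r')) (Aop g) - ip (S t (v r')) (Aop g)) \<le> e / 3 * E.nrm g"
      using \<delta>(2)[OF r'T _ g] st by simp
    have 2: "cmod (ip (S q (v r - v r')) (Aop g)) \<le> e / 3 * E.nrm g" for q
      using dual_bound[OF W(3) g, of q] \<eta>(2)[OF r'T r r'(2)] g
        mult_right_mono[of "E.nrm (v r - v r')" "e/3" "E.nrm g"] by (meson DW E.nrm_nonneg less_imp_le order_trans)
    have 3: "ip (S q (v r)) (Aop g) = ip (S q (v r - v r')) (Aop g) + ip (S q (v r')) (Aop g)" for q
      using H.eqv_ip(1)[OF S_diff_eqv[of "v r" "v r'" q] Aop_V[OF g]] W Aop_V[OF g] by (simp add: H.ip_diff VC)
    have "ip (S s (v r)) (Aop g) - ip (S t (v r)) (Aop g) = ip (S s (v r - v r')) (Aop g)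
        - ip (S t (v r - v r')) (Aop g) + (ip (S s (v r')) (Aop g) - ip (S t (v r')) (Aop g))"
      using 3[of s] 3[of t] by simp
    then have "cmod (ip (S s (v r)) (Aop g) - ip (S t (v r)) (Aop g)) \<le> cmod (ip (S s (v r - v r')) (Aop g))
        + cmod (ip (S t (v r - v r')) (Aop g)) + cmod (ip (S s (v r')) (Aop g) - ip (S t (v r')) (Aop g))"
      by (metis (no_types, opaque_lifting) add_mono_thms_linordered_semiring(3) norm_triangle_ineq norm_triangle_ineq4 order_trans)
    also have "\<dots> \<le> e / 3 * E.nrm g + e / 3 * E.nrm g + e / 3 * E.nrm g" by (intro add_mono 1 2)
    finally show ?thesis by (simp add: algebra_simps)
  qed
  then show ?thesis using d by blast
qed

text \<open>Subtract the two mild identities, test against \<open>Aop g\<close>, and read the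
  resulting bound as an energy norm through \<open>nrm_le_dual\<close>. The modulus of continuity is
  used only for the initial datum and the curve of the reference solution.\<close>

theorem mild_continuous_dependence:
  assumes n: "CR T n" and u: "mild n u" and e: "e > 0"
  shows "\<exists>\<delta>>0. \<forall>n' u'. CR T n' \<and> mild n' u' \<and> distCR T n n' < \<delta> \<longrightarrow> (\<forall>t\<in>{0..T}. E.nrm (u t - u' t) \<le> e)"
proof -
  obtain L where L: "L \<ge> 0" "\<And>v w. v \<in> W \<Longrightarrow> w \<in> W \<Longrightarrow> E.nrm (F w - F v) \<le> L * (1 + E.nrm v) * E.nrm (w - v)"
    using F_lip by blast
  have cu: "curve u" using u by (simp add: mild_def)
  obtain B where B: "B \<ge> 0" "\<And>t. t \<in> {0..T} \<Longrightarrow> E.nrm (u t) \<le> B" using curve_bounded[OF cu] by blast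
  define L1 where "L1 = L * (1 + B)"
  have L1: "L1 \<ge> 0" using L B by (simp add: L1_def)
  \<comment> \<open>Chosen so that Gronwall's bound e1 (1 + T) exp (L1 T) equals e.\<close>
  define e1 where "e1 = e / ((1 + T) * exp (L1 * T))"
  have e1: "e1 > 0" using e T by (simp add: e1_def)
  obtain \<delta>1 where \<delta>1: "\<delta>1 > 0" "\<And>s t g. \<bar>s - t\<bar> < \<delta>1 \<Longrightarrow> g \<in> D \<Longrightarrow>
      cmod (ip (S s u0) (Aop g) - ip (S t u0) (Aop g)) \<le> e1 * E.nrm g"
    using dual_continuity[OF u0 e1] by blast
  have cF: "curve (\<lambda>t. F (u t))" by (rule curve_F[OF cu])
  obtain \<delta>2 where \<delta>2: "\<delta>2 > 0" "\<And>r s t g. r \<in> {0..T} \<Longrightarrow> \<bar>s - t\<bar> < \<delta>2 \<Longrightarrow> g \<in> D \<Longrightarrow>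
      cmod (ip (S s (F (u r))) (Aop g) - ip (S t (F (u r))) (Aop g)) \<le> e1 * E.nrm g"
    using dual_continuity_curve[OF cF e1] by blast
  \<comment> \<open>The group parameter is an increment of the path, so two path values enter and
    the uniform distance counts twice.\<close>
  define \<delta> where "\<delta> = min \<delta>1 \<delta>2 / 2"
  have \<delta>: "\<delta> > 0" using \<delta>1 \<delta>2 by (simp add: \<delta>_def)
  have "E.nrm (u t - u' t) \<le> e"
    if n': "CR T n'" and u': "mild n' u'" and d: "distCR T n n' < \<delta>" and t: "t \<in> {0..T}" for n' u' t
  proof -
    have cu': "curve u'" using u' by (simp add: mild_def)
    have cF': "curve (\<lambda>t. F (u' t))" by (rule curve_F[OF cu'])
    have nn: "\<bar>(n t - n s) - (n' t - n' s)\<bar> < min \<delta>1 \<delta>2" if "s \<in> {0..T}" "t \<in> {0..T}" for s t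
      using distCR_metric(5)[OF T n n', of s] distCR_metric(5)[OF T n n', of t] that d unfolding \<delta>_def by linarith
    define \<phi> where "\<phi> = (\<lambda>t. E.nrm (u t - u' t))"
    have c\<phi>: "continuous_on {0..T} \<phi>" unfolding \<phi>_def by (rule curve_diff_continuous[OF cu cu'])
    have "\<phi> t \<le> e1 * (1 + T) + L1 * integral {0..t} \<phi>" if t: "t \<in> {0..T}" for t
      unfolding \<phi>_def[THEN fun_cong, of t]
    proof (rule nrm_le_dual)
      have 0: "0 \<in> {0..T}" using T by simp
      have sub: "{0..t} \<subseteq> {0..T}" using t by auto
      have i\<phi>: "\<phi> integrable_on {0..t}" using continuous_on_subset[OF c\<phi> sub] by (rule integrable_continuous_real)
      have \<phi>0: "0 \<le> \<phi> s" if "s \<in> {0..T}" for s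
        unfolding \<phi>_def using that cu cu' by (intro E.nrm_nonneg E.V_diff curveW)
      show Wt: "u t - u' t \<in> W" using cu cu' t by (intro E.V_diff curveW)
      have "0 \<le> integral {0..t} \<phi>" using \<phi>0 sub by (intro integral_nonneg i\<phi>) auto
      then show "0 \<le> e1 * (1 + T) + L1 * integral {0..t} \<phi>" using e1 T L1 by simp
      fix g assume g: "g \<in> D"
      define G where "G = Aop g"
      have GV: "G \<in> V" using g by (simp add: G_def Aop_V)
      have gW: "g \<in> W" using g by simp
      define k where "k = (\<lambda>s. ip (S (n t - n s) (F (u s))) G)"
      define k' where "k' = (\<lambda>s. ip (S (n' t - n' s) (F (u' s))) G)"
      have "continuous_on {0..T} k" unfolding k_def
        using n by (intro integrand_continuous[OF cF _ GV]) (simp add: CR_def)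
      then have ik: "k integrable_on {0..t}" using continuous_on_subset[OF _ sub] by (intro integrable_continuous_real)
      have "continuous_on {0..T} k'" unfolding k'_def
        using n' by (intro integrand_continuous[OF cF' _ GV]) (simp add: CR_def)
      then have ik': "k' integrable_on {0..t}" using continuous_on_subset[OF _ sub] by (intro integrable_continuous_real)
      have ut: "ip (u t) G = ip (S (n t - n 0) u0) G + \<i> * integral {0..t} k"
        using u t GV by (simp add: mild_def k_def)
      have u't: "ip (u' t) G = ip (S (n' t - n' 0) u0) G + \<i> * integral {0..t} k'"
        using u' t GV by (simp add: mild_def k'_def)
      have "u t \<in> V" "u' t \<in> V" using curveW[OF cu t] curveW[OF cu' t] by auto
      then have "ip (u t - u' t) G = (ip (S (n t - n 0) u0) G - ip (S (n' t - n' 0) u0) G)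
          + \<i> * integral {0..t} (\<lambda>s. k s - k' s)"
        unfolding integral_diff[OF ik ik'] using GV by (simp add: H.ip_diff ut u't algebra_simps)
      then have "cmod (ip (u t - u' t) G) \<le> cmod (ip (S (n t - n 0) u0) G - ip (S (n' t - n' 0) u0) G)
          + cmod (integral {0..t} (\<lambda>s. k s - k' s))"
        using norm_triangle_ineq[of "ip (S (n t - n 0) u0) G - ip (S (n' t - n' 0) u0) G"
            "\<i> * integral {0..t} (\<lambda>s. k s - k' s)"] by (simp add: norm_mult)
      also have "cmod (ip (S (n t - n 0) u0) G - ip (S (n' t - n' 0) u0) G) \<le> e1 * E.nrm g"
        unfolding G_def using nn[OF 0 t] by (intro \<delta>1(2) g) simp
      also have "cmod (integral {0..t} (\<lambda>s. k s - k' s)) \<le> integral {0..t} (\<lambda>s. (e1 + L1 * \<phi> s) * E.nrm g)"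
      proof (rule integral_norm_bound_integral)
        show "(\<lambda>s. k s - k' s) integrable_on {0..t}" by (rule integrable_diff[OF ik ik'])
        show "(\<lambda>s. (e1 + L1 * \<phi> s) * E.nrm g) integrable_on {0..t}"
          by (intro integrable_on_mult_left integrable_add integrable_on_mult_right i\<phi> integrable_const_ivl)
        fix s assume "s \<in> {0..t}"
        then have s: "s \<in> {0..T}" using sub by auto
        have W: "F (u s) \<in> W" "F (u' s) \<in> W" "u s \<in> W" "u' s \<in> W" using curveW[OF cu s] curveW[OF cu' s] F_W by auto
        \<comment> \<open>The first difference changes the path with the reference nonlinearity
          frozen; the second changes the nonlinearity under a single group element. Neither asks for
          a modulus of continuity along the other solution.\<close>
        have "k s - k' s = (ip (S (n t - n s) (F (u s))) G - ip (S (n' t - n' s) (F (u s))) G)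
            + ip (S (n' t - n' s) (F (u s) - F (u' s))) G"
          using H.eqv_ip(1)[OF S_diff_eqv[of "F (u s)" "F (u' s)" "n' t - n' s"] GV] W GV
          by (simp add: k_def k'_def H.ip_diff VC)
        then have "cmod (k s - k' s) \<le> cmod (ip (S (n t - n s) (F (u s))) G - ip (S (n' t - n' s) (F (u s))) G)
            + cmod (ip (S (n' t - n' s) (F (u s) - F (u' s))) G)" using norm_triangle_ineq by metis
        also have "\<dots> \<le> e1 * E.nrm g + E.nrm (F (u s) - F (u' s)) * E.nrm g"
          unfolding G_def using nn[OF s t] W
          by (intro add_mono \<delta>2(2) dual_bound g s) (auto simp: VC)
        also have "E.nrm (F (u s) - F (u' s)) \<le> L1 * \<phi> s"
        proof -
          have "E.nrm (F (u s) - F (u' s)) = E.nrm (F (u' s) - F (u s))" using W by (intro E.nrm_commute)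
          also have "\<dots> \<le> L * (1 + E.nrm (u s)) * E.nrm (u' s - u s)" using W by (intro L(2))
          also have "\<dots> \<le> L1 * E.nrm (u' s - u s)" unfolding L1_def using B(2)[OF s] L(1) W
            by (intro mult_right_mono mult_left_mono) (auto simp: VC)
          also have "E.nrm (u' s - u s) = \<phi> s" unfolding \<phi>_def using W by (intro E.nrm_commute)
          finally show ?thesis .
        qed
        finally show "norm (k s - k' s) \<le> (e1 + L1 * \<phi> s) * E.nrm g"
          using gW by (simp add: algebra_simps mult_right_mono)
      qed
      also have "integral {0..t} (\<lambda>s. (e1 + L1 * \<phi> s) * E.nrm g) = (e1 * t + L1 * integral {0..t} \<phi>) * E.nrm g"
      proof -
        have "integral {0..t} (\<lambda>s. e1 + L1 * \<phi> s) = integral {0..t} (\<lambda>s. e1) + integral {0..t} (\<lambda>s. L1 * \<phi> s)"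
          by (intro integral_add integrable_on_mult_right i\<phi> integrable_const_ivl)
        also have "\<dots> = e1 * t + L1 * integral {0..t} \<phi>" using t by simp
        finally show ?thesis by simp
      qed
      finally have "cmod (ip (u t - u' t) G) \<le> (e1 * (1 + t) + L1 * integral {0..t} \<phi>) * E.nrm g"
        by (simp add: algebra_simps)
      also have "\<dots> \<le> (e1 * (1 + T) + L1 * integral {0..t} \<phi>) * E.nrm g"
        using e1 t gW by (intro mult_right_mono add_right_mono mult_left_mono) auto
      finally show "cmod (ip (u t - u' t) (Aop g)) \<le> (e1 * (1 + T) + L1 * integral {0..t} \<phi>) * E.nrm g"
        by (simp add: G_def)
    qed
    from gronwall[OF c\<phi> L1 this t] have "\<phi> t \<le> e1 * (1 + T) * exp (L1 * t)" .
    also have "\<dots> \<le> e1 * (1 + T) * exp (L1 * T)" using e1 T t L1 by (intro mult_left_mono) (auto intro: mult_left_mono)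
    also have "\<dots> = e" using T by (simp add: e1_def)
    finally show ?thesis by (simp add: \<phi>_def)
  qed
  then show ?thesis using \<delta> by blast
qed

end

section \<open>Square-integrable functions on an interval\<close>

context semi_inner begin

text \<open>Boundedness of p makes the set of vectors against which it is weakly null closed in
  norm.\<close>

lemma ip_tendsto_0_closure:
  assumes p: "\<And>j::nat. p j \<in> V" "\<And>j. nrm (p j) \<le> B" and \<psi>: "\<psi> \<in> V"
    and ap: "\<And>e. e > 0 \<Longrightarrow> \<exists>\<phi>\<in>V. nrm (\<psi> - \<phi>) < e \<and> (\<lambda>j. ip (p j) \<phi>) \<longlonglongrightarrow> 0"
  shows "(\<lambda>j. ip (p j) \<psi>) \<longlonglongrightarrow> 0"
proof (rule LIMSEQ_I)
  fix e :: real assume e: "e > 0"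
  have B: "B \<ge> 0" using p nrm_nonneg order_trans by blast
  obtain \<phi> where \<phi>: "\<phi> \<in> V" "nrm (\<psi> - \<phi>) < e / (2 * (B + 1))" "(\<lambda>j. ip (p j) \<phi>) \<longlonglongrightarrow> 0"
    using ap[of "e / (2 * (B + 1))"] e B by auto
  obtain N where N: "\<And>j. j \<ge> N \<Longrightarrow> cmod (ip (p j) \<phi>) < e / 2"
    using LIMSEQ_D[OF \<phi>(3), of "e/2"] e by auto
  have "norm (ip (p j) \<psi> - 0) < e" if "j \<ge> N" for j
  proof -
    have "ip (p j) \<psi> = ip (p j) \<phi> + ip (p j) (\<psi> - \<phi>)" using p \<psi> \<phi> by (simp add: ip_simps V_closed)
    then have "cmod (ip (p j) \<psi>) \<le> cmod (ip (p j) \<phi>) + cmod (ip (p j) (\<psi> - \<phi>))"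
      by (metis norm_triangle_ineq)
    also have "cmod (ip (p j) (\<psi> - \<phi>)) \<le> nrm (p j) * nrm (\<psi> - \<phi>)"
      using p \<psi> \<phi> by (intro Cauchy_Schwarz) (auto simp: V_closed)
    also have "\<dots> \<le> B * (e / (2 * (B + 1)))"
      using p \<psi> \<phi> B by (intro mult_mono) (auto simp: V_closed)
    also have "\<dots> \<le> e / 2" using B e by (simp add: field_simps)
    finally show ?thesis using N[OF that] by simp
  qed
  then show "\<exists>N. \<forall>j\<ge>N. norm (ip (p j) \<psi> - 0) < e" by blast
qed

end

definition fscl :: "complex \<Rightarrow> (real \<Rightarrow> complex) \<Rightarrow> real \<Rightarrow> complex" where
  "fscl c f = (\<lambda>x. c * f x)"

definition L2ip :: "real set \<Rightarrow> (real \<Rightarrow> complex) \<Rightarrow> (real \<Rightarrow> complex) \<Rightarrow> complex" where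
  "L2ip S f g = (LINT x|lebesgue_on S. f x * cnj (g x))"

lemma L2_integrable_mult:
  assumes f: "L2 S f" and g: "L2 S g"
  shows "integrable (lebesgue_on S) (\<lambda>x. f x * g x)"
proof (rule Bochner_Integration.integrable_bound)
  show "integrable (lebesgue_on S) (\<lambda>x. (cmod (f x))\<^sup>2 + (cmod (g x))\<^sup>2)"
    using f g by (auto simp: L2_def)
  show "(\<lambda>x. f x * g x) \<in> borel_measurable (lebesgue_on S)" using f g by (auto simp: L2_def)
  have "cmod (f x * g x) \<le> (cmod (f x))\<^sup>2 + (cmod (g x))\<^sup>2" for x
    using sum_squares_bound[of "cmod (f x)" "cmod (g x)"] mult_nonneg_nonneg[of "cmod (f x)" "cmod (g x)"]
    unfolding norm_mult mult.assoc by (smt (verit) norm_ge_zero)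
  then show "AE x in lebesgue_on S. norm (f x * g x) \<le> norm ((cmod (f x))\<^sup>2 + (cmod (g x))\<^sup>2)"
    by (intro AE_I2) (auto simp: abs_of_nonneg)
qed

lemma L2_norm_le:
  assumes f: "L2 S f" and g: "g \<in> borel_measurable (lebesgue_on S)" and le: "\<And>x. x \<in> S \<Longrightarrow> cmod (g x) \<le> K * cmod (f x)"
  shows "L2 S g"
  unfolding L2_def
proof (rule conjI[OF g], rule Bochner_Integration.integrable_bound[where f="\<lambda>x. K\<^sup>2 * (cmod (f x))\<^sup>2"])
  show "integrable (lebesgue_on S) (\<lambda>x. K\<^sup>2 * (cmod (f x))\<^sup>2)" using f by (auto simp: L2_def)
  show "(\<lambda>x. (cmod (g x))\<^sup>2) \<in> borel_measurable (lebesgue_on S)" using g by measurable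
  have "(cmod (g x))\<^sup>2 \<le> K\<^sup>2 * (cmod (f x))\<^sup>2" if "x \<in> S" for x
    using power_mono[OF le[OF that], of 2] by (simp add: power_mult_distrib)
  then show "AE x in lebesgue_on S. norm ((cmod (g x))\<^sup>2) \<le> norm (K\<^sup>2 * (cmod (f x))\<^sup>2)"
    by (intro AE_I2) (auto simp: abs_mult)
qed

lemma borel_measurable_cnj:
  assumes "f \<in> borel_measurable M" shows "(\<lambda>x. cnj (f x)) \<in> borel_measurable M"
  using borel_measurable_continuous_on[of cnj f M] assms continuous_on_cnj[OF continuous_on_id] by auto

lemma L2_cnj: "L2 S f \<Longrightarrow> L2 S (\<lambda>x. cnj (f x))"
  by (rule L2_norm_le[where K=1]) (auto simp: L2_def intro: borel_measurable_cnj)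

lemma L2_norm: "L2 S f \<Longrightarrow> L2 S (\<lambda>x. of_real (cmod (f x)))"
  by (rule L2_norm_le[where K=1]) (auto simp: L2_def)

lemma L2_scl: "L2 S f \<Longrightarrow> L2 S (\<lambda>x. c * f x)"
  by (rule L2_norm_le[where K="cmod c"]) (auto simp: L2_def norm_mult)

lemma L2_mult_bounded:
  assumes "L2 S f" "c \<in> borel_measurable (lebesgue_on S)" "\<And>x. x \<in> S \<Longrightarrow> cmod (c x) \<le> K"
  shows "L2 S (\<lambda>x. c x * f x)"
  by (rule L2_norm_le[where K=K, OF assms(1)]) (use assms in \<open>auto simp: L2_def norm_mult mult_right_mono\<close>)

lemma L2_add:
  assumes f: "L2 S f" and g: "L2 S g"
  shows "L2 S (\<lambda>x. f x + g x)"
  unfolding L2_def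
proof (rule conjI, rule_tac [2] Bochner_Integration.integrable_bound[where f="\<lambda>x. 2 * (cmod (f x))\<^sup>2 + 2 * (cmod (g x))\<^sup>2"])
  show "(\<lambda>x. f x + g x) \<in> borel_measurable (lebesgue_on S)"
    "(\<lambda>x. (cmod (f x + g x))\<^sup>2) \<in> borel_measurable (lebesgue_on S)"
    using f g by (auto simp: L2_def)
  show "integrable (lebesgue_on S) (\<lambda>x. 2 * (cmod (f x))\<^sup>2 + 2 * (cmod (g x))\<^sup>2)" using f g by (auto simp: L2_def)
  have "(cmod (f x + g x))\<^sup>2 \<le> 2 * (cmod (f x))\<^sup>2 + 2 * (cmod (g x))\<^sup>2" for x
  proof -
    have "(cmod (f x + g x))\<^sup>2 \<le> (cmod (f x) + cmod (g x))\<^sup>2" by (intro power_mono norm_triangle_ineq) auto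
    then show ?thesis using sum_squares_bound[of "cmod (f x)" "cmod (g x)"] by (simp add: power2_sum)
  qed
  then show "AE x in lebesgue_on S. norm ((cmod (f x + g x))\<^sup>2) \<le> norm (2 * (cmod (f x))\<^sup>2 + 2 * (cmod (g x))\<^sup>2)"
    by (intro AE_I2) auto
qed

lemma L2_diff: "L2 S f \<Longrightarrow> L2 S g \<Longrightarrow> L2 S (\<lambda>x. f x - g x)"
  using L2_add[of S f "\<lambda>x. (-1) * g x"] L2_scl[of S g "-1"] by simp

lemma L2_cong: assumes "L2 S f" "\<And>x. x \<in> S \<Longrightarrow> g x = f x" shows "L2 S g"
proof -
  have "g \<in> borel_measurable (lebesgue_on S)"
    using assms measurable_cong[of "lebesgue_on S" g f borel] by (auto simp: L2_def)
  then show ?thesis by (rule L2_norm_le[OF assms(1), where K=1]) (simp add: assms)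
qed

interpretation L2: semi_inner fscl "Collect (L2 S)" "L2ip S" for S
proof (unfold_locales)
  fix c :: complex and d :: complex and x y z :: "real \<Rightarrow> complex"
  show "fscl c (x + y) = fscl c x + fscl c y" "fscl (c + d) x = fscl c x + fscl d x"
    "fscl c (fscl d x) = fscl (c * d) x" "fscl 1 x = x"
    by (auto simp: fscl_def fun_eq_iff algebra_simps)
  show "0 \<in> Collect (L2 S)" by (simp add: L2_def zero_fun_def)
  show "x \<in> Collect (L2 S) \<Longrightarrow> y \<in> Collect (L2 S) \<Longrightarrow> x + y \<in> Collect (L2 S)"
    using L2_add by (simp add: plus_fun_def)
  show "x \<in> Collect (L2 S) \<Longrightarrow> fscl c x \<in> Collect (L2 S)" using L2_scl by (simp add: fscl_def)
  show "x \<in> Collect (L2 S) \<Longrightarrow> 0 \<le> Re (L2ip S x x)"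
  proof -
    have "L2ip S x x = complex_of_real (LINT t|lebesgue_on S. (cmod (x t))\<^sup>2)"
      unfolding L2ip_def complex_norm_square[symmetric] by (rule integral_complex_of_real)
    then show ?thesis by simp
  qed
  have i: "integrable (lebesgue_on S) (\<lambda>t. f t * cnj (g t))" if "f \<in> Collect (L2 S)" "g \<in> Collect (L2 S)" for f g
    using L2_integrable_mult L2_cnj that by auto
  show "x \<in> Collect (L2 S) \<Longrightarrow> y \<in> Collect (L2 S) \<Longrightarrow> z \<in> Collect (L2 S) \<Longrightarrow> L2ip S (x + y) z = L2ip S x z + L2ip S y z"
    using i[of x z] i[of y z] by (simp add: L2ip_def distrib_right)
  show "x \<in> Collect (L2 S) \<Longrightarrow> z \<in> Collect (L2 S) \<Longrightarrow> L2ip S (fscl c x) z = c * L2ip S x z"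
    using i[of x z] by (simp add: L2ip_def fscl_def mult.assoc)
  show "x \<in> Collect (L2 S) \<Longrightarrow> y \<in> Collect (L2 S) \<Longrightarrow> L2ip S y x = cnj (L2ip S x y)"
  proof -
    have "L2ip S y x = (LINT t|lebesgue_on S. cnj (x t * cnj (y t)))" by (simp add: L2ip_def mult.commute)
    then show ?thesis by (simp add: L2ip_def integral_cnj del: complex_cnj_mult)
  qed
qed

abbreviation nrm2 :: "real set \<Rightarrow> (real \<Rightarrow> complex) \<Rightarrow> real" where "nrm2 S \<equiv> semi_inner.nrm (L2ip S)"

lemma L2ip_self: "L2ip S f f = complex_of_real (LINT t|lebesgue_on S. (cmod (f t))\<^sup>2)"
  unfolding L2ip_def complex_norm_square[symmetric] by (rule integral_complex_of_real)

lemma nrm2_eq: "nrm2 S f = sqrt (LINT t|lebesgue_on S. (cmod (f t))\<^sup>2)"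
  by (simp add: L2.nrm_def L2ip_self)

lemma nrm2_power2: "(nrm2 S f)\<^sup>2 = (LINT t|lebesgue_on S. (cmod (f t))\<^sup>2)"
  by (simp add: nrm2_eq)

lemma nrm2_mono:
  assumes f: "L2 S f" and g: "L2 S g" and le: "\<And>x. x \<in> S \<Longrightarrow> cmod (g x) \<le> cmod (f x)"
  shows "nrm2 S g \<le> nrm2 S f"
  unfolding nrm2_eq using f g le by (intro real_sqrt_le_mono integral_mono) (auto simp: L2_def)

lemma nrm2_dominated_convergence:
  assumes \<psi>: "L2 S \<psi>" and \<phi>: "\<And>n::nat. L2 S (\<phi> n)" and w: "L2 S w"
    and lim: "\<And>x. x \<in> S \<Longrightarrow> (\<lambda>n. \<phi> n x) \<longlonglongrightarrow> \<psi> x"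
    and le: "\<And>n x. x \<in> S \<Longrightarrow> cmod (\<phi> n x) \<le> cmod (w x)"
  shows "(\<lambda>n. nrm2 S (\<psi> - \<phi> n)) \<longlonglongrightarrow> 0"
proof -
  have "(\<lambda>n. LINT t|lebesgue_on S. (cmod (\<psi> t - \<phi> n t))\<^sup>2) \<longlonglongrightarrow> (LINT t|lebesgue_on S. 0)"
  proof (rule integral_dominated_convergence[where w="\<lambda>t. 4 * (cmod (w t))\<^sup>2"])
    show "(\<lambda>t. (cmod (\<psi> t - \<phi> n t))\<^sup>2) \<in> borel_measurable (lebesgue_on S)" for n
      using \<psi> \<phi>[of n] by (auto simp: L2_def)
    show "integrable (lebesgue_on S) (\<lambda>t. 4 * (cmod (w t))\<^sup>2)" using w by (auto simp: L2_def)
    show "AE t in lebesgue_on S. (\<lambda>n. (cmod (\<psi> t - \<phi> n t))\<^sup>2) \<longlonglongrightarrow> 0"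
    proof (intro AE_I2)
      fix x assume "x \<in> space (lebesgue_on S)"
      then have "(\<lambda>n. (cmod (\<psi> x - \<phi> n x))\<^sup>2) \<longlonglongrightarrow> (cmod (\<psi> x - \<psi> x))\<^sup>2"
        using lim by (intro tendsto_intros) auto
      then show "(\<lambda>n. (cmod (\<psi> x - \<phi> n x))\<^sup>2) \<longlonglongrightarrow> 0" by simp
    qed
    show "AE t in lebesgue_on S. norm ((cmod (\<psi> t - \<phi> n t))\<^sup>2) \<le> 4 * (cmod (w t))\<^sup>2" for n
    proof (intro AE_I2)
      fix x assume "x \<in> space (lebesgue_on S)"
      then have x: "x \<in> S" by simp
      have "cmod (\<psi> x) \<le> cmod (w x)"
        using tendsto_norm[OF lim[OF x]] le[OF x] by (intro LIMSEQ_le_const2) auto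
      then have "cmod (\<psi> x - \<phi> n x) \<le> 2 * cmod (w x)"
        using le[OF x, of n] norm_triangle_ineq4[of "\<psi> x" "\<phi> n x"] by linarith
      then show "norm ((cmod (\<psi> x - \<phi> n x))\<^sup>2) \<le> 4 * (cmod (w x))\<^sup>2"
        using power_mono[of "cmod (\<psi> x - \<phi> n x)" "2 * cmod (w x)" 2] by (simp add: power_mult_distrib)
    qed
  qed auto
  then have "(\<lambda>n. sqrt (LINT t|lebesgue_on S. (cmod (\<psi> t - \<phi> n t))\<^sup>2)) \<longlonglongrightarrow> sqrt 0"
    by (intro tendsto_real_sqrt) simp
  then show ?thesis by (simp add: nrm2_eq)
qed

lemma L2_indicator:
  assumes "A \<in> sets lebesgue" "A \<subseteq> S" "S \<in> sets lebesgue" "emeasure lebesgue A < \<infinity>"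
  shows "L2 S (indicator A)"
proof -
  have A: "A \<in> sets (lebesgue_on S)" using assms by (simp add: sets_restrict_space_iff)
  have "emeasure (lebesgue_on S) A < \<infinity>" using assms by (simp add: emeasure_restrict_space)
  then have "integrable (lebesgue_on S) (indicator A :: real \<Rightarrow> real)" using A by simp
  moreover have "(\<lambda>x. (cmod (indicator A x))\<^sup>2) = (indicator A :: real \<Rightarrow> real)"
    by (auto simp: fun_eq_iff indicator_def)
  moreover have "(indicator A :: real \<Rightarrow> complex) \<in> borel_measurable (lebesgue_on S)" using A by simp
  ultimately show ?thesis by (simp add: L2_def)
qed

definition edge_ivl :: "real set \<Rightarrow> bool" where
  "edge_ivl S \<longleftrightarrow> S = {0..} \<or> (\<exists>l>0. S = {0..l})"

lemma edge_ivl_facts: assumes "edge_ivl S"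
  shows "S \<in> sets lebesgue" "0 \<in> S" "x \<in> S \<Longrightarrow> 0 \<le> x" "x \<in> S \<Longrightarrow> y \<in> S \<Longrightarrow> {x..y} \<subseteq> S"
    "S \<in> sets borel" "y \<in> S \<Longrightarrow> 0 \<le> x \<Longrightarrow> x \<le> y \<Longrightarrow> x \<in> S"
  using assms by (auto simp: edge_ivl_def)

lemma L2_indicator_Icc: assumes "edge_ivl S" "x \<in> S" "y \<in> S" shows "L2 S (indicator {x..y})"
  by (intro L2_indicator edge_ivl_facts(1)[OF assms(1)] edge_ivl_facts(4)[OF assms])
    (auto simp: emeasure_lborel_Icc_eq)

lemma nrm2_indicator_Icc: assumes "edge_ivl S" "x \<in> S" "y \<in> S" "x \<le> y"
  shows "nrm2 S (indicator {x..y}) = sqrt (y - x)"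
proof -
  have sub: "{x..y} \<subseteq> S" "S \<in> sets lebesgue" using edge_ivl_facts(1)[OF assms(1)] edge_ivl_facts(4)[OF assms(1-3)] by auto
  have "(LINT t|lebesgue_on S. (cmod (indicator {x..y} t))\<^sup>2) = (LINT t|lebesgue_on S. indicator {x..y} t :: real)"
    by (intro Bochner_Integration.integral_cong) (auto simp: indicator_def)
  also have "\<dots> = measure (lebesgue_on S) {x..y}" using sub by (simp add: Int_absorb2)
  also have "\<dots> = y - x" using sub assms(4) by (simp add: measure_restrict_space)
  finally show ?thesis by (simp add: nrm2_eq)
qed

text \<open>Links the two integrals in play: \<open>wderiv\<close> uses the gauge integral,
  \<open>L2ip\<close> the Lebesgue integral on S.\<close>

lemma L2_Icc:
  assumes S: "edge_ivl S" and f: "L2 S f" and xy: "x \<in> S" "y \<in> S"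
  shows "f absolutely_integrable_on {x..y}" "integral {x..y} f = L2ip S f (indicator {x..y})"
proof -
  have sub: "{x..y} \<subseteq> S" "S \<in> sets lebesgue" using edge_ivl_facts(1)[OF S] edge_ivl_facts(4)[OF S xy] by auto
  have i: "integrable (lebesgue_on S) (\<lambda>t. f t * indicator {x..y} t)"
    using L2_integrable_mult[OF f L2_indicator_Icc[OF S xy]] .
  have eq: "(\<lambda>t. indicat_real S t *\<^sub>R (f t * indicator {x..y} t)) = (\<lambda>t. indicat_real {x..y} t *\<^sub>R f t)"
    using sub by (auto simp: fun_eq_iff indicator_def)
  have "integrable lebesgue (\<lambda>t. indicat_real S t *\<^sub>R (f t * indicator {x..y} t))"
    using i sub by (subst (asm) integrable_restrict_space) auto
  then show 1: "f absolutely_integrable_on {x..y}" unfolding eq set_integrable_def .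
  have c: "cnj (indicator {x..y} t) = indicator {x..y} t" for t :: real by (simp add: indicator_def)
  have "L2ip S f (indicator {x..y}) = (LINT t|lebesgue. indicat_real S t *\<^sub>R (f t * indicator {x..y} t))"
    unfolding L2ip_def c using sub by (subst integral_restrict_space) auto
  also have "\<dots> = integral {x..y} f"
    unfolding eq using set_lebesgue_integral_eq_integral(2)[OF 1] by (simp add: set_lebesgue_integral_def)
  finally show "integral {x..y} f = L2ip S f (indicator {x..y})" by simp
qed

lemma L2_Icc_integral_le:
  assumes S: "edge_ivl S" and f: "L2 S f" and xy: "x \<in> S" "y \<in> S" "x \<le> y"
  shows "integral {x..y} (\<lambda>t. cmod (f t)) \<le> nrm2 S f * sqrt (y - x)"
proof -
  have n: "L2 S (\<lambda>t. complex_of_real (cmod (f t)))" by (rule L2_norm[OF f])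
  have "integral {x..y} (\<lambda>t. complex_of_real (cmod (f t))) = complex_of_real (integral {x..y} (\<lambda>t. cmod (f t)))"
  proof -
    have "(\<lambda>t. cmod (f t)) integrable_on {x..y}" using L2_Icc(1)[OF S f xy(1,2)] absolutely_integrable_on_def by blast
    then have "((\<lambda>t. complex_of_real (cmod (f t))) has_integral complex_of_real (integral {x..y} (\<lambda>t. cmod (f t)))) {x..y}"
      by (intro has_integral_of_real integrable_integral)
    then show ?thesis by (rule integral_unique)
  qed
  moreover have "cmod (integral {x..y} (\<lambda>t. complex_of_real (cmod (f t)))) \<le> nrm2 S f * sqrt (y - x)"
  proof -
    have "cmod (L2ip S (\<lambda>t. complex_of_real (cmod (f t))) (indicator {x..y})) \<le>
       nrm2 S (\<lambda>t. complex_of_real (cmod (f t))) * nrm2 S (indicator {x..y})"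
      using n L2_indicator_Icc[OF S xy(1,2)] by (intro L2.Cauchy_Schwarz) auto
    also have "nrm2 S (\<lambda>t. complex_of_real (cmod (f t))) = nrm2 S f" by (simp add: nrm2_eq)
    finally show ?thesis using L2_Icc(2)[OF S n xy(1,2)] nrm2_indicator_Icc[OF S xy] by simp
  qed
  ultimately show ?thesis by simp
qed

subsection \<open>Weak convergence tested on intervals\<close>

text \<open>First rung of the climb from intervals to all of L2. Intersecting with
  \<open>{0..d}\<close> keeps measures finite, so a complement becomes a difference of indicators in
  L2; a countable disjoint union is a norm limit of finite ones, and boundedness of p lets the limit
  pass.\<close>

lemma weak_null_borel:
  assumes S: "edge_ivl S" and p: "\<And>j::nat. L2 S (p j)" "\<And>j. nrm2 S (p j) \<le> B"
    and lim: "\<And>x y. x \<in> S \<Longrightarrow> y \<in> S \<Longrightarrow> (\<lambda>j. integral {x..y} (p j)) \<longlonglongrightarrow> 0"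
    and d: "d \<in> S" and A: "A \<in> sets borel"
  shows "(\<lambda>j. L2ip S (p j) (indicator (A \<inter> {0..d}))) \<longlonglongrightarrow> 0"
proof -
  note SF = edge_ivl_facts[OF S]
  have fin: "L2 S (indicator (A \<inter> {0..d}))" if "A \<in> sets borel" for A
  proof (rule L2_indicator)
    have "emeasure lebesgue (A \<inter> {0..d}) \<le> emeasure lebesgue {0..d}" using that by (intro emeasure_mono) auto
    also have "\<dots> < \<infinity>" by (simp add: emeasure_lborel_Icc_eq)
    finally show "emeasure lebesgue (A \<inter> {0..d}) < \<infinity>" .
  qed (use that SF(1) SF(4)[OF SF(2) d] in auto)
  have K: "L2 S (indicator {0..d})" using L2_indicator_Icc[OF S SF(2) d] .
  show ?thesis using A
  proof (induction rule: borel_set_induct)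
    case (interval a b)
    show ?case
    proof (cases "max a 0 \<le> min b d")
      case True
      then have "{a..b} \<inter> {0..d} = {max a 0..min b d}" by auto
      moreover have "max a 0 \<in> S" "min b d \<in> S" using True SF(6)[OF d] by auto
      ultimately show ?thesis using lim L2_Icc(2)[OF S p(1)] by simp
    next
      case False
      then have "{a..b} \<inter> {0..d} = {}" by auto
      then show ?thesis by (simp add: L2ip_def)
    qed
  next
    case empty
    show ?case by (simp add: L2ip_def)
  next
    case (compl A)
    have A: "A \<in> sets borel" by (rule compl(1))
    have "indicator ((- A) \<inter> {0..d}) = indicator {0..d} - (indicator (A \<inter> {0..d}) :: real \<Rightarrow> complex)"
      by (auto simp: fun_eq_iff indicator_def)
    then have "L2ip S (p j) (indicator ((- A) \<inter> {0..d})) = integral {0..d} (p j) - L2ip S (p j) (indicator (A \<inter> {0..d}))" for j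
      using L2.ip_diff_right[of "indicator {0..d}" S "indicator (A \<inter> {0..d})" "p j"] K fin[OF A] p(1)[of j] L2_Icc(2)[OF S p(1) SF(2) d]
      by simp
    then show ?case using tendsto_diff[OF lim[OF SF(2) d] compl(2)] by simp
  next
    case (union A)
    have A: "A i \<in> sets borel" for i using union(2) by auto
    define \<phi> where "\<phi> = (\<lambda>n. indicator ((\<Union>i<n. A i) \<inter> {0..d}) :: real \<Rightarrow> complex)"
    have \<phi>2: "L2 S (\<phi> n)" for n unfolding \<phi>_def using A by (intro fin) auto
    have sum: "\<phi> (Suc n) = \<phi> n + indicator (A n \<inter> {0..d})" for n
    proof -
      have "A i \<inter> A n = {}" if "i < n" for i
        using union(1) that unfolding disjoint_family_on_def by (metis UNIV_I less_irrefl)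
      then have "(\<Union>i<n. A i) \<inter> A n = {}" by blast
      then show ?thesis by (auto simp: \<phi>_def fun_eq_iff indicator_def lessThan_Suc)
    qed
    have Z: "(\<lambda>j. L2ip S (p j) (\<phi> n)) \<longlonglongrightarrow> 0" for n
    proof (induction n)
      case 0
      show ?case by (simp add: \<phi>_def L2ip_def)
    next
      case (Suc n)
      have "L2ip S (p j) (\<phi> (Suc n)) = L2ip S (p j) (\<phi> n) + L2ip S (p j) (indicator (A n \<inter> {0..d}))" for j
        unfolding sum using \<phi>2 fin[OF A] p(1) by (intro L2.ip_add_right) auto
      then show ?case using tendsto_add[OF Suc union(3)[of n]] by simp
    qed
    have U: "L2 S (indicator ((\<Union>i. A i) \<inter> {0..d}))" using A by (intro fin) auto
    have conv: "(\<lambda>n. nrm2 S (indicator ((\<Union>i. A i) \<inter> {0..d}) - \<phi> n)) \<longlonglongrightarrow> 0"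
    proof (rule nrm2_dominated_convergence[OF U \<phi>2 K])
      fix x assume "x \<in> S"
      show "(\<lambda>n. \<phi> n x) \<longlonglongrightarrow> indicator ((\<Union>i. A i) \<inter> {0..d}) x"
      proof (cases "x \<in> (\<Union>i. A i)")
        case True
        then obtain i where "x \<in> A i" by auto
        then have "\<phi> n x = indicator ((\<Union>i. A i) \<inter> {0..d}) x" if "n \<ge> Suc i" for n
          using that by (auto simp: \<phi>_def indicator_def)
        then show ?thesis by (intro tendsto_eventually) (auto simp: eventually_sequentially)
      next
        case False
        then show ?thesis by (simp add: \<phi>_def)
      qed
      show "cmod (\<phi> n x) \<le> cmod (indicator {0..d} x)" for n by (auto simp: \<phi>_def indicator_def)
    qed
    show ?case
    proof (rule L2.ip_tendsto_0_closure[of p S B])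
      fix e :: real assume "e > 0"
      from order_tendstoD(2)[OF conv this] obtain n where "nrm2 S (indicator ((\<Union>i. A i) \<inter> {0..d}) - \<phi> n) < e"
        by (auto simp: eventually_sequentially)
      then show "\<exists>\<phi>\<in>Collect (L2 S). nrm2 S (indicator ((\<Union>i. A i) \<inter> {0..d}) - \<phi>) < e \<and> (\<lambda>j. L2ip S (p j) \<phi>) \<longlonglongrightarrow> 0"
        using \<phi>2 Z by (intro bexI[of _ "\<phi> n"]) auto
    qed (use p U in auto)
  qed
qed

lemma L2ip_cong_AE:
  assumes "L2 S f" "L2 S g" "L2 S h" "AE x in lebesgue_on S. g x = h x"
  shows "L2ip S f g = L2ip S f h"
  unfolding L2ip_def
proof (rule integral_cong_AE)
  show "(\<lambda>x. f x * cnj (g x)) \<in> borel_measurable (lebesgue_on S)" "(\<lambda>x. f x * cnj (h x)) \<in> borel_measurable (lebesgue_on S)"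
    using assms by (auto simp: L2_def intro!: borel_measurable_times borel_measurable_cnj)
  show "AE x in lebesgue_on S. f x * cnj (g x) = f x * cnj (h x)" using assms(4) by eventually_elim simp
qed

text \<open>A Lebesgue set differs from a Borel set by a null set, which the pairing does not
  see.\<close>

lemma weak_null_lebesgue:
  assumes S: "edge_ivl S" and p: "\<And>j::nat. L2 S (p j)" "\<And>j. nrm2 S (p j) \<le> B"
    and lim: "\<And>x y. x \<in> S \<Longrightarrow> y \<in> S \<Longrightarrow> (\<lambda>j. integral {x..y} (p j)) \<longlonglongrightarrow> 0"
    and d: "d \<in> S" and A: "A \<in> sets lebesgue"
  shows "L2 S (indicator (A \<inter> {0..d}))" "(\<lambda>j. L2ip S (p j) (indicator (A \<inter> {0..d}))) \<longlonglongrightarrow> 0"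
proof -
  note SF = edge_ivl_facts[OF S]
  have fin: "L2 S (indicator (A \<inter> {0..d}))" if "A \<in> sets lebesgue" for A
  proof (rule L2_indicator)
    have "emeasure lebesgue (A \<inter> {0..d}) \<le> emeasure lebesgue {0..d}" using that by (intro emeasure_mono) auto
    also have "\<dots> < \<infinity>" by (simp add: emeasure_lborel_Icc_eq)
    finally show "emeasure lebesgue (A \<inter> {0..d}) < \<infinity>" .
  qed (use that SF(1) SF(4)[OF SF(2) d] in auto)
  show L2A: "L2 S (indicator (A \<inter> {0..d}))" by (rule fin[OF A])
  obtain A' N N' where A': "A = A' \<union> N" "A' \<in> sets lborel" "N \<subseteq> N'" "N' \<in> null_sets lborel"
    using A by (rule sets_completionE)
  have "AE x in lebesgue. x \<notin> N'" using A'(4) by (intro AE_completion AE_not_in)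
  then have "AE x in lebesgue_on S. x \<notin> N'"
    using SF(1) by (subst AE_restrict_space_iff) auto
  then have ae: "AE x in lebesgue_on S. indicator (A \<inter> {0..d}) x = (indicator (A' \<inter> {0..d}) x :: complex)"
    by eventually_elim (use A' in \<open>auto simp: indicator_def\<close>)
  have "L2ip S (p j) (indicator (A \<inter> {0..d})) = L2ip S (p j) (indicator (A' \<inter> {0..d}))" for j
    by (rule L2ip_cong_AE[OF p(1) L2A fin ae]) (use A' in auto)
  then show "(\<lambda>j. L2ip S (p j) (indicator (A \<inter> {0..d}))) \<longlonglongrightarrow> 0"
    using weak_null_borel[OF S p lim d, of A'] A'(2) by simp
qed

lemma weak_null:
  assumes S: "edge_ivl S" and p: "\<And>j::nat. L2 S (p j)" "\<And>j. nrm2 S (p j) \<le> B"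
    and lim: "\<And>x y. x \<in> S \<Longrightarrow> y \<in> S \<Longrightarrow> (\<lambda>j. integral {x..y} (p j)) \<longlonglongrightarrow> 0"
    and \<psi>: "L2 S \<psi>"
  shows "(\<lambda>j. L2ip S (p j) \<psi>) \<longlonglongrightarrow> 0"
proof -
  note SF = edge_ivl_facts[OF S]
  have "\<psi> \<in> borel_measurable (lebesgue_on S)" using \<psi> by (simp add: L2_def)
  from borel_measurable_implies_sequence_metric[OF this, of 0]
  obtain F where F0: "\<forall>i. simple_function (lebesgue_on S) (F i)"
    "\<forall>x\<in>S. (\<lambda>i. F i x) \<longlonglongrightarrow> \<psi> x" "\<forall>i. \<forall>x\<in>S. dist (F i x) 0 \<le> 2 * dist (\<psi> x) 0"
    unfolding space_lebesgue_on by blast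
  then have F: "\<And>i. simple_function (lebesgue_on S) (F i)"
    "\<And>x. x \<in> S \<Longrightarrow> (\<lambda>i. F i x) \<longlonglongrightarrow> \<psi> x" "\<And>i x. x \<in> S \<Longrightarrow> cmod (F i x) \<le> 2 * cmod (\<psi> x)"
    by (auto simp: dist_norm)
  \<comment> \<open>Points exhausting S. Level sets of a simple function may have infinite measure
    on the half-line, so the n-th approximant is cut off at \<open>dd n\<close>.\<close>
  obtain dd where dd: "\<And>n::nat. dd n \<in> S" "\<And>n x. x \<in> S \<Longrightarrow> x \<le> real n \<Longrightarrow> x \<le> dd n"
  proof (cases "S = {0..}")
    case True
    then show ?thesis by (intro that[of real]) auto
  next
    case False
    then obtain l where "l > 0" "S = {0..l}" using S by (auto simp: edge_ivl_def)
    then show ?thesis by (intro that[of "\<lambda>_. l"]) auto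
  qed
  define \<phi> where "\<phi> = (\<lambda>n x. F n x * indicator {0..dd n} x)"
  have rep: "\<phi> n x = (\<Sum>y\<in>F n ` S. y * indicator ((F n -` {y} \<inter> S) \<inter> {0..dd n}) x)" if "x \<in> S" for n x
  proof -
    have fin: "finite (F n ` S)" using F(1)[of n] by (simp add: simple_function_def)
    have "(\<Sum>y\<in>F n ` S. y * indicator ((F n -` {y} \<inter> S) \<inter> {0..dd n}) x) = (\<Sum>y\<in>F n ` S. if y = F n x then \<phi> n x else 0)"
      using that by (intro sum.cong refl) (auto simp: \<phi>_def indicator_def)
    also have "\<dots> = \<phi> n x" using fin that by simp
    finally show ?thesis by simp
  qed
  have good: "L2 S (\<lambda>x. \<Sum>y\<in>Y. y * indicator ((F n -` {y} \<inter> S) \<inter> {0..dd n}) x) \<and>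
      (\<lambda>j. L2ip S (p j) (\<lambda>x. \<Sum>y\<in>Y. y * indicator ((F n -` {y} \<inter> S) \<inter> {0..dd n}) x)) \<longlonglongrightarrow> 0"
    if "finite Y" "Y \<subseteq> F n ` S" for n Y using that
  proof (induction Y rule: finite_induct)
    case empty
    show ?case using L2.V_zero[of S] by (simp add: L2ip_def zero_fun_def)
  next
    case (insert y Y)
    define r where "r = (\<lambda>x. \<Sum>y\<in>Y. y * indicator ((F n -` {y} \<inter> S) \<inter> {0..dd n}) x)"
    define i where "i = (indicator ((F n -` {y} \<inter> S) \<inter> {0..dd n}) :: real \<Rightarrow> complex)"
    have r: "L2 S r" "(\<lambda>j. L2ip S (p j) r) \<longlonglongrightarrow> 0" using insert by (auto simp: r_def)
    have "F n -` {y} \<inter> S \<in> sets lebesgue"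
      using F(1)[of n] insert.prems SF(1) by (auto simp: simple_function_def sets_restrict_space_iff)
    from weak_null_lebesgue[OF S p lim dd(1)[of n] this]
    have i: "L2 S i" "(\<lambda>j. L2ip S (p j) i) \<longlonglongrightarrow> 0" by (auto simp: i_def)
    have eq: "(\<lambda>x. \<Sum>y\<in>insert y Y. y * indicator ((F n -` {y} \<inter> S) \<inter> {0..dd n}) x) = fscl y i + r"
      unfolding fun_eq_iff r_def i_def fscl_def plus_fun_def sum.insert[OF insert.hyps] by simp
    have "L2ip S (p j) (fscl y i + r) = cnj y * L2ip S (p j) i + L2ip S (p j) r" for j
      using i r p(1) L2.V_scl[of i S y] by (simp add: L2.ip_add_right L2.ip_scl_right)
    moreover have "(\<lambda>j. cnj y * L2ip S (p j) i + L2ip S (p j) r) \<longlonglongrightarrow> cnj y * 0 + 0"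
      by (intro tendsto_intros i r)
    ultimately show ?case unfolding eq using L2.V_add[OF L2.V_scl] i r by auto
  qed
  have fin: "finite (F n ` S)" for n using F(1)[of n] by (simp add: simple_function_def)
  have \<phi>2: "L2 S (\<phi> n)" for n
    by (rule L2_cong[OF conjunct1[OF good[OF fin[of n] subset_refl]]]) (rule rep)
  have Z: "(\<lambda>j. L2ip S (p j) (\<phi> n)) \<longlonglongrightarrow> 0" for n
  proof -
    have "L2ip S (p j) (\<phi> n) = L2ip S (p j) (\<lambda>x. \<Sum>y\<in>F n ` S. y * indicator ((F n -` {y} \<inter> S) \<inter> {0..dd n}) x)" for j
      unfolding L2ip_def by (intro Bochner_Integration.integral_cong) (simp_all add: rep)
    then show ?thesis using conjunct2[OF good[OF fin[of n] subset_refl]] by simp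
  qed
  have conv: "(\<lambda>n. nrm2 S (\<psi> - \<phi> n)) \<longlonglongrightarrow> 0"
  proof (rule nrm2_dominated_convergence[OF \<psi> \<phi>2 L2_scl[OF \<psi>, of 2]])
    fix x assume x: "x \<in> S"
    obtain N :: nat where N: "x \<le> real N" using real_arch_simple by blast
    have "\<phi> n x = F n x" if "n \<ge> N" for n
      using dd(2)[OF x, of n] N that SF(3)[OF x] by (auto simp: \<phi>_def indicator_def)
    then have "\<forall>\<^sub>F n in sequentially. F n x = \<phi> n x" unfolding eventually_sequentially by metis
    then show "(\<lambda>n. \<phi> n x) \<longlonglongrightarrow> \<psi> x" by (rule Lim_transform_eventually[OF F(2)[OF x]])
    show "cmod (\<phi> n x) \<le> cmod (2 * \<psi> x)" for n
      using F(3)[OF x, of n] by (auto simp: \<phi>_def indicator_def norm_mult)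
  qed
  show ?thesis
  proof (rule L2.ip_tendsto_0_closure[of p S B])
    fix e :: real assume "e > 0"
    from order_tendstoD(2)[OF conv this] obtain n where "nrm2 S (\<psi> - \<phi> n) < e"
      by (auto simp: eventually_sequentially)
    then show "\<exists>\<phi>\<in>Collect (L2 S). nrm2 S (\<psi> - \<phi>) < e \<and> (\<lambda>j. L2ip S (p j) \<phi>) \<longlonglongrightarrow> 0"
      using \<phi>2 Z by (intro bexI[of _ "\<phi> n"]) auto
  qed (use p \<psi> in auto)
qed

lemma L2_null_integrals:
  assumes S: "edge_ivl S" and p: "L2 S p" and 0: "\<And>x y. x \<in> S \<Longrightarrow> y \<in> S \<Longrightarrow> integral {x..y} p = 0"
  shows "nrm2 S p = 0"
proof -
  \<comment> \<open>\<open>weak_null\<close> for the constant sequence p, tested against p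
    itself.\<close>
  have "(\<lambda>j::nat. L2ip S p p) \<longlonglongrightarrow> 0"
    by (rule weak_null[OF S p order_refl _ p]) (simp add: 0)
  then have "L2ip S p p = 0" using LIMSEQ_const_iff by blast
  then show ?thesis by (simp add: L2.nrm_def)
qed

section \<open>Weak derivatives on an interval\<close>

text \<open>The class in which products are differentiated. It contains the derivatives of growing
  exponentials on the half-line and is stable under multiplication by continuous functions, unlike
  square integrability.\<close>

definition locint :: "real set \<Rightarrow> (real \<Rightarrow> complex) \<Rightarrow> bool" where
  "locint S p \<longleftrightarrow> (\<forall>x\<in>S. \<forall>y\<in>S. p absolutely_integrable_on {x..y})"

lemma L2_locint: "edge_ivl S \<Longrightarrow> L2 S p \<Longrightarrow> locint S p"
  by (simp add: locint_def L2_Icc(1))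

lemma continuous_mult_absolutely_integrable:
  fixes c p :: "real \<Rightarrow> complex"
  assumes "continuous_on {x..y} c" "p absolutely_integrable_on {x..y}"
  shows "(\<lambda>t. c t * p t) absolutely_integrable_on {x..y}"
proof (rule absolutely_integrable_bounded_measurable_product[where h="(*)"])
  show "bilinear ((*) :: complex \<Rightarrow> _)"
    by (simp add: bilinear_def bounded_linear.linear bounded_linear_mult_left bounded_linear_mult_right)
  show "c \<in> borel_measurable (lebesgue_on {x..y})"
    using assms(1) by (intro continuous_imp_measurable_on_sets_lebesgue) auto
  show "bounded (c ` {x..y})" using assms(1) by (intro compact_imp_bounded compact_continuous_image) auto
qed (use assms in auto)

lemma absolutely_integrable_cnj:
  assumes "p absolutely_integrable_on A" shows "(\<lambda>t. cnj (p t)) absolutely_integrable_on A"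
  using absolutely_integrable_linear[OF assms bounded_linear_cnj] by (simp add: o_def)

lemma absolutely_integrable_norm_le:
  fixes p :: "real \<Rightarrow> complex"
  assumes "p absolutely_integrable_on {x..y}"
  shows "cmod (integral {x..y} p) \<le> integral {x..y} (\<lambda>t. cmod (p t))"
  using assms by (intro integral_norm_bound_integral) (auto simp: absolutely_integrable_on_def)

lemma wderivD:
  assumes "wderiv S f p" "x \<in> S" "y \<in> S" "x \<le> y"
  shows "f y - f x = integral {x..y} p" "(p has_integral (f y - f x)) {x..y}"
proof -
  show h: "(p has_integral (f y - f x)) {x..y}" using assms by (simp add: wderiv_def)
  show "f y - f x = integral {x..y} p" using integral_unique[OF h] by simp
qed

lemma wderiv_bound:
  assumes "locint S p" "wderiv S f p" "x \<in> S" "y \<in> S" "x \<le> y"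
  shows "cmod (f y - f x) \<le> integral {x..y} (\<lambda>t. cmod (p t))"
  using wderivD(1)[OF assms(2-5)] absolutely_integrable_norm_le[where p=p and x=x and y=y] assms by (simp add: locint_def)

lemma wderiv_continuous_Icc:
  assumes S: "edge_ivl S" and p: "locint S p" and f: "wderiv S f p" and xy: "x \<in> S" "y \<in> S"
  shows "continuous_on {x..y} f"
proof -
  have "p integrable_on {x..y}" using p xy by (auto simp: locint_def absolutely_integrable_on_def)
  then have "continuous_on {x..y} (\<lambda>t. f x + integral {x..t} p)"
    by (intro continuous_intros indefinite_integral_continuous_1)
  moreover have "f x + integral {x..t} p = f t" if t: "t \<in> {x..y}" for t
  proof -
    have "t \<in> S" "x \<le> t" using t edge_ivl_facts(4)[OF S xy] by auto
    then show ?thesis using wderivD(1)[OF f xy(1), of t] by (simp add: algebra_simps)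
  qed
  ultimately show ?thesis using continuous_on_eq by blast
qed

lemma wderiv_continuous:
  assumes S: "edge_ivl S" and p: "locint S p" and f: "wderiv S f p"
  shows "continuous_on S f"
proof (cases "S = {0..}")
  case False
  then obtain l where "S = {0..l}" "l > 0" using S by (auto simp: edge_ivl_def)
  then show ?thesis using wderiv_continuous_Icc[OF S p f, of 0 l] by simp
next
  case True
  show ?thesis unfolding continuous_on_def
  proof
    fix x assume x: "x \<in> S"
    have "continuous_on {0..x + 1} f" using wderiv_continuous_Icc[OF S p f, of 0 "x + 1"] x True by simp
    then have "(f \<longlongrightarrow> f x) (at x within {0..x + 1})" using x True by (auto simp: continuous_on_def)
    moreover have "at x within {0..x + 1} = at x within S"
      by (rule at_within_nhd[of _ "{..<x + 1}"]) (auto simp: True)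
    ultimately show "(f \<longlongrightarrow> f x) (at x within S)" by simp
  qed
qed

lemma wderivI:
  assumes "locint S p" "\<And>x y. x \<in> S \<Longrightarrow> y \<in> S \<Longrightarrow> x \<le> y \<Longrightarrow> f y - f x = integral {x..y} p"
  shows "wderiv S f p"
  unfolding wderiv_def
proof (intro ballI impI)
  fix x y assume "x \<in> S" "y \<in> S" "x \<le> y"
  then show "(p has_integral (f y - f x)) {x..y}"
    using assms(2)[of x y] assms(1) by (simp add: locint_def absolutely_integrable_on_def integrable_integral)
qed

lemma wderiv_add: "wderiv S f p \<Longrightarrow> wderiv S g q \<Longrightarrow> wderiv S (\<lambda>x. f x + g x) (\<lambda>x. p x + q x)"
  unfolding wderiv_def
proof (intro ballI impI)
  fix x y assume f: "\<forall>x\<in>S. \<forall>y\<in>S. x \<le> y \<longrightarrow> (p has_integral f y - f x) {x..y}"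
    and g: "\<forall>x\<in>S. \<forall>y\<in>S. x \<le> y \<longrightarrow> (q has_integral g y - g x) {x..y}" and xy: "x \<in> S" "y \<in> S" "x \<le> y"
  have "((\<lambda>x. p x + q x) has_integral ((f y - f x) + (g y - g x))) {x..y}"
    using f g xy by (intro has_integral_add) auto
  then show "((\<lambda>x. p x + q x) has_integral (f y + g y - (f x + g x))) {x..y}" by (simp add: algebra_simps)
qed

lemma wderiv_scl: "wderiv S f p \<Longrightarrow> wderiv S (\<lambda>x. c * f x) (\<lambda>x. c * p x)"
  unfolding wderiv_def right_diff_distrib[symmetric] by (simp add: has_integral_mult_right)

lemma wderiv_diff: "wderiv S f p \<Longrightarrow> wderiv S g q \<Longrightarrow> wderiv S (\<lambda>x. f x - g x) (\<lambda>x. p x - q x)"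
  using wderiv_add[of S f p "\<lambda>x. (-1) * g x" "\<lambda>x. (-1) * q x"] wderiv_scl[of S g q "-1"] by simp

lemma wderiv_cnj: assumes "wderiv S f p" shows "wderiv S (\<lambda>x. cnj (f x)) (\<lambda>x. cnj (p x))"
  unfolding wderiv_def
proof (intro ballI impI)
  fix x y assume "x \<in> S" "y \<in> S" "x \<le> y"
  then have "(p has_integral (f y - f x)) {x..y}" using assms by (auto simp: wderiv_def)
  from has_integral_linear[OF this bounded_linear_cnj]
  show "((\<lambda>x. cnj (p x)) has_integral (cnj (f y) - cnj (f x))) {x..y}" by (simp add: o_def)
qed

lemma wderiv_const: "wderiv S (\<lambda>x. c) (\<lambda>x. 0)"
  by (simp add: wderiv_def)

lemma wderiv_cong:
  assumes "edge_ivl S" "wderiv S f p" "\<And>x. x \<in> S \<Longrightarrow> f' x = f x" "\<And>x. x \<in> S \<Longrightarrow> p' x = p x"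
  shows "wderiv S f' p'"
  unfolding wderiv_def
proof (intro ballI impI)
  fix x y assume xy: "x \<in> S" "y \<in> S" "x \<le> y"
  then have "(p has_integral (f y - f x)) {x..y}" using assms by (auto simp: wderiv_def)
  then show "(p' has_integral (f' y - f' x)) {x..y}"
    using has_integral_eq[of "{x..y}" p p'] edge_ivl_facts(4)[OF assms(1) xy(1,2)] assms(3,4) xy by (metis subsetD)
qed

lemma locint_add: "locint S p \<Longrightarrow> locint S q \<Longrightarrow> locint S (\<lambda>x. p x + q x)"
  by (simp add: locint_def set_integral_add(1))

lemma locint_mult_continuous: assumes "edge_ivl S" "continuous_on S c" "locint S p"
  shows "locint S (\<lambda>x. c x * p x)"
  unfolding locint_def
proof (intro ballI)
  fix x y assume xy: "x \<in> S" "y \<in> S"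
  show "(\<lambda>x. c x * p x) absolutely_integrable_on {x..y}"
    using assms(3) xy continuous_on_subset[OF assms(2) edge_ivl_facts(4)[OF assms(1) xy]]
    by (intro continuous_mult_absolutely_integrable) (auto simp: locint_def)
qed

lemma locint_cnj: "locint S p \<Longrightarrow> locint S (\<lambda>x. cnj (p x))"
  by (simp add: locint_def absolutely_integrable_cnj)

text \<open>Cutting the interval into short pieces bounds the total increment by an arbitrarily
  small multiple of the integral of k. This allows calculus with weak derivatives without
  differentiating at points.\<close>

lemma const_from_small_intervals:
  fixes \<Phi> :: "real \<Rightarrow> complex"
  assumes k: "k integrable_on {a..b}" "\<And>t. 0 \<le> k t" and ab: "a \<le> b"
    and small: "\<And>e. e > 0 \<Longrightarrow> \<exists>\<delta>>0. \<forall>x y. a \<le> x \<and> x \<le> y \<and> y \<le> b \<and> y - x < \<delta> \<longrightarrow>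
       cmod (\<Phi> y - \<Phi> x) \<le> e * integral {x..y} k"
  shows "\<Phi> b = \<Phi> a"
proof -
  define J where "J = integral {a..b} k"
  have J: "J \<ge> 0" unfolding J_def using k by (intro integral_nonneg) auto
  have "cmod (\<Phi> b - \<Phi> a) \<le> 0 + e" if "e > 0" for e
  proof -
    have "e / (J + 1) > 0" using that J by simp
    then obtain \<delta> where \<delta>: "\<delta> > 0" "\<And>x y. a \<le> x \<Longrightarrow> x \<le> y \<Longrightarrow> y \<le> b \<Longrightarrow> y - x < \<delta> \<Longrightarrow>
       cmod (\<Phi> y - \<Phi> x) \<le> e / (J + 1) * integral {x..y} k"
      using small by meson
    obtain N :: nat where N: "real N > (b - a) / \<delta>" using reals_Archimedean2 by blast
    have N0: "real N > 0" using N ab \<delta>(1) by (meson diff_ge_0_iff_ge divide_nonneg_pos le_less_trans)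
    define h where "h = (b - a) / real N"
    have h: "h \<ge> 0" "h < \<delta>" using N N0 ab \<delta>(1) by (auto simp: h_def field_simps)
    have hN: "real N * h = b - a" using N0 by (simp add: h_def)
    have "cmod (\<Phi> (a + real j * h) - \<Phi> a) \<le> e / (J + 1) * integral {a..a + real j * h} k" if "j \<le> N" for j
      using that
    proof (induction j)
      case 0
      show ?case by simp
    next
      case (Suc j)
      let ?x = "a + real j * h" and ?y = "a + real (Suc j) * h"
      have "real (Suc j) * h \<le> real N * h" using Suc.prems h by (intro mult_right_mono) auto
      then have yb: "?y \<le> b" using hN by simp
      have xy: "a \<le> ?x" "?x \<le> ?y" "?y - ?x < \<delta>" using h by (auto simp: algebra_simps)
      have ki: "k integrable_on {a..?y}" by (rule integrable_on_subinterval[OF k(1)]) (use yb in auto)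
      have comb: "integral {a..?x} k + integral {?x..?y} k = integral {a..?y} k"
        using xy by (intro Henstock_Kurzweil_Integration.integral_combine ki) auto
      have "cmod (\<Phi> ?y - \<Phi> a) \<le> cmod (\<Phi> ?y - \<Phi> ?x) + cmod (\<Phi> ?x - \<Phi> a)"
        using norm_triangle_ineq[of "\<Phi> ?y - \<Phi> ?x" "\<Phi> ?x - \<Phi> a"] by simp
      also have "\<dots> \<le> e / (J + 1) * integral {?x..?y} k + e / (J + 1) * integral {a..?x} k"
        using Suc.prems by (intro add_mono \<delta>(2)[OF xy(1,2) yb xy(3)] Suc.IH) simp
      also have "\<dots> = e / (J + 1) * integral {a..?y} k" using comb by (metis add.commute distrib_left)
      finally show ?case .
    qed
    from this[of N] have "cmod (\<Phi> b - \<Phi> a) \<le> e / (J + 1) * J" using hN by (simp add: J_def)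
    also have "\<dots> \<le> e" using J that by (simp add: field_simps)
    finally show ?thesis by simp
  qed
  then have "cmod (\<Phi> b - \<Phi> a) \<le> 0" using field_le_epsilon by blast
  then show ?thesis by simp
qed

text \<open>The real differential of \<open>G\<close> at \<open>z\<close> is \<open>h \<mapsto> \<alpha> z h + \<beta> z cnj h\<close>.\<close>
lemma wderiv_chain:
  assumes S: "edge_ivl S" and p: "locint S p" and u: "wderiv S u p" and K: "K \<ge> 0"
    and lip\<alpha>: "\<And>z w. cmod (\<alpha> w - \<alpha> z) \<le> K * cmod (w - z)"
    and lip\<beta>: "\<And>z w. cmod (\<beta> w - \<beta> z) \<le> K * cmod (w - z)"
    and tay: "\<And>z w. cmod (G w - G z - (\<alpha> z * (w - z) + \<beta> z * cnj (w - z))) \<le> K * (cmod (w - z))\<^sup>2"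
  shows "wderiv S (\<lambda>x. G (u x)) (\<lambda>x. \<alpha> (u x) * p x + \<beta> (u x) * cnj (p x))"
    "locint S (\<lambda>x. \<alpha> (u x) * p x + \<beta> (u x) * cnj (p x))"
proof -
  define q where "q = (\<lambda>x. \<alpha> (u x) * p x + \<beta> (u x) * cnj (p x))"
  have cu: "continuous_on S u" by (rule wderiv_continuous[OF S p u])
  have c\<alpha>: "continuous_on A \<alpha>" for A
    using lip\<alpha> K by (intro lipschitz_on_continuous_on) (auto simp: lipschitz_on_def dist_norm)
  have c\<beta>: "continuous_on A \<beta>" for A
    using lip\<beta> K by (intro lipschitz_on_continuous_on) (auto simp: lipschitz_on_def dist_norm)
  have q: "locint S q" unfolding q_def
    by (intro locint_add locint_mult_continuous[OF S] locint_cnj p continuous_on_compose2[OF c\<alpha> cu]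
        continuous_on_compose2[OF c\<beta> cu]) auto
  then show "locint S (\<lambda>x. \<alpha> (u x) * p x + \<beta> (u x) * cnj (p x))" by (simp add: q_def)
  have "wderiv S (\<lambda>x. G (u x)) q"
  proof (rule wderivI[OF q])
    fix a b assume ab: "a \<in> S" "b \<in> S" "a \<le> b"
    have sub: "{a..b} \<subseteq> S" by (rule edge_ivl_facts(4)[OF S ab(1,2)])
    have aip: "p absolutely_integrable_on {x..y}" if "x \<in> {a..b}" "y \<in> {a..b}" for x y
      using p subsetD[OF sub that(1)] subsetD[OF sub that(2)] by (simp add: locint_def)
    have aiq: "q absolutely_integrable_on {x..y}" if "x \<in> {a..b}" "y \<in> {a..b}" for x y
      using q subsetD[OF sub that(1)] subsetD[OF sub that(2)] by (simp add: locint_def)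
    have cub: "continuous_on {a..b} u" using continuous_on_subset[OF cu sub] .
    \<comment> \<open>The difference of the two sides of the chain rule. On a short interval its
      increment is at most the oscillation of u, times a constant, times the integral of the norm of
      p.\<close>
    define \<Phi> where "\<Phi> = (\<lambda>t. G (u t) - integral {a..t} q)"
    have "\<Phi> b = \<Phi> a"
    proof (rule const_from_small_intervals[where k="\<lambda>t. cmod (p t)"])
      show "(\<lambda>t. cmod (p t)) integrable_on {a..b}" using aip[of a b] ab by (auto simp: absolutely_integrable_on_def)
      fix e :: real assume e: "e > 0"
      \<comment> \<open>Of the three units of K, one is the Taylor remainder and two come from
        freezing \<alpha> and \<beta> at the left end point.\<close>
      define e' where "e' = e / (3 * (K + 1))"
      have e': "e' > 0" using e K by (simp add: e'_def)
      have "uniformly_continuous_on {a..b} u" using cub by (intro compact_uniformly_continuous) auto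
      then obtain \<delta> where \<delta>: "\<delta> > 0" "\<And>x y. x \<in> {a..b} \<Longrightarrow> y \<in> {a..b} \<Longrightarrow> dist y x < \<delta> \<Longrightarrow> dist (u y) (u x) < e'"
        unfolding uniformly_continuous_on_def using e' by meson
      have "cmod (\<Phi> y - \<Phi> x) \<le> e * integral {x..y} (\<lambda>t. cmod (p t))"
        if xy: "a \<le> x" "x \<le> y" "y \<le> b" "y - x < \<delta>" for x y
      proof -
        define J where "J = integral {x..y} (\<lambda>t. cmod (p t))"
        have in': "x \<in> {a..b}" "y \<in> {a..b}" using xy by auto
        have inS: "x \<in> S" "y \<in> S" using in' sub by auto
        have ip: "p integrable_on {x..y}" and ipn: "(\<lambda>t. cmod (p t)) integrable_on {x..y}"
          and icp: "(\<lambda>t. cnj (p t)) integrable_on {x..y}"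
          using aip[OF in'] absolutely_integrable_cnj[OF aip[OF in']] by (auto simp: absolutely_integrable_on_def)
        have J0: "J \<ge> 0" unfolding J_def using ipn by (intro integral_nonneg) auto
        have du: "cmod (u r - u x) \<le> e'" if "r \<in> {x..y}" for r
          using \<delta>(2)[of x r] that xy by (auto simp: dist_norm)
        define r where "r = (\<lambda>t. (\<alpha> (u t) - \<alpha> (u x)) * p t + (\<beta> (u t) - \<beta> (u x)) * cnj (p t))"
        have uyx: "u y - u x = integral {x..y} p" by (rule wderivD(1)[OF u inS xy(2)])
        have cuyx: "cnj (u y - u x) = integral {x..y} (\<lambda>t. cnj (p t))"
          using integral_linear[OF ip bounded_linear_cnj] uyx by (simp add: o_def)
        have lin: "integral {x..y} (\<lambda>t. \<alpha> (u x) * p t + \<beta> (u x) * cnj (p t)) = \<alpha> (u x) * (u y - u x) + \<beta> (u x) * cnj (u y - u x)"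
          unfolding uyx cuyx[unfolded uyx] using ip icp
          by (subst integral_add) (auto intro: integrable_on_mult_right)
        have iq: "q integrable_on {x..y}" using aiq[OF in'] by (auto simp: absolutely_integrable_on_def)
        have il: "(\<lambda>t. \<alpha> (u x) * p t + \<beta> (u x) * cnj (p t)) integrable_on {x..y}"
          using ip icp by (intro integrable_add integrable_on_mult_right)
        have rq: "r = (\<lambda>t. q t - (\<alpha> (u x) * p t + \<beta> (u x) * cnj (p t)))"
          by (auto simp: r_def q_def fun_eq_iff algebra_simps)
        have ir: "r integrable_on {x..y}" unfolding rq by (intro integrable_diff iq il)
        have "integral {a..y} q - integral {a..x} q = integral {x..y} q"
          using aiq[of a y] xy Henstock_Kurzweil_Integration.integral_combine[of a x y q] in'
          by (simp add: absolutely_integrable_on_def algebra_simps)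
        moreover have "integral {x..y} q = integral {x..y} r + (\<alpha> (u x) * (u y - u x) + \<beta> (u x) * cnj (u y - u x))"
          unfolding rq lin[symmetric] using integral_diff[OF iq il] by simp
        ultimately have split: "\<Phi> y - \<Phi> x = (G (u y) - G (u x) - (\<alpha> (u x) * (u y - u x) + \<beta> (u x) * cnj (u y - u x))) - integral {x..y} r"
          by (simp add: \<Phi>_def algebra_simps)
        have "cmod (integral {x..y} r) \<le> integral {x..y} (\<lambda>t. 2 * K * e' * cmod (p t))"
        proof (rule integral_norm_bound_integral[OF ir])
          show "(\<lambda>t. 2 * K * e' * cmod (p t)) integrable_on {x..y}" using ipn by (intro integrable_on_mult_right)
          fix t assume t: "t \<in> {x..y}"
          have "cmod (\<alpha> (u t) - \<alpha> (u x)) \<le> K * e'" "cmod (\<beta> (u t) - \<beta> (u x)) \<le> K * e'"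
            using order_trans[OF lip\<alpha> mult_left_mono[OF du[OF t] K]] order_trans[OF lip\<beta> mult_left_mono[OF du[OF t] K]] by auto
          then have "cmod ((\<alpha> (u t) - \<alpha> (u x)) * p t) \<le> K * e' * cmod (p t)" "cmod ((\<beta> (u t) - \<beta> (u x)) * cnj (p t)) \<le> K * e' * cmod (p t)"
            by (auto simp: norm_mult mult_right_mono)
          then show "cmod (r t) \<le> 2 * K * e' * cmod (p t)" unfolding r_def
            using norm_triangle_ineq[of "(\<alpha> (u t) - \<alpha> (u x)) * p t" "(\<beta> (u t) - \<beta> (u x)) * cnj (p t)"] by linarith
        qed
        also have "\<dots> = 2 * K * e' * J" by (simp add: J_def)
        finally have b1: "cmod (integral {x..y} r) \<le> 2 * K * e' * J" .
        have "cmod (u y - u x) \<le> J" unfolding J_def uyx by (rule absolutely_integrable_norm_le[OF aip[OF in']])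
        then have "(cmod (u y - u x))\<^sup>2 \<le> e' * J" unfolding power2_eq_square
          using du[of y] xy e' by (intro mult_mono) auto
        then have b2: "cmod (G (u y) - G (u x) - (\<alpha> (u x) * (u y - u x) + \<beta> (u x) * cnj (u y - u x))) \<le> K * (e' * J)"
          using order_trans[OF tay mult_left_mono[OF _ K]] by blast
        have "cmod (\<Phi> y - \<Phi> x) \<le> K * (e' * J) + 2 * K * e' * J"
          unfolding split using b1 b2 norm_triangle_le_diff[of _ _ "K * (e' * J) + 2 * K * e' * J"] by (meson add_mono)
        also have "\<dots> = (3 * K * e') * J" by (simp add: algebra_simps)
        also have "\<dots> \<le> e * J" using J0 K e by (intro mult_right_mono) (auto simp: e'_def field_simps)
        finally show ?thesis by (simp add: J_def)
      qed
      then show "\<exists>\<delta>>0. \<forall>x y. a \<le> x \<and> x \<le> y \<and> y \<le> b \<and> y - x < \<delta> \<longrightarrow> cmod (\<Phi> y - \<Phi> x) \<le> e * integral {x..y} (\<lambda>t. cmod (p t))"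
        using \<delta>(1) by blast
    qed (use ab in auto)
    then show "G (u b) - G (u a) = integral {a..b} q" by (simp add: \<Phi>_def algebra_simps)
  qed
  then show "wderiv S (\<lambda>x. G (u x)) (\<lambda>x. \<alpha> (u x) * p x + \<beta> (u x) * cnj (p x))" by (simp add: q_def)
qed

lemma wderiv_square:
  assumes S: "edge_ivl S" and p: "locint S p" and u: "wderiv S u p"
  shows "wderiv S (\<lambda>x. (u x)\<^sup>2) (\<lambda>x. 2 * u x * p x)"
proof -
  have "wderiv S (\<lambda>x. (u x)\<^sup>2) (\<lambda>x. 2 * u x * p x + 0 * cnj (p x))"
  proof (rule wderiv_chain(1)[OF S p u, where K=2 and G="\<lambda>z. z\<^sup>2" and \<alpha>="\<lambda>z. 2 * z" and \<beta>="\<lambda>z. 0"])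
    show "cmod (2 * w - 2 * z) \<le> 2 * cmod (w - z)" for w z :: complex
      by (metis norm_mult norm_numeral order_refl right_diff_distrib)
    have "w\<^sup>2 - z\<^sup>2 - (2 * z * (w - z) + 0 * cnj (w - z)) = (w - z)\<^sup>2" for w z :: complex
      by (simp add: power2_eq_square algebra_simps)
    then show "cmod (w\<^sup>2 - z\<^sup>2 - (2 * z * (w - z) + 0 * cnj (w - z))) \<le> 2 * (cmod (w - z))\<^sup>2" for w z :: complex
      by (simp add: norm_power)
  qed auto
  then show ?thesis by simp
qed

text \<open>Polarisation: the chain rule handles one function at a time, and squaring meets its
  Lipschitz and Taylor conditions globally.\<close>

lemma wderiv_mult:
  assumes S: "edge_ivl S" and p: "locint S p" and q: "locint S q" and f: "wderiv S f p" and g: "wderiv S g q"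
  shows "wderiv S (\<lambda>x. f x * g x) (\<lambda>x. p x * g x + f x * q x)"
    "locint S (\<lambda>x. p x * g x + f x * q x)"
proof -
  have "wderiv S (\<lambda>x. (1/2) * ((f x + g x)\<^sup>2 - (f x)\<^sup>2 - (g x)\<^sup>2)) (\<lambda>x. (1/2) * (2 * (f x + g x) * (p x + q x) - 2 * f x * p x - 2 * g x * q x))"
    by (intro wderiv_scl wderiv_diff wderiv_square[OF S] wderiv_add locint_add p q f g)
  then show "wderiv S (\<lambda>x. f x * g x) (\<lambda>x. p x * g x + f x * q x)"
    by (rule wderiv_cong[OF S]) (simp_all add: power2_eq_square algebra_simps)
  have "locint S (\<lambda>x. g x * p x + f x * q x)"
    by (intro locint_add locint_mult_continuous[OF S] p q wderiv_continuous[OF S p f] wderiv_continuous[OF S q g])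
  then show "locint S (\<lambda>x. p x * g x + f x * q x)" by (simp add: mult.commute)
qed

subsection \<open>Uniqueness\<close>

lemma wderiv_unique:
  assumes S: "edge_ivl S" and p: "L2 S p" "wderiv S f p" and q: "L2 S q" "wderiv S f q"
  shows "nrm2 S (p - q) = 0"
proof (rule L2_null_integrals[OF S])
  show "L2 S (p - q)" using L2_diff[OF p(1) q(1)] by (simp add: fun_diff_def)
  fix x y assume xy: "x \<in> S" "y \<in> S"
  show "integral {x..y} (p - q) = 0"
  proof (cases "x \<le> y")
    case True
    have "((\<lambda>t. p t - q t) has_integral 0) {x..y}"
      using has_integral_diff[OF wderivD(2)[OF p(2) xy True] wderivD(2)[OF q(2) xy True]] by simp
    then show ?thesis by (simp add: integral_unique fun_diff_def)
  qed simp
qed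

text \<open>Agreement holds at the end points too, where the vertex conditions evaluate
  \<open>dd\<close>. There the fundamental theorem of calculus is used in its one-sided
  form.\<close>

lemma wderiv_unique_continuous:
  assumes S: "edge_ivl S" and p: "continuous_on S p" "wderiv S f p" and q: "continuous_on S q" "wderiv S f q"
    and x: "x \<in> S"
  shows "p x = q x"
proof -
  obtain y where y: "y \<in> S" "y > 0" "x \<le> y"
  proof (cases "x = 0")
    case True
    show ?thesis
    proof (cases "S = {0..}")
      case False
      then obtain l where "S = {0..l}" "l > 0" using S by (auto simp: edge_ivl_def)
      then show ?thesis using that[of l] True by auto
    qed (use that[of 1] True in auto)
  next
    case False
    then show ?thesis using that[of x] x edge_ivl_facts(3)[OF S x] by auto
  qed
  have sub: "{0..y} \<subseteq> S" using edge_ivl_facts[OF S] y by blast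
  have x0: "x \<in> {0..y}" using edge_ivl_facts(3)[OF S x] y by auto
  define d where "d = (\<lambda>t. p t - q t)"
  have cd: "continuous_on {0..y} d" unfolding d_def
    using p q sub by (intro continuous_intros) (auto intro: continuous_on_subset)
  have 0: "integral {0..t} d = 0" if "t \<in> {0..y}" for t
  proof -
    have "t \<in> S" using that sub by auto
    then have "(d has_integral 0) {0..t}" unfolding d_def
      using has_integral_diff[OF wderivD(2)[OF p(2) edge_ivl_facts(2)[OF S]] wderivD(2)[OF q(2) edge_ivl_facts(2)[OF S]], of t] that by simp
    then show ?thesis by (rule integral_unique)
  qed
  have "((\<lambda>t. integral {0..t} d) has_vector_derivative d x) (at x within {0..y})"
    by (rule integral_has_vector_derivative[OF cd x0])
  then have "((\<lambda>t. 0) has_vector_derivative d x) (at x within {0..y})"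
    by (rule has_vector_derivative_transform[rotated 2]) (use 0 x0 in auto)
  moreover have "((\<lambda>t. 0) has_vector_derivative 0) (at x within {0..y})" by simp
  ultimately have "d x = 0"
    using vector_derivative_unique_within_closed_interval[where a=0 and b=y and x=x and f="\<lambda>t. 0::complex"] y x0 by simp
  then show ?thesis by (simp add: d_def)
qed

subsection \<open>Pointwise bounds\<close>

text \<open>Compare f at x with f at y and average over y in an interval of length r containing x.
  Keeping r free gives an interpolation inequality: a small r makes the derivative term small. The
  condition r \<le> l/2 leaves room for such an interval on one side of x.\<close>

lemma H1_pointwise:
  assumes S: "edge_ivl S" and f: "L2 S f" and p: "L2 S p" "wderiv S f p" and x: "x \<in> S"
    and r: "r > 0" and len: "\<And>l. S = {0..l} \<Longrightarrow> r \<le> l / 2"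
  shows "cmod (f x) \<le> nrm2 S f / sqrt r + sqrt r * nrm2 S p"
proof -
  obtain c d where cd: "c \<in> S" "d \<in> S" "d - c = r" "x \<in> {c..d}"
  proof (cases "x + r \<in> S")
    case True
    then show ?thesis using that[of x "x + r"] x r by auto
  next
    case False
    then have "S \<noteq> {0..}" using x r by auto
    then obtain l where l: "S = {0..l}" "l > 0" using S by (auto simp: edge_ivl_def)
    then have "x - r \<in> S" using False x r len[OF l(1)] by auto
    then show ?thesis using that[of "x - r" x] x r by auto
  qed
  have cd': "c \<le> d" using cd r by simp
  have sub: "{c..d} \<subseteq> S" by (rule edge_ivl_facts(4)[OF S cd(1,2)])
  have bd: "cmod (f x) \<le> cmod (f y) + sqrt r * nrm2 S p" if y: "y \<in> {c..d}" for y
  proof -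
    have *: "cmod (f b - f a) \<le> sqrt r * nrm2 S p" if "a \<in> {c..d}" "b \<in> {c..d}" "a \<le> b" for a b
    proof -
      have ab: "a \<in> S" "b \<in> S" using that sub by auto
      have "cmod (f b - f a) \<le> nrm2 S p * sqrt (b - a)"
        using wderiv_bound[OF L2_locint[OF S p(1)] p(2) ab that(3)] L2_Icc_integral_le[OF S p(1) ab that(3)] by linarith
      also have "\<dots> \<le> nrm2 S p * sqrt r" using that cd p(1) by (intro mult_left_mono real_sqrt_le_mono) auto
      finally show ?thesis by (simp add: mult.commute)
    qed
    have "cmod (f x - f y) \<le> sqrt r * nrm2 S p"
      using *[of x y] *[of y x] y cd(4) by (cases "x \<le> y") (auto simp: norm_minus_commute)
    then show ?thesis using norm_triangle_ineq2[of "f x" "f y"] by linarith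
  qed
  have fi: "(\<lambda>t. cmod (f t)) integrable_on {c..d}"
    using L2_Icc(1)[OF S f cd(1,2)] by (auto simp: absolutely_integrable_on_def)
  have "integral {c..d} (\<lambda>t. cmod (f x)) \<le> integral {c..d} (\<lambda>t. cmod (f t) + sqrt r * nrm2 S p)"
    using bd fi by (intro integral_le integrable_add integrable_const_ivl) auto
  also have "\<dots> = integral {c..d} (\<lambda>t. cmod (f t)) + r * (sqrt r * nrm2 S p)"
    using fi cd cd' by (subst integral_add) auto
  also have "integral {c..d} (\<lambda>t. cmod (f t)) \<le> nrm2 S f * sqrt r"
    using L2_Icc_integral_le[OF S f cd(1,2) cd'] cd by simp
  finally have "r * cmod (f x) \<le> nrm2 S f * sqrt r + r * (sqrt r * nrm2 S p)" using cd cd' by simp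
  also have "\<dots> = r * (nrm2 S f / sqrt r + sqrt r * nrm2 S p)"
    using r by (simp add: field_simps)
  finally show ?thesis using r by simp
qed

subsection \<open>Integration by parts\<close>

lemma integral_Icc_tendsto:
  fixes f :: "real \<Rightarrow> 'b::euclidean_space"
  assumes f: "integrable (lebesgue_on {0..}) f"
  shows "(\<lambda>n. integral {0..real n} f) \<longlonglongrightarrow> (LINT x|lebesgue_on {0..}. f x)"
proof -
  have eq: "integral {0..real n} f = (LINT x|lebesgue_on {0..}. indicat_real {0..real n} x *\<^sub>R f x)" for n
  proof -
    have e: "(\<lambda>t. indicat_real {0..} t *\<^sub>R (indicat_real {0..real n} t *\<^sub>R f t)) = (\<lambda>t. indicat_real {0..real n} t *\<^sub>R f t)"
      by (auto simp: fun_eq_iff indicator_def)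
    have "integrable (lebesgue_on {0..}) (\<lambda>x. indicat_real {0..real n} x *\<^sub>R f x)"
      using f by (intro integrable_mult_indicator) (auto simp: sets_restrict_space_iff)
    then have "integrable lebesgue (\<lambda>t. indicat_real {0..} t *\<^sub>R (indicat_real {0..real n} t *\<^sub>R f t))"
      by (subst (asm) integrable_restrict_space) auto
    then have ai: "f absolutely_integrable_on {0..real n}" unfolding e set_integrable_def .
    have "(LINT x|lebesgue_on {0..}. indicat_real {0..real n} x *\<^sub>R f x) = (LINT t|lebesgue. indicat_real {0..} t *\<^sub>R (indicat_real {0..real n} t *\<^sub>R f t))"
      by (subst integral_restrict_space) auto
    then show ?thesis unfolding e
      using set_lebesgue_integral_eq_integral(2)[OF ai] by (simp add: set_lebesgue_integral_def)
  qed
  show ?thesis unfolding eq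
  proof (rule integral_dominated_convergence[where w="\<lambda>x. norm (f x)"])
    show "f \<in> borel_measurable (lebesgue_on {0..})" using f by simp
    show "(\<lambda>x. indicat_real {0..real n} x *\<^sub>R f x) \<in> borel_measurable (lebesgue_on {0..})" for n
      using f by (intro borel_measurable_scaleR borel_measurable_indicator) (auto simp: sets_restrict_space_iff)
    show "AE x in lebesgue_on {0..}. (\<lambda>n. indicat_real {0..real n} x *\<^sub>R f x) \<longlonglongrightarrow> f x"
    proof (intro AE_I2)
      fix x :: real assume "x \<in> space (lebesgue_on {0..})"
      then have x: "0 \<le> x" by simp
      obtain N :: nat where "x \<le> real N" using real_arch_simple by blast
      then have "indicat_real {0..real n} x *\<^sub>R f x = f x" if "n \<ge> N" for n
        using that x by (auto simp: indicator_def)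
      then show "(\<lambda>n. indicat_real {0..real n} x *\<^sub>R f x) \<longlonglongrightarrow> f x"
        by (intro tendsto_eventually) (auto simp: eventually_sequentially)
    qed
  qed (use f in \<open>auto simp: indicator_def\<close>)
qed

lemma L2ip_by_parts:
  assumes S: "edge_ivl S" and f: "L2 S f" "L2 S p" "wderiv S f p" and g: "L2 S g" "L2 S q" "wderiv S g q"
  shows "L2ip S p g + L2ip S f q = (if S = {0..} then 0 else f (Sup S) * cnj (g (Sup S))) - f 0 * cnj (g 0)"
proof -
  define h where "h = (\<lambda>x. f x * cnj (g x))"
  define r where "r = (\<lambda>x. p x * cnj (g x) + f x * cnj (q x))"
  note li = L2_locint[OF S f(2)] locint_cnj[OF L2_locint[OF S g(2)]]
  have h: "wderiv S h r" unfolding h_def r_def by (rule wderiv_mult(1)[OF S li f(3) wderiv_cnj[OF g(3)]])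
  have i1: "integrable (lebesgue_on S) (\<lambda>x. p x * cnj (g x))" "integrable (lebesgue_on S) (\<lambda>x. f x * cnj (q x))"
    using f g by (auto intro!: L2_integrable_mult L2_cnj)
  have ir: "integrable (lebesgue_on S) r" unfolding r_def using i1 by simp
  have ih: "integrable (lebesgue_on S) h" unfolding h_def using f g by (auto intro!: L2_integrable_mult L2_cnj)
  have sum: "L2ip S p g + L2ip S f q = (LINT x|lebesgue_on S. r x)"
    unfolding L2ip_def r_def using i1 by simp
  show ?thesis
  proof (cases "S = {0..}")
    case False
    then obtain l where l: "S = {0..l}" "l > 0" using S by (auto simp: edge_ivl_def)
    have "(r has_integral (LINT x|lebesgue_on S. r x)) {0..l}"
      using has_integral_integral_lebesgue_on[OF ir] l by simp
    moreover have "(r has_integral (h l - h 0)) {0..l}" using wderivD(2)[OF h, of 0 l] l by simp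
    ultimately have "(LINT x|lebesgue_on S. r x) = h l - h 0" by (rule has_integral_unique)
    moreover have "Sup S = l" using l by simp
    ultimately show ?thesis using False sum by (simp add: h_def)
  next
    case True
    have 1: "(\<lambda>n. h (real n) - h 0) \<longlonglongrightarrow> (LINT x|lebesgue_on S. r x)"
    proof -
      have "integral {0..real n} r = h (real n) - h 0" for n using wderivD(1)[OF h, of 0 "real n"] True by simp
      then show ?thesis using integral_Icc_tendsto[of r] ir True by simp
    qed
    \<comment> \<open>The boundary term at infinity must vanish. Averaging over the n-th unit
      interval bounds the norm of \<open>h (real n)\<close> by the integral of k there, which tends
      to 0 because k is integrable.\<close>
    define k where "k = (\<lambda>x. cmod (h x) + cmod (r x))"
    have "integrable (lebesgue_on {0..}) k" unfolding k_def using ih ir True by simp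
    from integral_Icc_tendsto[OF this] have J: "(\<lambda>n. integral {0..real n} k) \<longlonglongrightarrow> (LINT x|lebesgue_on {0..}. k x)" .
    have "(\<lambda>n. integral {0..real (Suc n)} k - integral {0..real n} k) \<longlonglongrightarrow> (LINT x|lebesgue_on {0..}. k x) - (LINT x|lebesgue_on {0..}. k x)"
      by (intro tendsto_diff J LIMSEQ_Suc[OF J])
    then have J0: "(\<lambda>n. integral {0..real (Suc n)} k - integral {0..real n} k) \<longlonglongrightarrow> 0" by simp
    have ae: "r absolutely_integrable_on {x..y}" "h absolutely_integrable_on {x..y}" if "0 \<le> x" "0 \<le> y" for x y
    proof -
      show "r absolutely_integrable_on {x..y}"
        using wderiv_mult(2)[OF S li f(3) wderiv_cnj[OF g(3)]] that True by (simp add: locint_def r_def)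
      have "continuous_on {x..y} h"
        using wderiv_continuous_Icc[OF S _ h] wderiv_mult(2)[OF S li f(3) wderiv_cnj[OF g(3)]] that True by (simp add: r_def)
      then show "h absolutely_integrable_on {x..y}" by (rule absolutely_integrable_continuous_real)
    qed
    have "cmod (h (real n)) \<le> integral {0..real (Suc n)} k - integral {0..real n} k" for n
    proof -
      let ?a = "real n" and ?b = "real (Suc n)"
      have ki: "k integrable_on {x..y}" "(\<lambda>t. cmod (h t)) integrable_on {x..y}" "(\<lambda>t. cmod (r t)) integrable_on {x..y}"
        if "0 \<le> x" "0 \<le> y" for x y
        using ae[OF that] unfolding k_def by (auto simp: absolutely_integrable_on_def intro!: integrable_add)
      have "cmod (h ?a) \<le> cmod (h y) + integral {?a..?b} (\<lambda>t. cmod (r t))" if y: "y \<in> {?a..?b}" for y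
      proof -
        have "cmod (h y - h ?a) \<le> integral {?a..y} (\<lambda>t. cmod (r t))"
          using wderivD(1)[OF h, of ?a y] absolutely_integrable_norm_le[OF ae(1), of ?a y] y True by simp
        also have "\<dots> \<le> integral {?a..?b} (\<lambda>t. cmod (r t))" using y ki by (intro integral_subset_le) auto
        finally show ?thesis using norm_triangle_ineq3[of "h ?a" "h y"] norm_minus_commute[of "h ?a" "h y"] by linarith
      qed
      then have "integral {?a..?b} (\<lambda>t. cmod (h ?a)) \<le> integral {?a..?b} (\<lambda>y. cmod (h y) + integral {?a..?b} (\<lambda>t. cmod (r t)))"
        using ki[of ?a ?b] by (intro integral_le integrable_add integrable_const_ivl) auto
      also have "\<dots> = integral {?a..?b} (\<lambda>y. cmod (h y)) + integral {?a..?b} (\<lambda>t. cmod (r t))"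
        using ki[of ?a ?b] by (subst integral_add) auto
      also have "\<dots> = integral {?a..?b} k" unfolding k_def using ki[of ?a ?b] by (subst integral_add) auto
      also have "\<dots> = integral {0..?b} k - integral {0..?a} k"
        using Henstock_Kurzweil_Integration.integral_combine[of 0 ?a ?b k] ki[of 0 ?b] by (simp add: algebra_simps)
      finally show ?thesis by simp
    qed
    then have "(\<lambda>n. h (real n)) \<longlonglongrightarrow> 0"
      by (intro Lim_null_comparison[OF _ J0] always_eventually allI) auto
    then have "(\<lambda>n. h (real n) - h 0) \<longlonglongrightarrow> 0 - h 0" by (intro tendsto_intros)
    with 1 have "(LINT x|lebesgue_on S. r x) = 0 - h 0" by (rule LIMSEQ_unique)
    then show ?thesis using True sum by (simp add: h_def)
  qed
qed

section \<open>The resolvent equation on an interval\<close>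

lemma borel_measurable_continuous_edge:
  assumes "edge_ivl S" "continuous_on S f" shows "f \<in> borel_measurable (lebesgue_on S)"
  using assms edge_ivl_facts(1)[OF assms(1)] by (intro continuous_imp_measurable_on_sets_lebesgue)

text \<open>On the half-line, monotone convergence turns a bound uniform in X into
  integrability.\<close>

lemma L2_of_bounded_integrals:
  assumes S: "edge_ivl S" and f: "continuous_on S f"
    and C: "\<And>X. X \<in> S \<Longrightarrow> integral {0..X} (\<lambda>t. (cmod (f t))\<^sup>2) \<le> C"
  shows "L2 S f"
proof -
  define w where "w = (\<lambda>t. (cmod (f t))\<^sup>2)"
  have w: "continuous_on S w" unfolding w_def using f by (intro continuous_intros)
  have "w absolutely_integrable_on S"
  proof (cases "S = {0..}")
    case False
    then obtain l where "S = {0..l}" using S by (auto simp: edge_ivl_def)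
    then show ?thesis using w absolutely_integrable_continuous_real by blast
  next
    case True
    have wi: "w integrable_on {0..real n}" for n
      using continuous_on_subset[OF w] True by (intro integrable_continuous_real) auto
    define F where "F = (\<lambda>(n::nat) t. if t \<in> {0..real n} then w t else 0)"
    have iF: "F n integrable_on {0..}" "integral {0..} (F n) = integral {0..real n} w" for n
    proof -
      have "{0..} \<inter> {0..real n} = {0..real n}" by auto
      then show "F n integrable_on {0..}" "integral {0..} (F n) = integral {0..real n} w"
        using wi[of n] integrable_restrict_Int[of "{0..real n}" w "{0..}"] integral_restrict_Int[of "{0..}" "{0..real n}" w]
        unfolding F_def by (simp_all add: Int_commute)
    qed
    have "w integrable_on {0..} \<and> (\<lambda>n. integral {0..} (F n)) \<longlonglongrightarrow> integral {0..} w"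
    proof (rule monotone_convergence_increasing)
      show "F n integrable_on {0..}" for n by (rule iF)
      show "F n x \<le> F (Suc n) x" for n x by (auto simp: F_def w_def)
      show "(\<lambda>n. F n x) \<longlonglongrightarrow> w x" if "x \<in> {0..}" for x
      proof -
        obtain N :: nat where "x \<le> real N" using real_arch_simple by blast
        then have "F n x = w x" if "n \<ge> N" for n using that \<open>x \<in> {0..}\<close> by (auto simp: F_def)
        then show ?thesis by (intro tendsto_eventually) (auto simp: eventually_sequentially)
      qed
      have "norm (integral {0..} (F n)) \<le> C" for n
      proof -
        have "0 \<le> integral {0..real n} w" using wi by (intro integral_nonneg) (auto simp: w_def)
        then show ?thesis using C[of "real n"] True iF(2)[of n] by (simp add: w_def)
      qed
      then show "bounded (range (\<lambda>n. integral {0..} (F n)))" by (auto simp: bounded_iff)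
    qed
    then show ?thesis using True by (intro nonnegative_absolutely_integrable_1) (auto simp: w_def)
  qed
  then have "integrable (lebesgue_on S) w" by (rule absolutely_integrable_imp_integrable) (rule edge_ivl_facts(1)[OF S])
  then show ?thesis using borel_measurable_continuous_edge[OF S f] by (simp add: L2_def w_def)
qed

lemma integral_norm_sq_le:
  assumes S: "edge_ivl S" and f: "L2 S f" and xy: "x \<in> S" "y \<in> S"
  shows "(\<lambda>t. (cmod (f t))\<^sup>2) integrable_on {x..y}" "integral {x..y} (\<lambda>t. (cmod (f t))\<^sup>2) \<le> (nrm2 S f)\<^sup>2"
proof -
  have i: "integrable (lebesgue_on S) (\<lambda>t. (cmod (f t))\<^sup>2)" using f by (simp add: L2_def)
  have hi: "((\<lambda>t. (cmod (f t))\<^sup>2) has_integral (nrm2 S f)\<^sup>2) S"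
    unfolding nrm2_power2 by (rule has_integral_integral_lebesgue_on[OF i edge_ivl_facts(1)[OF S]])
  have sub: "{x..y} \<subseteq> S" by (rule edge_ivl_facts(4)[OF S xy])
  show 1: "(\<lambda>t. (cmod (f t))\<^sup>2) integrable_on {x..y}"
    by (rule integrable_on_subinterval[OF has_integral_integrable[OF hi] sub])
  show "integral {x..y} (\<lambda>t. (cmod (f t))\<^sup>2) \<le> (nrm2 S f)\<^sup>2"
    using integral_subset_le[OF sub 1 has_integral_integrable[OF hi]] integral_unique[OF hi] by simp
qed

lemma wderiv_norm_sq:
  assumes S: "edge_ivl S" and q: "locint S q" and g: "wderiv S g q" and xy: "x \<in> S" "y \<in> S" "x \<le> y"
  shows "((\<lambda>t. 2 * Re (q t * cnj (g t))) has_integral ((cmod (g y))\<^sup>2 - (cmod (g x))\<^sup>2)) {x..y}"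
proof -
  have "wderiv S (\<lambda>t. g t * cnj (g t)) (\<lambda>t. q t * cnj (g t) + g t * cnj (q t))"
    by (rule wderiv_mult(1)[OF S q locint_cnj[OF q] g wderiv_cnj[OF g]])
  from has_integral_linear[OF wderivD(2)[OF this xy] bounded_linear_Re]
  show ?thesis unfolding cmod_power2 by (simp add: o_def power2_eq_square algebra_simps)
qed

lemma young_Re: assumes "\<kappa> > 0" shows "2 * \<bar>Re (b * cnj g)\<bar> \<le> (cmod b)\<^sup>2 / \<kappa> + \<kappa> * (cmod g)\<^sup>2"
proof -
  have "\<bar>Re (b * cnj g)\<bar> \<le> cmod b * cmod g" using abs_Re_le_cmod[of "b * cnj g"] by (simp add: norm_mult)
  moreover have "0 \<le> (cmod b / sqrt \<kappa> - sqrt \<kappa> * cmod g)\<^sup>2" by simp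
  moreover have "(cmod b / sqrt \<kappa> - sqrt \<kappa> * cmod g)\<^sup>2 = (cmod b)\<^sup>2 / \<kappa> + \<kappa> * (cmod g)\<^sup>2 - 2 * (cmod b * cmod g)"
    using assms by (simp add: power2_diff power_divide power_mult_distrib)
  ultimately show ?thesis by linarith
qed

text \<open>The damping -k g contributes -2 Re k to the growth rate of the squared norm of g;
  Young's inequality spends half of it on the source b. The bound is uniform in X.\<close>

lemma stable_energy:
  assumes S: "edge_ivl S" and \<kappa>: "Re k > 0" and b: "L2 S b" and g: "continuous_on S g"
    and d: "wderiv S g (\<lambda>x. b x - k * g x)" and X: "X \<in> S"
  shows "Re k * integral {0..X} (\<lambda>t. (cmod (g t))\<^sup>2) \<le> (cmod (g 0))\<^sup>2 + (nrm2 S b)\<^sup>2 / Re k"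
proof -
  note SF = edge_ivl_facts[OF S]
  have X0: "0 \<le> X" using SF(3)[OF X] .
  have lg: "locint S g"
  proof -
    have "locint S (\<lambda>x. g x * 1)" by (rule locint_mult_continuous[OF S g]) (simp add: locint_def)
    then show ?thesis by simp
  qed
  have li: "locint S (\<lambda>x. b x - k * g x)"
    using locint_add[OF L2_locint[OF S b] locint_mult_continuous[OF S continuous_on_const[of S "-k"] lg]] by simp
  note ns = wderiv_norm_sq[OF S li d SF(2) X X0]
  have gi: "(\<lambda>t. (cmod (g t))\<^sup>2) integrable_on {0..X}"
    using continuous_on_subset[OF g SF(4)[OF SF(2) X]] by (intro integrable_continuous_real continuous_intros)
  note bi = integral_norm_sq_le[OF S b SF(2) X]
  have "(cmod (g X))\<^sup>2 - (cmod (g 0))\<^sup>2 \<le> integral {0..X} (\<lambda>t. (cmod (b t))\<^sup>2 / Re k - Re k * (cmod (g t))\<^sup>2)"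
  proof (rule has_integral_le[OF ns integrable_integral])
    show "(\<lambda>t. (cmod (b t))\<^sup>2 / Re k - Re k * (cmod (g t))\<^sup>2) integrable_on {0..X}"
      using bi(1) gi by (intro integrable_diff integrable_on_divide integrable_on_mult_right)
    fix t assume "t \<in> {0..X}"
    have "Re ((b t - k * g t) * cnj (g t)) = Re (b t * cnj (g t)) - Re k * (cmod (g t))\<^sup>2"
      unfolding cmod_power2 by (simp add: algebra_simps power2_eq_square)
    then show "2 * Re ((b t - k * g t) * cnj (g t)) \<le> (cmod (b t))\<^sup>2 / Re k - Re k * (cmod (g t))\<^sup>2"
      using young_Re[OF \<kappa>, of "b t" "g t"] by linarith
  qed
  also have "\<dots> = integral {0..X} (\<lambda>t. (cmod (b t))\<^sup>2) / Re k - Re k * integral {0..X} (\<lambda>t. (cmod (g t))\<^sup>2)"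
    using bi(1) gi by (subst integral_diff) (auto intro: integrable_on_divide integrable_on_mult_right)
  also have "\<dots> \<le> (nrm2 S b)\<^sup>2 / Re k - Re k * integral {0..X} (\<lambda>t. (cmod (g t))\<^sup>2)"
    using bi(2) \<kappa> by (simp add: divide_right_mono)
  finally show ?thesis using zero_le_power2[of "cmod (g X)"] by linarith
qed

lemma stable_L2:
  assumes S: "edge_ivl S" and \<kappa>: "Re k > 0" and b: "L2 S b" and g: "continuous_on S g"
    and d: "wderiv S g (\<lambda>x. b x - k * g x)"
  shows "L2 S g"
proof (rule L2_of_bounded_integrals[OF S g])
  fix X assume "X \<in> S"
  from stable_energy[OF S \<kappa> b g d this]
  show "integral {0..X} (\<lambda>t. (cmod (g t))\<^sup>2) \<le> ((cmod (g 0))\<^sup>2 + (nrm2 S b)\<^sup>2 / Re k) / Re k"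
    using \<kappa> by (simp add: field_simps)
qed

text \<open>Here the solution grows to the right, so the estimate runs backwards: the value at X
  controls everything to its left.\<close>

lemma unstable_energy:
  assumes S: "edge_ivl S" and \<kappa>: "Re k > 0" and h: "L2 S h" and b: "continuous_on S b"
    and d: "wderiv S b (\<lambda>x. k * b x - h x)" and xX: "x \<in> S" "X \<in> S" "x \<le> X"
  shows "(cmod (b x))\<^sup>2 + Re k * integral {x..X} (\<lambda>t. (cmod (b t))\<^sup>2) \<le> (cmod (b X))\<^sup>2 + (nrm2 S h)\<^sup>2 / Re k"
proof -
  note SF = edge_ivl_facts[OF S]
  have lb: "locint S b"
  proof -
    have "locint S (\<lambda>x. b x * 1)" by (rule locint_mult_continuous[OF S b]) (simp add: locint_def)
    then show ?thesis by simp
  qed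
  have li: "locint S (\<lambda>x. k * b x - h x)"
    using locint_add[OF locint_mult_continuous[OF S continuous_on_const[of S k] lb] L2_locint[OF S L2_scl[OF h, of "-1"]]] by simp
  note ns = wderiv_norm_sq[OF S li d xX]
  have gi: "(\<lambda>t. (cmod (b t))\<^sup>2) integrable_on {x..X}"
    using continuous_on_subset[OF b SF(4)[OF xX(1,2)]] by (intro integrable_continuous_real continuous_intros)
  note hi = integral_norm_sq_le[OF S h xX(1,2)]
  have "integral {x..X} (\<lambda>t. Re k * (cmod (b t))\<^sup>2 - (cmod (h t))\<^sup>2 / Re k) \<le> (cmod (b X))\<^sup>2 - (cmod (b x))\<^sup>2"
  proof (rule has_integral_le[OF integrable_integral ns])
    show "(\<lambda>t. Re k * (cmod (b t))\<^sup>2 - (cmod (h t))\<^sup>2 / Re k) integrable_on {x..X}"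
      using hi(1) gi by (intro integrable_diff integrable_on_divide integrable_on_mult_right)
    fix t assume "t \<in> {x..X}"
    have "Re ((k * b t - h t) * cnj (b t)) = Re k * (cmod (b t))\<^sup>2 - Re (h t * cnj (b t))"
      unfolding cmod_power2 by (simp add: algebra_simps power2_eq_square)
    then show "Re k * (cmod (b t))\<^sup>2 - (cmod (h t))\<^sup>2 / Re k \<le> 2 * Re ((k * b t - h t) * cnj (b t))"
      using young_Re[OF \<kappa>, of "h t" "b t"] by linarith
  qed
  moreover have "integral {x..X} (\<lambda>t. Re k * (cmod (b t))\<^sup>2 - (cmod (h t))\<^sup>2 / Re k) =
      Re k * integral {x..X} (\<lambda>t. (cmod (b t))\<^sup>2) - integral {x..X} (\<lambda>t. (cmod (h t))\<^sup>2) / Re k"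
    using hi(1) gi by (subst integral_diff) (auto intro: integrable_on_divide integrable_on_mult_right)
  moreover have "integral {x..X} (\<lambda>t. (cmod (h t))\<^sup>2) / Re k \<le> (nrm2 S h)\<^sup>2 / Re k"
    using hi(2) \<kappa> by (simp add: divide_right_mono)
  ultimately show ?thesis by linarith
qed

lemma wderiv_of_derivative:
  assumes "\<And>x. (f has_vector_derivative f' x) (at x)"
  shows "wderiv S f f'"
  unfolding wderiv_def
  by (auto intro!: fundamental_theorem_of_calculus has_vector_derivative_at_within[OF assms])

lemma wderiv_exp: "wderiv S (\<lambda>x. exp (c * of_real x)) (\<lambda>x. c * exp (c * of_real x))"
proof (rule wderiv_of_derivative)
  fix x :: real
  show "((\<lambda>x. exp (c * of_real x)) has_vector_derivative c * exp (c * of_real x)) (at x)"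
  proof -
    have "((\<lambda>x. c * of_real x) has_vector_derivative c * 1) (at x)"
      using has_vector_derivative_of_real[OF DERIV_ident, of "at x"] by (intro has_vector_derivative_mult_right) simp
    from field_vector_diff_chain_at[OF this DERIV_exp]
    show ?thesis by (simp add: o_def)
  qed
qed

lemma locint_continuous: assumes "edge_ivl S" "continuous_on S f" shows "locint S f"
  using locint_mult_continuous[OF assms, of "\<lambda>_. 1"] by (simp add: locint_def)

lemma wderiv_indefinite:
  assumes S: "edge_ivl S" and c: "locint S c"
  shows "wderiv S (\<lambda>x. integral {0..x} c) c"
proof (rule wderivI[OF c])
  fix x y assume xy: "x \<in> S" "y \<in> S" "x \<le> y"
  have "c integrable_on {0..y}" using c edge_ivl_facts(2)[OF S] xy by (auto simp: locint_def absolutely_integrable_on_def)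
  then show "integral {0..y} c - integral {0..x} c = integral {x..y} c"
    using Henstock_Kurzweil_Integration.integral_combine[of 0 x y c] edge_ivl_facts(3)[OF S xy(1)] xy(3)
    by (simp add: algebra_simps)
qed

lemma exp_decay_L2: assumes S: "edge_ivl S" and \<kappa>: "Re k > 0" shows "L2 S (\<lambda>x. exp (- k * of_real x))"
proof (rule stable_L2[OF S \<kappa>, where b="\<lambda>_. 0"])
  show "L2 S (\<lambda>_. 0)" by (simp add: L2_def)
  show "continuous_on S (\<lambda>x. exp (- k * of_real x))" by (intro continuous_intros)
  show "wderiv S (\<lambda>x. exp (- k * of_real x)) (\<lambda>x. 0 - k * exp (- k * of_real x))"
    using wderiv_exp[of S "-k"] by simp
qed

text \<open>Variation of constants leaves one free constant, and a wrong choice leaves an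
  exponentially growing part. The right one is the integral of \<open>c\<close> up to the far end of
  S, finite or infinite.\<close>

lemma solve_unstable:
  assumes S: "edge_ivl S" and \<kappa>: "Re k > 0" and h: "L2 S h"
  obtains b where "continuous_on S b" "wderiv S b (\<lambda>x. k * b x - h x)" "L2 S b"
proof -
  note SF = edge_ivl_facts[OF S]
  define c where "c = (\<lambda>y. exp (- k * of_real y) * h y)"
  have cl: "locint S c" unfolding c_def
    by (intro locint_mult_continuous[OF S] L2_locint[OF S h] continuous_intros)
  define C where "C = (\<lambda>x. integral {0..x} c)"
  have dC: "wderiv S C c" unfolding C_def by (rule wderiv_indefinite[OF S cl])
  have le: "locint S (\<lambda>x. k * exp (k * of_real x))" by (intro locint_continuous[OF S] continuous_intros)
  define B where "B = (\<lambda>I x. exp (k * of_real x) * (I - C x))"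
  have cB: "continuous_on S (B I)" for I
    unfolding B_def using wderiv_continuous[OF S cl dC] by (intro continuous_intros)
  have dB: "wderiv S (B I) (\<lambda>x. k * B I x - h x)" for I
  proof -
    have d1: "wderiv S (\<lambda>x. I - C x) (\<lambda>x. 0 - c x)" by (intro wderiv_diff wderiv_const dC)
    have l1: "locint S (\<lambda>x. 0 - c x)"
      using locint_mult_continuous[OF S continuous_on_const[of S "-1"] cl] by simp
    have "wderiv S (\<lambda>x. exp (k * of_real x) * (I - C x)) (\<lambda>x. k * exp (k * of_real x) * (I - C x) + exp (k * of_real x) * (0 - c x))"
      by (rule wderiv_mult(1)[OF S le l1 wderiv_exp d1])
    then show ?thesis
    proof (rule wderiv_cong[OF S])
      fix x
      have "exp (k * of_real x) * exp (- k * of_real x) = 1" by (simp add: exp_add[symmetric])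
      then have "exp (k * of_real x) * c x = h x" by (simp add: c_def mult.assoc[symmetric])
      then show "k * B I x - h x = k * exp (k * of_real x) * (I - C x) + exp (k * of_real x) * (0 - c x)"
        by (simp add: B_def algebra_simps)
    qed (simp add: B_def)
  qed
  \<comment> \<open>With the constant \<open>C X\<close> the solution vanishes at X, so the backward
    estimate gives a bound that does not depend on X and survives the limit X to infinity.\<close>
  have BX: "(cmod (B (C X) x))\<^sup>2 \<le> (nrm2 S h)\<^sup>2 / Re k" if "x \<in> S" "X \<in> S" "x \<le> X" for x X
  proof -
    have "0 \<le> Re k * integral {x..X} (\<lambda>t. (cmod (B (C X) t))\<^sup>2)"
      using \<kappa> continuous_on_subset[OF cB SF(4)[OF that(1,2)]]
      by (intro mult_nonneg_nonneg integral_nonneg integrable_continuous_real continuous_intros) auto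
    moreover have "B (C X) X = 0" by (simp add: B_def)
    ultimately show ?thesis using unstable_energy[OF S \<kappa> h cB dB that, of "C X"] by simp
  qed
  show ?thesis
  proof (cases "S = {0..}")
    case False
    then obtain l where l: "S = {0..l}" "l > 0" using S by (auto simp: edge_ivl_def)
    define b where "b = B (C l)"
    have "L2 S b"
    proof (rule L2_of_bounded_integrals[OF S])
      show "continuous_on S b" unfolding b_def by (rule cB)
      fix X assume X: "X \<in> S"
      have "integral {0..X} (\<lambda>t. (cmod (b t))\<^sup>2) \<le> integral {0..l} (\<lambda>t. (cmod (b t))\<^sup>2)"
        using X l continuous_on_subset[OF cB[of "C l"]] unfolding b_def
        by (intro integral_subset_le integrable_continuous_real continuous_intros) auto
      then show "integral {0..X} (\<lambda>t. (cmod (b t))\<^sup>2) \<le> integral {0..l} (\<lambda>t. (cmod (b t))\<^sup>2)" .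
    qed
    then show ?thesis using that[of b] cB dB by (simp add: b_def)
  next
    case True
    have "integrable (lebesgue_on {0..}) c"
      using L2_integrable_mult[OF exp_decay_L2[OF S \<kappa>] h] True by (simp add: c_def)
    from integral_Icc_tendsto[OF this]
    have CI: "(\<lambda>n. C (real n)) \<longlonglongrightarrow> (LINT x|lebesgue_on {0..}. c x)" by (simp add: C_def)
    define b where "b = B (LINT x|lebesgue_on {0..}. c x)"
    have bb: "(cmod (b x))\<^sup>2 \<le> (nrm2 S h)\<^sup>2 / Re k" if x: "x \<in> S" for x
    proof (rule LIMSEQ_le_const2)
      show "(\<lambda>n. (cmod (B (C (real n)) x))\<^sup>2) \<longlonglongrightarrow> (cmod (b x))\<^sup>2"
        unfolding b_def B_def by (intro tendsto_intros CI)
      obtain N :: nat where "x \<le> real N" using real_arch_simple by blast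
      then show "\<exists>N. \<forall>n\<ge>N. (cmod (B (C (real n)) x))\<^sup>2 \<le> (nrm2 S h)\<^sup>2 / Re k"
        using BX[OF x] True by (intro exI[of _ N]) auto
    qed
    have "L2 S b"
    proof (rule L2_of_bounded_integrals[OF S])
      show "continuous_on S b" unfolding b_def by (rule cB)
      fix X assume X: "X \<in> S"
      have "(cmod (b 0))\<^sup>2 + Re k * integral {0..X} (\<lambda>t. (cmod (b t))\<^sup>2) \<le> (cmod (b X))\<^sup>2 + (nrm2 S h)\<^sup>2 / Re k"
        unfolding b_def by (rule unstable_energy[OF S \<kappa> h cB dB SF(2) X SF(3)[OF X]])
      then have "Re k * integral {0..X} (\<lambda>t. (cmod (b t))\<^sup>2) \<le> (nrm2 S h)\<^sup>2 / Re k + (nrm2 S h)\<^sup>2 / Re k"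
        using bb[OF X] zero_le_power2[of "cmod (b 0)"] by linarith
      then show "integral {0..X} (\<lambda>t. (cmod (b t))\<^sup>2) \<le> ((nrm2 S h)\<^sup>2 / Re k + (nrm2 S h)\<^sup>2 / Re k) / Re k"
        using \<kappa> by (simp add: pos_le_divide_eq mult.commute)
    qed
    then show ?thesis using that[of b] cB dB by (simp add: b_def)
  qed
qed

text \<open>\<open>k\<^sup>2 - \<partial>\<^sup>2 = (k - \<partial>)(k + \<partial>)\<close>: first the unstable factor is solved by integrating from the far end,
  then the stable one by integrating from \<open>0\<close>.\<close>
lemma solve_resolvent_edge:
  assumes S: "edge_ivl S" and \<kappa>: "Re k > 0" and h: "L2 S h"
  obtains g q where "L2 S g" "L2 S q" "wderiv S g q" "wderiv S q (\<lambda>x. k\<^sup>2 * g x - h x)"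
proof -
  obtain b where b: "continuous_on S b" "wderiv S b (\<lambda>x. k * b x - h x)" "L2 S b"
    using solve_unstable[OF S \<kappa> h] by blast
  define c where "c = (\<lambda>y. exp (k * of_real y) * b y)"
  have cc: "continuous_on S c" unfolding c_def using b(1) by (intro continuous_intros)
  define C where "C = (\<lambda>x. integral {0..x} c)"
  have dC: "wderiv S C c" unfolding C_def by (rule wderiv_indefinite[OF S locint_continuous[OF S cc]])
  have cC: "continuous_on S C" by (rule wderiv_continuous[OF S locint_continuous[OF S cc] dC])
  define g where "g = (\<lambda>x. exp (- k * of_real x) * C x)"
  have cg: "continuous_on S g" unfolding g_def using cC by (intro continuous_intros)
  have dg: "wderiv S g (\<lambda>x. b x - k * g x)"
  proof -
    have le: "locint S (\<lambda>x. (- k) * exp ((- k) * of_real x))" by (intro locint_continuous[OF S] continuous_intros)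
    have "wderiv S (\<lambda>x. exp ((- k) * of_real x) * C x) (\<lambda>x. (- k) * exp ((- k) * of_real x) * C x + exp ((- k) * of_real x) * c x)"
      by (rule wderiv_mult(1)[OF S le locint_continuous[OF S cc] wderiv_exp dC])
    then show ?thesis
    proof (rule wderiv_cong[OF S])
      fix x
      have "exp (- k * of_real x) * exp (k * of_real x) = 1" by (simp add: exp_add[symmetric])
      then have "exp (- k * of_real x) * c x = b x" by (simp add: c_def mult.assoc[symmetric])
      then show "b x - k * g x = (- k) * exp ((- k) * of_real x) * C x + exp ((- k) * of_real x) * c x"
        by (simp add: g_def algebra_simps)
    qed (simp add: g_def)
  qed
  have g2: "L2 S g" by (rule stable_L2[OF S \<kappa> b(3) cg dg])
  have q2: "L2 S (\<lambda>x. b x - k * g x)" by (intro L2_diff L2_scl b g2)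
  have "wderiv S (\<lambda>x. b x - k * g x) (\<lambda>x. (k * b x - h x) - k * (b x - k * g x))"
    by (intro wderiv_diff wderiv_scl b dg)
  then have "wderiv S (\<lambda>x. b x - k * g x) (\<lambda>x. k\<^sup>2 * g x - h x)"
    by (rule wderiv_cong[OF S]) (simp_all add: power2_eq_square algebra_simps)
  then show ?thesis using that[OF g2 q2 dg] by blast
qed

section \<open>The truncated nonlinearity\<close>

text \<open>The derivative is bounded up to \<rho> = sqrt (3 R), where p \<ge> 1 tames the power at
  0, and the function vanishes beyond, since there a squared over R is at least 3.\<close>

lemma profile_lipschitz:
  fixes \<zeta> :: "real \<Rightarrow> real"
  assumes p: "p \<ge> 1" and R: "R > 0" and d: "\<And>s. DERIV \<zeta> s :> \<zeta>' s" and c: "continuous_on UNIV \<zeta>'"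
    and z: "\<And>s. s \<ge> 3 \<Longrightarrow> \<zeta> s = 0"
  obtains L where "L \<ge> 0" "\<And>a b. 0 \<le> a \<Longrightarrow> 0 \<le> b \<Longrightarrow>
     \<bar>a powr p * \<zeta> (a\<^sup>2 / R) - b powr p * \<zeta> (b\<^sup>2 / R)\<bar> \<le> L * \<bar>a - b\<bar>"
    "\<And>a. 0 \<le> a \<Longrightarrow> \<bar>a powr p * \<zeta> (a\<^sup>2 / R)\<bar> \<le> L"
proof -
  define m where "m = (\<lambda>a. a powr p * \<zeta> (a\<^sup>2 / R))"
  define \<rho> where "\<rho> = sqrt (3 * R)"
  have \<rho>: "\<rho> > 0" "\<rho>\<^sup>2 = 3 * R" using R by (auto simp: \<rho>_def)
  have c\<zeta>: "continuous_on A \<zeta>" for A using d DERIV_isCont continuous_at_imp_continuous_on by blast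
  obtain B where B: "B > 0" "\<And>s. s \<in> {0..3} \<Longrightarrow> \<bar>\<zeta> s\<bar> \<le> B"
    using compact_imp_bounded[OF compact_continuous_image[OF c\<zeta>[of "{0..3}"] compact_Icc]] unfolding bounded_pos by auto
  obtain B' where B': "B' > 0" "\<And>s. s \<in> {0..3} \<Longrightarrow> \<bar>\<zeta>' s\<bar> \<le> B'"
    using compact_imp_bounded[OF compact_continuous_image[OF continuous_on_subset[OF c] compact_Icc], of 0 3] unfolding bounded_pos by auto
  define L where "L = p * \<rho> powr (p - 1) * B + \<rho> powr p * (B' * (2 * \<rho> / R))"
  have L0: "L \<ge> 0" using p B B' \<rho> R by (auto simp: L_def)
  have zero: "m a = 0" if "a \<ge> \<rho>" for a
  proof -
    have "\<rho>\<^sup>2 \<le> a\<^sup>2" using that \<rho> by (intro power_mono) auto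
    then show ?thesis using \<rho> R z by (simp add: m_def field_simps)
  qed
  have m0: "m 0 = 0" by (simp add: m_def)
  have cm: "continuous_on {0..\<rho>} m" unfolding m_def
    using p R by (intro continuous_on_mult continuous_on_powr' continuous_on_compose2[OF c\<zeta>[of UNIV]]
        continuous_on_divide continuous_on_power continuous_on_id continuous_on_const) auto
  have dm: "DERIV m x :> p * x powr (p - 1) * \<zeta> (x\<^sup>2 / R) + x powr p * (\<zeta>' (x\<^sup>2 / R) * (2 * x / R))" if "x > 0" for x
  proof -
    have "DERIV (\<lambda>a. \<zeta> (a\<^sup>2 / R)) x :> \<zeta>' (x\<^sup>2 / R) * (2 * x / R)"
      by (rule DERIV_chain2[OF d]) (use R in \<open>auto intro!: derivative_eq_intros\<close>)
    then show ?thesis unfolding m_def using that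
      by (auto intro!: derivative_eq_intros simp: powr_diff)
  qed
  have lip0: "\<bar>m b - m a\<bar> \<le> L * (b - a)" if ab: "0 \<le> a" "a < b" "b \<le> \<rho>" for a b
  proof -
    have "\<exists>l x. a < x \<and> x < b \<and> DERIV m x :> l \<and> m b - m a = (b - a) * l"
    proof (rule MVT[OF ab(2)])
      show "continuous_on {a..b} m" using cm ab by (auto intro: continuous_on_subset)
      show "m differentiable (at x)" if "a < x" "x < b" for x
        using dm[of x] that ab real_differentiable_def by (meson le_less_trans)
    qed
    then obtain l x where x: "a < x" "x < b" "DERIV m x :> l" "m b - m a = (b - a) * l" by blast
    have x0: "0 < x" "x \<le> \<rho>" using x ab by auto
    have l: "l = p * x powr (p - 1) * \<zeta> (x\<^sup>2 / R) + x powr p * (\<zeta>' (x\<^sup>2 / R) * (2 * x / R))"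
      using DERIV_unique[OF x(3) dm[OF x0(1)]] .
    have "x\<^sup>2 \<le> \<rho>\<^sup>2" using x0 by (intro power_mono) auto
    then have s: "x\<^sup>2 / R \<in> {0..3}" using \<rho> R by (auto simp: field_simps)
    have "\<bar>l\<bar> \<le> \<bar>p * x powr (p - 1) * \<zeta> (x\<^sup>2 / R)\<bar> + \<bar>x powr p * (\<zeta>' (x\<^sup>2 / R) * (2 * x / R))\<bar>" unfolding l by (rule abs_triangle_ineq)
    also have "\<dots> = p * x powr (p - 1) * \<bar>\<zeta> (x\<^sup>2 / R)\<bar> + x powr p * (\<bar>\<zeta>' (x\<^sup>2 / R)\<bar> * (2 * x / R))"
      using p x0 R by (simp add: abs_mult)
    also have "\<dots> \<le> L" unfolding L_def
      using B(2)[OF s] B'(2)[OF s] p x0 R B(1) B'(1) by (intro add_mono mult_mono powr_mono2 divide_right_mono) auto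
    finally have "\<bar>l\<bar> \<le> L" .
    then show ?thesis using x(4) ab by (simp add: abs_mult mult.commute)
  qed
  have lip1: "\<bar>m b - m a\<bar> \<le> L * (b - a)" if ab: "0 \<le> a" "a \<le> b" for a b
  proof -
    consider "b \<le> \<rho>" "a < b" | "a = b" | "b > \<rho>" "a < \<rho>" | "a \<ge> \<rho>" "b > \<rho>" using ab by linarith
    then show ?thesis
    proof cases
      case 1 then show ?thesis using lip0 ab by blast
    next
      case 2 then show ?thesis by simp
    next
      case 3
      have "\<bar>m b - m a\<bar> = \<bar>m \<rho> - m a\<bar>" using zero[of b] zero[of \<rho>] 3 by simp
      also have "\<dots> \<le> L * (\<rho> - a)" using lip0 ab 3 by simp
      also have "\<dots> \<le> L * (b - a)" using 3 L0 by (intro mult_left_mono) auto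
      finally show ?thesis .
    next
      case 4 then show ?thesis using zero L0 ab by simp
    qed
  qed
  have lip: "\<bar>m a - m b\<bar> \<le> L * \<bar>a - b\<bar>" if "0 \<le> a" "0 \<le> b" for a b
    using lip1[of a b] lip1[of b a] that by (cases "a \<le> b") (auto simp: abs_minus_commute)
  have bd: "\<bar>m a\<bar> \<le> L * \<rho>" if "0 \<le> a" for a
  proof (cases "a \<ge> \<rho>")
    case False
    have "\<bar>m a\<bar> \<le> L * a" using lip1[of 0 a] that m0 by simp
    also have "\<dots> \<le> L * \<rho>" using False L0 by (intro mult_left_mono) auto
    finally show ?thesis .
  qed (use zero L0 \<rho> in simp)
  show ?thesis
  proof (rule that[of "max L (L * \<rho>)"])
    show "max L (L * \<rho>) \<ge> 0" using L0 by simp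
    fix a b :: real assume ab: "0 \<le> a" "0 \<le> b"
    have "L * \<bar>a - b\<bar> \<le> max L (L * \<rho>) * \<bar>a - b\<bar>" by (intro mult_right_mono) auto
    then show "\<bar>a powr p * \<zeta> (a\<^sup>2 / R) - b powr p * \<zeta> (b\<^sup>2 / R)\<bar> \<le> max L (L * \<rho>) * \<bar>a - b\<bar>"
      using lip[OF ab] by (simp add: m_def)
    show "\<bar>a powr p * \<zeta> (a\<^sup>2 / R)\<bar> \<le> max L (L * \<rho>)"
      using bd[OF ab(1)] by (simp add: m_def)
  qed
qed

text \<open>\<open>sgn\<close> jumps at 0, but the weight compensates: |w| (sgn z - sgn w) = (|w| -
  |z|) sgn z + (z - w).\<close>

lemma sgn_diff_bound: fixes z w :: complex shows "cmod w * cmod (sgn z - sgn w) \<le> 2 * cmod (z - w)"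
proof (cases "z = 0")
  case True
  then show ?thesis by (cases "w = 0") (auto simp: norm_sgn)
next
  case False
  have "cmod w * cmod (sgn z - sgn w) = cmod (of_real (cmod w) * (sgn z - sgn w))" by (simp add: norm_mult)
  also have "of_real (cmod w) * (sgn z - sgn w) = (of_real (cmod w) - of_real (cmod z)) * sgn z + (z - w)"
    using False by (simp add: sgn_eq algebra_simps)
  also have "cmod \<dots> \<le> cmod ((of_real (cmod w) - of_real (cmod z)) * sgn z) + cmod (z - w)" by (rule norm_triangle_ineq)
  also have "cmod ((of_real (cmod w) - of_real (cmod z)) * sgn z) = \<bar>cmod w - cmod z\<bar>"
    using False by (simp add: norm_mult norm_sgn of_real_diff[symmetric] del: of_real_diff)
  also have "\<dots> \<le> cmod (z - w)" using norm_triangle_ineq3[of w z] by (simp add: norm_minus_commute)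
  finally show ?thesis by simp
qed

text \<open>For a radial map z \<mapsto> \<phi>(|z|) z, put \<kappa>(a) = a \<phi>'(a). The real
  differential has \<alpha> = \<phi> + \<kappa>/2 and \<beta> = (\<kappa>/2) (sgn z) squared, taken
  at |z|. Both profiles are Lipschitz, and a Lipschitz differential gives the quadratic Taylor
  remainder.\<close>

lemma FR_differential:
  fixes \<theta> :: "real \<Rightarrow> real"
  assumes sm: "smooth_compact \<theta>" and z2: "\<forall>x\<ge>2. \<theta> x = 0" and \<sigma>: "\<sigma> \<ge> 1/2" and R: "R > 0"
  obtains \<alpha> \<beta> :: "complex \<Rightarrow> complex" and K :: real where "K \<ge> 0"
    "\<And>z w. cmod (\<alpha> w - \<alpha> z) \<le> K * cmod (w - z)" "\<And>z w. cmod (\<beta> w - \<beta> z) \<le> K * cmod (w - z)"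
    "\<And>z. cmod (\<alpha> z) \<le> K" "\<And>z. cmod (\<beta> z) \<le> K"
    "\<And>z w. cmod (FR \<sigma> R \<theta> w - FR \<sigma> R \<theta> z - (\<alpha> z * (w - z) + \<beta> z * cnj (w - z))) \<le> K * (cmod (w - z))\<^sup>2"
    "\<And>z w. cmod (FR \<sigma> R \<theta> w - FR \<sigma> R \<theta> z) \<le> K * cmod (w - z)"
proof -
  define p where "p = 2 * \<sigma>"
  have p: "p \<ge> 1" using \<sigma> by (simp add: p_def)
  define \<theta>1 where "\<theta>1 = deriv \<theta>"
  define \<theta>2 where "\<theta>2 = deriv \<theta>1"
  have D: "((deriv ^^ k) \<theta>) differentiable (at x)" for k x using sm by (simp add: smooth_compact_def)
  have d0: "DERIV \<theta> s :> \<theta>1 s" for s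
    using D[of 0 s] by (simp add: \<theta>1_def DERIV_deriv_iff_real_differentiable)
  have d1: "DERIV \<theta>1 s :> \<theta>2 s" for s
    using D[of 1 s] by (simp add: \<theta>1_def \<theta>2_def DERIV_deriv_iff_real_differentiable)
  have "\<theta>2 differentiable (at s)" for s using D[of 2 s] by (simp add: \<theta>1_def \<theta>2_def numeral_2_eq_2)
  then have c2: "continuous_on UNIV \<theta>2" by (meson differentiable_imp_continuous_within continuous_at_imp_continuous_on)
  have c1: "continuous_on UNIV \<theta>1" using d1 DERIV_isCont continuous_at_imp_continuous_on by blast
  \<comment> \<open>The derivative is read off on the open half-line beyond 2; the threshold 3 stays
    inside it.\<close>
  have z1: "\<theta>1 s = 0" if "s \<ge> 3" for s
  proof -
    have "DERIV (\<lambda>x. 0) s :> \<theta>1 s"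
      by (rule has_field_derivative_transform_within_open[OF d0, where S="{2<..}"]) (use that z2 in auto)
    then show ?thesis using DERIV_unique[OF _ DERIV_const] by blast
  qed
  \<comment> \<open>From a \<phi>'(a) = a powr p times (p \<theta>(s) + 2 s \<theta>'(s)) with s = a
    squared over R, so \<kappa> is again a profile of the kind treated by
    \<open>profile_lipschitz\<close>.\<close>
  define \<zeta> where "\<zeta> = (\<lambda>s. p * \<theta> s + 2 * s * \<theta>1 s)"
  define \<zeta>' where "\<zeta>' = (\<lambda>s. p * \<theta>1 s + (2 * \<theta>1 s + 2 * s * \<theta>2 s))"
  have d\<zeta>: "DERIV \<zeta> s :> \<zeta>' s" for s
    unfolding \<zeta>_def \<zeta>'_def by (auto intro!: derivative_eq_intros d0 d1)
  have c\<zeta>: "continuous_on UNIV \<zeta>'" unfolding \<zeta>'_def by (intro continuous_intros c1 c2)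
  have z\<zeta>: "\<zeta> s = 0" if "s \<ge> 3" for s using z1[OF that] z2 that by (simp add: \<zeta>_def)
  define \<phi> where "\<phi> = (\<lambda>a. a powr p * \<theta> (a\<^sup>2 / R))"
  define \<kappa> where "\<kappa> = (\<lambda>a. a powr p * \<zeta> (a\<^sup>2 / R))"
  obtain L1 where L1: "L1 \<ge> 0" "\<And>a b. 0 \<le> a \<Longrightarrow> 0 \<le> b \<Longrightarrow> \<bar>\<phi> a - \<phi> b\<bar> \<le> L1 * \<bar>a - b\<bar>" "\<And>a. 0 \<le> a \<Longrightarrow> \<bar>\<phi> a\<bar> \<le> L1"
    unfolding \<phi>_def by (rule profile_lipschitz[OF p R d0 c1]) (use z2 in auto)
  obtain L2 where L2: "L2 \<ge> 0" "\<And>a b. 0 \<le> a \<Longrightarrow> 0 \<le> b \<Longrightarrow> \<bar>\<kappa> a - \<kappa> b\<bar> \<le> L2 * \<bar>a - b\<bar>" "\<And>a. 0 \<le> a \<Longrightarrow> \<bar>\<kappa> a\<bar> \<le> L2"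
    unfolding \<kappa>_def by (rule profile_lipschitz[OF p R d\<zeta> c\<zeta>]) (use z\<zeta> in auto)
  have 0: "\<phi> 0 = 0" "\<kappa> 0 = 0" by (auto simp: \<phi>_def \<kappa>_def)
  define L where "L = max L1 L2"
  have L: "L \<ge> 0" using L1 by (simp add: L_def)
  have lip\<phi>: "\<bar>\<phi> (cmod w) - \<phi> (cmod z)\<bar> \<le> L * cmod (w - z)" for z w
  proof -
    have "\<bar>\<phi> (cmod w) - \<phi> (cmod z)\<bar> \<le> L1 * \<bar>cmod w - cmod z\<bar>" by (intro L1) auto
    also have "\<dots> \<le> L * cmod (w - z)" using norm_triangle_ineq3[of w z] L1(1) by (intro mult_mono) (auto simp: L_def)
    finally show ?thesis .
  qed
  have lip\<kappa>: "\<bar>\<kappa> (cmod w) - \<kappa> (cmod z)\<bar> \<le> L * cmod (w - z)" for z w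
  proof -
    have "\<bar>\<kappa> (cmod w) - \<kappa> (cmod z)\<bar> \<le> L2 * \<bar>cmod w - cmod z\<bar>" by (intro L2) auto
    also have "\<dots> \<le> L * cmod (w - z)" using norm_triangle_ineq3[of w z] L2(1) by (intro mult_mono) (auto simp: L_def)
    finally show ?thesis .
  qed
  have b\<phi>: "\<bar>\<phi> (cmod z)\<bar> \<le> L" for z using L1(3)[of "cmod z"] by (simp add: L_def)
  have b\<kappa>: "\<bar>\<kappa> (cmod z)\<bar> \<le> L" for z using L2(3)[of "cmod z"] by (simp add: L_def)
  define \<alpha> where "\<alpha> = (\<lambda>z. complex_of_real (\<phi> (cmod z) + \<kappa> (cmod z) / 2))"
  define \<beta> where "\<beta> = (\<lambda>z. complex_of_real (\<kappa> (cmod z) / 2) * (sgn z)\<^sup>2)"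
  define K0 where "K0 = 3 * L"
  have lip\<alpha>: "cmod (\<alpha> w - \<alpha> z) \<le> K0 * cmod (w - z)" for z w
  proof -
    have "cmod (\<alpha> w - \<alpha> z) = \<bar>(\<phi> (cmod w) + \<kappa> (cmod w) / 2) - (\<phi> (cmod z) + \<kappa> (cmod z) / 2)\<bar>"
      unfolding \<alpha>_def of_real_diff[symmetric] norm_of_real ..
    also have "\<dots> \<le> \<bar>\<phi> (cmod w) - \<phi> (cmod z)\<bar> + \<bar>\<kappa> (cmod w) - \<kappa> (cmod z)\<bar>" by linarith
    also have "\<dots> \<le> L * cmod (w - z) + L * cmod (w - z)" by (intro add_mono lip\<phi> lip\<kappa>)
    also have "\<dots> \<le> K0 * cmod (w - z)" using L by (simp add: K0_def algebra_simps)
    finally show ?thesis .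
  qed
  have sg: "cmod (sgn z) \<le> 1" for z :: complex by (simp add: norm_sgn)
  have lip\<beta>: "cmod (\<beta> w - \<beta> z) \<le> K0 * cmod (w - z)" for z w
  proof -
    have "\<beta> w - \<beta> z = of_real ((\<kappa> (cmod w) - \<kappa> (cmod z)) / 2) * (sgn w)\<^sup>2
        + of_real (\<kappa> (cmod z) / 2) * ((sgn w - sgn z) * (sgn w + sgn z))"
      unfolding \<beta>_def by (simp add: power2_eq_square field_simps)
    then have "cmod (\<beta> w - \<beta> z) \<le> cmod (of_real ((\<kappa> (cmod w) - \<kappa> (cmod z)) / 2) * (sgn w)\<^sup>2)
        + cmod (of_real (\<kappa> (cmod z) / 2) * ((sgn w - sgn z) * (sgn w + sgn z)))"
      using norm_triangle_ineq by metis
    also have "cmod (of_real ((\<kappa> (cmod w) - \<kappa> (cmod z)) / 2) * (sgn w)\<^sup>2) \<le> \<bar>(\<kappa> (cmod w) - \<kappa> (cmod z)) / 2\<bar> * 1"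
      unfolding norm_mult norm_of_real norm_power using sg[of w] by (intro mult_left_mono power_le_one) auto
    also have "\<dots> \<le> \<bar>\<kappa> (cmod w) - \<kappa> (cmod z)\<bar>" by simp
    also have "\<dots> \<le> L * cmod (w - z)" by (rule lip\<kappa>)
    also have "cmod (of_real (\<kappa> (cmod z) / 2) * ((sgn w - sgn z) * (sgn w + sgn z))) \<le> \<bar>\<kappa> (cmod z) / 2\<bar> * (cmod (sgn w - sgn z) * 2)"
      unfolding norm_mult norm_of_real
      using norm_triangle_ineq[of "sgn w" "sgn z"] sg[of w] sg[of z] by (intro mult_left_mono) auto
    also have "\<dots> = \<bar>\<kappa> (cmod z)\<bar> * cmod (sgn w - sgn z)" by simp
    \<comment> \<open>\<kappa> vanishes at 0, so its Lipschitz bound supplies the factor |z| that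
      makes up for the jump of \<open>sgn\<close>.\<close>
    also have "\<dots> \<le> (L * cmod z) * cmod (sgn w - sgn z)"
      using lip\<kappa>[of z 0] 0 by (intro mult_right_mono) auto
    also have "\<dots> = L * (cmod z * cmod (sgn w - sgn z))" by simp
    also have "\<dots> \<le> L * (2 * cmod (w - z))" using L sgn_diff_bound[of z w] by (intro mult_left_mono) auto
    finally show ?thesis by (simp add: K0_def)
  qed
  have b\<alpha>: "cmod (\<alpha> z) \<le> K0" for z
    using b\<phi>[of z] b\<kappa>[of z] L unfolding \<alpha>_def norm_of_real K0_def by linarith
  have b\<beta>: "cmod (\<beta> z) \<le> K0" for z
  proof -
    have "cmod (\<beta> z) \<le> \<bar>\<kappa> (cmod z) / 2\<bar> * 1"
      unfolding \<beta>_def norm_mult norm_of_real norm_power using sg[of z] by (intro mult_left_mono power_le_one) auto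
    then show ?thesis using b\<kappa>[of z] L unfolding K0_def by linarith
  qed
  have F: "FR \<sigma> R \<theta> z = of_real (\<phi> (cmod z)) * z" for z by (simp add: FR_def \<phi>_def p_def)
  have hd: "(FR \<sigma> R \<theta> has_derivative (\<lambda>h. \<alpha> z * h + \<beta> z * cnj h)) (at z)" for z
  proof (cases "z = 0")
    case True
    \<comment> \<open>At the origin \<open>FR\<close> is of second order, because \<phi> itself is
      at most L |y|.\<close>
    have "((\<lambda>y. L * cmod y) \<longlongrightarrow> L * cmod 0) (at 0)" by (intro tendsto_intros)
    then have t0: "((\<lambda>y. L * cmod y) \<longlongrightarrow> 0) (at 0)" by simp
    have "norm (norm (FR \<sigma> R \<theta> y) / norm y) \<le> L * cmod y" for y
    proof -
      have "\<bar>\<phi> (cmod y)\<bar> \<le> L * cmod y" using lip\<phi>[of y 0] 0 by simp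
      then show ?thesis unfolding F by (cases "y = 0") (auto simp: norm_mult L)
    qed
    then have "((\<lambda>y. norm (FR \<sigma> R \<theta> y) / norm y) \<longlongrightarrow> 0) (at 0)"
      by (intro Lim_null_comparison[OF _ t0] always_eventually) auto
    then have "(FR \<sigma> R \<theta> has_derivative (\<lambda>h. 0)) (at 0)"
      unfolding has_derivative_iff_norm by (simp add: F)
    then show ?thesis using True 0 by (simp add: \<alpha>_def \<beta>_def)
  next
    case False
    define \<rho> where "\<rho> = cmod z"
    have \<rho>: "\<rho> > 0" using False by (simp add: \<rho>_def)
    have d\<phi>: "DERIV \<phi> \<rho> :> \<kappa> \<rho> / \<rho>"
    proof -
      have "DERIV (\<lambda>a. \<theta> (a\<^sup>2 / R)) \<rho> :> \<theta>1 (\<rho>\<^sup>2 / R) * (2 * \<rho> / R)"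
        by (rule DERIV_chain2[OF d0]) (use R in \<open>auto intro!: derivative_eq_intros\<close>)
      then have "DERIV \<phi> \<rho> :> p * \<rho> powr (p - 1) * \<theta> (\<rho>\<^sup>2 / R) + \<rho> powr p * (\<theta>1 (\<rho>\<^sup>2 / R) * (2 * \<rho> / R))"
        unfolding \<phi>_def using \<rho> by (auto intro!: derivative_eq_intros simp: powr_diff)
      also have "p * \<rho> powr (p - 1) * \<theta> (\<rho>\<^sup>2 / R) + \<rho> powr p * (\<theta>1 (\<rho>\<^sup>2 / R) * (2 * \<rho> / R)) = \<kappa> \<rho> / \<rho>"
        using \<rho> by (simp add: \<kappa>_def \<zeta>_def powr_diff field_simps power2_eq_square)
      finally show ?thesis .
    qed
    have dn: "(norm has_derivative (\<lambda>h. sgn z \<bullet> h)) (at z)" using has_derivative_norm[OF False] by (simp add: inner_commute)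
    have "((\<lambda>w. \<phi> (cmod w)) has_derivative (\<lambda>h. (\<kappa> \<rho> / \<rho>) * (sgn z \<bullet> h))) (at z)"
      using has_derivative_compose[OF dn d\<phi>[unfolded has_field_derivative_def, unfolded \<rho>_def]] by (simp only: \<rho>_def)
    then have "((\<lambda>w. of_real (\<phi> (cmod w)) * w) has_derivative
        (\<lambda>h. of_real (\<phi> (cmod z)) * h + of_real ((\<kappa> \<rho> / \<rho>) * (sgn z \<bullet> h)) * z)) (at z)"
      by (intro has_derivative_mult[OF has_derivative_of_real has_derivative_ident, THEN has_derivative_eq_rhs])
        auto
    moreover have "of_real (\<phi> (cmod z)) * h + of_real ((\<kappa> \<rho> / \<rho>) * (sgn z \<bullet> h)) * z = \<alpha> z * h + \<beta> z * cnj h" for h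
    proof -
      have z: "z = of_real \<rho> * sgn z" using \<rho> by (simp add: \<rho>_def sgn_eq)
      have n1: "sgn z * cnj (sgn z) = 1"
        using complex_norm_square[of "sgn z"] False by (simp add: norm_sgn)
      have in': "complex_of_real (sgn z \<bullet> h) = (cnj (sgn z) * h + sgn z * cnj h) / 2"
        by (simp add: complex_eq_iff inner_complex_def mult_ac)
      have "of_real ((\<kappa> \<rho> / \<rho>) * (sgn z \<bullet> h)) * z = of_real (\<kappa> \<rho>) * (of_real (sgn z \<bullet> h) * sgn z)"
        using \<rho> by (subst (2) z) simp
      also have "of_real (sgn z \<bullet> h) * sgn z = (h + (sgn z)\<^sup>2 * cnj h) / 2"
        unfolding in' using n1 by (simp add: power2_eq_square field_simps)
      finally show ?thesis unfolding \<alpha>_def \<beta>_def \<rho>_def[symmetric] by (simp add: field_simps)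
    qed
    ultimately show ?thesis by (simp add: F[abs_def])
  qed
  have Tay: "cmod (FR \<sigma> R \<theta> w - FR \<sigma> R \<theta> z - (\<alpha> z * (w - z) + \<beta> z * cnj (w - z))) \<le> 2 * K0 * (cmod (w - z))\<^sup>2" for z w
  proof -
    have "norm (FR \<sigma> R \<theta> w - FR \<sigma> R \<theta> z - (\<alpha> z * (w - z) + \<beta> z * cnj (w - z))) \<le> norm (w - z) * (2 * K0 * cmod (w - z))"
    proof (rule differentiable_bound_linearization[where S="closed_segment z w" and f'="\<lambda>x h. \<alpha> x * h + \<beta> x * cnj h"])
      show "z + t *\<^sub>R (w - z) \<in> closed_segment z w" if "t \<in> {0..1}" for t
        using that by (auto simp: in_segment algebra_simps intro!: exI[of _ t])
      show "(FR \<sigma> R \<theta> has_derivative (\<lambda>h. \<alpha> x * h + \<beta> x * cnj h)) (at x within closed_segment z w)" for x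
        using hd has_derivative_at_withinI by blast
      fix x assume x: "x \<in> closed_segment z w"
      have xz: "cmod (x - z) \<le> cmod (w - z)" using segment_bound1[OF x] by (simp add: norm_minus_commute)
      show "onorm ((\<lambda>h. \<alpha> x * h + \<beta> x * cnj h) - (\<lambda>h. \<alpha> z * h + \<beta> z * cnj h)) \<le> 2 * K0 * cmod (w - z)"
      proof (rule onorm_le)
        fix h
        have "norm (((\<lambda>h. \<alpha> x * h + \<beta> x * cnj h) - (\<lambda>h. \<alpha> z * h + \<beta> z * cnj h)) h) = cmod ((\<alpha> x - \<alpha> z) * h + (\<beta> x - \<beta> z) * cnj h)"
          by (simp add: algebra_simps)
        also have "\<dots> \<le> cmod (\<alpha> x - \<alpha> z) * cmod h + cmod (\<beta> x - \<beta> z) * cmod h"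
          using norm_triangle_ineq[of "(\<alpha> x - \<alpha> z) * h" "(\<beta> x - \<beta> z) * cnj h"] by (simp add: norm_mult)
        also have "\<dots> \<le> (K0 * cmod (w - z)) * cmod h + (K0 * cmod (w - z)) * cmod h"
          using order_trans[OF lip\<alpha> mult_left_mono[OF xz]] order_trans[OF lip\<beta> mult_left_mono[OF xz]] L
          by (intro add_mono mult_right_mono) (auto simp: K0_def)
        finally show "norm (((\<lambda>h. \<alpha> x * h + \<beta> x * cnj h) - (\<lambda>h. \<alpha> z * h + \<beta> z * cnj h)) h) \<le> 2 * K0 * cmod (w - z) * norm h"
          by (simp add: algebra_simps)
      qed
    qed auto
    then show ?thesis by (simp add: power2_eq_square mult_ac)
  qed
  have Lip: "cmod (FR \<sigma> R \<theta> w - FR \<sigma> R \<theta> z) \<le> 2 * K0 * cmod (w - z)" for z w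
  proof (rule differentiable_bound[where S=UNIV and f'="\<lambda>x h. \<alpha> x * h + \<beta> x * cnj h"])
    show "(FR \<sigma> R \<theta> has_derivative (\<lambda>h. \<alpha> x * h + \<beta> x * cnj h)) (at x within UNIV)" for x using hd by simp
    show "onorm (\<lambda>h. \<alpha> x * h + \<beta> x * cnj h) \<le> 2 * K0" for x
    proof (rule onorm_le)
      fix h
      have "cmod (\<alpha> x * h + \<beta> x * cnj h) \<le> cmod (\<alpha> x) * cmod h + cmod (\<beta> x) * cmod h"
        using norm_triangle_ineq[of "\<alpha> x * h" "\<beta> x * cnj h"] by (simp add: norm_mult)
      also have "\<dots> \<le> K0 * cmod h + K0 * cmod h" by (intro add_mono mult_right_mono b\<alpha> b\<beta>) auto
      finally show "cmod (\<alpha> x * h + \<beta> x * cnj h) \<le> 2 * K0 * cmod h" by simp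
    qed
  qed auto
  have K0: "0 \<le> K0" using L by (simp add: K0_def)
  have up: "y \<le> 2 * K0 * x" if "y \<le> K0 * x" "0 \<le> x" for x y
    using that K0 mult_nonneg_nonneg[OF K0 that(2)] by linarith
  show ?thesis
  proof (rule that[of "2 * K0" \<alpha> \<beta>])
    show "0 \<le> 2 * K0" using K0 by simp
    show "cmod (\<alpha> w - \<alpha> z) \<le> 2 * K0 * cmod (w - z)" "cmod (\<beta> w - \<beta> z) \<le> 2 * K0 * cmod (w - z)" for z w
      by (auto intro!: up lip\<alpha> lip\<beta>)
    show "cmod (\<alpha> z) \<le> 2 * K0" "cmod (\<beta> z) \<le> 2 * K0" for z using b\<alpha>[of z] b\<beta>[of z] K0 by auto
  qed (rule Tay, rule Lip)
qed

section \<open>Vertex matrices\<close>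

lemma mapp_add: "mapp E A (\<lambda>i. x i + y i) i = mapp E A x i + mapp E A y i"
  by (simp add: mapp_def sum.distrib distrib_left)

lemma mapp_scl: "mapp E A (\<lambda>i. c * x i) i = c * mapp E A x i"
  by (simp add: mapp_def sum_distrib_left mult_ac)

lemma mapp_diff: "mapp E A (\<lambda>i. x i - y i) i = mapp E A x i - mapp E A y i"
  by (simp add: mapp_def sum_subtractf right_diff_distrib)

lemma mapp_cong: "(\<And>j. j \<in> E \<Longrightarrow> x j = y j) \<Longrightarrow> mapp E A x i = mapp E A y i"
  by (simp add: mapp_def)

lemma mapp_mmul: assumes "finite E" shows "mapp E A (mapp E B x) i = mapp E (mmul E A B) x i"
proof -
  have "mapp E A (mapp E B x) i = (\<Sum>j\<in>E. \<Sum>k\<in>E. A i j * B j k * x k)"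
    by (simp add: mapp_def sum_distrib_left mult.assoc)
  also have "\<dots> = (\<Sum>k\<in>E. \<Sum>j\<in>E. A i j * B j k * x k)" by (rule sum.swap)
  finally show ?thesis by (simp add: mapp_def mmul_def sum_distrib_right)
qed

lemma mapp_0: "(\<And>j. j \<in> E \<Longrightarrow> A i j = 0) \<Longrightarrow> mapp E A x i = 0"
  by (simp add: mapp_def)

lemma mapp_PRm: assumes "finite E" "i \<in> E"
  shows "mapp E (PRm P Q) x i = x i - mapp E P x i - mapp E Q x i"
proof -
  have "(\<Sum>j\<in>E. (if i = j then 1 else 0) * x j) = (\<Sum>j\<in>E. if i = j then x j else 0)" by (intro sum.cong) auto
  also have "\<dots> = x i" using assms by simp
  finally show ?thesis by (simp add: mapp_def PRm_def left_diff_distrib sum_subtractf)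
qed

lemma herm_adjoint: assumes "finite E" "herm_on E A"
  shows "(\<Sum>i\<in>E. mapp E A x i * cnj (y i)) = (\<Sum>i\<in>E. x i * cnj (mapp E A y i))"
proof -
  have "(\<Sum>i\<in>E. mapp E A x i * cnj (y i)) = (\<Sum>i\<in>E. \<Sum>j\<in>E. A i j * x j * cnj (y i))"
    by (simp add: mapp_def sum_distrib_right)
  also have "\<dots> = (\<Sum>j\<in>E. \<Sum>i\<in>E. A i j * x j * cnj (y i))" by (rule sum.swap)
  also have "\<dots> = (\<Sum>j\<in>E. \<Sum>i\<in>E. x j * cnj (A j i * y i))"
  proof (intro sum.cong refl)
    fix i j assume "i \<in> E" "j \<in> E"
    then have "A i j = cnj (A j i)" using assms(2) unfolding herm_on_def by blast
    then show "A i j * x j * cnj (y i) = x j * cnj (A j i * y i)" by (simp only: complex_cnj_mult mult_ac)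
  qed
  finally show ?thesis by (simp add: mapp_def sum_distrib_left)
qed

locale vertex_matrices =
  fixes E :: "('e \<times> bool) set" and P Q L :: "'e \<times> bool \<Rightarrow> 'e \<times> bool \<Rightarrow> complex"
  assumes fin: "finite E"
    and P: "orth_proj_on E P" and Q: "orth_proj_on E Q"
    and PQ: "\<And>i j. i \<in> E \<Longrightarrow> j \<in> E \<Longrightarrow> mmul E P Q i j = 0"
    and L: "herm_on E L"
    and LPR: "\<And>i j. i \<in> E \<Longrightarrow> j \<in> E \<Longrightarrow> mmul E (PRm P Q) (mmul E L (PRm P Q)) i j = L i j"
begin

lemma PP: "i \<in> E \<Longrightarrow> mapp E P (mapp E P x) i = mapp E P x i"
  unfolding mapp_mmul[OF fin] using P by (simp add: orth_proj_on_def mapp_def)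

lemma QQ: "i \<in> E \<Longrightarrow> mapp E Q (mapp E Q x) i = mapp E Q x i"
  unfolding mapp_mmul[OF fin] using Q by (simp add: orth_proj_on_def mapp_def)

lemma PQ0: "i \<in> E \<Longrightarrow> mapp E P (mapp E Q x) i = 0"
  using PQ fin by (simp add: mapp_mmul mapp_0)

text \<open>Both matrices are Hermitian, so this is the adjoint of \<open>PQ0\<close>.\<close>

lemma QP0: assumes "i \<in> E" shows "mapp E Q (mapp E P x) i = 0"
proof -
  have h: "herm_on E P" "herm_on E Q" using P Q by (auto simp: orth_proj_on_def)
  have "mmul E Q P i j = 0" if j: "j \<in> E" for j
  proof -
    have "mmul E Q P i j = (\<Sum>k\<in>E. cnj (P j k * Q k i))" unfolding mmul_def
    proof (intro sum.cong refl)
      fix k assume k: "k \<in> E"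
      have "Q i k = cnj (Q k i)" "P k j = cnj (P j k)" using h k assms j unfolding herm_on_def by blast+
      then show "Q i k * P k j = cnj (P j k * Q k i)" by (simp only: complex_cnj_mult mult_ac)
    qed
    also have "\<dots> = cnj (mmul E P Q j i)" by (simp add: mmul_def)
    finally show ?thesis using PQ[OF j assms] by simp
  qed
  then show ?thesis using fin by (simp add: mapp_mmul mapp_0)
qed

lemma mapp_PR: "i \<in> E \<Longrightarrow> mapp E (PRm P Q) x i = x i - mapp E P x i - mapp E Q x i"
  using fin by (rule mapp_PRm)

lemma P_PR: assumes "i \<in> E" shows "mapp E P (mapp E (PRm P Q) x) i = 0"
proof -
  have "mapp E P (mapp E (PRm P Q) x) i = mapp E P (\<lambda>i. x i - mapp E P x i - mapp E Q x i) i"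
    by (intro mapp_cong mapp_PR)
  then show ?thesis using PP[OF assms] PQ0[OF assms] by (simp add: mapp_diff)
qed

lemma Q_PR: assumes "i \<in> E" shows "mapp E Q (mapp E (PRm P Q) x) i = 0"
proof -
  have "mapp E Q (mapp E (PRm P Q) x) i = mapp E Q (\<lambda>i. x i - mapp E P x i - mapp E Q x i) i"
    by (intro mapp_cong mapp_PR)
  then show ?thesis using QQ[OF assms] QP0[OF assms] by (simp add: mapp_diff)
qed

lemma L_eq: assumes "i \<in> E" shows "mapp E L x i = mapp E (PRm P Q) (mapp E L (mapp E (PRm P Q) x)) i"
proof -
  have "mapp E (PRm P Q) (mapp E L (mapp E (PRm P Q) x)) i = mapp E (PRm P Q) (mapp E (mmul E L (PRm P Q)) x) i"
    using fin by (intro mapp_cong) (simp add: mapp_mmul)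
  also have "\<dots> = mapp E (mmul E (PRm P Q) (mmul E L (PRm P Q))) x i" using fin by (simp add: mapp_mmul)
  also have "\<dots> = mapp E L x i" using LPR assms by (simp add: mapp_def)
  finally show ?thesis by simp
qed

lemma P_L: assumes "i \<in> E" shows "mapp E P (mapp E L x) i = 0"
  using mapp_cong[of E "mapp E L x" "mapp E (PRm P Q) (mapp E L (mapp E (PRm P Q) x))", OF L_eq] P_PR[OF assms] by metis

lemma Q_L: assumes "i \<in> E" shows "mapp E Q (mapp E L x) i = 0"
  using mapp_cong[of E "mapp E L x" "mapp E (PRm P Q) (mapp E L (mapp E (PRm P Q) x))", OF L_eq] Q_PR[OF assms] by metis

text \<open>The three vertex conditions are the components of a single equation in the ranges of the
  mutually orthogonal projections.\<close>
lemma conditions_from_sum: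
  assumes eq: "\<And>i. i \<in> E \<Longrightarrow> mapp E P x i + mapp E Q y i + mapp E (PRm P Q) y i - mapp E L (mapp E (PRm P Q) x) i = 0"
    and i: "i \<in> E"
  shows "mapp E P x i = 0" "mapp E Q y i = 0" "mapp E (PRm P Q) y i = mapp E L (mapp E (PRm P Q) x) i"
proof -
  let ?s = "\<lambda>i. mapp E P x i + mapp E Q y i + mapp E (PRm P Q) y i - mapp E L (mapp E (PRm P Q) x) i"
  have z: "mapp E A ?s i = 0" for A
  proof -
    have "mapp E A ?s i = mapp E A (\<lambda>_. 0) i" by (rule mapp_cong) (rule eq)
    then show ?thesis by (simp add: mapp_def)
  qed
  have *: "mapp E A ?s i = mapp E A (mapp E P x) i + mapp E A (mapp E Q y) i + mapp E A (mapp E (PRm P Q) y) i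
      - mapp E A (mapp E L (mapp E (PRm P Q) x)) i" for A by (simp add: mapp_add mapp_diff)
  show 1: "mapp E P x i = 0" using z[of P] unfolding * using i by (simp add: PP PQ0 P_PR P_L)
  show 2: "mapp E Q y i = 0" using z[of Q] unfolding * using i by (simp add: QQ QP0 Q_PR Q_L)
  show "mapp E (PRm P Q) y i = mapp E L (mapp E (PRm P Q) x) i" using eq[OF i] 1 2 by simp
qed

text \<open>The boundary term of Green's formula at one vertex. The first condition kills the P
  component of x, the second that of y in the range of Q, so only the third component of the pairing
  survives and there y is given by L.\<close>

lemma boundary_form:
  assumes x: "\<And>i. i \<in> E \<Longrightarrow> mapp E P x i = 0" and y: "\<And>i. i \<in> E \<Longrightarrow> mapp E Q y i = 0"
    and yz: "\<And>i. i \<in> E \<Longrightarrow> mapp E (PRm P Q) y i = mapp E L (mapp E (PRm P Q) z) i"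
  shows "(\<Sum>i\<in>E. x i * cnj (y i)) = (\<Sum>i\<in>E. mapp E L (mapp E (PRm P Q) x) i * cnj (mapp E (PRm P Q) z i))"
proof -
  let ?R = "mapp E (PRm P Q)"
  have h: "herm_on E P" "herm_on E Q" using P Q by (auto simp: orth_proj_on_def)
  have "(\<Sum>i\<in>E. x i * cnj (y i)) = (\<Sum>i\<in>E. ?R x i * cnj (y i)) + (\<Sum>i\<in>E. mapp E Q x i * cnj (y i))"
    unfolding sum.distrib[symmetric] using x by (intro sum.cong refl) (simp add: mapp_PR algebra_simps)
  also have "(\<Sum>i\<in>E. mapp E Q x i * cnj (y i)) = 0" unfolding herm_adjoint[OF fin h(2)] using y by simp
  also have "(\<Sum>i\<in>E. ?R x i * cnj (y i)) = (\<Sum>i\<in>E. ?R x i * cnj (?R y i)) + (\<Sum>i\<in>E. ?R x i * cnj (mapp E P y i))"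
    unfolding sum.distrib[symmetric] using y by (intro sum.cong refl) (simp add: mapp_PR algebra_simps)
  also have "(\<Sum>i\<in>E. ?R x i * cnj (mapp E P y i)) = 0" unfolding herm_adjoint[OF fin h(1), symmetric] using P_PR by simp
  also have "(\<Sum>i\<in>E. ?R x i * cnj (?R y i)) = (\<Sum>i\<in>E. ?R x i * cnj (mapp E L (?R z) i))" using yz by simp
  also have "\<dots> = (\<Sum>i\<in>E. mapp E L (?R x) i * cnj (?R z i))" by (rule herm_adjoint[OF fin L, symmetric])
  finally show ?thesis by simp
qed

end

section \<open>First and second derivatives\<close>

lemma H1_d1: assumes "H1 S f" shows "L2 S f" "L2 S (d1 S f)" "wderiv S f (d1 S f)"
  using assms someI_ex[of "\<lambda>g. L2 S g \<and> wderiv S f g"] by (auto simp: H1_def d1_def)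

lemma H1I: "L2 S f \<Longrightarrow> L2 S p \<Longrightarrow> wderiv S f p \<Longrightarrow> H1 S f" by (auto simp: H1_def)

lemma d1_eqv: assumes "edge_ivl S" "L2 S f" "L2 S p" "wderiv S f p"
  shows "nrm2 S (d1 S f - p) = 0"
  using wderiv_unique[OF assms(1) H1_d1(2,3)[OF H1I[OF assms(2-4)]] assms(3,4)] .

text \<open>\<open>dd\<close> and \<open>d2\<close> are \<open>SOME\<close> choices. They agree with
  explicitly given derivatives q and r, pointwise for q by continuity and up to a null function for
  r, so later computations can use q and r.\<close>

lemma H2_dd: assumes S: "edge_ivl S" and f: "L2 S f" and q: "L2 S q" "wderiv S f q" and r: "L2 S r" "wderiv S q r"
  shows "H2 S f" "L2 S (dd S f)" "wderiv S f (dd S f)" "\<And>x. x \<in> S \<Longrightarrow> dd S f x = q x"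
    "L2 S (d2 S f)" "wderiv S (dd S f) (d2 S f)" "nrm2 S (d2 S f - r) = 0"
proof -
  show "H2 S f" using assms by (auto simp: H2_def)
  have "\<exists>g. L2 S g \<and> wderiv S f g \<and> (\<exists>h. L2 S h \<and> wderiv S g h)" using assms by blast
  from someI_ex[OF this] have dd: "L2 S (dd S f)" "wderiv S f (dd S f)" "\<exists>h. L2 S h \<and> wderiv S (dd S f) h"
    unfolding dd_def[symmetric] by auto
  show "L2 S (dd S f)" "wderiv S f (dd S f)" by (fact dd)+
  from someI_ex[OF dd(3)] show d2: "L2 S (d2 S f)" "wderiv S (dd S f) (d2 S f)" unfolding d2_def by auto
  show eq: "dd S f x = q x" if "x \<in> S" for x
    by (rule wderiv_unique_continuous[OF S _ dd(2) _ q(2) that])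
      (use wderiv_continuous[OF S L2_locint[OF S d2(1)] d2(2)] wderiv_continuous[OF S L2_locint[OF S r(1)] r(2)] in auto)
  have "wderiv S (dd S f) r" by (rule wderiv_cong[OF S r(2)]) (use eq in auto)
  then show "nrm2 S (d2 S f - r) = 0" by (rule wderiv_unique[OF S d2 r(1)])
qed

lemma H2_spec: assumes S: "edge_ivl S" and f: "H2 S f"
  shows "H1 S f" "L2 S f" "L2 S (dd S f)" "wderiv S f (dd S f)" "L2 S (d2 S f)" "wderiv S (dd S f) (d2 S f)"
    "nrm2 S (d1 S f - dd S f) = 0"
proof -
  obtain q r where qr: "L2 S q" "wderiv S f q" "L2 S r" "wderiv S q r" and f2: "L2 S f" using f by (auto simp: H2_def)
  note dd = H2_dd[OF S f2 qr]
  show "H1 S f" using f2 qr by (intro H1I)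
  show "L2 S f" by (fact f2)
  show "L2 S (dd S f)" "wderiv S f (dd S f)" "L2 S (d2 S f)" "wderiv S (dd S f) (d2 S f)" by (fact dd)+
  show "nrm2 S (d1 S f - dd S f) = 0" by (rule d1_eqv[OF S f2 dd(2,3)])
qed

section \<open>The quantum graph\<close>

definition gscl :: "complex \<Rightarrow> ('e \<Rightarrow> real \<Rightarrow> complex) \<Rightarrow> 'e \<Rightarrow> real \<Rightarrow> complex" where
  "gscl c F = (\<lambda>e x. c * F e x)"

lemma gscl_apply: "gscl c F e = fscl c (F e)" by (simp add: gscl_def fscl_def)

lemma gdiff_minus: "gdiff F G = F - G" by (simp add: gdiff_def fun_eq_iff)

locale qg =
  fixes len :: "'e::finite \<Rightarrow> ereal" and vtx :: "'e \<times> bool \<Rightarrow> 'v"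
    and PD PN Lam :: "'v \<Rightarrow> 'e \<times> bool \<Rightarrow> 'e \<times> bool \<Rightarrow> complex" and Mc :: real
  assumes graph: "qgraph len vtx PD PN Lam" and Mc: "Mc > 0"
    and Mc_equiv: "\<exists>c C. 0 < c \<and> 0 < C \<and> (\<forall>F\<in>DE len vtx PD.
                     c * H1norm len F \<le> normE Mc len vtx PD PN Lam F \<and>
                     normE Mc len vtx PD PN Lam F \<le> C * H1norm len F)"
begin

abbreviation I :: "'e \<Rightarrow> real set" where "I e \<equiv> edge_int len e"
abbreviation ev :: "'v \<Rightarrow> ('e \<times> bool) set" where "ev v \<equiv> ends len vtx v"
abbreviation PR :: "'v \<Rightarrow> 'e \<times> bool \<Rightarrow> 'e \<times> bool \<Rightarrow> complex" where "PR v \<equiv> PRm (PD v) (PN v)"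
abbreviation W :: "('e \<Rightarrow> real \<Rightarrow> complex) set" where "W \<equiv> DE len vtx PD"

lemma len_pos: "0 < len e" using graph by (simp add: qgraph_def)

lemma I_inf: "len e = \<infinity> \<Longrightarrow> I e = {0..}" by (auto simp: edge_int_def)

lemma I_fin: assumes "len e \<noteq> \<infinity>"
  shows "I e = {0..real_of_ereal (len e)}" "0 < real_of_ereal (len e)"
proof -
  obtain l where l: "len e = ereal l" using assms len_pos[of e] by (cases "len e") auto
  then show "I e = {0..real_of_ereal (len e)}" "0 < real_of_ereal (len e)"
    using len_pos[of e] by (auto simp: edge_int_def)
qed

lemma edge: "edge_ivl (I e)"
  using I_inf[of e] I_fin[of e] unfolding edge_ivl_def by blast

lemma I_eq_inf_iff: "I e = {0..} \<longleftrightarrow> len e = \<infinity>"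
proof
  assume *: "I e = {0..}"
  show "len e = \<infinity>"
  proof (rule ccontr)
    assume "len e \<noteq> \<infinity>"
    note l = I_fin[OF this]
    have "real_of_ereal (len e) + 1 \<in> I e" using l(2) unfolding * by simp
    then have "real_of_ereal (len e) + 1 \<in> {0..real_of_ereal (len e)}" by (simp only: l(1))
    then show False by simp
  qed
qed (rule I_inf)

lemma endpt_in: "valid_end len p \<Longrightarrow> endpt len p \<in> I (fst p)"
  using I_fin[of "fst p"] edge_ivl_facts(2)[OF edge[of "fst p"]] by (auto simp: valid_end_def endpt_def)

lemma vm: "vertex_matrices (ev v) (PD v) (PN v) (Lam v)"
proof -
  have g: "orth_proj_on (ev v) (PD v) \<and> orth_proj_on (ev v) (PN v) \<and>
        (\<forall>i\<in>ev v. \<forall>j\<in>ev v. mmul (ev v) (PD v) (PN v) i j = 0) \<and> herm_on (ev v) (Lam v) \<and>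
        (\<forall>i\<in>ev v. \<forall>j\<in>ev v. mmul (ev v) (PR v) (mmul (ev v) (Lam v) (PR v)) i j = Lam v i j)"
    using graph unfolding qgraph_def Let_def by blast
  then show ?thesis by unfold_locales auto
qed

lemma sum_valid_ends:
  fixes h :: "'e \<times> bool \<Rightarrow> complex"
  shows "(\<Sum>p | valid_end len p. h p) = (\<Sum>e\<in>UNIV. h (e, False) + (if len e = \<infinity> then 0 else h (e, True)))"
proof -
  have "(\<Sum>p | valid_end len p. h p) = (\<Sum>p\<in>UNIV. if valid_end len p then h p else 0)"
    by (simp add: sum.If_cases)
  also have "\<dots> = (\<Sum>e\<in>UNIV. \<Sum>b\<in>UNIV. if valid_end len (e, b) then h (e, b) else 0)"
    unfolding sum.cartesian_product by simp
  also have "\<dots> = (\<Sum>e\<in>UNIV. h (e, False) + (if len e = \<infinity> then 0 else h (e, True)))"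
    by (intro sum.cong refl) (auto simp: UNIV_bool valid_end_def)
  finally show ?thesis .
qed

lemma sum_vertices:
  fixes h :: "'e \<times> bool \<Rightarrow> complex"
  shows "(\<Sum>v\<in>vertices len vtx. \<Sum>p\<in>ev v. h p) = (\<Sum>p | valid_end len p. h p)"
  unfolding vertices_def ends_def
  by (subst (2) sum.image_gen[where g=vtx]) (auto intro!: sum.cong)

section \<open>Square-integrable functions on the graph\<close>

lemma innerG_eq: "innerG len F G = (\<Sum>e\<in>UNIV. L2ip (I e) (F e) (G e))"
  by (simp add: innerG_def L2ip_def)

lemma L2G_D: "L2G len F \<Longrightarrow> L2 (I e) (F e)" by (simp add: L2G_def)

lemma vector_space_gscl: "vector_space (gscl :: complex \<Rightarrow> ('e \<Rightarrow> real \<Rightarrow> complex) \<Rightarrow> _)"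
  by unfold_locales (auto simp: gscl_def fun_eq_iff algebra_simps)

sublocale H: semi_inner gscl "Collect (L2G len)" "innerG len"
proof (intro semi_inner.intro vector_space_gscl)
  fix x y z :: "'e \<Rightarrow> real \<Rightarrow> complex" and c
  show "0 \<in> Collect (L2G len)" using L2.V_zero by (simp add: L2G_def)
  show "x \<in> Collect (L2G len) \<Longrightarrow> y \<in> Collect (L2G len) \<Longrightarrow> x + y \<in> Collect (L2G len)"
    using L2.V_add by (auto simp: L2G_def)
  show "x \<in> Collect (L2G len) \<Longrightarrow> gscl c x \<in> Collect (L2G len)"
    using L2.V_scl by (auto simp: L2G_def gscl_apply)
  show "x \<in> Collect (L2G len) \<Longrightarrow> y \<in> Collect (L2G len) \<Longrightarrow> z \<in> Collect (L2G len) \<Longrightarrow>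
      innerG len (x + y) z = innerG len x z + innerG len y z"
    using L2.ip_add by (simp add: innerG_eq L2G_def sum.distrib)
  show "x \<in> Collect (L2G len) \<Longrightarrow> z \<in> Collect (L2G len) \<Longrightarrow> innerG len (gscl c x) z = c * innerG len x z"
    using L2.ip_scl by (simp add: innerG_eq L2G_def gscl_apply sum_distrib_left)
  show "x \<in> Collect (L2G len) \<Longrightarrow> y \<in> Collect (L2G len) \<Longrightarrow> innerG len y x = cnj (innerG len x y)"
    unfolding innerG_eq cnj_sum by (intro sum.cong refl L2.ip_cnj) (auto simp: L2G_def)
  show "x \<in> Collect (L2G len) \<Longrightarrow> 0 \<le> Re (innerG len x x)"
    unfolding innerG_eq Re_sum by (intro sum_nonneg L2.ip_nonneg) (auto simp: L2G_def)
qed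

lemma Hnrm_power2: "(H.nrm F)\<^sup>2 = (\<Sum>e\<in>UNIV. (nrm2 (I e) (F e))\<^sup>2)"
proof -
  have "Re (innerG len F F) = (\<Sum>e\<in>UNIV. (nrm2 (I e) (F e))\<^sup>2)"
    unfolding innerG_eq Re_sum by (simp add: L2ip_self nrm2_power2)
  moreover have "0 \<le> (\<Sum>e\<in>UNIV. (nrm2 (I e) (F e))\<^sup>2)" by (intro sum_nonneg) auto
  ultimately show ?thesis by (simp add: H.nrm_def)
qed

lemma normG_eq: "normG len F = H.nrm F"
  unfolding normG_def H.nrm_def innerG_eq Re_sum by (simp add: L2ip_self)

lemma Hnrm_eq_0: "(\<And>e. nrm2 (I e) (F e) = 0) \<Longrightarrow> H.nrm F = 0"
  using Hnrm_power2[of F] by simp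

lemma nrm2_le_Hnrm: "nrm2 (I e) (F e) \<le> H.nrm F" if "L2G len F"
proof (rule power2_le_imp_le)
  show "(nrm2 (I e) (F e))\<^sup>2 \<le> (H.nrm F)\<^sup>2" unfolding Hnrm_power2 by (rule member_le_sum) auto
qed (use that in simp)

section \<open>The form domain and its derivatives\<close>

lemma W_H1: "F \<in> W \<Longrightarrow> H1 (I e) (F e)" by (simp add: DE_def H1G_def)
lemma W_L2: "F \<in> W \<Longrightarrow> L2G len F" using W_H1 H1_d1(1) by (auto simp: L2G_def)
lemma W_bc: "F \<in> W \<Longrightarrow> i \<in> ev v \<Longrightarrow> mapp (ev v) (PD v) (bval len F) i = 0" by (simp add: DE_def)

lemma H1_add: assumes "H1 S f" "H1 S g" shows "H1 S (f + g)"
  unfolding plus_fun_def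
  by (intro H1I[OF L2_add L2_add wderiv_add]) (rule H1_d1[OF assms(1)] H1_d1[OF assms(2)])+

lemma H1_scl: assumes "H1 S f" shows "H1 S (fscl c f)"
  unfolding fscl_def by (intro H1I[OF L2_scl L2_scl wderiv_scl]) (rule H1_d1[OF assms])+

lemma bval_add: "bval len (F + G) = (\<lambda>p. bval len F p + bval len G p)" by (simp add: bval_def fun_eq_iff)
lemma bval_scl: "bval len (gscl c F) = (\<lambda>p. c * bval len F p)" by (simp add: bval_def fun_eq_iff gscl_def)

lemma W_add: "F \<in> W \<Longrightarrow> G \<in> W \<Longrightarrow> F + G \<in> W"
  by (auto simp: DE_def H1G_def bval_add mapp_add intro: H1_add)

lemma W_scl: "F \<in> W \<Longrightarrow> gscl c F \<in> W"
  by (auto simp: DE_def H1G_def bval_scl mapp_scl gscl_apply intro: H1_scl)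

abbreviation dF :: "('e \<Rightarrow> real \<Rightarrow> complex) \<Rightarrow> 'e \<Rightarrow> real \<Rightarrow> complex" where
  "dF F e \<equiv> d1 (I e) (F e)"

lemma dF_L2: "F \<in> W \<Longrightarrow> L2 (I e) (dF F e)" "F \<in> W \<Longrightarrow> wderiv (I e) (F e) (dF F e)"
  using H1_d1[OF W_H1] by auto

lemma dF_eqv: assumes "F \<in> W" "L2 (I e) p" "wderiv (I e) (F e) p" shows "L2.eqv (I e) (dF F e) p"
  using d1_eqv[OF edge H1_d1(1)[OF W_H1[OF assms(1)]] assms(2,3)] dF_L2[OF assms(1)] assms(2) by (simp add: L2.eqv_def)

lemma dF_add: assumes F: "F \<in> W" and G: "G \<in> W" shows "L2.eqv (I e) (dF (F + G) e) (dF F e + dF G e)"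
proof (rule dF_eqv[OF W_add[OF F G]])
  show "L2 (I e) (dF F e + dF G e)" using dF_L2 F G L2_add by (auto simp: plus_fun_def)
  show "wderiv (I e) ((F + G) e) (dF F e + dF G e)" using dF_L2(2)[OF F] dF_L2(2)[OF G] wderiv_add unfolding plus_fun_def by blast
qed

lemma dF_scl: assumes F: "F \<in> W" shows "L2.eqv (I e) (dF (gscl c F) e) (fscl c (dF F e))"
proof (rule dF_eqv[OF W_scl[OF F]])
  show "L2 (I e) (fscl c (dF F e))" using dF_L2(1)[OF F] L2_scl unfolding fscl_def by blast
  show "wderiv (I e) (gscl c F e) (fscl c (dF F e))" using dF_L2(2)[OF F] wderiv_scl unfolding fscl_def gscl_apply by blast
qed

lemma dF_diff: assumes F: "F \<in> W" and G: "G \<in> W" and FG: "F - G \<in> W"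
  shows "L2.eqv (I e) (dF (F - G) e) (dF F e - dF G e)"
proof (rule dF_eqv[OF FG])
  show "L2 (I e) (dF F e - dF G e)" using dF_L2 F G L2_diff by (auto simp: fun_diff_def)
  show "wderiv (I e) ((F - G) e) (dF F e - dF G e)" using dF_L2(2)[OF F] dF_L2(2)[OF G] wderiv_diff unfolding fun_diff_def by blast
qed

section \<open>The energy form\<close>

definition bnd :: "('e \<Rightarrow> real \<Rightarrow> complex) \<Rightarrow> ('e \<Rightarrow> real \<Rightarrow> complex) \<Rightarrow> complex" where
  "bnd F G = (\<Sum>v\<in>vertices len vtx. \<Sum>i\<in>ev v.
     mapp (ev v) (Lam v) (mapp (ev v) (PR v) (bval len F)) i * cnj (mapp (ev v) (PR v) (bval len G) i))"

definition aG :: "('e \<Rightarrow> real \<Rightarrow> complex) \<Rightarrow> ('e \<Rightarrow> real \<Rightarrow> complex) \<Rightarrow> complex" where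
  "aG F G = of_real Mc * innerG len F G + (\<Sum>e\<in>UNIV. L2ip (I e) (dF F e) (dF G e)) + bnd F G"

lemma bnd_add: "bnd (F + G) K = bnd F K + bnd G K"
proof -
  have "mapp (ev v) (Lam v) (mapp (ev v) (PR v) (bval len (F + G))) i =
    mapp (ev v) (Lam v) (mapp (ev v) (PR v) (bval len F)) i + mapp (ev v) (Lam v) (mapp (ev v) (PR v) (bval len G)) i" for v i
    unfolding bval_add mapp_add[symmetric] by (rule mapp_cong) (simp add: mapp_add)
  then show ?thesis by (simp add: bnd_def distrib_right sum.distrib)
qed

lemma bnd_scl: "bnd (gscl c F) K = c * bnd F K"
proof -
  have "mapp (ev v) (Lam v) (mapp (ev v) (PR v) (bval len (gscl c F))) i =
    c * mapp (ev v) (Lam v) (mapp (ev v) (PR v) (bval len F)) i" for v i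
    unfolding bval_scl mapp_scl[symmetric] by (rule mapp_cong) (simp add: mapp_scl)
  then show ?thesis by (simp add: bnd_def sum_distrib_left mult.assoc)
qed

lemma bnd_cnj: "bnd G F = cnj (bnd F G)"
  unfolding bnd_def cnj_sum[of _ "vertices len vtx"]
proof (rule sum.cong[OF refl])
  fix v assume "v \<in> vertices len vtx"
  interpret vertex_matrices "ev v" "PD v" "PN v" "Lam v" by (rule vm)
  show "(\<Sum>i\<in>ev v. mapp (ev v) (Lam v) (mapp (ev v) (PR v) (bval len G)) i * cnj (mapp (ev v) (PR v) (bval len F) i))
      = cnj (\<Sum>i\<in>ev v. mapp (ev v) (Lam v) (mapp (ev v) (PR v) (bval len F)) i * cnj (mapp (ev v) (PR v) (bval len G) i))"
    by (subst herm_adjoint[OF fin L]) (simp add: mult.commute)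
qed

lemma Re_aG: "Re (aG F F) = Mc * (normG len F)\<^sup>2 + Eform len vtx PD PN Lam F"
proof -
  have "Re (\<Sum>e\<in>UNIV. L2ip (I e) (dF F e) (dF F e)) = (\<Sum>e\<in>UNIV. LINT x|lebesgue_on (I e). (cmod (dF F e x))\<^sup>2)"
    by (simp add: L2ip_self)
  moreover have "Re (innerG len F F) = (normG len F)\<^sup>2"
    unfolding normG_eq Hnrm_power2 innerG_eq Re_sum by (simp add: L2ip_self nrm2_power2)
  ultimately show ?thesis by (simp add: aG_def Eform_def Let_def bnd_def)
qed

lemma H1norm_nonneg: "0 \<le> H1norm len F"
  unfolding H1norm_def by (intro real_sqrt_ge_zero sum_nonneg add_nonneg_nonneg integral_nonneg) auto

sublocale E: semi_inner gscl W aG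
proof (intro semi_inner.intro vector_space_gscl)
  fix x y z :: "'e \<Rightarrow> real \<Rightarrow> complex" and c
  show "0 \<in> W"
  proof -
    have "H1 (I e) 0" for e using L2.V_zero[of "I e"] wderiv_const[of "I e" 0] by (intro H1I[where p=0]) (auto simp: zero_fun_def)
    then show ?thesis by (auto simp: DE_def H1G_def bval_def mapp_def)
  qed
  show "x \<in> W \<Longrightarrow> y \<in> W \<Longrightarrow> x + y \<in> W" by (rule W_add)
  show "x \<in> W \<Longrightarrow> gscl c x \<in> W" by (rule W_scl)
  show "aG (x + y) z = aG x z + aG y z" if "x \<in> W" "y \<in> W" "z \<in> W"
  proof -
    have "L2ip (I e) (dF (x + y) e) (dF z e) = L2ip (I e) (dF x e) (dF z e) + L2ip (I e) (dF y e) (dF z e)" for e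
      using L2.eqv_ip(1)[OF dF_add[OF that(1,2)], of "dF z e" e] L2.ip_add[of "dF x e" "I e" "dF y e" "dF z e"] dF_L2 that by auto
    then show ?thesis using H.ip_add[of x y z] that W_L2 by (simp add: aG_def bnd_add sum.distrib algebra_simps)
  qed
  show "aG (gscl c x) z = c * aG x z" if "x \<in> W" "z \<in> W"
  proof -
    have "L2ip (I e) (dF (gscl c x) e) (dF z e) = c * L2ip (I e) (dF x e) (dF z e)" for e
      using L2.eqv_ip(1)[OF dF_scl[OF that(1)], of "dF z e" e c] L2.ip_scl[of "dF x e" "I e" "dF z e" c] dF_L2 that by auto
    then show ?thesis using H.ip_scl[of x z c] that W_L2
      by (simp add: aG_def bnd_scl distrib_left sum_distrib_left mult_ac)
  qed
  show "aG y x = cnj (aG x y)" if "x \<in> W" "y \<in> W"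
  proof -
    have "(\<Sum>e\<in>UNIV. L2ip (I e) (dF y e) (dF x e)) = cnj (\<Sum>e\<in>UNIV. L2ip (I e) (dF x e) (dF y e))"
      unfolding cnj_sum by (intro sum.cong refl L2.ip_cnj) (use dF_L2 that in auto)
    then show ?thesis using H.ip_cnj[of x y] that W_L2 bnd_cnj[of y x] by (simp add: aG_def)
  qed
  show "0 \<le> Re (aG x x)" if x: "x \<in> W"
  proof -
    \<comment> \<open>Nonnegativity of the form is contained in the norm equivalence:
      \<open>normE\<close> is bounded below by a nonnegative quantity, and \<open>sqrt\<close> of a
      negative number would be negative.\<close>
    obtain c where "c > 0" "c * H1norm len x \<le> normE Mc len vtx PD PN Lam x" using Mc_equiv x by blast
    then have "0 \<le> normE Mc len vtx PD PN Lam x"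
      using H1norm_nonneg[of x] by (meson less_imp_le mult_nonneg_nonneg order_trans)
    then show ?thesis by (simp add: normE_def Re_aG)
  qed
qed

lemma normE_eq: "normE Mc len vtx PD PN Lam F = E.nrm F"
  by (simp add: normE_def E.nrm_def Re_aG)

lemma H1norm_power2: "(H1norm len F)\<^sup>2 = (\<Sum>e\<in>UNIV. (nrm2 (I e) (F e))\<^sup>2 + (nrm2 (I e) (dF F e))\<^sup>2)"
  unfolding H1norm_def nrm2_power2
  by (intro real_sqrt_pow2 sum_nonneg add_nonneg_nonneg integral_nonneg) auto

lemma equiv: obtains c C where "c > 0" "C > 0" "\<And>F. F \<in> W \<Longrightarrow> c * H1norm len F \<le> E.nrm F"
  "\<And>F. F \<in> W \<Longrightarrow> E.nrm F \<le> C * H1norm len F"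
  using Mc_equiv unfolding normE_eq by blast

lemma nrm2_le_H1norm: assumes "F \<in> W"
  shows "nrm2 (I e) (F e) \<le> H1norm len F" "nrm2 (I e) (dF F e) \<le> H1norm len F"
proof -
  have "(nrm2 (I e) (F e))\<^sup>2 + (nrm2 (I e) (dF F e))\<^sup>2 \<le> (H1norm len F)\<^sup>2"
    unfolding H1norm_power2 by (rule member_le_sum) auto
  then have "(nrm2 (I e) (F e))\<^sup>2 \<le> (H1norm len F)\<^sup>2" "(nrm2 (I e) (dF F e))\<^sup>2 \<le> (H1norm len F)\<^sup>2"
    using zero_le_power2[of "nrm2 (I e) (F e)"] zero_le_power2[of "nrm2 (I e) (dF F e)"] by linarith+
  then show "nrm2 (I e) (F e) \<le> H1norm len F" "nrm2 (I e) (dF F e) \<le> H1norm len F"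
    by (auto intro: power2_le_imp_le H1norm_nonneg)
qed

lemma Hnrm_le_H1norm: "H.nrm F \<le> H1norm len F"
proof (rule power2_le_imp_le[OF _ H1norm_nonneg])
  show "(H.nrm F)\<^sup>2 \<le> (H1norm len F)\<^sup>2" unfolding Hnrm_power2 H1norm_power2 by (rule sum_mono) simp
qed

lemma H1norm_le_sum: assumes "F \<in> W"
  shows "H1norm len F \<le> (\<Sum>e\<in>UNIV. nrm2 (I e) (F e) + nrm2 (I e) (dF F e))"
proof (rule power2_le_imp_le)
  have nn: "0 \<le> nrm2 (I e) (F e)" "0 \<le> nrm2 (I e) (dF F e)" for e
    using W_L2[OF assms] dF_L2(1)[OF assms] by (auto simp: L2G_def)
  show "0 \<le> (\<Sum>e\<in>UNIV. nrm2 (I e) (F e) + nrm2 (I e) (dF F e))" using nn by (intro sum_nonneg) simp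
  have sq: "(\<Sum>e\<in>A. (g e)\<^sup>2) \<le> (\<Sum>e\<in>A. g e)\<^sup>2" if "\<And>e. 0 \<le> g e" for g :: "'e \<Rightarrow> real" and A
  proof -
    have "finite A" by simp
    then show ?thesis
    proof (induction A rule: finite_induct)
      case (insert x A)
      have "0 \<le> g x * (\<Sum>e\<in>A. g e)" using that by (intro mult_nonneg_nonneg sum_nonneg)
      then show ?case using insert by (simp add: power2_sum)
    qed simp
  qed
  have "(H1norm len F)\<^sup>2 \<le> (\<Sum>e\<in>UNIV. (nrm2 (I e) (F e) + nrm2 (I e) (dF F e))\<^sup>2)"
    unfolding H1norm_power2 using nn by (intro sum_mono) (simp add: power2_sum)
  also have "\<dots> \<le> (\<Sum>e\<in>UNIV. nrm2 (I e) (F e) + nrm2 (I e) (dF F e))\<^sup>2" using nn by (intro sq) simp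
  finally show "(H1norm len F)\<^sup>2 \<le> (\<Sum>e\<in>UNIV. nrm2 (I e) (F e) + nrm2 (I e) (dF F e))\<^sup>2" .
qed

section \<open>Green's formula on the graph\<close>

lemma DLap_H2: "G \<in> DLap len vtx PD PN Lam \<Longrightarrow> H2 (I e) (G e)" by (simp add: DLap_def H2G_def)

lemma DLap_W: "DLap len vtx PD PN Lam \<subseteq> W"
  using H2_spec(1)[OF edge] DLap_H2 by (auto simp: DLap_def DE_def H1G_def H2G_def Let_def)

lemma Lap_L2G: "G \<in> DLap len vtx PD PN Lam \<Longrightarrow> L2G len (Lap len G)"
  using H2_spec(5)[OF edge DLap_H2] by (auto simp: L2G_def Lap_def)

text \<open>Integrate by parts on each edge, regroup the end-point terms by vertex, and evaluate
  each vertex with \<open>boundary_form\<close>.\<close>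

lemma green:
  assumes F: "F \<in> W" and G: "G \<in> DLap len vtx PD PN Lam"
  shows "aG F G = innerG len F (gscl (of_real Mc) G - Lap len G)"
proof -
  have GW: "G \<in> W" using G DLap_W by blast
  define B where "B = (\<lambda>e. (if I e = {0..} then 0 else F e (Sup (I e)) * cnj (dd (I e) (G e) (Sup (I e)))) - F e 0 * cnj (dd (I e) (G e) 0))"
  have edge_green: "L2ip (I e) (dF F e) (dF G e) = - L2ip (I e) (F e) (Lap len G e) + B e" for e
  proof -
    note H = H2_spec[OF edge DLap_H2[OF G], of e]
    have "L2.eqv (I e) (dF G e) (dd (I e) (G e))" using H dF_L2(1)[OF GW] by (simp add: L2.eqv_def)
    then have "L2ip (I e) (dF F e) (dF G e) = L2ip (I e) (dF F e) (dd (I e) (G e))"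
      using dF_L2(1)[OF F] by (intro L2.eqv_ip(2)) auto
    moreover have "L2ip (I e) (dF F e) (dd (I e) (G e)) + L2ip (I e) (F e) (d2 (I e) (G e)) = B e"
      unfolding B_def by (rule L2ip_by_parts[OF edge L2G_D[OF W_L2[OF F]] dF_L2[OF F] H(3,5,6)])
    ultimately show ?thesis by (simp add: Lap_def algebra_simps)
  qed
  \<comment> \<open>\<open>dval\<close> is the derivative pointing into the edge, so both ends enter
    with the same sign.\<close>
  have Be: "B e = - (bval len F (e, False) * cnj (dval len G (e, False)) + (if len e = \<infinity> then 0 else bval len F (e, True) * cnj (dval len G (e, True))))" for e
  proof (cases "len e = \<infinity>")
    case True
    then show ?thesis by (simp add: B_def I_inf bval_def dval_def endpt_def)
  next
    case False
    then have "Sup (I e) = real_of_ereal (len e)" using I_fin[OF False] by simp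
    then show ?thesis using False I_eq_inf_iff[of e] by (simp add: B_def bval_def dval_def endpt_def)
  qed
  have "(\<Sum>e\<in>UNIV. B e) = - (\<Sum>p | valid_end len p. bval len F p * cnj (dval len G p))"
    by (simp only: sum_valid_ends Be sum_negf)
  also have "\<dots> = - (\<Sum>v\<in>vertices len vtx. \<Sum>p\<in>ev v. bval len F p * cnj (dval len G p))" unfolding sum_vertices ..
  also have "\<dots> = - bnd F G"
  proof -
    have "(\<Sum>p\<in>ev v. bval len F p * cnj (dval len G p)) = (\<Sum>i\<in>ev v.
     mapp (ev v) (Lam v) (mapp (ev v) (PR v) (bval len F)) i * cnj (mapp (ev v) (PR v) (bval len G) i))" for v
    proof -
      interpret vertex_matrices "ev v" "PD v" "PN v" "Lam v" by (rule vm)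
      show ?thesis
        by (rule boundary_form) (use W_bc[OF F] G in \<open>auto simp: DLap_def Let_def\<close>)
    qed
    then show ?thesis by (simp add: bnd_def)
  qed
  finally have "(\<Sum>e\<in>UNIV. L2ip (I e) (dF F e) (dF G e)) = - innerG len F (Lap len G) - bnd F G"
    unfolding edge_green sum.distrib by (simp add: sum_negf innerG_eq)
  moreover have "innerG len F (gscl (of_real Mc) G - Lap len G) = of_real Mc * innerG len F G - innerG len F (Lap len G)"
    using W_L2[OF F] W_L2[OF GW] Lap_L2G[OF G] by (simp add: H.ip_diff_right H.ip_scl_right H.V_scl[simplified])
  ultimately show ?thesis by (simp add: aG_def)
qed

section \<open>Pointwise values and weak convergence in the form domain\<close>

lemma pointwise_bound:
  obtains r0 where "r0 > 0" "\<And>F x r. F \<in> W \<Longrightarrow> x \<in> I e \<Longrightarrow> 0 < r \<Longrightarrow> r \<le> r0 \<Longrightarrow>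
     cmod (F e x) \<le> nrm2 (I e) (F e) / sqrt r + sqrt r * nrm2 (I e) (dF F e)"
proof -
  define r0 where "r0 = (if len e = \<infinity> then 1 else real_of_ereal (len e) / 2)"
  have "r0 > 0" using I_fin(2)[of e] by (simp add: r0_def)
  moreover have "cmod (F e x) \<le> nrm2 (I e) (F e) / sqrt r + sqrt r * nrm2 (I e) (dF F e)"
    if "F \<in> W" "x \<in> I e" "0 < r" "r \<le> r0" for F x r
  proof (rule H1_pointwise[OF edge L2G_D[OF W_L2] dF_L2])
    fix l assume l: "I e = {0..l}"
    have "len e \<noteq> \<infinity>"
    proof
      assume "len e = \<infinity>"
      then have "{0..} = {0..l}" using I_inf l by simp
      then have "\<bar>l\<bar> + 1 \<in> {0..l}" by (metis abs_ge_zero add_nonneg_nonneg atLeast_iff zero_le_one)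
      then show False by simp
    qed
    moreover from this have "l = real_of_ereal (len e)"
      using I_fin[of e] l by (metis Icc_eq_Icc less_le_not_le linorder_not_le)
    ultimately show "r \<le> l / 2" using that by (simp add: r0_def)
  qed (use that in auto)
  ultimately show ?thesis using that by blast
qed

lemma weak_pointwise:
  assumes v: "\<And>j::nat. v j \<in> W" "\<And>j. E.nrm (v j) \<le> B" and 0: "(\<lambda>j. H.nrm (v j)) \<longlonglongrightarrow> 0" and x: "x \<in> I e"
  shows "(\<lambda>j. v j e x) \<longlonglongrightarrow> 0"
proof (rule LIMSEQ_I)
  fix \<epsilon> :: real assume \<epsilon>: "\<epsilon> > 0"
  obtain c C where c: "c > 0" "\<And>F. F \<in> W \<Longrightarrow> c * H1norm len F \<le> E.nrm F" using equiv by metis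
  obtain r0 where r0: "r0 > 0" "\<And>F x r. F \<in> W \<Longrightarrow> x \<in> I e \<Longrightarrow> 0 < r \<Longrightarrow> r \<le> r0 \<Longrightarrow>
     cmod (F e x) \<le> nrm2 (I e) (F e) / sqrt r + sqrt r * nrm2 (I e) (dF F e)" using pointwise_bound by blast
  define B' where "B' = \<bar>B\<bar> / c + 1"
  have B': "B' > 0" using c(1) by (simp add: B'_def add_nonneg_pos)
  have d: "nrm2 (I e) (dF (v j) e) \<le> B'" for j
  proof -
    have "c * H1norm len (v j) \<le> \<bar>B\<bar>" using c(2)[OF v(1)[of j]] v(2)[of j] by linarith
    then have "H1norm len (v j) \<le> \<bar>B\<bar> / c" using c(1) by (simp add: field_simps)
    then show ?thesis using nrm2_le_H1norm(2)[OF v(1)[of j], of e] by (simp add: B'_def)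
  qed
  \<comment> \<open>First r is made so small that the derivative term is at most \<epsilon>/2,
    uniformly in j; only then is the L2 norm taken small relative to sqrt r.\<close>
  define r where "r = min r0 ((\<epsilon> / (2 * B'))\<^sup>2)"
  have r: "0 < r" "r \<le> r0" using r0(1) \<epsilon> B' by (auto simp: r_def)
  have "sqrt r \<le> sqrt ((\<epsilon> / (2 * B'))\<^sup>2)" by (intro real_sqrt_le_mono) (simp add: r_def)
  then have sr: "sqrt r \<le> \<epsilon> / (2 * B')" using \<epsilon> B' by simp
  have "\<epsilon> * sqrt r / 2 > 0" using \<epsilon> r by simp
  from LIMSEQ_D[OF 0 this] obtain N where N: "\<And>j. j \<ge> N \<Longrightarrow> H.nrm (v j) < \<epsilon> * sqrt r / 2"
    using v W_L2 by (auto simp: abs_less_iff)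
  have "norm (v j e x - 0) < \<epsilon>" if "j \<ge> N" for j
  proof -
    have "nrm2 (I e) (v j e) < \<epsilon> * sqrt r / 2" using nrm2_le_Hnrm[OF W_L2[OF v(1)], of e j] N[OF that] by linarith
    then have "nrm2 (I e) (v j e) / sqrt r < \<epsilon> / 2" using r by (simp add: field_simps)
    moreover have "sqrt r * nrm2 (I e) (dF (v j) e) \<le> (\<epsilon> / (2 * B')) * B'"
      using sr d[of j] \<epsilon> B' r L2.nrm_nonneg[of "dF (v j) e" "I e"] dF_L2(1)[OF v(1)] by (intro mult_mono) auto
    moreover have "(\<epsilon> / (2 * B')) * B' = \<epsilon> / 2" using B' by simp
    ultimately have "cmod (v j e x) < \<epsilon>" using r0(2)[OF v(1) x r, of j] by linarith
    then show ?thesis by simp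
  qed
  then show "\<exists>N. \<forall>j\<ge>N. norm (v j e x - 0) < \<epsilon>" by blast
qed

text \<open>Verifies the condition \<open>weak\<close>. Point values tend to 0, so the vertex terms
  vanish in the limit, and so do the integrals of the derivatives over intervals, being differences
  of point values; \<open>weak_null\<close> handles the derivative pairing.\<close>

lemma weak_form:
  assumes v: "\<And>j::nat. v j \<in> W" "\<And>j. E.nrm (v j) \<le> B" and 0: "(\<lambda>j. H.nrm (v j)) \<longlonglongrightarrow> 0" and f: "f \<in> W"
  shows "(\<lambda>j. aG (v j) f) \<longlonglongrightarrow> 0"
proof -
  obtain c C where c: "c > 0" "\<And>F. F \<in> W \<Longrightarrow> c * H1norm len F \<le> E.nrm F" using equiv by metis
  have pt: "(\<lambda>j. v j e x) \<longlonglongrightarrow> 0" if "x \<in> I e" for e x by (rule weak_pointwise[OF v 0 that])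
  have 1: "(\<lambda>j. innerG len (v j) f) \<longlonglongrightarrow> 0"
  proof (rule Lim_null_comparison)
    show "\<forall>\<^sub>F j in sequentially. norm (innerG len (v j) f) \<le> H.nrm (v j) * H.nrm f"
      using H.Cauchy_Schwarz W_L2 v(1) f by (intro always_eventually) auto
    show "(\<lambda>j. H.nrm (v j) * H.nrm f) \<longlonglongrightarrow> 0" using tendsto_mult_left_zero[OF 0] .
  qed
  have 2: "(\<lambda>j. L2ip (I e) (dF (v j) e) (dF f e)) \<longlonglongrightarrow> 0" for e
  proof (rule weak_null[OF edge dF_L2(1)[OF v(1)] _ _ dF_L2(1)[OF f]])
    show "nrm2 (I e) (dF (v j) e) \<le> \<bar>B\<bar> / c" for j
    proof -
      have "c * H1norm len (v j) \<le> \<bar>B\<bar>" using c(2)[OF v(1)[of j]] v(2)[of j] by linarith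
      then have "H1norm len (v j) \<le> \<bar>B\<bar> / c" using c(1) by (simp add: field_simps)
      then show ?thesis using nrm2_le_H1norm(2)[OF v(1)[of j], of e] by simp
    qed
    fix x y assume xy: "x \<in> I e" "y \<in> I e"
    show "(\<lambda>j. integral {x..y} (dF (v j) e)) \<longlonglongrightarrow> 0"
    proof (cases "x \<le> y")
      case True
      have "integral {x..y} (dF (v j) e) = v j e y - v j e x" for j
        using wderivD(1)[OF dF_L2(2)[OF v(1)] xy True, of j] by simp
      then show ?thesis using tendsto_diff[OF pt[OF xy(2)] pt[OF xy(1)]] by simp
    qed simp
  qed
  have bv: "(\<lambda>j. bval len (v j) p) \<longlonglongrightarrow> 0" if "valid_end len p" for p
    unfolding bval_def by (rule pt[OF endpt_in[OF that]])
  have mp: "(\<lambda>j. mapp (ev w) A (x j) i) \<longlonglongrightarrow> 0" if "\<And>p. p \<in> ev w \<Longrightarrow> (\<lambda>j. x j p) \<longlonglongrightarrow> 0" for w A x i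
  proof -
    have "(\<lambda>j. \<Sum>p\<in>ev w. A i p * x j p) \<longlonglongrightarrow> (\<Sum>p\<in>ev w. A i p * 0)"
      by (intro tendsto_sum tendsto_mult tendsto_const that)
    then show ?thesis by (simp add: mapp_def)
  qed
  have "(\<lambda>j. bnd (v j) f) \<longlonglongrightarrow> (\<Sum>v\<in>vertices len vtx. \<Sum>i\<in>ev v. 0 * cnj (mapp (ev v) (PR v) (bval len f) i))"
    unfolding bnd_def by (intro tendsto_sum tendsto_mult tendsto_const mp bv) (auto simp: ends_def)
  then have 3: "(\<lambda>j. bnd (v j) f) \<longlonglongrightarrow> 0" by simp
  have "(\<lambda>j. aG (v j) f) \<longlonglongrightarrow> of_real Mc * 0 + (\<Sum>e\<in>(UNIV::'e set). 0) + 0"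
    unfolding aG_def by (intro tendsto_add tendsto_mult tendsto_const tendsto_sum 1 2 3)
  then show ?thesis by simp
qed

end

context qg begin

subsection \<open>Lipschitz continuity of the nonlinearity\<close>

text \<open>The derivatives differ by (\<alpha>(w) - \<alpha>(v)) v' + \<alpha>(w) (w' - v') and the
  conjugate analogue. The first term costs the maximum of |w - v| times the norm of v', which is
  where the one-sided factor 1 + E.nrm v comes from.\<close>

lemma FRG_lipschitz:
  assumes sm: "smooth_compact \<theta>" and z2: "\<forall>x\<ge>2. \<theta> x = 0" and \<sigma>: "\<sigma> \<ge> 1/2" and R: "R > 0"
    and H2: "H2hyp \<sigma> R \<theta> len vtx PD"
  shows "\<exists>L\<ge>0. \<forall>v\<in>W. \<forall>w\<in>W. E.nrm (FRG \<sigma> R \<theta> w - FRG \<sigma> R \<theta> v) \<le> L * (1 + E.nrm v) * E.nrm (w - v)"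
proof -
  obtain \<alpha> \<beta> K where K: "K \<ge> 0"
    and lip\<alpha>: "\<And>z w. cmod (\<alpha> w - \<alpha> z) \<le> K * cmod (w - z)" and lip\<beta>: "\<And>z w. cmod (\<beta> w - \<beta> z) \<le> K * cmod (w - z)"
    and b\<alpha>: "\<And>z. cmod (\<alpha> z) \<le> K" and b\<beta>: "\<And>z. cmod (\<beta> z) \<le> K"
    and tay: "\<And>z w. cmod (FR \<sigma> R \<theta> w - FR \<sigma> R \<theta> z - (\<alpha> z * (w - z) + \<beta> z * cnj (w - z))) \<le> K * (cmod (w - z))\<^sup>2"
    and lipF: "\<And>z w. cmod (FR \<sigma> R \<theta> w - FR \<sigma> R \<theta> z) \<le> K * cmod (w - z)"
    by (rule FR_differential[OF sm z2 \<sigma> R]) blast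
  let ?F = "FRG \<sigma> R \<theta>"
  have FW: "?F v \<in> W" if "v \<in> W" for v using H2 that by (simp add: H2hyp_def)
  obtain c C where c: "c > 0" "C > 0" "\<And>F. F \<in> W \<Longrightarrow> c * H1norm len F \<le> E.nrm F"
    "\<And>F. F \<in> W \<Longrightarrow> E.nrm F \<le> C * H1norm len F" using equiv by metis
  have "\<exists>r0>0. \<forall>F x r. F \<in> W \<and> x \<in> I e \<and> 0 < r \<and> r \<le> r0 \<longrightarrow>
     cmod (F e x) \<le> nrm2 (I e) (F e) / sqrt r + sqrt r * nrm2 (I e) (dF F e)" for e
    by (rule pointwise_bound[of e]) blast
  then obtain r where r: "\<And>e. r e > 0" "\<And>e F x. F \<in> W \<Longrightarrow> x \<in> I e \<Longrightarrow>
     cmod (F e x) \<le> nrm2 (I e) (F e) / sqrt (r e) + sqrt (r e) * nrm2 (I e) (dF F e)"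
    by (metis order_refl)
  \<comment> \<open>The constant of the embedding of H1 into bounded functions on the edge, from
    averaging over length \<open>r e\<close>.\<close>
  define Ce where "Ce = (\<lambda>e. 1 / sqrt (r e) + sqrt (r e))"
  have Ce: "Ce e \<ge> 0" for e using r(1)[of e] by (simp add: Ce_def less_imp_le)
  have c\<alpha>: "continuous_on A \<alpha>" for A
    using lip\<alpha> K by (intro lipschitz_on_continuous_on) (auto simp: lipschitz_on_def dist_norm)
  have c\<beta>: "continuous_on A \<beta>" for A
    using lip\<beta> K by (intro lipschitz_on_continuous_on) (auto simp: lipschitz_on_def dist_norm)
  have edge_bound: "nrm2 (I e) ((?F w - ?F v) e) + nrm2 (I e) (dF (?F w - ?F v) e) \<le>
      (3 * K + 2 * K * Ce e) * ((1 + H1norm len v) * H1norm len (w - v))" if v: "v \<in> W" and w: "w \<in> W" for v w e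
  proof -
    define u where "u = w - v"
    have u: "u \<in> W" unfolding u_def by (rule E.V_diff[OF w v])
    define N where "N = H1norm len u"
    have N: "N \<ge> 0" by (simp add: N_def H1norm_nonneg)
    have FFW: "?F w - ?F v \<in> W" by (rule E.V_diff[OF FW[OF w] FW[OF v]])
    define s where "s = Ce e * N"
    have s0: "s \<ge> 0" using N Ce by (simp add: s_def)
    have us: "cmod (u e x) \<le> s" if x: "x \<in> I e" for x
    proof -
      have "cmod (u e x) \<le> nrm2 (I e) (u e) / sqrt (r e) + sqrt (r e) * nrm2 (I e) (dF u e)" by (rule r(2)[OF u x])
      also have "\<dots> \<le> N / sqrt (r e) + sqrt (r e) * N"
        using nrm2_le_H1norm[OF u, of e] r(1)[of e] unfolding N_def
        by (intro add_mono divide_right_mono mult_left_mono) auto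
      finally show ?thesis by (simp add: s_def Ce_def algebra_simps)
    qed
    have us': "cmod (w e x - v e x) \<le> s" if "x \<in> I e" for x using us[OF that] by (simp add: u_def)
    have L2v: "L2 (I e) (v e)" "L2 (I e) (w e)" "L2 (I e) (u e)" using W_L2 v w u by (auto simp: L2G_def)
    have 1: "nrm2 (I e) ((?F w - ?F v) e) \<le> K * N"
    proof -
      have "nrm2 (I e) ((?F w - ?F v) e) \<le> nrm2 (I e) (fscl (of_real K) (u e))"
      proof (rule nrm2_mono)
        show "L2 (I e) (fscl (of_real K) (u e))" using L2_scl[OF L2v(3)] by (simp add: fscl_def)
        show "L2 (I e) ((?F w - ?F v) e)" using W_L2[OF FFW] by (simp add: L2G_def)
        show "cmod ((?F w - ?F v) e x) \<le> cmod (fscl (of_real K) (u e) x)" for x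
          using lipF[of "w e x" "v e x"] K by (simp add: FRG_def fscl_def u_def norm_mult)
      qed
      also have "\<dots> = K * nrm2 (I e) (u e)" using L2v K by (simp add: L2.nrm_scl)
      also have "\<dots> \<le> K * N" unfolding N_def by (intro mult_left_mono nrm2_le_H1norm u K)
      finally show ?thesis .
    qed
    define dd where "dd = (\<lambda>f x. \<alpha> (f e x) * dF f e x + \<beta> (f e x) * cnj (dF f e x))"
    have wd: "wderiv (I e) (?F f e) (dd f)" "L2 (I e) (dd f)" if f: "f \<in> W" for f
    proof -
      have li: "locint (I e) (dF f e)" by (rule L2_locint[OF edge dF_L2(1)[OF f]])
      show "wderiv (I e) (?F f e) (dd f)"
        using wderiv_chain(1)[OF edge li dF_L2(2)[OF f] K lip\<alpha> lip\<beta> tay] by (simp add: FRG_def dd_def)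
      have cf: "continuous_on (I e) (f e)" by (rule wderiv_continuous[OF edge li dF_L2(2)[OF f]])
      have "(\<lambda>x. \<alpha> (f e x)) \<in> borel_measurable (lebesgue_on (I e))" "(\<lambda>x. \<beta> (f e x)) \<in> borel_measurable (lebesgue_on (I e))"
        using borel_measurable_continuous_edge[OF edge continuous_on_compose2[OF c\<alpha> cf]]
          borel_measurable_continuous_edge[OF edge continuous_on_compose2[OF c\<beta> cf]] by blast+
      then show "L2 (I e) (dd f)" unfolding dd_def
        by (intro L2_add L2_mult_bounded[where K=K] dF_L2 L2_cnj f b\<alpha> b\<beta>)
    qed
    define rr where "rr = dd w - dd v"
    have rr: "L2 (I e) rr" "wderiv (I e) ((?F w - ?F v) e) rr"
      using L2_diff[OF wd(2)[OF w] wd(2)[OF v]] wderiv_diff[OF wd(1)[OF w] wd(1)[OF v]] by (auto simp: rr_def fun_diff_def)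
    have p2: "L2 (I e) (dF v e)" "L2 (I e) (dF w e)" "L2 (I e) (dF w e - dF v e)"
      using dF_L2(1)[OF v] dF_L2(1)[OF w] L2_diff by (auto simp: fun_diff_def)
    have 2: "nrm2 (I e) (dF (?F w - ?F v) e) \<le> 2 * K * (s * H1norm len v) + 2 * K * N"
    proof -
      have "nrm2 (I e) (dF (?F w - ?F v) e) = nrm2 (I e) rr" by (rule L2.eqv_nrm[OF dF_eqv[OF FFW rr]])
      also have "\<dots> \<le> nrm2 (I e) (fscl (of_real (2 * K * s)) (\<lambda>x. of_real (cmod (dF v e x)))
          + fscl (of_real (2 * K)) (\<lambda>x. of_real (cmod (dF w e x - dF v e x))))"
      proof (rule nrm2_mono[OF _ rr(1)])
        show "L2 (I e) (fscl (of_real (2 * K * s)) (\<lambda>x. of_real (cmod (dF v e x)))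
          + fscl (of_real (2 * K)) (\<lambda>x. of_real (cmod (dF w e x - dF v e x))))"
          unfolding fscl_def plus_fun_def
          by (intro L2_add L2_scl L2_norm dF_L2(1)[OF v] L2_diff[OF dF_L2(1)[OF w] dF_L2(1)[OF v]])
        fix x assume x: "x \<in> I e"
        let ?p = "dF v e x" and ?q = "dF w e x"
        have A: "cmod (\<alpha> (w e x) - \<alpha> (v e x)) \<le> K * s" "cmod (\<beta> (w e x) - \<beta> (v e x)) \<le> K * s"
          using order_trans[OF lip\<alpha> mult_left_mono[OF us'[OF x] K]] order_trans[OF lip\<beta> mult_left_mono[OF us'[OF x] K]]
          by auto
        have rr_eq: "rr x = ((\<alpha> (w e x) - \<alpha> (v e x)) * ?p + \<alpha> (w e x) * (?q - ?p))
            + ((\<beta> (w e x) - \<beta> (v e x)) * cnj ?p + \<beta> (w e x) * cnj (?q - ?p))"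
          by (simp add: rr_def dd_def algebra_simps)
        have tri: "cmod ((a + b) + (c + d)) \<le> (cmod a + cmod b) + (cmod c + cmod d)" for a b c d
          by (intro order_trans[OF norm_triangle_ineq] add_mono norm_triangle_ineq)
        have "cmod (rr x) \<le> (cmod ((\<alpha> (w e x) - \<alpha> (v e x)) * ?p) + cmod (\<alpha> (w e x) * (?q - ?p)))
            + (cmod ((\<beta> (w e x) - \<beta> (v e x)) * cnj ?p) + cmod (\<beta> (w e x) * cnj (?q - ?p)))"
          unfolding rr_eq by (rule tri)
        also have "\<dots> \<le> ((K * s) * cmod ?p + K * cmod (?q - ?p)) + ((K * s) * cmod ?p + K * cmod (?q - ?p))"
          unfolding norm_mult complex_mod_cnj using A b\<alpha> b\<beta> by (intro add_mono mult_right_mono) auto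
        also have "\<dots> = 2 * K * s * cmod ?p + 2 * K * cmod (?q - ?p)" by (simp add: algebra_simps)
        also have "\<dots> = cmod (of_real (2 * K * s * cmod ?p + 2 * K * cmod (?q - ?p)))"
          unfolding norm_of_real using K s0 by simp
        finally show "cmod (rr x) \<le> cmod ((fscl (of_real (2 * K * s)) (\<lambda>x. of_real (cmod (dF v e x)))
          + fscl (of_real (2 * K)) (\<lambda>x. of_real (cmod (dF w e x - dF v e x)))) x)"
          by (simp add: fscl_def)
      qed
      also have "\<dots> \<le> nrm2 (I e) (fscl (of_real (2 * K * s)) (\<lambda>x. of_real (cmod (dF v e x))))
          + nrm2 (I e) (fscl (of_real (2 * K)) (\<lambda>x. of_real (cmod (dF w e x - dF v e x))))"
        using L2_scl[OF L2_norm[OF p2(1)]] L2_scl[OF L2_norm[OF p2(3)]]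
        by (intro L2.nrm_triangle) (auto simp: fscl_def)
      also have "\<dots> = 2 * K * s * nrm2 (I e) (dF v e) + 2 * K * nrm2 (I e) (dF w e - dF v e)"
      proof -
        have "nrm2 (I e) (\<lambda>x. of_real (cmod (dF v e x))) = nrm2 (I e) (dF v e)"
          "nrm2 (I e) (\<lambda>x. of_real (cmod (dF w e x - dF v e x))) = nrm2 (I e) (dF w e - dF v e)"
          by (auto simp: nrm2_eq)
        then show ?thesis
          using L2.nrm_scl[of "\<lambda>x. of_real (cmod (dF v e x))" "I e" "of_real (2 * K * s)"]
            L2.nrm_scl[of "\<lambda>x. of_real (cmod (dF w e x - dF v e x))" "I e" "of_real (2 * K)"]
            L2_norm[OF p2(1)] L2_norm[OF p2(3)] K s0 by (simp add: norm_mult)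
      qed
      also have "nrm2 (I e) (dF w e - dF v e) = nrm2 (I e) (dF u e)"
        using L2.eqv_nrm[OF dF_diff[OF w v, of e]] u by (simp add: u_def)
      also have "2 * K * s * nrm2 (I e) (dF v e) + 2 * K * nrm2 (I e) (dF u e) \<le> 2 * K * s * H1norm len v + 2 * K * N"
        using nrm2_le_H1norm(2)[OF v, of e] nrm2_le_H1norm(2)[OF u, of e] K s0 unfolding N_def
        by (intro add_mono mult_left_mono) auto
      finally show ?thesis by (simp only: mult.assoc)
    qed
    have V: "H1norm len v \<ge> 0" by (rule H1norm_nonneg)
    have "nrm2 (I e) ((?F w - ?F v) e) + nrm2 (I e) (dF (?F w - ?F v) e) \<le> 3 * K * N + 2 * K * Ce e * (H1norm len v * N)"
      using 1 2 by (simp add: s_def algebra_simps)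
    also have "\<dots> \<le> 3 * K * ((1 + H1norm len v) * N) + 2 * K * Ce e * ((1 + H1norm len v) * N)"
      using V N K Ce[of e] by (intro add_mono mult_left_mono) (auto simp: algebra_simps)
    finally show ?thesis by (simp add: N_def u_def algebra_simps)
  qed
  define L1 where "L1 = (\<Sum>e\<in>UNIV. 3 * K + 2 * K * Ce e)"
  have L1: "L1 \<ge> 0" unfolding L1_def using K Ce by (intro sum_nonneg) simp
  define L where "L = C * L1 * (1 + 1 / c) / c"
  have L: "L \<ge> 0" using c L1 by (simp add: L_def)
  have "E.nrm (?F w - ?F v) \<le> L * (1 + E.nrm v) * E.nrm (w - v)" if v: "v \<in> W" and w: "w \<in> W" for v w
  proof -
    have FFW: "?F w - ?F v \<in> W" by (rule E.V_diff[OF FW[OF w] FW[OF v]])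
    have u: "w - v \<in> W" by (rule E.V_diff[OF w v])
    have "H1norm len (?F w - ?F v) \<le> (\<Sum>e\<in>UNIV. (3 * K + 2 * K * Ce e) * ((1 + H1norm len v) * H1norm len (w - v)))"
      by (rule order_trans[OF H1norm_le_sum[OF FFW] sum_mono]) (rule edge_bound[OF v w])
    also have "\<dots> = L1 * ((1 + H1norm len v) * H1norm len (w - v))" by (simp add: L1_def sum_distrib_right)
    finally have 1: "H1norm len (?F w - ?F v) \<le> L1 * ((1 + H1norm len v) * H1norm len (w - v))" .
    have hv: "H1norm len v \<le> E.nrm v / c" "H1norm len (w - v) \<le> E.nrm (w - v) / c"
      using c(1) c(3)[OF v] c(3)[OF u] by (auto simp: field_simps)
    have nn: "0 \<le> E.nrm v" "0 \<le> E.nrm (w - v)" using v u by auto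
    have "E.nrm (?F w - ?F v) \<le> C * H1norm len (?F w - ?F v)" by (rule c(4)[OF FFW])
    also have "\<dots> \<le> C * (L1 * ((1 + H1norm len v) * H1norm len (w - v)))" using 1 c(2) by (intro mult_left_mono) auto
    also have "\<dots> \<le> C * (L1 * ((1 + E.nrm v / c) * (E.nrm (w - v) / c)))"
      using hv c(1,2) L1 H1norm_nonneg nn by (intro mult_left_mono mult_mono add_mono) auto
    also have "\<dots> \<le> C * (L1 * (((1 + 1 / c) * (1 + E.nrm v)) * (E.nrm (w - v) / c)))"
      using c(1,2) L1 nn by (intro mult_left_mono mult_right_mono) (auto simp: field_simps)
    also have "\<dots> = L * (1 + E.nrm v) * E.nrm (w - v)" by (simp add: L_def)
    finally show ?thesis .
  qed
  then show ?thesis using L by blast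
qed

subsection \<open>The resolvent\<close>

text \<open>All vertex conditions packed into one scalar equation per edge end, so that equations
  and unknown coefficients are equally many; \<open>conditions_from_sum\<close> splits them
  again.\<close>

definition comb :: "('e \<times> bool \<Rightarrow> complex) \<Rightarrow> ('e \<times> bool \<Rightarrow> complex) \<Rightarrow> 'e \<times> bool \<Rightarrow> complex" where
  "comb x y p = mapp (ev (vtx p)) (PD (vtx p)) x p + mapp (ev (vtx p)) (PN (vtx p)) y p
     + mapp (ev (vtx p)) (PR (vtx p)) y p - mapp (ev (vtx p)) (Lam (vtx p)) (mapp (ev (vtx p)) (PR (vtx p)) x) p"

text \<open>\<open>dval\<close> with the derivative given explicitly, which makes it linear, unlike
  an expression in the chosen \<open>dd\<close>.\<close>

definition dvQ :: "('e \<Rightarrow> real \<Rightarrow> complex) \<Rightarrow> 'e \<times> bool \<Rightarrow> complex" where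
  "dvQ Q p = (if snd p then - Q (fst p) (endpt len p) else Q (fst p) 0)"

lemma comb_add: "comb (\<lambda>p. x p + x' p) (\<lambda>p. y p + y' p) p = comb x y p + comb x' y' p"
proof -
  have "mapp E (Lam v) (mapp E (PR v) (\<lambda>p. x p + x' p)) p = mapp E (Lam v) (mapp E (PR v) x) p + mapp E (Lam v) (mapp E (PR v) x') p" for E v
    unfolding mapp_add[symmetric] by (rule mapp_cong) (simp add: mapp_add)
  then show ?thesis by (simp add: comb_def mapp_add)
qed

lemma comb_scl: "comb (\<lambda>p. c * x p) (\<lambda>p. c * y p) p = c * comb x y p"
proof -
  have "mapp E (Lam v) (mapp E (PR v) (\<lambda>p. c * x p)) p = c * mapp E (Lam v) (mapp E (PR v) x) p" for E v
    unfolding mapp_scl[symmetric] by (rule mapp_cong) (simp add: mapp_scl)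
  then show ?thesis by (simp add: comb_def mapp_scl algebra_simps)
qed

text \<open>Membership is tested on explicit derivatives: \<open>dd\<close> equals Q at the edge
  ends, so the conditions may be verified with \<open>dvQ\<close>.\<close>

lemma DLap_intro:
  assumes G: "\<And>e. L2 (I e) (G e)" "\<And>e. L2 (I e) (Q e)" "\<And>e. wderiv (I e) (G e) (Q e)"
    and P: "\<And>e. L2 (I e) (P e)" "\<And>e. wderiv (I e) (Q e) (P e)"
    and bc: "\<And>p. valid_end len p \<Longrightarrow> comb (bval len G) (dvQ Q) p = 0"
  shows "G \<in> DLap len vtx PD PN Lam" "\<And>e. nrm2 (I e) (Lap len G e - P e) = 0"
proof -
  note dd = H2_dd[OF edge G P]
  show "nrm2 (I e) (Lap len G e - P e) = 0" for e using dd(7)[of e] by (simp add: Lap_def)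
  have dv: "dval len G p = dvQ Q p" if "valid_end len p" for p
    using endpt_in[OF that] edge_ivl_facts(2)[OF edge[of "fst p"]] dd(4) by (auto simp: dval_def dvQ_def)
  show "G \<in> DLap len vtx PD PN Lam"
    unfolding DLap_def Let_def mem_Collect_eq
  proof (intro conjI allI ballI)
    show "H2G len G" using dd(1) by (simp add: H2G_def)
    fix v i assume i: "i \<in> ev v"
    interpret vertex_matrices "ev v" "PD v" "PN v" "Lam v" by (rule vm)
    have eq: "mapp (ev v) (PD v) (bval len G) j + mapp (ev v) (PN v) (dval len G) j
      + mapp (ev v) (PR v) (dval len G) j - mapp (ev v) (Lam v) (mapp (ev v) (PR v) (bval len G)) j = 0" if j: "j \<in> ev v" for j
    proof -
      have jv: "valid_end len j" "vtx j = v" using j by (auto simp: ends_def)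
      have "mapp (ev v) A (dval len G) j = mapp (ev v) A (dvQ Q) j" for A
        by (rule mapp_cong) (auto simp: ends_def dv)
      then show ?thesis using bc[OF jv(1)] jv(2) by (simp add: comb_def)
    qed
    show "mapp (ev v) (PD v) (bval len G) i = 0" "mapp (ev v) (PN v) (dval len G) i = 0"
      "mapp (ev v) (PR v) (dval len G) i = mapp (ev v) (Lam v) (mapp (ev v) (PR v) (bval len G)) i"
      using conditions_from_sum[OF eq i] by auto
  qed
qed

text \<open>The square-integrable solutions of f'' = k squared times f, one coefficient per edge
  end. The second exponential is normalised to exp (k (x - len e)), equal to 1 at the far end; it is
  absent on a half-line.\<close>

definition hom0 :: "complex \<Rightarrow> ('e \<times> bool \<Rightarrow> complex) \<Rightarrow> 'e \<Rightarrow> real \<Rightarrow> complex" where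
  "hom0 k c e x = c (e, False) * exp (- k * of_real x) +
     (if len e = \<infinity> then 0 else c (e, True) * exp (- k * of_real (real_of_ereal (len e))) * exp (k * of_real x))"

definition hom1 :: "complex \<Rightarrow> ('e \<times> bool \<Rightarrow> complex) \<Rightarrow> 'e \<Rightarrow> real \<Rightarrow> complex" where
  "hom1 k c e x = c (e, False) * (- k * exp (- k * of_real x)) +
     (if len e = \<infinity> then 0 else c (e, True) * exp (- k * of_real (real_of_ereal (len e))) * (k * exp (k * of_real x)))"

lemma hom_props: assumes k: "Re k > 0"
  shows "L2 (I e) (hom0 k c e)" "L2 (I e) (hom1 k c e)" "wderiv (I e) (hom0 k c e) (hom1 k c e)"
    "wderiv (I e) (hom1 k c e) (\<lambda>x. k\<^sup>2 * hom0 k c e x)"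
proof -
  let ?d = "c (e, True) * exp (- k * of_real (real_of_ereal (len e)))"
  have 1: "L2 (I e) (\<lambda>x. exp (- k * of_real x))" by (rule exp_decay_L2[OF edge k])
  have 2: "L2 (I e) (\<lambda>x. exp (k * of_real x))" if "len e \<noteq> \<infinity>"
  proof (rule L2_of_bounded_integrals[OF edge])
    show "continuous_on (I e) (\<lambda>x. exp (k * of_real x))" by (intro continuous_intros)
    fix X assume "X \<in> I e"
    then show "integral {0..X} (\<lambda>t. (cmod (exp (k * of_real t)))\<^sup>2) \<le> integral {0..real_of_ereal (len e)} (\<lambda>t. (cmod (exp (k * of_real t)))\<^sup>2)"
      using I_fin(1)[OF that] by (intro integral_subset_le integrable_continuous_real continuous_intros) auto
  qed
  have d1: "wderiv (I e) (\<lambda>x. exp (- k * of_real x)) (\<lambda>x. - k * exp (- k * of_real x))" by (rule wderiv_exp)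
  have d2: "wderiv (I e) (\<lambda>x. exp (k * of_real x)) (\<lambda>x. k * exp (k * of_real x))" by (rule wderiv_exp)
  have "L2 (I e) (hom0 k c e) \<and> L2 (I e) (hom1 k c e) \<and> wderiv (I e) (hom0 k c e) (hom1 k c e) \<and>
    wderiv (I e) (hom1 k c e) (\<lambda>x. k\<^sup>2 * hom0 k c e x)"
  proof (cases "len e = \<infinity>")
    case True
    have h: "hom0 k c e = (\<lambda>x. c (e, False) * exp (- k * of_real x))" "hom1 k c e = (\<lambda>x. c (e, False) * (- k * exp (- k * of_real x)))"
      using True by (auto simp: hom0_def hom1_def)
    have "wderiv (I e) (\<lambda>x. c (e, False) * (- k * exp (- k * of_real x))) (\<lambda>x. c (e, False) * (- k * (- k * exp (- k * of_real x))))"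
      by (intro wderiv_scl d1)
    then have "wderiv (I e) (hom1 k c e) (\<lambda>x. k\<^sup>2 * hom0 k c e x)"
      unfolding h by (rule wderiv_cong[OF edge]) (auto simp: power2_eq_square algebra_simps)
    then show ?thesis unfolding h by (intro conjI L2_scl wderiv_scl 1 d1)
  next
    case False
    have h: "hom0 k c e = (\<lambda>x. c (e, False) * exp (- k * of_real x) + ?d * exp (k * of_real x))"
      "hom1 k c e = (\<lambda>x. c (e, False) * (- k * exp (- k * of_real x)) + ?d * (k * exp (k * of_real x)))"
      using False by (auto simp: hom0_def hom1_def)
    have "wderiv (I e) (\<lambda>x. c (e, False) * (- k * exp (- k * of_real x)) + ?d * (k * exp (k * of_real x)))
       (\<lambda>x. c (e, False) * (- k * (- k * exp (- k * of_real x))) + ?d * (k * (k * exp (k * of_real x))))"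
      by (intro wderiv_add wderiv_scl d1 d2)
    then have "wderiv (I e) (hom1 k c e) (\<lambda>x. k\<^sup>2 * hom0 k c e x)"
      unfolding h by (rule wderiv_cong[OF edge]) (auto simp: power2_eq_square algebra_simps)
    then show ?thesis unfolding h by (intro conjI L2_add L2_scl wderiv_add wderiv_scl 1 2[OF False] d1 d2)
  qed
  then show "L2 (I e) (hom0 k c e)" "L2 (I e) (hom1 k c e)" "wderiv (I e) (hom0 k c e) (hom1 k c e)"
    "wderiv (I e) (hom1 k c e) (\<lambda>x. k\<^sup>2 * hom0 k c e x)" by auto
qed

text \<open>Evaluation at the two ends of a finite edge gives a system with determinant 1 - E E,
  where E = exp (-k l) has modulus below 1.\<close>

lemma hom0_eq_0_coeffs:
  assumes k: "Re k > 0" and z: "\<And>e x. x \<in> I e \<Longrightarrow> hom0 k c e x = 0" and p: "valid_end len p"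
  shows "c p = 0"
proof -
  obtain e b where eb: "p = (e, b)" by (cases p)
  have 0: "0 \<in> I e" by (rule edge_ivl_facts(2)[OF edge])
  show ?thesis
  proof (cases "len e = \<infinity>")
    case True
    then have "b = False" using p by (simp add: eb valid_end_def)
    then show ?thesis using z[OF 0] True by (simp add: hom0_def eb)
  next
    case False
    define l where "l = real_of_ereal (len e)"
    note l = I_fin[OF False, folded l_def]
    define E where "E = exp (- k * of_real l)"
    have EE: "E * exp (k * of_real l) = 1" by (simp add: E_def exp_add[symmetric])
    have 1: "c (e, False) + c (e, True) * E = 0" using z[OF 0] False by (simp add: hom0_def l_def E_def)
    have "l \<in> I e" using l by simp
    from z[OF this] have "c (e, False) * E + c (e, True) * (E * exp (k * of_real l)) = 0"
      using False by (simp add: hom0_def l_def E_def mult.assoc)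
    then have 2: "c (e, False) * E + c (e, True) = 0" unfolding EE by simp
    have "c (e, True) * (1 - E * E) = (c (e, False) * E + c (e, True)) - E * (c (e, False) + c (e, True) * E)"
      by (simp add: algebra_simps)
    then have 3: "c (e, True) * (1 - E * E) = 0" using 1 2 by simp
    have "cmod E < 1" using k l by (simp add: E_def)
    then have "cmod (E * E) < 1 * 1" unfolding norm_mult by (intro mult_strict_mono') auto
    then have "E * E \<noteq> 1" by auto
    then have "c (e, True) = 0" using 3 by simp
    moreover from this have "c (e, False) = 0" using 1 by simp
    ultimately show ?thesis by (cases b) (auto simp: eb)
  qed
qed

text \<open>Green's formula gives a(G, G) = (Mc - cnj \<mu>) times the squared L2 norm of G. Since
  a(G, G) is real, a non-real \<mu> forces G to be null; for real \<mu> \<ge> Mc the right side is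
  nonpositive and coercivity concludes.\<close>

lemma resolvent_injective:
  assumes G: "G \<in> DLap len vtx PD PN Lam" and eq: "\<And>e. nrm2 (I e) (Lap len G e - fscl \<mu> (G e)) = 0"
    and \<mu>: "Im \<mu> \<noteq> 0 \<or> Re \<mu> \<ge> Mc"
  shows "H.nrm G = 0"
proof -
  have GW: "G \<in> W" using G DLap_W by blast
  have GV: "G \<in> Collect (L2G len)" "Lap len G \<in> Collect (L2G len)" using W_L2[OF GW] Lap_L2G[OF G] by auto
  have "H.nrm (Lap len G - gscl \<mu> G) = 0" by (rule Hnrm_eq_0) (simp add: eq gscl_apply)
  then have "H.eqv (Lap len G) (gscl \<mu> G)" using GV H.V_scl by (intro H.eqvI) auto
  then have "innerG len G (Lap len G) = cnj \<mu> * innerG len G G"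
    using H.eqv_ip(2)[of "Lap len G" "gscl \<mu> G" G] GV by (simp add: H.ip_scl_right)
  then have "aG G G = (of_real Mc - cnj \<mu>) * innerG len G G"
    using green[OF GW G] GV H.V_scl[OF GV(1)] by (simp add: H.ip_diff_right H.ip_scl_right algebra_simps)
  then have *: "of_real ((E.nrm G)\<^sup>2) = (of_real Mc - cnj \<mu>) * of_real ((H.nrm G)\<^sup>2)"
    using E.ip_self[OF GW] H.ip_self[OF GV(1)] by simp
  show ?thesis
  proof (cases "Im \<mu> = 0")
    case False
    have "Im (of_real ((E.nrm G)\<^sup>2)) = Im \<mu> * (H.nrm G)\<^sup>2" unfolding * by simp
    then show ?thesis using False by simp
  next
    case True
    have "(E.nrm G)\<^sup>2 = (Mc - Re \<mu>) * (H.nrm G)\<^sup>2" using arg_cong[OF *, of Re] by simp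
    also have "\<dots> \<le> 0" using \<mu> True by (simp add: mult_nonpos_nonneg)
    finally have "E.nrm G = 0" by simp
    obtain c C where c: "c > 0" "\<And>F. F \<in> W \<Longrightarrow> c * H1norm len F \<le> E.nrm F" using equiv by metis
    have "c * H1norm len G \<le> 0" using c(2)[OF GW] \<open>E.nrm G = 0\<close> by simp
    then have "H1norm len G \<le> 0" using c(1) by (simp add: mult_le_0_iff)
    then show ?thesis using Hnrm_le_H1norm[of G] GV by (intro H.nrm_le_0) auto
  qed
qed

text \<open>Passes from a null norm to vanishing at every point, end points included, by viewing G
  as a constant sequence in \<open>weak_pointwise\<close>.\<close>

lemma zero_pointwise: assumes G: "G \<in> W" "H.nrm G = 0" and x: "x \<in> I e" shows "G e x = 0"
proof -
  have "(\<lambda>j::nat. G e x) \<longlonglongrightarrow> 0"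
    by (rule weak_pointwise[where B="E.nrm G"]) (use G x in auto)
  then show ?thesis using LIMSEQ_const_iff by blast
qed

lemma resolvent_surjective:
  assumes h: "L2G len h" and \<mu>: "Im \<mu> \<noteq> 0 \<or> Re \<mu> \<ge> Mc"
  shows "\<exists>G\<in>DLap len vtx PD PN Lam. H.nrm (gscl \<mu> G - Lap len G - h) = 0"
proof -
  define k where "k = csqrt \<mu>"
  have k2: "k\<^sup>2 = \<mu>" by (simp add: k_def)
  \<comment> \<open>The principal root has nonnegative real part; an imaginary root would make \<mu>
    real and nonpositive, which Mc > 0 excludes.\<close>
  have k: "Re k > 0"
  proof -
    have "Re k \<noteq> 0"
    proof
      assume 0: "Re k = 0"
      have "\<mu> = - of_real ((Im k)\<^sup>2)" unfolding k2[symmetric] using 0 by (simp add: complex_eq_iff power2_eq_square)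
      then have "Im \<mu> = 0" "Re \<mu> \<le> 0" by auto
      then show False using \<mu> Mc by simp
    qed
    moreover have "0 \<le> Re k" using csqrt_principal[of \<mu>] by (auto simp: k_def)
    ultimately show ?thesis by simp
  qed
  have "\<exists>g q. L2 (I e) g \<and> L2 (I e) q \<and> wderiv (I e) g q \<and> wderiv (I e) q (\<lambda>x. k\<^sup>2 * g x - h e x)" for e
    by (rule solve_resolvent_edge[OF edge k L2G_D[OF h, of e]]) blast
  then obtain g q where g: "\<And>e. L2 (I e) (g e)" "\<And>e. L2 (I e) (q e)" "\<And>e. wderiv (I e) (g e) (q e)"
    "\<And>e. wderiv (I e) (q e) (\<lambda>x. k\<^sup>2 * g e x - h e x)" by metis
  \<comment> \<open>Coefficients are indexed by the full type of edge ends to have a Euclidean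
    space; at the absent ends of half-lines T is the identity, which keeps the system square. Real
    linearity suffices to pass from injective to surjective.\<close>
  define T :: "complex ^ ('e \<times> bool) \<Rightarrow> complex ^ ('e \<times> bool)" where
    "T = (\<lambda>c. \<chi> p. if valid_end len p then comb (bval len (hom0 k (($) c))) (dvQ (hom1 k (($) c))) p else c $ p)"
  have hadd: "bval len (hom0 k (($) (b + c))) = (\<lambda>p. bval len (hom0 k (($) b)) p + bval len (hom0 k (($) c)) p)"
    "dvQ (hom1 k (($) (b + c))) = (\<lambda>p. dvQ (hom1 k (($) b)) p + dvQ (hom1 k (($) c)) p)" for b c
    by (auto simp: fun_eq_iff bval_def dvQ_def hom0_def hom1_def algebra_simps)
  have comp: "(r *\<^sub>R c) $ p = of_real r * (c $ p)" for r and c :: "complex ^ ('e \<times> bool)" and p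
    unfolding vector_scaleR_component by (rule scaleR_conv_of_real)
  have hscl: "bval len (hom0 k (($) (r *\<^sub>R c))) = (\<lambda>p. of_real r * bval len (hom0 k (($) c)) p)"
    "dvQ (hom1 k (($) (r *\<^sub>R c))) = (\<lambda>p. of_real r * dvQ (hom1 k (($) c)) p)" for r c
    unfolding fun_eq_iff bval_def dvQ_def hom0_def hom1_def comp by (auto simp: algebra_simps)
  have lin: "linear T"
  proof (rule linearI)
    show "T (b + c) = T b + T c" for b c
      by (simp add: T_def vec_eq_iff hadd comb_add)
    show "T (r *\<^sub>R c) = r *\<^sub>R T c" for r c
      unfolding vec_eq_iff
    proof
      fix p
      show "T (r *\<^sub>R c) $ p = (r *\<^sub>R T c) $ p"
        unfolding comp[of r "T c"]
        by (cases "valid_end len p") (simp_all add: T_def hscl comb_scl scaleR_conv_of_real[of r "c $ p"])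
    qed
  qed
  have inj: "inj T"
    unfolding linear_injective_0[OF lin]
  proof (intro allI impI)
    fix c assume T0: "T c = 0"
    have Tp: "(if valid_end len p then comb (bval len (hom0 k (($) c))) (dvQ (hom1 k (($) c))) p else c $ p) = 0" for p
      using arg_cong[OF T0, of "\<lambda>v. v $ p"] by (simp add: T_def)
    have bc: "comb (bval len (hom0 k (($) c))) (dvQ (hom1 k (($) c))) p = 0" if "valid_end len p" for p
      using Tp[of p] that by simp
    note D = DLap_intro[where G="hom0 k (($) c)" and Q="hom1 k (($) c)" and P="\<lambda>e x. k\<^sup>2 * hom0 k (($) c) e x",
        OF hom_props(1-3)[OF k] L2_scl[OF hom_props(1)[OF k]] hom_props(4)[OF k] bc]
    have "fscl \<mu> (hom0 k (($) c) e) = (\<lambda>x. k\<^sup>2 * hom0 k (($) c) e x)" for e by (simp add: fscl_def k2)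
    then have Lap_hom: "nrm2 (I e) (Lap len (hom0 k (($) c)) e - fscl \<mu> (hom0 k (($) c) e)) = 0" for e
      using D(2)[of e] by simp
    have "H.nrm (hom0 k (($) c)) = 0"
    proof (rule resolvent_injective)
      show "hom0 k (($) c) \<in> DLap len vtx PD PN Lam" by (rule D(1))
      show "nrm2 (I e) (Lap len (hom0 k (($) c)) e - fscl \<mu> (hom0 k (($) c) e)) = 0" for e by (rule Lap_hom)
    qed (rule \<mu>)
    then have "hom0 k (($) c) e x = 0" if "x \<in> I e" for e x
      using zero_pointwise[OF _ _ that, of "hom0 k (($) c)"] D(1) DLap_W by blast
    then have "c $ p = 0" if "valid_end len p" for p using hom0_eq_0_coeffs[OF k _ that, of "($) c"] by blast
    moreover have "c $ p = 0" if "\<not> valid_end len p" for p using Tp[of p] that by simp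
    ultimately show "c = 0" by (auto simp: vec_eq_iff)
  qed
  have "surj T" by (rule linear_injective_imp_surjective[OF lin inj]) (rule refl)
  \<comment> \<open>The particular solution g disregards the vertex conditions; the homogeneous part
    with coefficients c cancels its defect.\<close>
  then obtain c where c: "T c = (\<chi> p. - comb (bval len g) (dvQ q) p)" by (metis surjD)
  have c': "comb (bval len (hom0 k (($) c))) (dvQ (hom1 k (($) c))) p = - comb (bval len g) (dvQ q) p" if "valid_end len p" for p
    using arg_cong[OF c, of "\<lambda>v. v $ p"] that by (simp add: T_def)
  define G where "G = (\<lambda>e x. g e x + hom0 k (($) c) e x)"
  define Q where "Q = (\<lambda>e x. q e x + hom1 k (($) c) e x)"
  define P where "P = (\<lambda>e x. (k\<^sup>2 * g e x - h e x) + k\<^sup>2 * hom0 k (($) c) e x)"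
  have "G \<in> DLap len vtx PD PN Lam \<and> (\<forall>e. nrm2 (I e) (Lap len G e - P e) = 0)"
  proof -
    have a: "L2 (I e) (G e)" "L2 (I e) (Q e)" "wderiv (I e) (G e) (Q e)" "L2 (I e) (P e)" "wderiv (I e) (Q e) (P e)" for e
      unfolding G_def Q_def P_def
      by (intro L2_add L2_diff L2_scl wderiv_add g hom_props[OF k] L2G_D[OF h])+
    have "comb (bval len G) (dvQ Q) p = 0" if "valid_end len p" for p
    proof -
      have "bval len G = (\<lambda>p. bval len g p + bval len (hom0 k (($) c)) p)" "dvQ Q = (\<lambda>p. dvQ q p + dvQ (hom1 k (($) c)) p)"
        by (auto simp: fun_eq_iff bval_def dvQ_def G_def Q_def)
      then show ?thesis using c'[OF that] by (simp add: comb_add)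
    qed
    from DLap_intro[OF a this] show ?thesis by blast
  qed
  moreover have "H.nrm (gscl \<mu> G - Lap len G - h) = 0" if "\<forall>e. nrm2 (I e) (Lap len G e - P e) = 0" "G \<in> DLap len vtx PD PN Lam"
  proof (rule Hnrm_eq_0)
    fix e
    have eq: "(gscl \<mu> G - Lap len G - h) e = - (Lap len G e - P e)"
      by (auto simp: fun_eq_iff gscl_def P_def G_def k2 algebra_simps)
    have "L2 (I e) (Lap len G e - P e)"
    proof -
      have "L2 (I e) (Lap len G e)" using L2G_D[OF Lap_L2G[OF that(2)]] .
      moreover have "L2 (I e) (P e)" unfolding P_def by (intro L2_add L2_diff L2_scl g hom_props[OF k] L2G_D[OF h])
      ultimately show ?thesis using L2_diff by (simp add: fun_diff_def)
    qed
    then have "nrm2 (I e) (- (Lap len G e - P e)) = 0"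
      using L2.nrm_minus[of "Lap len G e - P e" "I e"] that(1) by (simp only: mem_Collect_eq)
    then show "nrm2 (I e) ((gscl \<mu> G - Lap len G - h) e) = 0" by (simp only: eq)
  qed
  ultimately show ?thesis by blast
qed

end

section \<open>The convergence theorem\<close>

lemma (in qg) nls_interpretation:
  assumes S: "schr_group len vtx PD PN Lam S"
    and theta: "smooth_compact \<theta>" "\<forall>x\<ge>2. \<theta> x = 0"
    and sigma: "\<sigma> \<ge> 1/2" and R: "R > 0" and T: "T > 0" and u0: "u0 \<in> DE len vtx PD"
    and H2: "H2hyp \<sigma> R \<theta> len vtx PD"
  shows "nls gscl (Collect (L2G len)) (innerG len) (DE len vtx PD) aG (DLap len vtx PD PN Lam) (Lap len) Mc S
     (FRG \<sigma> R \<theta>) T u0"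
proof -
  have scl_eq: "(\<lambda>e x. F e x + c * G e x) = F + gscl c G" for F G :: "'e \<Rightarrow> real \<Rightarrow> complex" and c
    by (simp add: fun_eq_iff gscl_def)
  have S': "\<And>\<tau> F. L2G len F \<Longrightarrow> L2G len (S \<tau> F)"
    "\<And>\<tau> F G c. L2G len F \<Longrightarrow> L2G len G \<Longrightarrow> H.nrm (S \<tau> (F + gscl c G) - (S \<tau> F + gscl c (S \<tau> G))) = 0"
    "\<And>\<tau>. \<exists>K. \<forall>F. L2G len F \<longrightarrow> H.nrm (S \<tau> F) \<le> K * H.nrm F"
    "\<And>F. L2G len F \<Longrightarrow> H.nrm (S 0 F - F) = 0"
    "\<And>s t F. L2G len F \<Longrightarrow> H.nrm (S (s + t) F - S s (S t F)) = 0"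
    "\<And>F. L2G len F \<Longrightarrow> ((\<lambda>\<tau>. H.nrm (S \<tau> F - F)) \<longlongrightarrow> 0) (at 0)"
    "\<And>F. F \<in> DLap len vtx PD PN Lam \<Longrightarrow>
      ((\<lambda>\<tau>. H.nrm (\<lambda>e x. (S \<tau> F e x - F e x) / complex_of_real \<tau> - \<i> * Lap len F e x)) \<longlongrightarrow> 0) (at 0)"
    using S unfolding schr_group_def normG_eq gdiff_minus scl_eq by blast+
  have gen_eq: "(\<lambda>e x. (S \<tau> F e x - F e x) / complex_of_real \<tau> - \<i> * Lap len F e x) =
      gscl (1 / of_real \<tau>) (S \<tau> F - F) - gscl \<i> (Lap len F)" for \<tau> F
    by (simp add: fun_eq_iff gscl_def)
  obtain c C where c: "c > 0" "\<And>F. F \<in> W \<Longrightarrow> c * H1norm len F \<le> E.nrm F" using equiv by metis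
  have coerc: "c * H.nrm f \<le> E.nrm f" if "f \<in> W" for f
    using c(2)[OF that] mult_left_mono[OF Hnrm_le_H1norm[of f], of c] c(1) by linarith
  have fg: "form_group gscl (Collect (L2G len)) (innerG len) (DE len vtx PD) aG (DLap len vtx PD PN Lam) (Lap len) Mc S"
  proof (intro form_group.intro H.semi_inner_axioms E.semi_inner_axioms form_group_axioms.intro)
    show "DE len vtx PD \<subseteq> Collect (L2G len)" using W_L2 by auto
    show "DLap len vtx PD PN Lam \<subseteq> DE len vtx PD" by (rule DLap_W)
    show "Lap len g \<in> Collect (L2G len)" if "g \<in> DLap len vtx PD PN Lam" for g using Lap_L2G[OF that] by simp
    show "\<exists>c>0. \<forall>f\<in>DE len vtx PD. c * H.nrm f \<le> E.nrm f" using c(1) coerc by blast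
    show "aG f g = innerG len f (gscl (of_real Mc) g - Lap len g)" if "f \<in> DE len vtx PD" "g \<in> DLap len vtx PD PN Lam" for f g
      by (rule green[OF that])
    show "\<exists>g\<in>DLap len vtx PD PN Lam. H.nrm (gscl \<mu> g - Lap len g - h) = 0"
      if "h \<in> Collect (L2G len)" "Im \<mu> \<noteq> 0 \<or> Mc \<le> Re \<mu>" for h \<mu>
      using resolvent_surjective that by simp
    show "(\<lambda>j. aG (v j) f) \<longlonglongrightarrow> 0"
      if "\<And>j::nat. v j \<in> DE len vtx PD" "\<And>j. E.nrm (v j) \<le> B" "(\<lambda>j. H.nrm (v j)) \<longlonglongrightarrow> 0" "f \<in> DE len vtx PD" for v f B
      by (rule weak_form[OF that])
    show "((\<lambda>\<tau>. H.nrm (gscl (1 / of_real \<tau>) (S \<tau> g - g) - gscl \<i> (Lap len g))) \<longlongrightarrow> 0) (at 0)"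
      if "g \<in> DLap len vtx PD PN Lam" for g
      using S'(7)[OF that] unfolding gen_eq .
  qed (use S' in auto)
  show ?thesis
  proof (intro nls.intro fg nls_axioms.intro T u0)
    show "FRG \<sigma> R \<theta> v \<in> DE len vtx PD" if "v \<in> DE len vtx PD" for v using H2 that by (simp add: H2hyp_def)
    show "\<exists>L\<ge>0. \<forall>v\<in>DE len vtx PD. \<forall>w\<in>DE len vtx PD. E.nrm (FRG \<sigma> R \<theta> w - FRG \<sigma> R \<theta> v) \<le> L * (1 + E.nrm v) * E.nrm (w - v)"
      by (rule FRG_lipschitz[OF theta sigma R H2])
  qed
qed

theorem theorem2p14:
  fixes len :: "'e::finite \<Rightarrow> ereal" and vtx :: "'e \<times> bool \<Rightarrow> 'v"
    and PD PN Lam :: "'v \<Rightarrow> 'e \<times> bool \<Rightarrow> 'e \<times> bool \<Rightarrow> complex"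
    and S :: "real \<Rightarrow> ('e \<Rightarrow> real \<Rightarrow> complex) \<Rightarrow> ('e \<Rightarrow> real \<Rightarrow> complex)"
    and Mc :: real and \<theta> :: "real \<Rightarrow> real" and \<sigma> R T :: real
    and u0 :: "'e \<Rightarrow> real \<Rightarrow> complex"
    and M :: "'w measure" and m :: "real \<Rightarrow> 'w \<Rightarrow> real"
    and N :: "'z measure" and \<beta> :: "real \<Rightarrow> 'z \<Rightarrow> real"
    and u_eps :: "real \<Rightarrow> 'w \<Rightarrow> real \<Rightarrow> 'e \<Rightarrow> real \<Rightarrow> complex"
    and u :: "'z \<Rightarrow> real \<Rightarrow> 'e \<Rightarrow> real \<Rightarrow> complex"
  assumes graph: "qgraph len vtx PD PN Lam"
    and Mc: "Mc > 0"
    and Mc_equiv: "\<exists>c C. 0 < c \<and> 0 < C \<and> (\<forall>F\<in>DE len vtx PD.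
                     c * H1norm len F \<le> normE Mc len vtx PD PN Lam F \<and>
                     normE Mc len vtx PD PN Lam F \<le> C * H1norm len F)"
    and S: "schr_group len vtx PD PN Lam S"
    and theta: "smooth_compact \<theta>" "\<forall>x\<in>{0..1}. \<theta> x = 1" "\<forall>x\<ge>2. \<theta> x = 0"
    and sigma: "\<sigma> \<ge> 1/2" and R: "R > 0" and T: "T > 0"
    and u0: "u0 \<in> DE len vtx PD"
    and H0: "H0 T M m N \<beta>"
    and H2: "H2hyp \<sigma> R \<theta> len vtx PD"
    and u_eps: "\<forall>\<epsilon>>0. \<forall>\<omega>\<in>space M.
                  mild_sol T Mc len vtx PD PN Lam S \<sigma> R \<theta> (beta_eps m \<epsilon> \<omega>) u0 (u_eps \<epsilon> \<omega>)"
    and u: "\<forall>\<omega>\<in>space N. mild_sol T Mc len vtx PD PN Lam S \<sigma> R \<theta> (\<lambda>t. \<beta> t \<omega>) u0 (u \<omega>)"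
  shows "conv_law M u_eps N u (CDE T Mc len vtx PD PN Lam) (distCDE T Mc len vtx PD PN Lam)"
proof -
  interpret qg len vtx PD PN Lam Mc by unfold_locales (fact graph Mc Mc_equiv)+
  interpret nls gscl "Collect (L2G len)" "innerG len" "DE len vtx PD" aG "DLap len vtx PD PN Lam" "Lap len" Mc S
    "FRG \<sigma> R \<theta>" T u0
    by (rule nls_interpretation[OF S theta(1,3) sigma R T u0 H2])
  have CDE_eq: "CDE T Mc len vtx PD PN Lam v \<longleftrightarrow> curve v" for v
    by (simp add: CDE_def curve_def normE_eq gdiff_minus)
  have mild_eq: "mild_sol T Mc len vtx PD PN Lam S \<sigma> R \<theta> n u0 v \<longleftrightarrow> mild n v" for n v
    by (simp add: mild_sol_def mild_def CDE_eq)
  have prob: "prob_space M" "prob_space N" and law: "conv_law M (beta_eps m) N (\<lambda>\<omega> t. \<beta> t \<omega>) (CR T) (distCR T)"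
    using H0 by (auto simp: H0_def std_BM_def)
  show ?thesis
  proof (rule conv_law_relation[where P="CR T" and d="distCR T" and Rel=mild, OF prob _ _ _ _ _ _ law])
    show "distCR T x x = 0" if "CR T x" for x using distCR_metric(1)[OF T that] .
    show "0 \<le> distCR T x y" if "CR T x" "CR T y" for x y using distCR_metric(2)[OF T that] .
    show "distCR T x y = distCR T y x" for x y by (rule distCR_metric(3)[OF T])
    show "distCR T x z \<le> distCR T x y + distCR T y z" if "CR T x" "CR T y" "CR T z" for x y z
      using distCR_metric(4)[OF T that] .
    show "CDE T Mc len vtx PD PN Lam v" if "mild n v" for n v using that by (simp add: CDE_eq mild_def)
    show "mild (beta_eps m \<epsilon> \<omega>) (u_eps \<epsilon> \<omega>)" if "\<epsilon> > 0" "\<omega> \<in> space M" for \<epsilon> \<omega>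
      using u_eps that by (simp add: mild_eq)
    show "mild (\<lambda>t. \<beta> t \<omega>) (u \<omega>)" if "\<omega> \<in> space N" for \<omega> using u that by (simp add: mild_eq)
    fix n v and e :: real assume n: "CR T n" and v: "mild n v" and e: "e > 0"
    \<comment> \<open>The supremum preserves only the weak inequality, so e/2 is requested to end
      strictly below e.\<close>
    obtain \<delta> where \<delta>: "\<delta> > 0" "\<And>n' v' t. CR T n' \<Longrightarrow> mild n' v' \<Longrightarrow> distCR T n n' < \<delta> \<Longrightarrow> t \<in> {0..T} \<Longrightarrow> E.nrm (v t - v' t) \<le> e / 2"
      using mild_continuous_dependence[OF n v, of "e / 2"] e by auto
    have "distCDE T Mc len vtx PD PN Lam v v' < e" if "CR T n'" "mild n' v'" "distCR T n n' < \<delta>" for n' v'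
    proof -
      have "distCDE T Mc len vtx PD PN Lam v v' \<le> e / 2"
        unfolding distCDE_def normE_eq gdiff_minus
        by (rule cSUP_least) (use T \<delta>(2)[OF that] in auto)
      then show ?thesis using e by linarith
    qed
    then show "\<exists>\<delta>>0. \<forall>n' v'. CR T n' \<and> mild n' v' \<and> distCR T n n' < \<delta> \<longrightarrow> distCDE T Mc len vtx PD PN Lam v v' < e"
      using \<delta>(1) by blast
  qed
qed

end
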